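(* Let $G$ be an LCA group and let $\mathcal K\subset\mathcal L$ be two lattices in $G$. Let $\psi\in L^2(G)$, $\psi\neq 0$. The following are equivalent: (a) $\langle\psi\rangle_{\mathcal K}$ is $\mathcal L$ invariant, i.e. $T_\ell f\in\langle\psi\rangle_{\mathcal K}$ for all $f\in\langle\psi\rangle_{\mathcal K}$ and all $\ell\in\mathcal L$. (b) $Z_{\mathcal L}(\psi)(\alpha+\beta_1,x)\,Z_{\mathcal L}(\psi)(\alpha+\beta_2,y)=0$ for all $\beta_1,\beta_2\in\mathcal K^\perp$ such that $[\beta_1]\neq[\beta_2]$ in $\mathcal K^\perp/\mathcal L^\perp$, and for a.e. $x,y\in C_{\mathcal L}$, $\alpha\in C_{\mathcal K^\perp}$.
   Context: An LCA group $G$ is an abelian group with a separable, locally compact, Hausdorff topology making the group operations continuous; $\mu_G$ is its Haar measure and $L^2(G)=L^2(G,\mu_G)$. $\widehat G$ is the dual group of continuous characters, and $(x,\alpha)=\alpha(x)$ for $x\in G,\alpha\in\widehat G$; the Fourier transform is $\widehat f(\alpha)=\int_G f(x)(-x,\alpha)\,d\mu_G(x)$, with $\widehat G$ carrying the Plancherel measure. A lattice $\mathcal L\subset G$ is a discrete subgroup with $G/\mathcal L$ compact; its dual lattice is $\mathcal L^\perp=\{\alpha\in\widehat G:(\ell,\alpha)=1\ \forall\ell\in\mathcal L\}$. If $\mathcal K\subset\mathcal L$ are lattices then $\mathcal L^\perp\subset\mathcal K^\perp$. $C_{\mathcal L}$ denotes a measurable set of representatives (tiling set) of $G/\mathcal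 L$, $C_{\mathcal K^\perp}$ a measurable set of representatives of $\widehat G/\mathcal K^\perp$, and $|T_{\mathcal L}|=\mu_G(C_{\mathcal L})$ (the measure of $G/\mathcal L$). Translation: $T_xf(y)=f(y-x)$. For $\psi\in L^2(G)$ and a lattice $\mathcal K$, $\langle\psi\rangle_{\mathcal K}=\overline{\operatorname{span}}\{T_k\psi:k\in\mathcal K\}$. The Zak transform with respect to a lattice $\mathcal L$ of $f\in L^1(G)$ is $Z_{\mathcal L}(f)(\alpha,x)=|T_{\mathcal L}|\sum_{\ell\in\mathcal L}f(x+\ell)(-\ell,\alpha)$, $\alpha\in\widehat G$, $x\in G$; it extends to an isometric isomorphism on $L^2(G)$ (onto $L^2(\widehat{\mathcal L},L^2(C_{\mathcal L}))$), and $Z_{\mathcal L}(f)$ for $f\in L^2(G)$ denotes this extension; it is $\mathcal L^\perp$-periodic in $\alpha$. *)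

theory Defs
  imports "HOL-Analysis.Analysis"
begin

definition LCA_group :: "'g::{ab_group_add, t2_space, second_countable_topology} itself \<Rightarrow> bool" where
  "LCA_group _ \<longleftrightarrow>
     continuous_on UNIV (\<lambda>p::'g \<times> 'g. fst p + snd p) \<and>
     continuous_on UNIV (\<lambda>x::'g. - x) \<and>
     locally_compact_space (euclidean :: 'g topology)"

definition haar_measure :: "'g::{ab_group_add, topological_space} measure \<Rightarrow> bool" where
  "haar_measure \<mu> \<longleftrightarrow>
     sets \<mu> = sets borel \<and> space \<mu> = UNIV \<and>
     (\<forall>x. \<forall>A\<in>sets \<mu>. emeasure \<mu> ((\<lambda>y. x + y) ` A) = emeasure \<mu> A) \<and>
     (\<forall>K. compact K \<longrightarrow> emeasure \<mu> K < \<infinity>) \<and>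
     emeasure \<mu> UNIV \<noteq> 0"

text \<open>The dual group: continuous characters; the group law of the dual is pointwise product,
  written additively in the paper, so \<open>\<alpha> + \<beta>\<close> is \<open>\<lambda>g. \<alpha> g * \<beta> g\<close> and \<open>(x,\<alpha>) = \<alpha> x\<close>.\<close>
definition characters :: "('g::{ab_group_add, topological_space} \<Rightarrow> complex) set" where
  "characters = {c. continuous_on UNIV c \<and> (\<forall>x y. c (x + y) = c x * c y) \<and> (\<forall>x. norm (c x) = 1)}"

definition char_add :: "('g \<Rightarrow> complex) \<Rightarrow> ('g \<Rightarrow> complex) \<Rightarrow> ('g \<Rightarrow> complex)" where
  "char_add \<alpha> \<beta> = (\<lambda>g. \<alpha> g * \<beta> g)"

definition char_neg :: "('g \<Rightarrow> complex) \<Rightarrow> ('g \<Rightarrow> complex)" where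
  "char_neg \<alpha> = (\<lambda>g. cnj (\<alpha> g))"

definition dual_topology :: "('g::{ab_group_add, topological_space} \<Rightarrow> complex) topology" where
  "dual_topology = topology_generated_by
     {{c \<in> characters. \<forall>x\<in>K. norm (c x - c0 x) < e} | K c0 e.
        compact K \<and> c0 \<in> characters \<and> e > 0}"

definition dual_borel :: "('g::{ab_group_add, topological_space} \<Rightarrow> complex) measure" where
  "dual_borel = sigma (topspace dual_topology) {U. openin dual_topology U}"

text \<open>A Haar measure on the dual group (Plancherel measure is one such; only null sets matter).\<close>
definition dual_haar_measure :: "('g::{ab_group_add, topological_space} \<Rightarrow> complex) measure \<Rightarrow> bool" where
  "dual_haar_measure \<nu> \<longleftrightarrow>
     sets \<nu> = sets dual_borel \<and> space \<nu> = characters \<and>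
     (\<forall>\<gamma>\<in>characters. \<forall>A\<in>sets \<nu>. emeasure \<nu> (char_add \<gamma> ` A) = emeasure \<nu> A) \<and>
     (\<forall>K. compactin dual_topology K \<longrightarrow> emeasure \<nu> K < \<infinity>) \<and>
     emeasure \<nu> characters \<noteq> 0"

definition lattice :: "'g::{ab_group_add, topological_space} set \<Rightarrow> bool" where
  "lattice L \<longleftrightarrow>
     0 \<in> L \<and> (\<forall>a\<in>L. \<forall>b\<in>L. a - b \<in> L) \<and>
     (\<forall>l\<in>L. \<exists>U. open U \<and> U \<inter> L = {l}) \<and>
     (\<exists>K. compact K \<and> (\<forall>x. \<exists>k\<in>K. \<exists>l\<in>L. x = k + l))"

definition dual_lattice :: "'g::{ab_group_add, topological_space} set \<Rightarrow> ('g \<Rightarrow> complex) set" where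
  "dual_lattice L = {\<alpha> \<in> characters. \<forall>l\<in>L. \<alpha> l = 1}"

definition tiling_set :: "'g::{ab_group_add, topological_space} set \<Rightarrow> 'g set \<Rightarrow> bool" where
  "tiling_set L C \<longleftrightarrow> C \<in> sets borel \<and> (\<forall>x. \<exists>!p. fst p \<in> C \<and> snd p \<in> L \<and> x = fst p + snd p)"

definition dual_tiling_set ::
    "('g::{ab_group_add, topological_space} \<Rightarrow> complex) set \<Rightarrow> ('g \<Rightarrow> complex) set \<Rightarrow> bool" where
  "dual_tiling_set \<Lambda> D \<longleftrightarrow> D \<in> sets dual_borel \<and> D \<subseteq> characters \<and>
     (\<forall>\<alpha>\<in>characters. \<exists>!p. fst p \<in> D \<and> snd p \<in> \<Lambda> \<and> \<alpha> = char_add (fst p) (snd p))"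

definition L2 :: "'g measure \<Rightarrow> ('g \<Rightarrow> complex) set" where
  "L2 \<mu> = {f. f \<in> borel_measurable \<mu> \<and> (\<integral>\<^sup>+x. ennreal ((norm (f x))\<^sup>2) \<partial>\<mu>) < \<infinity>}"

definition L2_dist2 :: "'g measure \<Rightarrow> ('g \<Rightarrow> complex) \<Rightarrow> ('g \<Rightarrow> complex) \<Rightarrow> ennreal" where
  "L2_dist2 \<mu> f g = (\<integral>\<^sup>+x. ennreal ((norm (f x - g x))\<^sup>2) \<partial>\<mu>)"

definition transl :: "'g::ab_group_add \<Rightarrow> ('g \<Rightarrow> complex) \<Rightarrow> ('g \<Rightarrow> complex)" where
  "transl x f = (\<lambda>y. f (y - x))"

definition closed_span_transl :: "'g::ab_group_add measure \<Rightarrow> 'g set \<Rightarrow> ('g \<Rightarrow> complex) \<Rightarrow> ('g \<Rightarrow> complex) set" where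
  "closed_span_transl \<mu> K \<psi> = {f \<in> L2 \<mu>. \<forall>e>0. \<exists>F a. finite F \<and> F \<subseteq> K \<and>
       L2_dist2 \<mu> f (\<lambda>y. \<Sum>k\<in>F. a k * transl k \<psi> y) < ennreal e}"

definition zak_L1 :: "'g measure \<Rightarrow> 'g set \<Rightarrow> 'g set \<Rightarrow> ('g::ab_group_add \<Rightarrow> complex)
    \<Rightarrow> ('g \<Rightarrow> complex) \<Rightarrow> 'g \<Rightarrow> complex" where
  "zak_L1 \<mu> L C f \<alpha> x = complex_of_real (measure \<mu> C) * (\<Sum>\<^sub>\<infinity>l\<in>L. f (x + l) * \<alpha> (- l))"

(* Z is (a representative of) the Zak transform Z_L(f) of f in L^2: it is
  L-perp-periodic in alpha, and it is the image of f under the continuous extension of the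
  Zak transform from L^1 cap L^2, i.e. the L^2(C_{L-perp} x C_L) limit of Z_L(f_n)
  for some (equivalently any) sequence f_n in L^1 cap L^2 converging to f in L^2. *)
definition is_zak_transform ::
    "'g measure \<Rightarrow> ('g \<Rightarrow> complex) measure \<Rightarrow> 'g set \<Rightarrow> 'g set \<Rightarrow> ('g \<Rightarrow> complex) set
     \<Rightarrow> ('g::{ab_group_add, topological_space} \<Rightarrow> complex) \<Rightarrow> (('g \<Rightarrow> complex) \<Rightarrow> 'g \<Rightarrow> complex) \<Rightarrow> bool" where
  "is_zak_transform \<mu> \<nu> L CL CLd f Z \<longleftrightarrow>
     (\<lambda>p. Z (fst p) (snd p)) \<in> borel_measurable (\<nu> \<Otimes>\<^sub>M \<mu>) \<and>
     (\<forall>lam\<in>dual_lattice L. \<forall>\<alpha>\<in>characters. \<forall>x. Z (char_add \<alpha> lam) x = Z \<alpha> x) \<and>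
     (\<exists>fs :: nat \<Rightarrow> 'g \<Rightarrow> complex.
        (\<forall>n. integrable \<mu> (fs n) \<and> fs n \<in> L2 \<mu>) \<and>
        (\<lambda>n. L2_dist2 \<mu> (fs n) f) \<longlonglongrightarrow> 0 \<and>
        (\<lambda>n. \<integral>\<^sup>+p. indicator (CLd \<times> CL) p *
              ennreal ((norm (zak_L1 \<mu> L CL (fs n) (fst p) (snd p) - Z (fst p) (snd p)))\<^sup>2)
              \<partial>(\<nu> \<Otimes>\<^sub>M \<mu>)) \<longlonglongrightarrow> 0)"

end

theory Submission
  imports Defs "HOL-Complex_Analysis.Great_Picard"
begin

text \<open>Let \<open>w \<alpha>\<close> be the squared norm of \<open>Z \<alpha>\<close> in \<open>L\<^sup>2(C)\<close>. For a finite combination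
  \<open>g\<close> of the translates \<open>T\<^sub>l \<psi>\<close>, \<open>l \<in> L\<close>, with symbol \<open>t \<alpha> = \<Sum>l. a l * \<alpha> (- l)\<close>, the isometry of the Zak transform
  says that the squared norm of \<open>g\<close> is, up to a constant, the integral of \<open>|t|\<^sup>2 w\<close> over a tile \<open>D\<close> of the dual of \<open>L\<close>,
  and condition (b) says that \<open>w (\<alpha> + \<beta>1) * w (\<alpha> + \<beta>2) = 0\<close> almost everywhere.

  If (a) holds, then \<open>\<alpha> \<mapsto> \<alpha> l\<close> is a limit in \<open>L\<^sup>2(w)\<close> of symbols that are periodic under the dual lattice of \<open>K\<close>; the
  same limit computed at \<open>\<alpha> + \<beta>1\<close> and at \<open>\<alpha> + \<beta>2\<close> differs by the constant factor \<open>\<beta>1 l / \<beta>2 l \<noteq> 1\<close>, so the two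
  weights cannot both be positive. If (b) holds, then \<open>\<alpha> \<mapsto> \<alpha> (- l)\<close> agrees, wherever \<open>w\<close> is positive, with the
  periodic function \<open>\<Sum>\<rho>. (\<alpha> + \<rho>) (- l) * 1\<^sub>E (\<alpha> + \<rho>)\<close>, where \<open>E\<close> is the support of \<open>w\<close> and \<open>\<rho>\<close> runs over representatives
  of the finite quotient of the dual lattices; approximating \<open>1\<^sub>E\<close> by symbols approximates \<open>T\<^sub>l \<psi>\<close> by translates under \<open>K\<close>.

  The duality theory that is needed reduces to one fact: every homomorphism from \<open>L\<close> to the circle extends to a character
  of the whole group that is close to \<open>1\<close> on a neighbourhood of \<open>0\<close> independent of the homomorphism. It is proved by
  maximising a convex functional over positive-definite functions; a near-maximiser is nearly multiplicative, and
  equicontinuity produces a genuine character in the limit.\<close>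


section \<open>Tilings by a countable group of measure-preserving maps\<close>

text \<open>Symbols with frequencies in \<open>L\<close> see only the restriction of a character to
  \<open>L\<close>. Approximating the indicator of the support of the weight by them therefore takes
  more than Borel measurability: the support must lie in the sigma-algebra generated by the
  evaluations at points of \<open>L\<close>. For this reason the weight is recovered almost
  everywhere as a limit of fibre norms of Zak sums of integrable functions, which depend on these
  evaluations alone. In the extremal argument, adding to and subtracting from a vector a unimodular
  multiple of its translate splits its positive-definite function into a convex combination of two
  others. Near the maximum of a Hilbert norm both parts must be almost proportional to the whole,
  and this is approximate multiplicativity. Smoothing by a fixed bump gives a modulus of continuity
  that depends on the bump alone, hence the uniform neighbourhood. The extension theorem is used in
  two ways. Existence gives orthogonality of characters and thus Parseval, and likewise the average
  over representatives that selects the frequencies in \<open>K\<close>. Uniformity gives the finite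
  measure of the dual tile and the finiteness of the quotient of the dual lattices.\<close>

locale tile =
  fixes M :: "'a measure" and I :: "'i set" and \<tau> :: "'i \<Rightarrow> 'a \<Rightarrow> 'a" and \<iota> :: "'i \<Rightarrow> 'i" and C :: "'a set"
  assumes countable_I: "countable I"
    and act_measurable: "i \<in> I \<Longrightarrow> \<tau> i \<in> measurable M M"
    and act_preserving: "i \<in> I \<Longrightarrow> distr M M (\<tau> i) = M"
    and bij_inv: "bij_betw \<iota> I I"
    and act_inv: "i \<in> I \<Longrightarrow> x \<in> space M \<Longrightarrow> \<tau> i (\<tau> (\<iota> i) x) = x"
    and tile_sets [measurable]: "C \<in> sets M"
    and tile_ex1: "x \<in> space M \<Longrightarrow> \<exists>!i. i \<in> I \<and> \<tau> i x \<in> C"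
begin

text \<open>Restriction to the tile is taken as a density, so that the space and the measurable sets
  remain those of \<open>M\<close>. For a tile of a lattice it plays the part of the invariant
  measure on the quotient.\<close>

definition MC :: "'a measure" where "MC = density M (indicator C)"

lemma space_MC [simp]: "space MC = space M" and sets_MC [simp, measurable_cong]: "sets MC = sets M"
  by (auto simp: MC_def)

lemma nn_integral_MC: "f \<in> borel_measurable M \<Longrightarrow> (\<integral>\<^sup>+x. f x \<partial>MC) = (\<integral>\<^sup>+x. indicator C x * f x \<partial>M)"
  unfolding MC_def by (subst nn_integral_density) auto

lemma AE_MC: "(AE x in MC. P x) \<longleftrightarrow> (AE x in M. x \<in> C \<longrightarrow> P x)"
  proof -
  have "0 < (indicator C x :: ennreal) \<longleftrightarrow> x \<in> C" for x
    by (simp add: indicator_def)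
  then show ?thesis unfolding MC_def by (subst AE_density) auto
qed

lemma emeasure_MC: "A \<in> sets M \<Longrightarrow> emeasure MC A = emeasure M (C \<inter> A)"
proof -
  assume A: "A \<in> sets M"
  have "emeasure MC A = (\<integral>\<^sup>+x. indicator C x * indicator A x \<partial>M)"
    unfolding MC_def using A by (intro emeasure_density) auto
  also have "\<dots> = (\<integral>\<^sup>+x. indicator (C \<inter> A) x \<partial>M)"
    by (intro nn_integral_cong) (simp add: indicator_def)
  also have "\<dots> = emeasure M (C \<inter> A)" using A by (intro nn_integral_indicator) auto
  finally show ?thesis .
qed

lemma inv_mem: "i \<in> I \<Longrightarrow> \<iota> i \<in> I"
  using bij_inv by (auto simp: bij_betw_def)

lemma nn_act: "i \<in> I \<Longrightarrow> f \<in> borel_measurable M \<Longrightarrow> (\<integral>\<^sup>+x. f (\<tau> i x) \<partial>M) = (\<integral>\<^sup>+x. f x \<partial>M)"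
  using nn_integral_distr[of "\<tau> i" M M f] act_measurable act_preserving by simp

text \<open>Insert the constant 1 as the sum over \<open>I\<close> of the indicators of
  \<open>C\<close> at the points \<tau> i x, exchange sum and integral, and substitute the inverse
  map in each term. The inverse then disappears on reindexing the sum.\<close>

lemma nn_integral_unfold:
  assumes F [measurable]: "F \<in> borel_measurable M"
  shows "(\<integral>\<^sup>+x. F x \<partial>M) = (\<integral>\<^sup>+x. (\<integral>\<^sup>+i. F (\<tau> i x) \<partial>count_space I) \<partial>MC)"
proof -
  have one: "(\<integral>\<^sup>+i. indicator C (\<tau> i x) \<partial>count_space I) = (1::ennreal)" if x: "x \<in> space M" for x
  proof -
    obtain j where j: "j \<in> I" "\<And>i. i \<in> I \<Longrightarrow> \<tau> i x \<in> C \<longleftrightarrow> i = j"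
      using tile_ex1[OF x] by blast
    have "(\<integral>\<^sup>+i. indicator C (\<tau> i x) \<partial>count_space I) = (\<integral>\<^sup>+i. indicator {j} i \<partial>count_space I)"
      using j by (intro nn_integral_cong) (auto simp: indicator_def)
    also have "\<dots> = 1"
      using j by (simp add: nn_integral_indicator)
    finally show ?thesis .
  qed
  have "(\<integral>\<^sup>+x. F x \<partial>M) = (\<integral>\<^sup>+x. F x * (\<integral>\<^sup>+i. indicator C (\<tau> i x) \<partial>count_space I) \<partial>M)"
    by (intro nn_integral_cong) (simp add: one)
  also have "\<dots> = (\<integral>\<^sup>+x. (\<integral>\<^sup>+i. F x * indicator C (\<tau> i x) \<partial>count_space I) \<partial>M)"
    by (intro nn_integral_cong) (simp add: nn_integral_cmult)
  also have "\<dots> = (\<integral>\<^sup>+i. (\<integral>\<^sup>+x. F x * indicator C (\<tau> i x) \<partial>M) \<partial>count_space I)"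
    by (intro nn_integral_count_space_nn_integral countable_I)
      (use act_measurable in \<open>auto intro!: borel_measurable_times_ennreal intro: measurable_compose\<close>)
  also have "\<dots> = (\<integral>\<^sup>+i. (\<integral>\<^sup>+x. indicator C x * F (\<tau> (\<iota> i) x) \<partial>M) \<partial>count_space I)"
  proof (rule nn_integral_cong)
    fix i assume "i \<in> space (count_space I)"
    then have i: "i \<in> I" by simp
    note [measurable] = act_measurable[OF i] act_measurable[OF inv_mem[OF i]]
    have "(\<integral>\<^sup>+x. F x * indicator C (\<tau> i x) \<partial>M) = (\<integral>\<^sup>+x. F (\<tau> (\<iota> i) x) * indicator C (\<tau> i (\<tau> (\<iota> i) x)) \<partial>M)"
      by (rule nn_act[OF inv_mem[OF i], of "\<lambda>x. F x * indicator C (\<tau> i x)", symmetric]) measurable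
    also have "\<dots> = (\<integral>\<^sup>+x. indicator C x * F (\<tau> (\<iota> i) x) \<partial>M)"
      by (intro nn_integral_cong) (simp add: act_inv i mult.commute)
    finally show "(\<integral>\<^sup>+x. F x * indicator C (\<tau> i x) \<partial>M) = \<dots>" .
  qed
  also have "\<dots> = (\<integral>\<^sup>+i. (\<integral>\<^sup>+x. indicator C x * F (\<tau> i x) \<partial>M) \<partial>count_space I)"
    by (rule nn_integral_bij_count_space[OF bij_inv])
  also have "\<dots> = (\<integral>\<^sup>+i. (\<integral>\<^sup>+x. F (\<tau> i x) \<partial>MC) \<partial>count_space I)"
    by (intro nn_integral_cong nn_integral_MC[symmetric])
      (use act_measurable in \<open>auto intro: measurable_compose\<close>)
  also have "\<dots> = (\<integral>\<^sup>+x. (\<integral>\<^sup>+i. F (\<tau> i x) \<partial>count_space I) \<partial>MC)"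
    by (rule nn_integral_count_space_nn_integral[symmetric, OF countable_I])
      (use act_measurable in \<open>auto intro: measurable_compose simp: measurable_cong_sets[OF sets_MC refl]\<close>)
  finally show ?thesis .
qed

text \<open>A set that meets every orbit has at least the measure of a tile: unfolded over the tile,
  its indicator counts at least one point per orbit.\<close>

lemma emeasure_tile_finite:
  assumes N [measurable]: "N \<in> sets M" and fin: "emeasure M N < \<infinity>"
    and cov: "\<And>x. x \<in> space M \<Longrightarrow> \<exists>i\<in>I. \<tau> i x \<in> N"
  shows "emeasure M C < \<infinity>"
proof -
  have "emeasure M C = (\<integral>\<^sup>+x. 1 \<partial>MC)"
    by (simp add: emeasure_MC)
  also have "\<dots> \<le> (\<integral>\<^sup>+x. (\<integral>\<^sup>+i. indicator N (\<tau> i x) \<partial>count_space I) \<partial>MC)"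
  proof (intro nn_integral_mono)
    fix x assume "x \<in> space MC"
    then obtain i where i: "i \<in> I" "\<tau> i x \<in> N" using cov by auto
    have "1 = (\<integral>\<^sup>+j. indicator {i} j \<partial>count_space I)" using i by simp
    also have "\<dots> \<le> (\<integral>\<^sup>+i. indicator N (\<tau> i x) \<partial>count_space I)"
      using i by (intro nn_integral_mono) (auto simp: indicator_def)
    finally show "1 \<le> (\<integral>\<^sup>+i. indicator N (\<tau> i x) \<partial>count_space I)" .
  qed
  also have "\<dots> = emeasure M N"
    by (subst nn_integral_unfold[symmetric]) auto
  finally show ?thesis using fin by simp
qed

text \<open>The exceptional points are carried by some \<tau> i into the null set of exceptions in
  the tile, so they lie in a countable union of preimages of a null set. In this form
  \<open>P\<close> may be any predicate, measurable or not.\<close>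

lemma AE_tile_invariant:
  assumes P: "AE x in M. x \<in> C \<longrightarrow> P x"
    and inv: "\<And>i x. i \<in> I \<Longrightarrow> x \<in> space M \<Longrightarrow> P (\<tau> i x) \<Longrightarrow> P x"
  shows "AE x in M. P x"
proof -
  have "AE x in M. \<tau> i x \<in> C \<longrightarrow> P (\<tau> i x)" if i: "i \<in> I" for i
  proof -
    have "AE x in distr M M (\<tau> i). x \<in> C \<longrightarrow> P x" by (simp only: act_preserving[OF i] P)
    then obtain N where N: "N \<in> null_sets (distr M M (\<tau> i))" "{x \<in> space M. \<not> (x \<in> C \<longrightarrow> P x)} \<subseteq> N"
      by (auto simp: eventually_ae_filter)
    have "AE x in distr M M (\<tau> i). x \<notin> N" by (rule AE_not_in[OF N(1)])
    then have "AE x in M. \<tau> i x \<notin> N"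
      using N(1) by (subst (asm) AE_distr_iff[OF act_measurable[OF i]])
        auto
    then show ?thesis
    proof (rule AE_mp, intro AE_I2 impI)
      fix x assume x: "x \<in> space M" and "\<tau> i x \<notin> N" "\<tau> i x \<in> C"
      then show "P (\<tau> i x)" using N(2) measurable_space[OF act_measurable[OF i] x] by blast
    qed
  qed
  then have "AE x in M. \<forall>i\<in>I. \<tau> i x \<in> C \<longrightarrow> P (\<tau> i x)"
    by (subst AE_ball_countable[OF countable_I]) auto
  moreover have "AE x in M. (\<forall>i\<in>I. \<tau> i x \<in> C \<longrightarrow> P (\<tau> i x)) \<longrightarrow> P x"
  proof (rule AE_I2, rule impI)
    fix x assume x: "x \<in> space M" and *: "\<forall>i\<in>I. \<tau> i x \<in> C \<longrightarrow> P (\<tau> i x)"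
    obtain i where "i \<in> I" "\<tau> i x \<in> C" using tile_ex1[OF x] by blast
    then show "P x" using inv[OF _ x] * by blast
  qed
  ultimately show ?thesis by (rule AE_mp)
qed

lemma emeasure_tile_pos:
  assumes "emeasure M (space M) \<noteq> 0" shows "emeasure M C \<noteq> 0"
proof
  assume "emeasure M C = 0"
  then have "AE x in M. x \<notin> C" by (intro AE_not_in) auto
  \<comment> \<open>The predicate \<open>False\<close> is trivially invariant, so a null tile would
    make the whole space null.\<close>
  then have "AE x in M. x \<in> C \<longrightarrow> False" by simp
  then have "AE x in M. False" by (rule AE_tile_invariant)
  then show False using assms by (simp add: AE_iff_measurable[OF sets.top])
qed

lemma sigma_finite:
  assumes "emeasure M C < \<infinity>" shows "sigma_finite_measure M"
proof
  let ?A = "(\<lambda>i. \<tau> i -` C \<inter> space M) ` I"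
  have 1: "\<tau> i -` C \<inter> space M \<in> sets M" "emeasure M (\<tau> i -` C \<inter> space M) \<noteq> \<infinity>" if i: "i \<in> I" for i
  proof -
    show "\<tau> i -` C \<inter> space M \<in> sets M" using act_measurable[OF i] by (auto intro: measurable_sets)
    have "emeasure M (\<tau> i -` C \<inter> space M) = emeasure (distr M M (\<tau> i)) C"
      by (simp add: emeasure_distr[OF act_measurable[OF i]])
    then show "emeasure M (\<tau> i -` C \<inter> space M) \<noteq> \<infinity>" using act_preserving[OF i] assms by simp
  qed
  show "\<exists>A. countable A \<and> A \<subseteq> sets M \<and> \<Union> A = space M \<and> (\<forall>a\<in>A. emeasure M a \<noteq> \<infinity>)"
  proof (intro exI conjI)
    show "countable ?A" by (simp add: countable_I)
    show "?A \<subseteq> sets M" "\<forall>a\<in>?A. emeasure M a \<noteq> \<infinity>" using 1 by auto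
    have "x \<in> \<Union> ?A" if x: "x \<in> space M" for x
    proof -
      obtain i where "i \<in> I" "\<tau> i x \<in> C" using tile_ex1[OF x] by blast
      then show ?thesis using x by blast
    qed
    then show "\<Union> ?A = space M" by auto
  qed
qed

text \<open>Compare with the tile \<open>\<sigma> C\<close>: both sides equal the integral of \<open>F\<close> over \<open>\<sigma> C\<close>.\<close>
lemma nn_integral_tile_shift:
  assumes F [measurable]: "F \<in> borel_measurable M"
    and Fper: "\<And>i x. i \<in> I \<Longrightarrow> x \<in> space M \<Longrightarrow> F (\<tau> i x) = F x"
    and \<sigma> [measurable]: "\<sigma> \<in> measurable M M" and \<sigma>' [measurable]: "\<sigma>' \<in> measurable M M"
    and pres: "distr M M \<sigma> = M"
    and inv: "\<And>x. x \<in> space M \<Longrightarrow> \<sigma>' (\<sigma> x) = x"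
    and comm: "\<And>i x. i \<in> I \<Longrightarrow> x \<in> space M \<Longrightarrow> \<sigma>' (\<tau> i x) = \<tau> i (\<sigma>' x)"
  shows "(\<integral>\<^sup>+x. F (\<sigma> x) \<partial>MC) = (\<integral>\<^sup>+x. F x \<partial>MC)"
proof -
  have "(\<integral>\<^sup>+x. F (\<sigma> x) \<partial>MC) = (\<integral>\<^sup>+x. indicator C (\<sigma>' (\<sigma> x)) * F (\<sigma> x) \<partial>M)"
    by (subst nn_integral_MC) (auto intro!: nn_integral_cong simp: inv)
  also have "\<dots> = (\<integral>\<^sup>+x. indicator C (\<sigma>' x) * F x \<partial>distr M M \<sigma>)"
    by (subst nn_integral_distr) auto
  also have "\<dots> = (\<integral>\<^sup>+x. indicator C (\<sigma>' x) * F x \<partial>M)" by (simp add: pres)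
  also have "\<dots> = (\<integral>\<^sup>+x. (\<integral>\<^sup>+i. indicator C (\<sigma>' (\<tau> i x)) * F (\<tau> i x) \<partial>count_space I) \<partial>MC)"
    by (rule nn_integral_unfold) auto
  also have "\<dots> = (\<integral>\<^sup>+x. F x \<partial>MC)"
  proof (rule nn_integral_cong)
    fix x assume "x \<in> space MC" then have x: "x \<in> space M" by simp
    obtain j where j: "j \<in> I" "\<And>i. i \<in> I \<Longrightarrow> \<tau> i (\<sigma>' x) \<in> C \<longleftrightarrow> i = j"
      using tile_ex1[OF measurable_space[OF \<sigma>' x]] by blast
    have "(\<integral>\<^sup>+i. indicator C (\<sigma>' (\<tau> i x)) * F (\<tau> i x) \<partial>count_space I) = (\<integral>\<^sup>+i. F x * indicator {j} i \<partial>count_space I)"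
      using j by (intro nn_integral_cong) (auto simp: indicator_def comm x Fper)
    also have "\<dots> = F x" using j by (simp add: nn_integral_cmult)
    finally show "(\<integral>\<^sup>+i. indicator C (\<sigma>' (\<tau> i x)) * F (\<tau> i x) \<partial>count_space I) = F x" .
  qed
  finally show ?thesis .
qed

lemma integral_tile_shift:
  fixes F :: "'a \<Rightarrow> complex"
  assumes F [measurable]: "F \<in> borel_measurable M" and bdd: "\<And>x. x \<in> space M \<Longrightarrow> norm (F x) \<le> B"
    and fin: "emeasure M C < \<infinity>"
    and Fper: "\<And>i x. i \<in> I \<Longrightarrow> x \<in> space M \<Longrightarrow> F (\<tau> i x) = F x"
    and \<sigma> [measurable]: "\<sigma> \<in> measurable M M" and \<sigma>' [measurable]: "\<sigma>' \<in> measurable M M"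
    and pres: "distr M M \<sigma> = M"
    and inv: "\<And>x. x \<in> space M \<Longrightarrow> \<sigma>' (\<sigma> x) = x"
    and comm: "\<And>i x. i \<in> I \<Longrightarrow> x \<in> space M \<Longrightarrow> \<sigma>' (\<tau> i x) = \<tau> i (\<sigma>' x)"
  shows "(\<integral>x. F (\<sigma> x) \<partial>MC) = (\<integral>x. F x \<partial>MC)"
proof -
  interpret MC: finite_measure MC
    by standard (use fin in \<open>auto simp: emeasure_MC\<close>)
  have real: "(\<integral>x. g (F (\<sigma> x)) \<partial>MC) = (\<integral>x. g (F x) \<partial>MC)"
    if g [measurable]: "g \<in> borel_measurable borel" and gb: "\<And>z. \<bar>g z\<bar> \<le> norm z" for g :: "complex \<Rightarrow> real"
  proof -
    have b: "\<bar>g (F x)\<bar> \<le> B" if "x \<in> space M" for x using gb[of "F x"] bdd[OF that] by linarith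
    have s: "\<sigma> x \<in> space M" if "x \<in> space M" for x using measurable_space[OF \<sigma> that] .
    have i1: "integrable MC (\<lambda>x. g (F x))" and i2: "integrable MC (\<lambda>x. g (F (\<sigma> x)))"
      by (auto intro!: MC.integrable_const_bound[where B=B] simp: b s)
    \<comment> \<open>Adding the bound \<open>B\<close> makes the function nonnegative, so the
      version for nonnegative integrals applies. The constant cancels again because the tile has
      finite measure.\<close>
    have "(\<integral>\<^sup>+x. ennreal (g (F (\<sigma> x)) + B) \<partial>MC) = (\<integral>\<^sup>+x. ennreal (g (F x) + B) \<partial>MC)"
      by (rule nn_integral_tile_shift[where F="\<lambda>x. ennreal (g (F x) + B)" and \<sigma>'=\<sigma>'])
        (auto simp: pres inv comm Fper)
    moreover have "(\<integral>x. g (F x) + B \<partial>MC) = enn2real (\<integral>\<^sup>+x. ennreal (g (F x) + B) \<partial>MC)"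
      using b by (intro integral_eq_nn_integral) (fastforce simp: abs_le_iff intro!: AE_I2)+
    moreover have "(\<integral>x. g (F (\<sigma> x)) + B \<partial>MC) = enn2real (\<integral>\<^sup>+x. ennreal (g (F (\<sigma> x)) + B) \<partial>MC)"
      using b s by (intro integral_eq_nn_integral) (fastforce simp: abs_le_iff intro!: AE_I2)+
    ultimately have "(\<integral>x. g (F (\<sigma> x)) + B \<partial>MC) = (\<integral>x. g (F x) + B \<partial>MC)" by simp
    then show ?thesis using i1 i2 by simp
  qed
  have s: "\<sigma> x \<in> space M" if "x \<in> space M" for x using measurable_space[OF \<sigma> that] .
  have i1: "integrable MC F" and i2: "integrable MC (\<lambda>x. F (\<sigma> x))"
    by (auto intro!: MC.integrable_const_bound[where B=B] simp: bdd s)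
  show ?thesis
    by (intro complex_eqI)
      (use i1 i2 real[of Re] real[of Im] in \<open>auto simp: integral_Re[symmetric] integral_Im[symmetric] abs_Re_le_cmod abs_Im_le_cmod simp del: integral_Re integral_Im\<close>)
qed

end

section \<open>Extension of homomorphisms to the circle\<close>

text \<open>Graph of a homomorphism from a subgroup to the unit circle. Graphs are ordered by
  inclusion and unions of chains are again such graphs, which suits Zorn's lemma; single-valuedness
  is encoded by the value at 0.\<close>

definition partial_hom :: "('g::ab_group_add \<times> complex) set \<Rightarrow> bool" where
  "partial_hom \<Gamma> \<longleftrightarrow> (0, 1) \<in> \<Gamma> \<and> (\<forall>a z b w. (a, z) \<in> \<Gamma> \<longrightarrow> (b, w) \<in> \<Gamma> \<longrightarrow> (a - b, z / w) \<in> \<Gamma>) \<and>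
     (\<forall>a z. (a, z) \<in> \<Gamma> \<longrightarrow> norm z = 1) \<and> (\<forall>z. (0, z) \<in> \<Gamma> \<longrightarrow> z = 1)"

definition nmult :: "nat \<Rightarrow> 'g::ab_group_add \<Rightarrow> 'g" where
  "nmult n a = (\<Sum>i<n. a)"

lemma nmult_simps [simp]: "nmult 0 a = 0" "nmult (Suc n) a = nmult n a + a"
  by (simp_all add: nmult_def)

lemma nmult_add: "nmult (m + n) a = nmult m a + nmult n a"
  by (induction n) (simp_all add: algebra_simps)

lemma partial_hom_minus:
  "partial_hom \<Gamma> \<Longrightarrow> (a, z) \<in> \<Gamma> \<Longrightarrow> (b, w) \<in> \<Gamma> \<Longrightarrow> (a - b, z / w) \<in> \<Gamma>"
  unfolding partial_hom_def by blast

lemma partial_hom_norm: "partial_hom \<Gamma> \<Longrightarrow> (a, z) \<in> \<Gamma> \<Longrightarrow> norm z = 1"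
  unfolding partial_hom_def by blast

lemma partial_hom_uminus: "partial_hom \<Gamma> \<Longrightarrow> (a, z) \<in> \<Gamma> \<Longrightarrow> (- a, 1 / z) \<in> \<Gamma>"
  using partial_hom_minus[of \<Gamma> 0 1 a z] by (simp add: partial_hom_def)

lemma partial_hom_plus:
  "partial_hom \<Gamma> \<Longrightarrow> (a, z) \<in> \<Gamma> \<Longrightarrow> (b, w) \<in> \<Gamma> \<Longrightarrow> (a + b, z * w) \<in> \<Gamma>"
  using partial_hom_minus[of \<Gamma> a z "- b" "1 / w"] partial_hom_uminus by fastforce

lemma partial_hom_unique:
  assumes "partial_hom \<Gamma>" "(a, z) \<in> \<Gamma>" "(a, w) \<in> \<Gamma>" shows "z = w"
proof -
  have "(0, z / w) \<in> \<Gamma>" using partial_hom_minus[OF assms] by simp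
  then have "z / w = 1" using assms(1) unfolding partial_hom_def by blast
  then show ?thesis by (cases "w = 0") auto
qed

text \<open>Elements of the enlarged domain are written with two natural multiples of
  \<open>a\<close> in place of an integer multiple. The new graph is single-valued because a
  relation between \<open>a\<close> and the old domain says, up to inversion, that some
  \<open>nmult n a\<close> lies in that domain, where \<open>compat\<close> fixes the value.\<close>

lemma partial_hom_extend:
  assumes \<Gamma>: "partial_hom \<Gamma>" and c: "norm c = 1"
    and compat: "\<And>n z. (nmult n a, z) \<in> \<Gamma> \<Longrightarrow> z = c ^ n"
  obtains \<Gamma>' where "partial_hom \<Gamma>'" "\<Gamma> \<subseteq> \<Gamma>'" "(a, c) \<in> \<Gamma>'"
proof
  let ?G = "{(g + nmult i a - nmult j a, z * c ^ i / c ^ j) |g z i j. (g, z) \<in> \<Gamma>}"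
  have c0: "c \<noteq> 0" using c by auto
  show "\<Gamma> \<subseteq> ?G"
  proof clarify
    fix g z assume "(g, z) \<in> \<Gamma>"
    then show "\<exists>g' z' i j. (g, z) = (g' + nmult i a - nmult j a, z' * c ^ i / c ^ j) \<and> (g', z') \<in> \<Gamma>"
      by (intro exI[of _ g] exI[of _ z] exI[of _ "0::nat"]) simp
  qed
  have one: "(0, 1) \<in> \<Gamma>" using \<Gamma> by (simp add: partial_hom_def)
  show "(a, c) \<in> ?G"
    by (rule CollectI, rule exI[of _ 0], rule exI[of _ 1], rule exI[of _ 1], rule exI[of _ 0]) (use one in simp)
  show "partial_hom ?G"
    unfolding partial_hom_def
  proof (intro conjI allI impI)
    show "(0, 1) \<in> ?G" using one \<open>\<Gamma> \<subseteq> ?G\<close> by blast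
  next
    fix x z y w assume "(x, z) \<in> ?G" "(y, w) \<in> ?G"
    then obtain g z' i j h w' k l where *: "x = g + nmult i a - nmult j a" "z = z' * c ^ i / c ^ j" "(g, z') \<in> \<Gamma>"
      "y = h + nmult k a - nmult l a" "w = w' * c ^ k / c ^ l" "(h, w') \<in> \<Gamma>" by blast
    have "x - y = (g - h) + nmult (i + l) a - nmult (j + k) a"
      by (simp add: * nmult_add algebra_simps)
    moreover have "z / w = (z' / w') * c ^ (i + l) / c ^ (j + k)"
      using c0 by (simp add: * power_add field_simps)
    ultimately show "(x - y, z / w) \<in> ?G"
      using partial_hom_minus[OF \<Gamma> *(3,6)] by blast
  next
    fix x z assume "(x, z) \<in> ?G"
    then show "norm z = 1" using partial_hom_norm[OF \<Gamma>] c by (auto simp: norm_mult norm_divide norm_power)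
  next
    fix z assume "(0, z) \<in> ?G"
    then obtain g z' i j where *: "0 = g + nmult i a - nmult j a" "z = z' * c ^ i / c ^ j" "(g, z') \<in> \<Gamma>" by blast
    show "z = 1"
    proof (cases "i \<le> j")
      case True
      then obtain d where d: "j = i + d" by (auto simp: le_iff_add)
      have "g = nmult d a" using *(1) by (simp add: d nmult_add algebra_simps)
      then have "z' = c ^ d" using compat *(3) by simp
      then show ?thesis using c0 by (simp add: *(2) d power_add)
    next
      case False
      then obtain d where d: "i = j + d" using le_iff_add[of j i] by auto
      have "g + nmult d a = 0" using *(1) by (simp add: d nmult_add)
      then have "- g = nmult d a" by (rule minus_unique)
      then have "1 / z' = c ^ d" using compat partial_hom_uminus[OF \<Gamma> *(3)] by simp
      moreover have "z' \<noteq> 0" using partial_hom_norm[OF \<Gamma> *(3)] by auto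
      ultimately show ?thesis using c0 by (simp add: *(2) d power_add field_simps)
    qed
  qed
qed

text \<open>The multiples of \<open>a\<close> in the domain are generated by the least positive one,
  so agreement at \<open>n0\<close> implies agreement at all of them. Subtracting \<open>n0\<close>
  repeatedly takes the place of division with remainder.\<close>

lemma partial_hom_compat:
  assumes \<Gamma>: "partial_hom \<Gamma>" and n0: "n0 > 0" "(nmult n0 a, c ^ n0) \<in> \<Gamma>"
    and least: "\<And>r z. 0 < r \<Longrightarrow> r < n0 \<Longrightarrow> (nmult r a, z) \<notin> \<Gamma>"
    and z: "(nmult n a, z) \<in> \<Gamma>"
  shows "z = c ^ n"
  using z
proof (induction n arbitrary: z rule: less_induct)
  case (less n)
  show ?case
  proof (cases "n < n0")
    case True
    then have "n = 0" using least[of n z] less.prems by blast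
    then show ?thesis using less.prems \<Gamma> by (auto simp: partial_hom_def)
  next
    case False
    then obtain d where d: "n = n0 + d" by (auto simp: not_less le_iff_add)
    have "(nmult d a, z / c ^ n0) \<in> \<Gamma>"
      using partial_hom_minus[OF \<Gamma> less.prems n0(2)] by (simp add: d nmult_add)
    then have "z / c ^ n0 = c ^ d" using less.IH[of d] n0(1) d by simp
    moreover have "c ^ n0 \<noteq> 0" using partial_hom_norm[OF \<Gamma> n0(2)] by (metis norm_zero zero_neq_one)
    ultimately show ?thesis by (simp add: d power_add field_simps)
  qed
qed

lemma unimodular_root:
  assumes "norm z = 1" "n > 0" obtains c :: complex where "norm c = 1" "c ^ n = z"
proof
  have "z = cis (Arg z)" using cis_Arg[of z] assms(1) by (cases "z = 0") (auto simp: sgn_div_norm)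
  then show "cis (Arg z / n) ^ n = z" using assms(2) by (simp add: Complex.DeMoivre)
qed simp

text \<open>Divisibility of the circle: a homomorphism that is 1 on \<open>K\<close> and nontrivial
  at \<open>l\<close> is extended to the whole group by Zorn's lemma. The result need not be
  continuous; \<open>extend_character\<close> later keeps only its values on the lattice.\<close>

lemma hom_separates:
  fixes K :: "'g::ab_group_add set"
  assumes K: "0 \<in> K" "\<And>a b. a \<in> K \<Longrightarrow> b \<in> K \<Longrightarrow> a - b \<in> K" and l: "l \<notin> K"
  obtains \<eta> :: "'g \<Rightarrow> complex" where "\<And>x y. \<eta> (x + y) = \<eta> x * \<eta> y" "\<And>x. norm (\<eta> x) = 1"
    "\<And>k. k \<in> K \<Longrightarrow> \<eta> k = 1" "\<eta> l \<noteq> 1"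
proof -
  have ph0: "partial_hom (K \<times> {1})" using K by (auto simp: partial_hom_def)
  \<comment> \<open>If \<open>l\<close> has finite order \<open>n0\<close> modulo \<open>K\<close>,
    a primitive root of unity of that order respects all relations, and it differs from 1 since
    \<open>l\<close> is not in \<open>K\<close>. Otherwise no relation constrains the value and -1
    serves.\<close>
  obtain c :: complex where c: "norm c = 1" "c \<noteq> 1" "\<And>n z. (nmult n l, z) \<in> K \<times> {1} \<Longrightarrow> z = c ^ n"
  proof (cases "\<exists>n>0. nmult n l \<in> K")
    case True
    define n0 where "n0 = (LEAST n. n > 0 \<and> nmult n l \<in> K)"
    have n0: "n0 > 0" "nmult n0 l \<in> K" using LeastI_ex[OF True] by (auto simp: n0_def)
    have least: "0 < r \<Longrightarrow> r < n0 \<Longrightarrow> nmult r l \<notin> K" for r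
      using not_less_Least[of r "\<lambda>n. n > 0 \<and> nmult n l \<in> K"] by (auto simp: n0_def)
    have n1: "n0 \<noteq> 1" using n0 l by auto
    have p: "cis (2 * pi / n0) ^ n0 = 1" using n0 by (simp add: Complex.DeMoivre)
    show thesis
    proof (rule that)
      show "cis (2 * pi / n0) \<noteq> 1"
      proof
        assume "cis (2 * pi / n0) = 1"
        then obtain k :: int where k: "2 * pi / n0 = of_int (2 * k) * pi"
          using cos_one_2pi_int[of "2 * pi / n0"] by (auto simp: complex_eq_iff)
        then have "1 / n0 = of_int k" using n0 by (simp add: field_simps)
        then have "of_int (k * int n0) = (1::real)" using n0 by (simp add: field_simps)
        then have "k * int n0 = 1" by linarith
        then show False using n0 n1 by (auto simp: zmult_eq_1_iff)
      qed
      show "z = cis (2 * pi / n0) ^ n" if "(nmult n l, z) \<in> K \<times> {1}" for n z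
        by (rule partial_hom_compat[OF ph0 n0(1) _ _ that]) (use n0 p least in auto)
    qed simp
  next
    case False
    show thesis
    proof (rule that)
      show "z = (-1) ^ n" if "(nmult n l, z) \<in> K \<times> {1}" for n and z :: complex
        using that False by (cases n) auto
    qed auto
  qed
  obtain \<Gamma>1 where \<Gamma>1: "partial_hom \<Gamma>1" "K \<times> {1} \<subseteq> \<Gamma>1" "(l, c) \<in> \<Gamma>1"
    using partial_hom_extend[OF ph0 c(1,3)] by blast
  let ?A = "{\<Gamma>. partial_hom \<Gamma> \<and> \<Gamma>1 \<subseteq> \<Gamma>}"
  have "\<exists>M\<in>?A. \<forall>X\<in>?A. M \<subseteq> X \<longrightarrow> X = M"
  proof (rule subset_Zorn_nonempty)
    show "?A \<noteq> {}" using \<Gamma>1 by blast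
    fix \<C> assume ne: "\<C> \<noteq> {}" and ch: "subset.chain ?A \<C>"
    have sub: "\<And>\<Gamma>. \<Gamma> \<in> \<C> \<Longrightarrow> partial_hom \<Gamma> \<and> \<Gamma>1 \<subseteq> \<Gamma>"
      using ch by (auto simp: subset_chain_def)
    have lin: "\<And>X Y. X \<in> \<C> \<Longrightarrow> Y \<in> \<C> \<Longrightarrow> X \<subseteq> Y \<or> Y \<subseteq> X"
      using ch by (auto simp: subset_chain_def)
    have "partial_hom (\<Union>\<C>)"
      unfolding partial_hom_def
    proof (intro conjI allI impI)
      show "(0, 1) \<in> \<Union>\<C>" using ne sub by (auto simp: partial_hom_def)
    next
      fix a z b w assume "(a, z) \<in> \<Union>\<C>" "(b, w) \<in> \<Union>\<C>"
      then obtain X Y where XY: "X \<in> \<C>" "Y \<in> \<C>" "(a, z) \<in> X" "(b, w) \<in> Y" by blast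
      then obtain Z where "Z \<in> \<C>" "(a, z) \<in> Z" "(b, w) \<in> Z" using lin[OF XY(1,2)] by blast
      then show "(a - b, z / w) \<in> \<Union>\<C>" using sub partial_hom_minus by blast
    qed (use sub in \<open>auto simp: partial_hom_def\<close>)
    then show "\<Union>\<C> \<in> ?A" using ne sub by blast
  qed
  then obtain M where M: "partial_hom M" "\<Gamma>1 \<subseteq> M" and max: "\<And>X. partial_hom X \<Longrightarrow> M \<subseteq> X \<Longrightarrow> X = M"
    by auto
  have total: "\<exists>z. (a, z) \<in> M" for a
  proof -
    \<comment> \<open>Some value for \<open>a\<close> is always compatible: a root of the value at
      the least positive multiple of \<open>a\<close> in the domain, or any value if no such
      multiple exists. Maximality then forces \<open>a\<close> into the domain.\<close>
    have "\<exists>c. norm c = 1 \<and> (\<forall>n z. (nmult n a, z) \<in> M \<longrightarrow> z = c ^ n)"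
    proof (cases "\<exists>n>0. \<exists>z. (nmult n a, z) \<in> M")
      case True
      define n0 where "n0 = (LEAST n. n > 0 \<and> (\<exists>z. (nmult n a, z) \<in> M))"
      have n0: "n0 > 0" "\<exists>z. (nmult n0 a, z) \<in> M"
        using LeastI_ex[of "\<lambda>n. n > 0 \<and> (\<exists>z. (nmult n a, z) \<in> M)"] True by (auto simp: n0_def)
      have least: "0 < r \<Longrightarrow> r < n0 \<Longrightarrow> (nmult r a, z) \<notin> M" for r z
        using not_less_Least[of r "\<lambda>n. n > 0 \<and> (\<exists>z. (nmult n a, z) \<in> M)"] by (auto simp: n0_def)
      obtain z0 where z0: "(nmult n0 a, z0) \<in> M" using n0 by blast
      obtain c where c: "norm c = 1" "c ^ n0 = z0"
        using unimodular_root[OF partial_hom_norm[OF M(1) z0] n0(1)] .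
      show ?thesis
      proof (intro exI[of _ c] conjI allI impI)
        fix n z assume "(nmult n a, z) \<in> M"
        then show "z = c ^ n" using partial_hom_compat[OF M(1) n0(1), of a c n z] z0 c(2) least by blast
      qed (rule c)
    next
      case False
      then show ?thesis
        by (intro exI[of _ 1]) (metis M(1) bot_nat_0.not_eq_extremum nmult_simps(1) norm_one partial_hom_def power_one)
    qed
    then obtain c where c: "norm c = 1" "\<And>n z. (nmult n a, z) \<in> M \<Longrightarrow> z = c ^ n" by blast
    obtain M' where "partial_hom M'" "M \<subseteq> M'" "(a, c) \<in> M'"
      using partial_hom_extend[OF M(1) c] by blast
    then show ?thesis using max by blast
  qed
  define \<eta> where "\<eta> x = (SOME z. (x, z) \<in> M)" for x
  have \<eta>: "(x, \<eta> x) \<in> M" for x using someI_ex[OF total] by (simp add: \<eta>_def)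
  show thesis
  proof (rule that)
    show "\<eta> (x + y) = \<eta> x * \<eta> y" for x y
      using partial_hom_unique[OF M(1) \<eta> partial_hom_plus[OF M(1) \<eta> \<eta>]] .
    show "norm (\<eta> x) = 1" for x using partial_hom_norm[OF M(1) \<eta>] .
    show "\<eta> k = 1" if "k \<in> K" for k using partial_hom_unique[OF M(1) \<eta>, of k 1] \<Gamma>1 M that by auto
    have "\<eta> l = c" using partial_hom_unique[OF M(1) \<eta>, of l c] \<Gamma>1 M by auto
    then show "\<eta> l \<noteq> 1" using c by simp
  qed
qed

section \<open>Locally compact abelian groups\<close>

locale lca =
  fixes \<mu> :: "'g::{ab_group_add, t2_space, second_countable_topology} measure"
  assumes G: "LCA_group TYPE('g)" and haar: "haar_measure \<mu>"
begin

lemma sets_mu [simp, measurable_cong]: "sets \<mu> = sets borel" and space_mu [simp]: "space \<mu> = UNIV"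
  using haar by (auto simp: haar_measure_def)

lemma continuous_plus_UNIV: "continuous_on UNIV (\<lambda>p::'g \<times> 'g. fst p + snd p)"
  and continuous_uminus_UNIV: "continuous_on UNIV (\<lambda>x::'g. - x)"
  and locally_compact: "locally_compact_space (euclidean :: 'g topology)"
  using G by (auto simp: LCA_group_def)

lemma continuous_on_group_plus [continuous_intros]:
  fixes f g :: "'b::topological_space \<Rightarrow> 'g"
  assumes "continuous_on A f" "continuous_on A g" shows "continuous_on A (\<lambda>x. f x + g x)"
  using continuous_on_compose2[OF continuous_plus_UNIV continuous_on_Pair[OF assms]] by simp

lemma continuous_on_group_uminus [continuous_intros]:
  fixes f :: "'b::topological_space \<Rightarrow> 'g"
  assumes "continuous_on A f" shows "continuous_on A (\<lambda>x. - f x)"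
  using continuous_on_compose2[OF continuous_uminus_UNIV assms] by simp

lemma continuous_on_group_diff [continuous_intros]:
  fixes f g :: "'b::topological_space \<Rightarrow> 'g"
  assumes "continuous_on A f" "continuous_on A g" shows "continuous_on A (\<lambda>x. f x - g x)"
  using continuous_on_group_plus[OF assms(1) continuous_on_group_uminus[OF assms(2)]] by simp

lemma measurable_plus [measurable]:
  fixes f g :: "'b \<Rightarrow> 'g"
  assumes [measurable]: "f \<in> borel_measurable N" "g \<in> borel_measurable N"
  shows "(\<lambda>x. f x + g x) \<in> borel_measurable N"
proof -
  have 1: "(\<lambda>p::'g \<times> 'g. fst p + snd p) \<in> borel_measurable (borel \<Otimes>\<^sub>M borel)"
    using borel_measurable_continuous_onI[OF continuous_plus_UNIV] by (simp add: borel_prod)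
  have 2: "(\<lambda>x. (f x, g x)) \<in> N \<rightarrow>\<^sub>M borel \<Otimes>\<^sub>M borel" by measurable
  show ?thesis using measurable_compose[OF 2 1] by simp
qed

lemma measurable_uminus [measurable]:
  fixes f :: "'b \<Rightarrow> 'g"
  assumes [measurable]: "f \<in> borel_measurable N" shows "(\<lambda>x. - f x) \<in> borel_measurable N"
  using borel_measurable_continuous_onI[OF continuous_uminus_UNIV] assms by (rule measurable_compose[rotated])

lemma measurable_minus [measurable]:
  fixes f g :: "'b \<Rightarrow> 'g"
  assumes [measurable]: "f \<in> borel_measurable N" "g \<in> borel_measurable N"
  shows "(\<lambda>x. f x - g x) \<in> borel_measurable N"
proof -
  have "(\<lambda>x. f x + (- g x)) \<in> borel_measurable N" by measurable
  then show ?thesis by simp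
qed

lemma distr_translate: "distr \<mu> \<mu> (\<lambda>x. x + t) = \<mu>"
proof (rule measure_eqI)
  fix A assume "A \<in> sets (distr \<mu> \<mu> (\<lambda>x. x + t))"
  then have A: "A \<in> sets \<mu>" by simp
  have "(\<lambda>x. x + t) -` A = (\<lambda>y. - t + y) ` A"
    by (auto simp: image_iff algebra_simps intro!: bexI)
  then have "emeasure \<mu> ((\<lambda>x. x + t) -` A) = emeasure \<mu> A"
    using haar A unfolding haar_measure_def by metis
  then show "emeasure (distr \<mu> \<mu> (\<lambda>x. x + t)) A = emeasure \<mu> A"
    using A by (subst emeasure_distr) auto
qed simp

lemma nn_integral_translate:
  "f \<in> borel_measurable borel \<Longrightarrow> (\<integral>\<^sup>+x. f (x + t) \<partial>\<mu>) = (\<integral>\<^sup>+x. f x \<partial>\<mu>)"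
  using nn_integral_distr[of "\<lambda>x. x + t" \<mu> \<mu> f] distr_translate[of t] by simp

lemma integral_translate:
  fixes f :: "'g \<Rightarrow> 'b::{banach, second_countable_topology}"
  shows "f \<in> borel_measurable borel \<Longrightarrow> (\<integral>x. f (x + t) \<partial>\<mu>) = (\<integral>x. f x \<partial>\<mu>)"
  using integral_distr[of "\<lambda>x. x + t" \<mu> \<mu> f] distr_translate[of t] by simp

lemma integrable_translate:
  fixes f :: "'g \<Rightarrow> 'b::{banach, second_countable_topology}"
  shows "f \<in> borel_measurable borel \<Longrightarrow> integrable \<mu> (\<lambda>x. f (x + t)) \<longleftrightarrow> integrable \<mu> f"
  using integrable_distr_eq[of "\<lambda>x. x + t" \<mu> \<mu> f] distr_translate[of t] by simp

lemma emeasure_compact_finite: "compact K \<Longrightarrow> emeasure \<mu> K < \<infinity>"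
  and emeasure_UNIV_nz: "emeasure \<mu> UNIV \<noteq> 0"
  using haar by (auto simp: haar_measure_def)

lemma open_translate: "open U \<Longrightarrow> open {x::'g. x + t \<in> U}"
  using open_vimage[of U "\<lambda>x. x + t"] continuous_on_group_plus[OF continuous_on_id continuous_on_const]
  by (simp add: vimage_def)

text \<open>By the Lindelof property countably many translates of a nonempty open set cover the
  group, so a null one would make the whole group null.\<close>

lemma emeasure_open_pos:
  assumes U: "open (U :: 'g set)" "U \<noteq> {}" shows "emeasure \<mu> U \<noteq> 0"
proof
  assume 0: "emeasure \<mu> U = 0"
  let ?F = "range (\<lambda>t. {x. x + t \<in> U})"
  have "\<And>S. S \<in> ?F \<Longrightarrow> open S" using open_translate[OF U(1)] by auto
  then obtain F' where F': "F' \<subseteq> ?F" "countable F'" "\<Union>F' = \<Union>?F"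
    by (rule Lindelof)
  obtain a where a: "a \<in> U" using U by blast
  have "x \<in> {x. x + (a - x) \<in> U}" for x using a by simp
  then have UN: "\<Union>?F = UNIV" by blast
  have null: "S \<in> null_sets \<mu>" if S: "S \<in> F'" for S
  proof -
    obtain t where t: "S = {x. x + t \<in> U}" using S F'(1) by auto
    have "emeasure \<mu> S = emeasure (distr \<mu> \<mu> (\<lambda>x. x + t)) U"
      using U(1) by (subst emeasure_distr) (auto simp: t vimage_def)
    then show ?thesis using open_translate[OF U(1), of t] 0 by (auto simp: distr_translate t)
  qed
  have "(\<Union>S\<in>F'. S) \<in> null_sets \<mu>" by (rule null_sets_UN') (use F' null in auto)
  then show False using emeasure_UNIV_nz F'(3) UN by auto
qed

lemma AE_continuous_eq_0:
  assumes f: "continuous_on UNIV (f :: 'g \<Rightarrow> complex)" and ae: "AE x in \<mu>. f x = 0"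
  shows "f x = 0"
proof (rule ccontr)
  assume "f x \<noteq> 0"
  have o: "open {x. f x \<noteq> 0}"
    using f by (intro open_Collect_neq) (auto intro: continuous_intros)
  then have "emeasure \<mu> {x. f x \<noteq> 0} = 0"
    using ae by (subst (asm) AE_iff_measurable[of "{x. f x \<noteq> 0}"]) auto
  then show False using emeasure_open_pos[OF o] \<open>f x \<noteq> 0\<close> by auto
qed

lemma nhd_half:
  assumes U: "open (U::'g set)" "0 \<in> U"
  obtains V where "open V" "0 \<in> V" "V \<subseteq> U" "\<And>x. x \<in> V \<Longrightarrow> - x \<in> V" "\<And>x y. x \<in> V \<Longrightarrow> y \<in> V \<Longrightarrow> x + y \<in> U"
proof -
  have "open ((\<lambda>p. fst p + snd p) -` U)"
    by (rule open_vimage[OF U(1) continuous_plus_UNIV])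
  moreover have "(0, 0) \<in> ((\<lambda>p. fst p + snd p) -` U)" using U by simp
  ultimately obtain A B where AB: "open A" "open B" "(0,0) \<in> A \<times> B" "A \<times> B \<subseteq> (\<lambda>p. fst p + snd p) -` U"
    by (rule open_prod_elim)
  define D where "D = A \<inter> B \<inter> U"
  have D: "open D" "0 \<in> D" using AB U by (auto simp: D_def)
  have oD: "open (uminus -` D)"
    by (rule open_vimage[OF D(1) continuous_uminus_UNIV])
  show thesis
  proof (rule that[of "D \<inter> uminus -` D"])
    show "x + y \<in> U" if "x \<in> D \<inter> uminus -` D" "y \<in> D \<inter> uminus -` D" for x y
    proof -
      have "(x, y) \<in> A \<times> B" using that by (auto simp: D_def)
      then show ?thesis using AB(4) by auto
    qed
  qed (use D oD in \<open>auto simp: D_def\<close>)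
qed

lemma nhd_compact:
  obtains V K where "open V" "(0::'g) \<in> V" "compact K" "V \<subseteq> K"
proof -
  obtain V K where "openin euclidean V" "compactin euclidean K" "(0::'g) \<in> V" "V \<subseteq> K"
    using locally_compact unfolding locally_compact_space_def by (metis UNIV_I topspace_euclidean)
  then show thesis using that by simp
qed

text \<open>A Urysohn function, available because locally compact Hausdorff spaces are completely
  regular.\<close>

lemma bump:
  assumes U: "open (U::'g set)" "0 \<in> U"
  obtains u :: "'g \<Rightarrow> real" where "continuous_on UNIV u" "\<And>x. 0 \<le> u x" "\<And>x. u x \<le> 1" "u 0 = 1" "\<And>x. x \<notin> U \<Longrightarrow> u x = 0"
proof -
  have "completely_regular_space (euclidean :: 'g topology)"
    using locally_compact
    by (intro locally_compact_regular_imp_completely_regular_space locally_compact_Hausdorff_imp_regular_space disjI1)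
      (auto simp: Hausdorff_space_def separation_t2 disjnt_def)
  then obtain f where f: "continuous_map euclidean (top_of_set {0..1::real}) f" "f 0 = 0" "f ` (- U) \<subseteq> {1}"
    using U unfolding completely_regular_space_def by (auto simp: closed_def) blast
  show thesis
  proof (rule that[of "\<lambda>x. 1 - f x"])
    show "continuous_on UNIV (\<lambda>x. 1 - f x)"
      using f(1) by (intro continuous_intros) (auto simp: continuous_map_in_subtopology)
    show "0 \<le> 1 - f x" "1 - f x \<le> 1" for x
      using continuous_map_image_subset_topspace[OF f(1)] by (auto simp: image_subset_iff)
  qed (use f in auto)
qed

end

section \<open>Lattices and quasi-periodic functions\<close>

lemma lattice_0: "lattice L \<Longrightarrow> 0 \<in> L"
  and lattice_diff: "lattice L \<Longrightarrow> a \<in> L \<Longrightarrow> b \<in> L \<Longrightarrow> a - b \<in> L"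
  by (auto simp: lattice_def)

lemma lattice_uminus: "lattice L \<Longrightarrow> a \<in> L \<Longrightarrow> - a \<in> L"
  using lattice_diff[of L 0 a] lattice_0 by auto

lemma lattice_plus: "lattice L \<Longrightarrow> a \<in> L \<Longrightarrow> b \<in> L \<Longrightarrow> a + b \<in> L"
  using lattice_diff[of L a "- b"] lattice_uminus by auto

lemma lattice_countable:
  fixes L :: "'g::{ab_group_add, t2_space, second_countable_topology} set"
  assumes "lattice L" shows "countable L"
proof -
  obtain B :: "'g set set" where B: "countable B" "topological_basis B"
    using ex_countable_basis by blast
  have "\<exists>b\<in>B. b \<inter> L = {l}" if l: "l \<in> L" for l
  proof -
    obtain U where U: "open U" "U \<inter> L = {l}" using assms l by (auto simp: lattice_def)
    have "l \<in> U" using U by blast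
    then obtain b where "b \<in> B" "l \<in> b" "b \<subseteq> U" using topological_basisE[OF B(2) U(1)] by blast
    then show ?thesis using U l by blast
  qed
  then obtain b where b: "\<And>l. l \<in> L \<Longrightarrow> b l \<in> B" "\<And>l. l \<in> L \<Longrightarrow> b l \<inter> L = {l}" by metis
  have "inj_on b L" by (rule inj_onI) (metis b(2) the_elem_eq)
  moreover have "countable (b ` L)" using b(1) B(1) by (auto intro: countable_subset)
  ultimately show ?thesis by (rule countable_image_inj_on[rotated])
qed

locale lca_lattice = lca \<mu> for \<mu> :: "'g::{ab_group_add, t2_space, second_countable_topology} measure" +
  fixes L C :: "'g set"
  assumes lat: "lattice L" and tiling: "tiling_set L C"
begin

lemmas L0 = lattice_0[OF lat] and Luminus = lattice_uminus[OF lat]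
  and Lplus = lattice_plus[OF lat] and Ldiff = lattice_diff[OF lat] and Lcountable = lattice_countable[OF lat]

sublocale T: tile \<mu> L "\<lambda>l x. x + l" uminus C
proof
  show "countable L" by (rule Lcountable)
  show "distr \<mu> \<mu> (\<lambda>x. x + i) = \<mu>" for i by (rule distr_translate)
  show "bij_betw uminus L L"
    by (rule bij_betw_byWitness[where f'=uminus]) (use Luminus in auto)
  show "C \<in> sets \<mu>" using tiling by (simp add: tiling_set_def)
  fix x
  obtain p where p: "fst p \<in> C \<and> snd p \<in> L \<and> x = fst p + snd p"
    "\<And>r. fst r \<in> C \<and> snd r \<in> L \<and> x = fst r + snd r \<Longrightarrow> r = p"
    using tiling unfolding tiling_set_def by blast
  show "\<exists>!i. i \<in> L \<and> x + i \<in> C"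
  proof (rule ex1I)
    show "- snd p \<in> L \<and> x + - snd p \<in> C" using p(1) Luminus by auto
    fix i assume "i \<in> L \<and> x + i \<in> C"
    then have "(x + i, - i) = p" using Luminus by (intro p(2)) auto
    then show "i = - snd p" by auto
  qed
qed auto

abbreviation "MC \<equiv> T.MC"

text \<open>Cocompactness supplies a compact set, hence one of finite Haar measure, that meets every
  coset of \<open>L\<close>.\<close>

lemma emeasure_C_finite: "emeasure \<mu> C < \<infinity>"
proof -
  obtain K0 where K0: "compact K0" "\<And>x. \<exists>k\<in>K0. \<exists>l\<in>L. x = k + l" using lat by (auto simp: lattice_def)
  show ?thesis
  proof (rule T.emeasure_tile_finite)
    show "K0 \<in> sets \<mu>" using K0(1) by (simp add: borel_compact)
    show "emeasure \<mu> K0 < \<infinity>" by (rule emeasure_compact_finite[OF K0(1)])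
    show "\<exists>i\<in>L. x + i \<in> K0" for x
    proof -
      obtain k l where "k \<in> K0" "l \<in> L" "x = k + l" using K0(2) by blast
      then show ?thesis by (intro bexI[of _ "- l"]) (auto simp: Luminus)
    qed
  qed
qed

sublocale MC: finite_measure MC
  by standard (use emeasure_C_finite in \<open>auto simp: T.emeasure_MC\<close>)

sublocale sigma_finite_measure \<mu>
  by (rule T.sigma_finite[OF emeasure_C_finite])

definition vol :: real where "vol = measure \<mu> C"

lemma vol_pos: "vol > 0"
  using T.emeasure_tile_pos emeasure_UNIV_nz emeasure_C_finite
  by (simp add: vol_def measure_def enn2real_positive_iff zero_less_iff_neq_zero)

lemma measure_MC_UNIV: "measure MC UNIV = vol"
  by (simp add: vol_def measure_def T.emeasure_MC)

text \<open>Both conditions hold everywhere and not merely modulo null sets, so translates and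
  products can be formed pointwise; such functions are automatically integrable over the
  tile.\<close>

definition bdd_meas :: "('g \<Rightarrow> complex) \<Rightarrow> bool" where
  "bdd_meas f \<longleftrightarrow> f \<in> borel_measurable borel \<and> (\<exists>B. \<forall>x. norm (f x) \<le> B)"

lemma bdd_meas_measurable [measurable_dest]: "bdd_meas f \<Longrightarrow> f \<in> borel_measurable borel"
  by (simp add: bdd_meas_def)

lemma bdd_meas_bound: "bdd_meas f \<Longrightarrow> \<exists>B\<ge>0. \<forall>x. norm (f x) \<le> B"
  unfolding bdd_meas_def by (meson norm_ge_zero order_trans)

lemma bdd_meas_add: "bdd_meas f \<Longrightarrow> bdd_meas g \<Longrightarrow> bdd_meas (\<lambda>x. f x + g x)"
  unfolding bdd_meas_def by (auto intro: norm_triangle_mono)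

lemma bdd_meas_mult: "bdd_meas f \<Longrightarrow> bdd_meas g \<Longrightarrow> bdd_meas (\<lambda>x. f x * g x)"
proof -
  assume f: "bdd_meas f" and g: "bdd_meas g"
  obtain A B where AB: "A \<ge> 0" "B \<ge> 0" "\<And>x. norm (f x) \<le> A" "\<And>x. norm (g x) \<le> B"
    using bdd_meas_bound[OF f] bdd_meas_bound[OF g] by blast
  have "norm (f x * g x) \<le> A * B" for x unfolding norm_mult by (intro mult_mono AB) auto
  then show ?thesis using f g unfolding bdd_meas_def by auto
qed

lemma bdd_meas_const [simp]: "bdd_meas (\<lambda>x. c)" by (auto simp: bdd_meas_def)

lemma bdd_meas_diff: "bdd_meas f \<Longrightarrow> bdd_meas g \<Longrightarrow> bdd_meas (\<lambda>x. f x - g x)"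
  using bdd_meas_add[of f "\<lambda>x. - 1 * g x"] bdd_meas_mult[of "\<lambda>x. - 1" g] by simp

lemma bdd_meas_cnj: "bdd_meas f \<Longrightarrow> bdd_meas (\<lambda>x. cnj (f x))"
  unfolding bdd_meas_def by (auto intro: measurable_compose[OF _ borel_measurable_continuous_onI[OF continuous_on_cnj[OF continuous_on_id]]])

lemma bdd_meas_shift: "bdd_meas f \<Longrightarrow> bdd_meas (\<lambda>x. f (x + t))" unfolding bdd_meas_def by auto

lemmas bdd_meas_intros = bdd_meas_add bdd_meas_diff bdd_meas_mult bdd_meas_const bdd_meas_cnj bdd_meas_shift

lemma bdd_meas_integrable: "bdd_meas f \<Longrightarrow> integrable MC f"
proof -
  assume f: "bdd_meas f"
  then obtain B where "\<And>x. norm (f x) \<le> B" unfolding bdd_meas_def by blast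
  then show ?thesis using f by (intro MC.integrable_const_bound[where B=B]) (auto simp: bdd_meas_def)
qed

lemma bdd_meas_integrable_norm2: "bdd_meas f \<Longrightarrow> integrable MC (\<lambda>x. (norm (f x))\<^sup>2)"
proof -
  assume f: "bdd_meas f"
  have "integrable MC (\<lambda>x. Re (f x * cnj (f x)))"
    by (intro integrable_Re bdd_meas_integrable bdd_meas_intros f)
  then show ?thesis by (simp add: complex_norm_square[symmetric] del: of_real_power)
qed

definition sqnorm :: "('g \<Rightarrow> complex) \<Rightarrow> real" where "sqnorm f = (\<integral>x. (norm (f x))\<^sup>2 \<partial>MC)"

lemma sqnorm_nonneg: "0 \<le> sqnorm f" unfolding sqnorm_def by simp

text \<open>Bounded sections of the line bundle over the quotient by \<open>L\<close> determined by
  \<eta>, in other words vectors of the representation induced from \<eta>. A character that agrees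
  with \<eta> on \<open>L\<close> is itself such a function, which is why it is sought among
  them.\<close>

definition quasi_periodic :: "('g \<Rightarrow> complex) \<Rightarrow> ('g \<Rightarrow> complex) \<Rightarrow> bool" where
  "quasi_periodic \<eta> f \<longleftrightarrow> bdd_meas f \<and> (\<forall>x. \<forall>l\<in>L. f (x + l) = \<eta> l * f x)"

lemma quasi_periodic_bdd_meas: "quasi_periodic \<eta> f \<Longrightarrow> bdd_meas f" by (simp add: quasi_periodic_def)

lemma quasi_periodic_L: "quasi_periodic \<eta> f \<Longrightarrow> l \<in> L \<Longrightarrow> f (x + l) = \<eta> l * f x" by (simp add: quasi_periodic_def)

lemma quasi_periodic_add: "quasi_periodic \<eta> f \<Longrightarrow> quasi_periodic \<eta> g \<Longrightarrow> quasi_periodic \<eta> (\<lambda>x. f x + g x)"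
  by (auto simp: quasi_periodic_def algebra_simps intro!: bdd_meas_intros)

lemma quasi_periodic_diff: "quasi_periodic \<eta> f \<Longrightarrow> quasi_periodic \<eta> g \<Longrightarrow> quasi_periodic \<eta> (\<lambda>x. f x - g x)"
  by (auto simp: quasi_periodic_def algebra_simps intro!: bdd_meas_intros)

lemma quasi_periodic_cmult: "quasi_periodic \<eta> f \<Longrightarrow> quasi_periodic \<eta> (\<lambda>x. c * f x)"
  by (auto simp: quasi_periodic_def algebra_simps intro!: bdd_meas_intros)

lemma quasi_periodic_shift: "quasi_periodic \<eta> f \<Longrightarrow> quasi_periodic \<eta> (\<lambda>x. f (x + t))"
proof -
  assume f: "quasi_periodic \<eta> f"
  have "f (x + l + t) = \<eta> l * f (x + t)" if "l \<in> L" for x l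
    using quasi_periodic_L[OF f that, of "x + t"] by (simp add: ac_simps)
  then show ?thesis using f by (auto simp: quasi_periodic_def intro!: bdd_meas_intros)
qed

text \<open>On periodic functions the integral over the tile is the invariant integral over the
  quotient by \<open>L\<close>.\<close>

lemma integral_periodic_shift:
  assumes F: "bdd_meas F" and per: "\<And>x l. l \<in> L \<Longrightarrow> F (x + l) = F x"
  shows "(\<integral>x. F (x + t) \<partial>MC) = (\<integral>x. F x \<partial>MC)"
proof -
  obtain B where "\<And>x. norm (F x) \<le> B" using F unfolding bdd_meas_def by blast
  then show ?thesis
    using F by (intro T.integral_tile_shift[where \<sigma>' = "\<lambda>x. x - t" and B = B])
      (auto simp: per distr_translate bdd_meas_def add_diff_eq diff_add_eq emeasure_C_finite[unfolded infinity_ennreal_def])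
qed

lemma inner_shift:
  assumes f: "quasi_periodic \<eta> f" and g: "quasi_periodic \<eta> g" and \<eta>: "\<And>l. l \<in> L \<Longrightarrow> norm (\<eta> l) = 1"
  shows "(\<integral>x. f (x + t) * cnj (g (x + t)) \<partial>MC) = (\<integral>x. f x * cnj (g x) \<partial>MC)"
proof (rule integral_periodic_shift)
  show "bdd_meas (\<lambda>x. f x * cnj (g x))" using f g by (intro bdd_meas_intros quasi_periodic_bdd_meas) auto
  fix x l assume l: "l \<in> L"
  have "\<eta> l * cnj (\<eta> l) = 1" using \<eta>[OF l] by (simp add: complex_norm_square[symmetric])
  then show "f (x + l) * cnj (g (x + l)) = f x * cnj (g x)"
    by (simp add: quasi_periodic_L[OF f l] quasi_periodic_L[OF g l])
qed

lemma sqnorm_eq_inner: "bdd_meas f \<Longrightarrow> complex_of_real (sqnorm f) = (\<integral>x. f x * cnj (f x) \<partial>MC)"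
  unfolding sqnorm_def by (simp only: complex_norm_square[symmetric] integral_complex_of_real)

lemma sqnorm_shift:
  assumes f: "quasi_periodic \<eta> f" and \<eta>: "\<And>l. l \<in> L \<Longrightarrow> norm (\<eta> l) = 1"
  shows "sqnorm (\<lambda>x. f (x + t)) = sqnorm f"
proof -
  have "complex_of_real (sqnorm (\<lambda>x. f (x + t))) = complex_of_real (sqnorm f)"
    by (subst (1 2) sqnorm_eq_inner) (auto intro!: bdd_meas_shift quasi_periodic_bdd_meas[OF f] simp: inner_shift[OF f f \<eta>])
  then show ?thesis by simp
qed

lemma sqnorm_cmult: "sqnorm (\<lambda>x. c * f x) = (norm c)\<^sup>2 * sqnorm f"
  by (simp add: sqnorm_def norm_mult power_mult_distrib)

text \<open>A diagonal matrix coefficient of the translation representation, hence a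
  positive-definite function of \<open>t\<close>; its value at 0 is \<open>sqnorm f\<close>.\<close>

definition autocorr :: "('g \<Rightarrow> complex) \<Rightarrow> 'g \<Rightarrow> complex" where
  "autocorr f t = (\<integral>x. f (x + t) * cnj (f x) \<partial>MC)"

lemma autocorr_0: "bdd_meas f \<Longrightarrow> autocorr f 0 = of_real (sqnorm f)"
  by (simp add: autocorr_def sqnorm_eq_inner)

text \<open>Cauchy-Schwarz in the form 2ab \<le> a^2 + b^2, which loses nothing here because shifts
  preserve \<open>sqnorm\<close>.\<close>

lemma autocorr_bound:
  assumes f: "quasi_periodic \<eta> f" and \<eta>: "\<And>l. l \<in> L \<Longrightarrow> norm (\<eta> l) = 1"
  shows "norm (autocorr f t) \<le> sqnorm f"
proof -
  have bf: "bdd_meas f" "bdd_meas (\<lambda>x. f (x + t))" using f by (auto intro: quasi_periodic_bdd_meas bdd_meas_shift)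
  have i: "integrable MC (\<lambda>x. (norm (f (x + t)))\<^sup>2)" "integrable MC (\<lambda>x. (norm (f x))\<^sup>2)"
    using bdd_meas_integrable_norm2 bf by auto
  have "norm (autocorr f t) \<le> (\<integral>x. norm (f (x + t) * cnj (f x)) \<partial>MC)"
    unfolding autocorr_def by (rule integral_norm_bound)
  also have "\<dots> \<le> (\<integral>x. ((norm (f (x + t)))\<^sup>2 + (norm (f x))\<^sup>2) / 2 \<partial>MC)"
  proof (rule integral_mono)
    show "integrable MC (\<lambda>x. norm (f (x + t) * cnj (f x)))"
      by (intro integrable_norm bdd_meas_integrable bdd_meas_intros bf)
    show "norm (f (x + t) * cnj (f x)) \<le> ((norm (f (x + t)))\<^sup>2 + (norm (f x))\<^sup>2) / 2" for x
      using sum_squares_bound[of "norm (f (x + t))" "norm (f x)"] by (simp add: norm_mult)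
  qed (use i in auto)
  also have "\<dots> = (sqnorm (\<lambda>x. f (x + t)) + sqnorm f) / 2" using i by (simp add: sqnorm_def)
  also have "\<dots> = sqnorm f" by (simp add: sqnorm_shift[OF f \<eta>])
  finally show ?thesis .
qed

lemma autocorr_L: "quasi_periodic \<eta> f \<Longrightarrow> l \<in> L \<Longrightarrow> autocorr f (t + l) = \<eta> l * autocorr f t"
  unfolding autocorr_def by (simp add: add.assoc[symmetric] quasi_periodic_L mult.assoc)

lemma autocorr_measurable: "bdd_meas f \<Longrightarrow> autocorr f \<in> borel_measurable borel"
proof -
  assume "bdd_meas f"
  note [measurable] = bdd_meas_measurable[OF this]
    measurable_compose[OF _ borel_measurable_continuous_onI[OF continuous_on_cnj[OF continuous_on_id]]]
  show ?thesis
    unfolding autocorr_def by (rule MC.borel_measurable_lebesgue_integral) measurable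
qed

lemma autocorr_minus:
  assumes f: "quasi_periodic \<eta> f" and \<eta>: "\<And>l. l \<in> L \<Longrightarrow> norm (\<eta> l) = 1"
  shows "autocorr f (- t) = cnj (autocorr f t)"
proof -
  have "autocorr f (- t) = (\<integral>x. f (x - t) * cnj (f x) \<partial>MC)" by (simp add: autocorr_def)
  also have "\<dots> = (\<integral>x. f (x + t - t) * cnj (f (x + t)) \<partial>MC)"
    by (rule inner_shift[OF _ f \<eta>, symmetric, where f="\<lambda>x. f (x - t)"]) (use quasi_periodic_shift[OF f, of "-t"] in auto)
  also have "\<dots> = (\<integral>x. cnj (f (x + t) * cnj (f x)) \<partial>MC)" by (simp add: mult.commute)
  also have "\<dots> = cnj (autocorr f t)" unfolding autocorr_def by (rule Bochner_Integration.integral_cnj)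
  finally show ?thesis .
qed

text \<open>By \<open>inner_shift\<close> each of the four products depends only on the difference
  of the two shifts, and |z| = 1 merges the two diagonal ones.\<close>

lemma autocorr_perturb:
  assumes f: "quasi_periodic \<eta> f" and \<eta>: "\<And>l. l \<in> L \<Longrightarrow> norm (\<eta> l) = 1" and z: "norm z = 1"
  shows "autocorr (\<lambda>x. f x + z * f (x + t)) s = 2 * autocorr f s + z * autocorr f (s + t) + cnj z * autocorr f (s - t)"
proof -
  have bf: "bdd_meas f" using f by (rule quasi_periodic_bdd_meas)
  have zz: "z * cnj z = 1" using z by (simp add: complex_norm_square[symmetric])
  have i: "integrable MC (\<lambda>x. f (x + a) * cnj (f (x + b)))" for a b
    by (intro bdd_meas_integrable bdd_meas_intros bf)
  have i0: "integrable MC (\<lambda>x. f (x + a) * cnj (f x))" for a using i[of a 0] by simp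
  have e: "(\<integral>x. f (x + a) * cnj (f (x + b)) \<partial>MC) = autocorr f (a - b)" for a b
    using inner_shift[OF quasi_periodic_shift[OF f, of "a - b"] f \<eta>, of b] by (simp add: autocorr_def ac_simps)
  have "autocorr (\<lambda>x. f x + z * f (x + t)) s = (\<integral>x. f (x + s) * cnj (f x) + f (x + (s + t)) * cnj (f (x + t))
       + z * (f (x + (s + t)) * cnj (f x)) + cnj z * (f (x + s) * cnj (f (x + t))) \<partial>MC)"
    unfolding autocorr_def
  proof (intro Bochner_Integration.integral_cong refl)
    fix x
    have "(a + z * b) * cnj (c + z * d) = a * cnj c + b * cnj d + z * (b * cnj c) + cnj z * (a * cnj d)" for a b c d
    proof -
      have "(a + z * b) * cnj (c + z * d) = a * cnj c + (z * cnj z) * (b * cnj d) + z * (b * cnj c) + cnj z * (a * cnj d)"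
        by (simp add: algebra_simps)
      then show ?thesis by (simp add: zz)
    qed
    then show "(f (x + s) + z * f (x + s + t)) * cnj (f x + z * f (x + t)) = f (x + s) * cnj (f x) + f (x + (s + t)) * cnj (f (x + t))
       + z * (f (x + (s + t)) * cnj (f x)) + cnj z * (f (x + s) * cnj (f (x + t)))" by (simp add: add.assoc)
  qed
  also have "\<dots> = autocorr f s + autocorr f s + z * autocorr f (s + t) + cnj z * autocorr f (s - t)"
    using i i0 by (simp add: e[of s 0, simplified] e) (simp add: autocorr_def)
  finally show ?thesis by simp
qed

end

section \<open>An extremal problem for positive-definite functions\<close>

locale char_ext = lca_lattice \<mu> L C
  for \<mu> :: "'g::{ab_group_add, t2_space, second_countable_topology} measure" and L C +
  fixes \<eta> :: "'g \<Rightarrow> complex" and u :: "'g \<Rightarrow> real"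
  assumes \<eta>_add: "\<eta> (x + y) = \<eta> x * \<eta> y" and \<eta>_norm: "norm (\<eta> x) = 1"
    and u_meas [measurable]: "u \<in> borel_measurable borel" and u_nonneg: "0 \<le> u x" and u_int: "integrable \<mu> u"
begin

text \<open>Averaging against the fixed weight \<open>u\<close> gives functions whose modulus of
  continuity depends on \<open>u\<close> and \<open>sqnorm f\<close> only. This uniformity in
  \<open>f\<close> and \<eta> is what allows limits to be taken.\<close>

definition smoothed :: "('g \<Rightarrow> complex) \<Rightarrow> 'g \<Rightarrow> complex" where
  "smoothed f x = (\<integral>y. of_real (u y) * autocorr f (x + y) \<partial>\<mu>)"

text \<open>The L1 modulus of continuity of \<open>u\<close> under translation.\<close>

definition osc :: "'g \<Rightarrow> real" where "osc t = (\<integral>y. \<bar>u (y - t) - u y\<bar> \<partial>\<mu>)"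

abbreviation "U \<equiv> integral\<^sup>L \<mu> u"

lemmas autocorr_bd = autocorr_bound[OF _ \<eta>_norm]

lemma weight_int:
  assumes f: "quasi_periodic \<eta> f" and v [measurable]: "v \<in> borel_measurable borel" and vi: "integrable \<mu> v"
  shows "integrable \<mu> (\<lambda>y. complex_of_real (v y) * autocorr f (x + y))"
proof (rule Bochner_Integration.integrable_bound)
  show "integrable \<mu> (\<lambda>y. sqnorm f * v y)" using vi by simp
  note [measurable] = autocorr_measurable[OF quasi_periodic_bdd_meas[OF f]]
  show "(\<lambda>y. complex_of_real (v y) * autocorr f (x + y)) \<in> borel_measurable \<mu>" by measurable
  have "norm (complex_of_real (v y) * autocorr f (x + y)) \<le> norm (sqnorm f * v y)" for y
    using mult_right_mono[OF autocorr_bd[OF f, of "x + y"], of "\<bar>v y\<bar>"]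
    by (simp add: norm_mult abs_mult sqnorm_nonneg mult.commute)
  then show "AE y in \<mu>. norm (complex_of_real (v y) * autocorr f (x + y)) \<le> norm (sqnorm f * v y)" by simp
qed

lemma weight_bound:
  assumes f: "quasi_periodic \<eta> f" and v [measurable]: "v \<in> borel_measurable borel" and vi: "integrable \<mu> v"
  shows "norm (\<integral>y. complex_of_real (v y) * autocorr f (x + y) \<partial>\<mu>) \<le> (\<integral>y. \<bar>v y\<bar> \<partial>\<mu>) * sqnorm f"
proof -
  have "norm (\<integral>y. complex_of_real (v y) * autocorr f (x + y) \<partial>\<mu>) \<le> (\<integral>y. norm (complex_of_real (v y) * autocorr f (x + y)) \<partial>\<mu>)"
    by (rule integral_norm_bound)
  also have "\<dots> \<le> (\<integral>y. \<bar>v y\<bar> * sqnorm f \<partial>\<mu>)"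
    by (rule integral_mono[OF integrable_norm[OF weight_int[OF f v vi]]])
      (use vi in \<open>auto intro!: mult_left_mono autocorr_bd[OF f] simp: norm_mult\<close>)
  also have "\<dots> = (\<integral>y. \<bar>v y\<bar> \<partial>\<mu>) * sqnorm f" using vi by simp
  finally show ?thesis .
qed

lemma smoothed_bound: "quasi_periodic \<eta> f \<Longrightarrow> norm (smoothed f x) \<le> U * sqnorm f"
  unfolding smoothed_def using weight_bound[OF _ u_meas u_int] by (simp add: u_nonneg)

lemma u_shift_int: "integrable \<mu> (\<lambda>y. u (y - t))"
  using integrable_translate[OF u_meas, of "- t"] u_int by simp

text \<open>Invariance of Haar measure moves the shift from \<open>autocorr f\<close>, whose
  continuity is not known, onto \<open>u\<close>.\<close>

lemma smoothed_osc:
  assumes f: "quasi_periodic \<eta> f" shows "norm (smoothed f (x + t) - smoothed f x) \<le> osc t * sqnorm f"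
proof -
  note [measurable] = autocorr_measurable[OF quasi_periodic_bdd_meas[OF f]]
  have "smoothed f (x + t) = (\<integral>y. of_real (u (y - t)) * autocorr f (x + y) \<partial>\<mu>)"
    using integral_translate[of "\<lambda>y. of_real (u (y - t)) * autocorr f (x + y)" t]
    by (simp add: smoothed_def add.assoc add.commute[of t])
  then have "smoothed f (x + t) - smoothed f x = (\<integral>y. of_real (u (y - t) - u y) * autocorr f (x + y) \<partial>\<mu>)"
    unfolding smoothed_def using weight_int[OF f _ u_int] weight_int[OF f _ u_shift_int]
    by (simp add: left_diff_distrib)
  also have "norm \<dots> \<le> osc t * sqnorm f"
    unfolding osc_def by (rule weight_bound[OF f]) (use u_int u_shift_int in auto)
  finally show ?thesis .
qed

lemma smoothed_eqv:
  assumes f: "quasi_periodic \<eta> f" shows "quasi_periodic \<eta> (smoothed f)"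
  unfolding quasi_periodic_def
proof (intro conjI allI ballI)
  note [measurable] = autocorr_measurable[OF quasi_periodic_bdd_meas[OF f]]
  have "smoothed f \<in> borel_measurable borel" unfolding smoothed_def by measurable
  then show "bdd_meas (smoothed f)" using smoothed_bound[OF f] unfolding bdd_meas_def by blast
  show "smoothed f (x + l) = \<eta> l * smoothed f x" if l: "l \<in> L" for x l
  proof -
    have "smoothed f (x + l) = (\<integral>y. \<eta> l * (of_real (u y) * autocorr f (x + y)) \<partial>\<mu>)"
      unfolding smoothed_def
    proof (intro Bochner_Integration.integral_cong refl)
      fix y
      have "x + l + y = (x + y) + l" by (simp add: ac_simps)
      then show "complex_of_real (u y) * autocorr f (x + l + y) = \<eta> l * (of_real (u y) * autocorr f (x + y))"
        by (simp only: autocorr_L[OF f l] mult_ac)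
    qed
    then show ?thesis by (simp add: smoothed_def)
  qed
qed

lemma autocorr_cmult: "autocorr (\<lambda>x. c * f x) t = of_real ((norm c)\<^sup>2) * autocorr f t"
proof -
  have "autocorr (\<lambda>x. c * f x) t = (\<integral>x. (c * cnj c) * (f (x + t) * cnj (f x)) \<partial>MC)"
    unfolding autocorr_def by (simp add: mult_ac)
  also have "\<dots> = (c * cnj c) * autocorr f t" unfolding autocorr_def by (rule integral_mult_right_zero)
  finally show ?thesis by (simp only: complex_norm_square)
qed

lemma smoothed_cmult: "smoothed (\<lambda>x. c * f x) x = of_real ((norm c)\<^sup>2) * smoothed f x"
  unfolding smoothed_def autocorr_cmult by (subst integral_mult_right_zero[symmetric]) (simp add: mult_ac)

lemma sqnorm_cong: "(\<And>x. f x = g x) \<Longrightarrow> sqnorm f = sqnorm g" by (simp add: sqnorm_def)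

lemma sqnorm_le:
  assumes "bdd_meas f" "\<And>x. norm (f x) \<le> B" shows "sqnorm f \<le> B\<^sup>2 * vol"
proof -
  have "sqnorm f \<le> (\<integral>x. B\<^sup>2 \<partial>MC)"
    unfolding sqnorm_def
    by (rule integral_mono) (use assms in \<open>auto intro!: bdd_meas_integrable_norm2 power_mono\<close>)
  also have "\<dots> = B\<^sup>2 * vol" using measure_MC_UNIV by (simp add: mult.commute)
  finally show ?thesis .
qed

definition sphere :: "('g \<Rightarrow> complex) set" where "sphere = {f. quasi_periodic \<eta> f \<and> sqnorm f = 1}"

definition M :: real where "M = (SUP f\<in>sphere. sqnorm (smoothed f))"

lemma bdd_M: "bdd_above ((\<lambda>f. sqnorm (smoothed f)) ` sphere)"
proof (rule bdd_aboveI2)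
  fix f assume "f \<in> sphere"
  then show "sqnorm (smoothed f) \<le> U\<^sup>2 * vol"
    using smoothed_bound[of f] by (intro sqnorm_le) (auto simp: sphere_def intro: quasi_periodic_bdd_meas smoothed_eqv)
qed

text \<open>\<open>smoothed\<close> is quadratic under scaling of \<open>f\<close>, so
  \<open>sqnorm (smoothed f)\<close> is homogeneous of degree four; this explains the square of
  \<open>sqnorm f\<close>.\<close>

lemma sqnorm_smoothed_le:
  assumes f: "quasi_periodic \<eta> f" shows "sqnorm (smoothed f) \<le> M * (sqnorm f)\<^sup>2"
proof (cases "sqnorm f = 0")
  case True
  have "smoothed f x = 0" for x using smoothed_bound[OF f, of x] True by simp
  then show ?thesis using True by (simp add: sqnorm_def)
next
  case False
  then have pos: "sqnorm f > 0" using sqnorm_nonneg[of f] by linarith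
  define c where "c = complex_of_real (1 / sqrt (sqnorm f))"
  have c: "(norm c)\<^sup>2 = 1 / sqnorm f" using pos by (simp add: c_def norm_divide power_divide)
  have "(\<lambda>x. c * f x) \<in> sphere"
    using f pos by (auto simp: sphere_def sqnorm_cmult c intro!: quasi_periodic_cmult)
  then have "sqnorm (smoothed (\<lambda>x. c * f x)) \<le> M" unfolding M_def by (rule cSUP_upper[OF _ bdd_M])
  moreover have "sqnorm (smoothed (\<lambda>x. c * f x)) = sqnorm (smoothed f) / (sqnorm f)\<^sup>2"
  proof -
    have "sqnorm (smoothed (\<lambda>x. c * f x)) = sqnorm (\<lambda>x. of_real (1 / sqnorm f) * smoothed f x)"
      by (rule sqnorm_cong) (simp add: smoothed_cmult c del: of_real_power)
    also have "\<dots> = sqnorm (smoothed f) / (sqnorm f)\<^sup>2"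
      by (subst sqnorm_cmult) (use pos in \<open>simp add: norm_divide power_divide\<close>)
    finally show ?thesis .
  qed
  ultimately show ?thesis using pos by (simp add: field_simps)
qed

lemma smoothed_perturb:
  assumes f: "quasi_periodic \<eta> f" and z: "norm z = 1"
  shows "smoothed (\<lambda>x. f x + z * f (x + t)) x = 2 * smoothed f x + z * smoothed f (x + t) + cnj z * smoothed f (x - t)"
proof -
  have i: "integrable \<mu> (\<lambda>y. complex_of_real (u y) * autocorr f (a + y))" for a
    by (rule weight_int[OF f u_meas u_int])
  have "smoothed (\<lambda>x. f x + z * f (x + t)) x = (\<integral>y. 2 * (of_real (u y) * autocorr f (x + y))
      + z * (of_real (u y) * autocorr f (x + t + y)) + cnj z * (of_real (u y) * autocorr f (x - t + y)) \<partial>\<mu>)"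
    unfolding smoothed_def
  proof (intro Bochner_Integration.integral_cong refl)
    fix y
    have "x + y + t = x + t + y" "x + y - t = x - t + y" by (simp_all add: algebra_simps)
    then show "complex_of_real (u y) * autocorr (\<lambda>x. f x + z * f (x + t)) (x + y) = 2 * (of_real (u y) * autocorr f (x + y))
      + z * (of_real (u y) * autocorr f (x + t + y)) + cnj z * (of_real (u y) * autocorr f (x - t + y))"
      by (simp only: autocorr_perturb[OF f \<eta>_norm z]) (simp only: ring_distribs mult_ac)
  qed
  also have "\<dots> = 2 * smoothed f x + z * smoothed f (x + t) + cnj z * smoothed f (x - t)"
    unfolding smoothed_def using i by simp
  finally show ?thesis .
qed

text \<open>Perturbing \<open>f\<close> to \<open>f \<plusminus> z f(\<cdot> + t)\<close> cannot push \<open>sqnorm (smoothed f)\<close> above the supremum \<open>M\<close>.\<close>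
lemma near_maximum_real:
  fixes t :: 'g and z :: complex
  assumes f: "f \<in> sphere" and z: "norm z = 1"
  defines "r \<equiv> Re (z * autocorr f t)"
  shows "sqnorm (\<lambda>x. z * smoothed f (x + t) + cnj z * smoothed f (x - t) - 2 * of_real r * smoothed f x) \<le> 4 * (M - sqnorm (smoothed f))"
proof -
  have ef: "quasi_periodic \<eta> f" and qf: "sqnorm f = 1" using f by (auto simp: sphere_def)
  define w where "w = smoothed f"
  define d where "d x = z * w (x + t) + cnj z * w (x - t)" for x
  have ew: "quasi_periodic \<eta> w" unfolding w_def by (rule smoothed_eqv[OF ef])
  have bw: "bdd_meas w" "bdd_meas d" using quasi_periodic_bdd_meas[OF ew] unfolding d_def
    by (auto intro!: bdd_meas_intros bdd_meas_shift[of w "- t", simplified])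
  have r1: "\<bar>r\<bar> \<le> 1"
  proof -
    have "\<bar>r\<bar> \<le> norm (z * autocorr f t)" unfolding r_def by (rule abs_Re_le_cmod)
    also have "\<dots> \<le> 1" using autocorr_bd[OF ef, of t] z by (simp add: norm_mult qf)
    finally show ?thesis .
  qed
  \<comment> \<open>The two perturbed functions have squared norms 2 + 2r and 2 - 2r, and their
    autocorrelations add up to four times that of \<open>f\<close>. After normalisation they exhibit
    \<open>autocorr f\<close> as a convex combination.\<close>
  have key: "sqnorm (\<lambda>x. 2 * w x + of_real s * d x) \<le> M * (2 + 2 * s * r)\<^sup>2" if s: "s = 1 \<or> s = - 1" for s :: real
  proof -
    let ?z = "of_real s * z" let ?g = "\<lambda>x. f x + ?z * f (x + t)"
    have nz: "norm ?z = 1" using z s by (auto simp: norm_mult)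
    have eg: "quasi_periodic \<eta> ?g" by (intro quasi_periodic_add quasi_periodic_cmult quasi_periodic_shift ef)
    have "complex_of_real (sqnorm ?g) = autocorr ?g 0" by (simp add: autocorr_0 quasi_periodic_bdd_meas[OF eg])
    also have "\<dots> = 2 * autocorr f 0 + ?z * autocorr f t + cnj ?z * autocorr f (- t)"
      using autocorr_perturb[OF ef \<eta>_norm nz, of t 0] by simp
    also have "\<dots> = 2 + (?z * autocorr f t + cnj (?z * autocorr f t))"
      by (simp add: autocorr_0 quasi_periodic_bdd_meas[OF ef] qf autocorr_minus[OF ef \<eta>_norm])
    also have "\<dots> = of_real (2 + 2 * s * r)"
      by (simp only: complex_add_cnj) (simp add: r_def mult.assoc)
    finally have qg: "sqnorm ?g = 2 + 2 * s * r" by (simp only: of_real_eq_iff)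
    have "smoothed ?g x = 2 * w x + of_real s * d x" for x
      by (subst smoothed_perturb[OF ef nz]) (simp add: w_def d_def algebra_simps)
    then have "sqnorm (\<lambda>x. 2 * w x + of_real s * d x) = sqnorm (smoothed ?g)" by (simp add: sqnorm_def)
    also have "\<dots> \<le> M * (sqnorm ?g)\<^sup>2" by (rule sqnorm_smoothed_le[OF eg])
    finally show ?thesis by (simp only: qg)
  qed
  \<comment> \<open>A weighted parallelogram law expressing strict convexity of the norm. The
    crossed weights turn the bounds of \<open>key\<close> into 8 (1 - r^2) M, with the same factor
    that stands before \<open>sqnorm w\<close>, so that only the gap between \<open>M\<close> and
    \<open>sqnorm w\<close> remains.\<close>
  have alg: "(1 - r) * (norm (2 * a + b))\<^sup>2 + (1 + r) * (norm (2 * a - b))\<^sup>2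
      = 2 * (norm (b - 2 * of_real r * a))\<^sup>2 + 8 * (1 - r\<^sup>2) * (norm a)\<^sup>2" for a b :: complex
    by (simp only: cmod_power2) (simp add: power2_eq_square algebra_simps)
  have i: "integrable MC (\<lambda>x. (norm (2 * w x + d x))\<^sup>2)" "integrable MC (\<lambda>x. (norm (2 * w x - d x))\<^sup>2)"
    "integrable MC (\<lambda>x. (norm (d x - 2 * of_real r * w x))\<^sup>2)" "integrable MC (\<lambda>x. (norm (w x))\<^sup>2)"
    by (intro bdd_meas_integrable_norm2 bdd_meas_intros bw)+
  have "2 * sqnorm (\<lambda>x. d x - 2 * of_real r * w x) + 8 * (1 - r\<^sup>2) * sqnorm w
      = (\<integral>x. 2 * (norm (d x - 2 * of_real r * w x))\<^sup>2 + 8 * (1 - r\<^sup>2) * (norm (w x))\<^sup>2 \<partial>MC)"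
    unfolding sqnorm_def using i by (simp add: Bochner_Integration.integral_add)
  also have "\<dots> = (\<integral>x. (1 - r) * (norm (2 * w x + d x))\<^sup>2 + (1 + r) * (norm (2 * w x - d x))\<^sup>2 \<partial>MC)"
    by (simp only: alg)
  also have "\<dots> = (1 - r) * sqnorm (\<lambda>x. 2 * w x + d x) + (1 + r) * sqnorm (\<lambda>x. 2 * w x - d x)"
    unfolding sqnorm_def using i by (simp add: Bochner_Integration.integral_add)
  also have "\<dots> \<le> (1 - r) * (M * (2 + 2 * r)\<^sup>2) + (1 + r) * (M * (2 - 2 * r)\<^sup>2)"
    using key[of 1] key[of "-1"] r1 by (intro add_mono mult_left_mono) auto
  also have "\<dots> = 8 * (1 - r\<^sup>2) * M" by (simp add: power2_eq_square algebra_simps)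
  finally have "sqnorm (\<lambda>x. d x - 2 * of_real r * w x) \<le> 4 * ((1 - r\<^sup>2) * (M - sqnorm w))"
    by (simp add: algebra_simps)
  also have "\<dots> \<le> 4 * (1 * (M - sqnorm w))"
  proof (intro mult_left_mono mult_right_mono)
    show "0 \<le> M - sqnorm w" using sqnorm_smoothed_le[OF ef] qf by (simp add: w_def)
  qed auto
  finally show ?thesis by (simp add: d_def w_def)
qed

text \<open>The cases z = 1 and z = \<i> control the sum and the difference of the shifts by t and
  -t. Together they isolate the shift by t, with the multiplier \<open>autocorr f t\<close>
  assembled from its real and imaginary parts.\<close>

lemma near_maximum:
  assumes f: "f \<in> sphere"
  shows "sqnorm (\<lambda>x. smoothed f (x + t) - autocorr f t * smoothed f x) \<le> 4 * (M - sqnorm (smoothed f))"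
proof -
  have ef: "quasi_periodic \<eta> f" using f by (auto simp: sphere_def)
  define w where "w = smoothed f"
  define p where "p = autocorr f t"
  have ew: "quasi_periodic \<eta> w" unfolding w_def by (rule smoothed_eqv[OF ef])
  define A where "A x = w (x + t) + w (x - t) - 2 * of_real (Re p) * w x" for x
  define B where "B x = \<i> * w (x + t) - \<i> * w (x - t) + 2 * of_real (Im p) * w x" for x
  have bw: "bdd_meas w" by (rule quasi_periodic_bdd_meas[OF ew])
  have bAB: "bdd_meas A" "bdd_meas B" unfolding A_def B_def by (intro bdd_meas_intros bw bdd_meas_shift[of w "- t", simplified])+
  have qA: "sqnorm A \<le> 4 * (M - sqnorm w)"
    using near_maximum_real[OF f, of 1 t] by (simp add: A_def[abs_def] w_def p_def)
  have qB: "sqnorm B \<le> 4 * (M - sqnorm w)"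
    using near_maximum_real[OF f, of \<i> t] by (simp add: B_def[abs_def] w_def p_def)
  have pt: "4 * (norm (w (x + t) - p * w x))\<^sup>2 \<le> 2 * (norm (A x))\<^sup>2 + 2 * (norm (B x))\<^sup>2" for x
  proof -
    have "2 * (w (x + t) - p * w x) = A x - \<i> * B x"
      by (simp add: A_def B_def complex_eq_iff algebra_simps)
    then have "4 * (norm (w (x + t) - p * w x))\<^sup>2 = (norm (A x - \<i> * B x))\<^sup>2"
      using norm_mult[of 2 "w (x + t) - p * w x"] by (simp add: power_mult_distrib)
    also have "\<dots> \<le> (norm (A x) + norm (B x))\<^sup>2"
      using norm_triangle_ineq4[of "A x" "\<i> * B x"] by (intro power_mono) (auto simp: norm_mult)
    also have "\<dots> \<le> 2 * (norm (A x))\<^sup>2 + 2 * (norm (B x))\<^sup>2"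
      using sum_squares_bound[of "norm (A x)" "norm (B x)"] by (simp add: power2_sum)
    finally show ?thesis .
  qed
  have i: "integrable MC (\<lambda>x. (norm (w (x + t) - p * w x))\<^sup>2)" "integrable MC (\<lambda>x. (norm (A x))\<^sup>2)"
    "integrable MC (\<lambda>x. (norm (B x))\<^sup>2)"
    by (intro bdd_meas_integrable_norm2 bdd_meas_intros bw bAB)+
  have "4 * sqnorm (\<lambda>x. w (x + t) - p * w x) = (\<integral>x. 4 * (norm (w (x + t) - p * w x))\<^sup>2 \<partial>MC)"
    by (simp add: sqnorm_def)
  also have "\<dots> \<le> (\<integral>x. 2 * (norm (A x))\<^sup>2 + 2 * (norm (B x))\<^sup>2 \<partial>MC)"
    by (rule integral_mono) (use i pt in auto)
  also have "\<dots> = 2 * sqnorm A + 2 * sqnorm B" using i by (simp add: sqnorm_def)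
  also have "\<dots> \<le> 16 * (M - sqnorm w)" using qA qB by simp
  finally show ?thesis by (simp add: w_def p_def)
qed

end

context lca_lattice
begin

lemma sqnorm_eq_0_continuous:
  assumes v: "quasi_periodic \<eta> v" and \<eta>: "\<And>x. norm (\<eta> x) = 1" and cont: "continuous_on UNIV v" and 0: "sqnorm v = 0"
  shows "v x = 0"
proof (rule AE_continuous_eq_0[OF cont])
  have "AE x in MC. (norm (v x))\<^sup>2 = 0"
    using 0 bdd_meas_integrable_norm2[OF quasi_periodic_bdd_meas[OF v]] unfolding sqnorm_def
    by (subst (asm) integral_nonneg_eq_0_iff_AE) auto
  then have "AE x in MC. v x = 0" by simp
  then show "AE x in \<mu>. v x = 0"
    unfolding T.AE_MC
  proof (rule T.AE_tile_invariant)
    fix l x assume "l \<in> L" and "v (x + l) = 0"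
    then show "v x = 0" using \<eta>[of l] by (auto simp: quasi_periodic_L[OF v])
  qed
qed

lemma sqnorm_tendsto:
  assumes bdd_meas: "\<And>n::nat. bdd_meas (g n)" "bdd_meas g'" and bd: "\<And>n x. norm (g n x) \<le> B"
    and lim: "\<And>x. (\<lambda>n. g n x) \<longlonglongrightarrow> g' x"
  shows "(\<lambda>n. sqnorm (g n)) \<longlonglongrightarrow> sqnorm g'"
  unfolding sqnorm_def
proof (rule integral_dominated_convergence[where w="\<lambda>_. B\<^sup>2"])
  show "AE x in MC. (\<lambda>n. (norm (g n x))\<^sup>2) \<longlonglongrightarrow> (norm (g' x))\<^sup>2"
    by (intro AE_I2 tendsto_intros lim)
  show "AE x in MC. norm ((norm (g n x))\<^sup>2) \<le> B\<^sup>2" for n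
    using bd by (intro AE_I2) (simp add: power_mono)
qed (use bdd_meas in \<open>auto dest!: bdd_meas_measurable\<close>)

end

context char_ext
begin

text \<open>Smoothed near-maximisers are bounded and equicontinuous, so a subsequence converges
  pointwise to a continuous \<open>w\<close> with \<open>sqnorm w = M\<close>. By
  \<open>near_maximum\<close> the translates of \<open>w\<close> are exact multiples of
  \<open>w\<close>, and dividing by \<open>w 0\<close> gives the character.\<close>

lemma exists_character:
  assumes osc0: "\<And>e. e > 0 \<Longrightarrow> \<exists>V. open V \<and> 0 \<in> V \<and> (\<forall>t\<in>V. osc t \<le> e)"
    and ne: "sphere \<noteq> {}" and Mpos: "M > 0"
  obtains \<phi> where "\<phi> \<in> characters" "\<And>l. l \<in> L \<Longrightarrow> \<phi> l = \<eta> l" "\<And>t. norm (\<phi> t - 1) \<le> osc t / sqrt (M / vol)"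
proof -
  have "\<exists>f\<in>sphere. M - 1 / Suc n < sqnorm (smoothed f)" for n
    using less_cSUP_iff[OF ne bdd_M, of "M - 1 / Suc n"] by (auto simp: M_def[symmetric])
  then obtain F where F: "\<And>n. F n \<in> sphere" "\<And>n. M - 1 / Suc n < sqnorm (smoothed (F n))" by metis
  have eF: "quasi_periodic \<eta> (F n)" and qF: "sqnorm (F n) = 1" for n using F(1)[of n] by (auto simp: sphere_def)
  have omU: "norm (smoothed (F n) x) \<le> U" for n x using smoothed_bound[OF eF] by (simp add: qF)
  obtain D :: "'g set" where D: "countable D" "\<And>X. open X \<Longrightarrow> X \<noteq> {} \<Longrightarrow> \<exists>d\<in>D. d \<in> X"
    using countable_dense_exists by blast
  obtain k :: "nat \<Rightarrow> nat" where k: "strict_mono k" "\<And>x. x \<in> D \<Longrightarrow> \<exists>l. (\<lambda>n. smoothed (F (k n)) x) \<longlonglongrightarrow> l"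
    using function_convergent_subsequence[OF D(1), of "\<lambda>n. smoothed (F n)" U] omU by blast
  define g where "g n = smoothed (F (k n))" for n
  have eg: "quasi_periodic \<eta> (g n)" for n unfolding g_def by (rule smoothed_eqv[OF eF])
  have gU: "norm (g n x) \<le> U" for n x unfolding g_def by (rule omU)
  have gosc: "norm (g n (x + t) - g n x) \<le> osc t" for n x t
    unfolding g_def using smoothed_osc[OF eF[of "k n"], of x t] by (simp add: qF)
  \<comment> \<open>The subsequence converges on the countable dense set \<open>D\<close>;
    equicontinuity compares \<open>x\<close> with a nearby point of \<open>D\<close>.\<close>
  have "Cauchy (\<lambda>n. g n x)" for x
  proof (rule metric_CauchyI)
    fix e :: real assume "e > 0"
    then obtain V where V: "open V" "0 \<in> V" "\<And>t. t \<in> V \<Longrightarrow> osc t \<le> e / 4" using osc0[of "e / 4"] by auto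
    have "open {y. y + (- x) \<in> V}" "x \<in> {y. y + (- x) \<in> V}" using open_translate[OF V(1), of "- x"] V(2) by simp_all
    then obtain d where d: "d \<in> D" "d + (- x) \<in> V" using D(2) by blast
    have gd: "norm (g n d - g n x) \<le> e / 4" for n
      using gosc[where n=n and x=x and t="d - x"] V(3)[OF d(2)] by (simp add: algebra_simps)
    have "Cauchy (\<lambda>n. g n d)" using k(2)[OF d(1)] unfolding g_def by (auto intro: LIMSEQ_imp_Cauchy)
    then obtain N where N: "\<And>m n. m \<ge> N \<Longrightarrow> n \<ge> N \<Longrightarrow> dist (g m d) (g n d) < e / 4"
      using \<open>e > 0\<close> metric_CauchyD[of "\<lambda>n. g n d" "e / 4"] by auto
    have "dist (g m x) (g n x) < e" if "m \<ge> N" "n \<ge> N" for m n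
    proof -
      have "dist (g m x) (g n x) \<le> dist (g m d) (g m x) + dist (g m d) (g n d) + dist (g n d) (g n x)"
        by (metis (no_types, lifting) add_right_mono dist_commute dist_triangle dual_order.trans)
      also have "\<dots> < e" using gd[of m] gd[of n] N[OF that] \<open>e > 0\<close> by (simp add: dist_norm)
      finally show ?thesis .
    qed
    then show "\<exists>N. \<forall>m\<ge>N. \<forall>n\<ge>N. dist (g m x) (g n x) < e" by blast
  qed
  then have "\<exists>l. (\<lambda>n. g n x) \<longlonglongrightarrow> l" for x
    by (meson Cauchy_convergent convergent_def)
  then obtain w where w: "\<And>x. (\<lambda>n. g n x) \<longlonglongrightarrow> w x" by metis
  have wosc: "norm (w (x + t) - w x) \<le> osc t" for x t
    by (rule Lim_bounded[OF tendsto_norm[OF tendsto_diff[OF w w]]]) (use gosc in auto)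
  have wU: "norm (w x) \<le> U" for x
    by (rule Lim_bounded[OF tendsto_norm[OF w]]) (use gU in auto)
  have cw: "continuous_on UNIV w"
    unfolding continuous_on_eq_continuous_at[OF open_UNIV]
  proof
    fix x
    show "isCont w x" unfolding isCont_def
    proof (rule tendstoI)
      fix e :: real assume "e > 0"
      then obtain V where V: "open V" "0 \<in> V" "\<And>t. t \<in> V \<Longrightarrow> osc t \<le> e / 2" using osc0[of "e / 2"] by auto
      have "open {y. y + (- x) \<in> V}" "x \<in> {y. y + (- x) \<in> V}" using open_translate[OF V(1), of "- x"] V(2) by simp_all
      moreover have "dist (w y) (w x) < e" if "y \<in> {y. y + (- x) \<in> V}" for y
        using wosc[where x=x and t="y - x"] V(3)[of "y - x"] that \<open>e > 0\<close> by (simp add: dist_norm)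
      ultimately show "\<forall>\<^sub>F y in at x. dist (w y) (w x) < e"
        unfolding eventually_at_topological by blast
    qed
  qed
  have bw: "bdd_meas w" using borel_measurable_continuous_onI[OF cw] wU by (auto simp: bdd_meas_def)
  have ew: "quasi_periodic \<eta> w"
    unfolding quasi_periodic_def
  proof (intro conjI allI ballI bw)
    fix x l assume l: "l \<in> L"
    have "(\<lambda>n. \<eta> l * g n x) \<longlonglongrightarrow> w (x + l)" using w[of "x + l"] by (simp add: quasi_periodic_L[OF eg l])
    then show "w (x + l) = \<eta> l * w x" using tendsto_mult_left[OF w] LIMSEQ_unique by blast
  qed
  have qM: "(\<lambda>n. sqnorm (g n)) \<longlonglongrightarrow> M"
  proof (rule tendsto_sandwich[where f="\<lambda>n. M - 1 / real (Suc n)" and h="\<lambda>n. M"])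
    have "M - 1 / real (Suc n) \<le> sqnorm (g n)" for n
    proof -
      have "1 / real (Suc (k n)) \<le> 1 / real (Suc n)" using seq_suble[OF k(1), of n] by (simp add: frac_le)
      then show ?thesis using F(2)[of "k n"] by (simp add: g_def)
    qed
    then show "\<forall>\<^sub>F n in sequentially. M - 1 / real (Suc n) \<le> sqnorm (g n)" by simp
    have "sqnorm (g n) \<le> M" for n using sqnorm_smoothed_le[OF eF] by (simp add: g_def qF)
    then show "\<forall>\<^sub>F n in sequentially. sqnorm (g n) \<le> M" by simp
    show "(\<lambda>n. M - 1 / real (Suc n)) \<longlonglongrightarrow> M"
      using tendsto_diff[OF tendsto_const[of M] LIMSEQ_Suc[OF lim_1_over_n]] by simp
  qed simp
  moreover have "(\<lambda>n. sqnorm (g n)) \<longlonglongrightarrow> sqnorm w"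
    by (rule sqnorm_tendsto[OF quasi_periodic_bdd_meas[OF eg] bw gU w])
  ultimately have qw: "sqnorm w = M" using LIMSEQ_unique by blast
  \<comment> \<open>The approximate multipliers lie in the closed unit disc, hence converge along a
    further subsequence. The defect tends to 0 because the sequence is maximising, and continuity
    turns a zero square norm into equality at every point.\<close>
  have ex_c: "\<exists>c. norm c \<le> 1 \<and> (\<forall>x. w (x + t) = c * w x)" for t
  proof -
    define p where "p n = autocorr (F (k n)) t" for n
    have p1: "p n \<in> cball 0 1" for n using autocorr_bd[OF eF, of "k n" t] by (simp add: p_def qF)
    obtain c r where cr: "c \<in> cball 0 1" "strict_mono (r :: nat \<Rightarrow> nat)" "(p \<circ> r) \<longlonglongrightarrow> c"
      using compact_cball[of "0::complex" 1] p1 unfolding compact_def by blast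
    define h where "h n x = g (r n) (x + t) - p (r n) * g (r n) x" for n x
    have nh: "norm (h n x) \<le> U + 1 * U" for n x
    proof -
      have "norm (h n x) \<le> norm (g (r n) (x + t)) + norm (p (r n)) * norm (g (r n) x)"
        unfolding h_def by (metis norm_mult norm_triangle_ineq4)
      also have "\<dots> \<le> U + 1 * U"
        using p1[of "r n"] by (intro add_mono mult_mono gU) auto
      finally show ?thesis .
    qed
    have bh: "bdd_meas (h n)" for n unfolding h_def by (intro bdd_meas_intros quasi_periodic_bdd_meas[OF eg])
    have e': "quasi_periodic \<eta> (\<lambda>x. w (x + t) - c * w x)" by (intro quasi_periodic_diff quasi_periodic_shift quasi_periodic_cmult ew)
    have l: "(\<lambda>n. h n x) \<longlonglongrightarrow> w (x + t) - c * w x" for x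
      unfolding h_def using cr(3) LIMSEQ_subseq_LIMSEQ[OF w cr(2)]
      by (intro tendsto_intros) (auto simp: o_def)
    have "(\<lambda>n. sqnorm (h n)) \<longlonglongrightarrow> sqnorm (\<lambda>x. w (x + t) - c * w x)"
      by (rule sqnorm_tendsto[OF bh quasi_periodic_bdd_meas[OF e'] nh l])
    moreover have "(\<lambda>n. sqnorm (h n)) \<longlonglongrightarrow> 0"
    proof (rule tendsto_sandwich[where f="\<lambda>n. 0" and h="\<lambda>n. 4 * (M - sqnorm (g (r n)))"])
      have "(\<lambda>n. sqnorm (g (r n))) \<longlonglongrightarrow> M" using LIMSEQ_subseq_LIMSEQ[OF qM cr(2)] by (simp add: o_def)
      then have "(\<lambda>n. 4 * (M - sqnorm (g (r n)))) \<longlonglongrightarrow> 4 * (M - M)" by (intro tendsto_intros)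
      then show "(\<lambda>n. 4 * (M - sqnorm (g (r n)))) \<longlonglongrightarrow> 0" by simp
      show "\<forall>\<^sub>F n in sequentially. sqnorm (h n) \<le> 4 * (M - sqnorm (g (r n)))"
        using near_maximum[OF F(1)] by (simp add: h_def[abs_def] g_def p_def)
    qed (auto simp: sqnorm_nonneg)
    ultimately have q0: "sqnorm (\<lambda>x. w (x + t) - c * w x) = 0" using LIMSEQ_unique by blast
    have ct: "continuous_on UNIV (\<lambda>x. w (x + t) - c * w x)"
      by (intro continuous_on_diff continuous_on_mult continuous_on_const cw continuous_on_compose2[OF cw continuous_on_group_plus] continuous_on_id) auto
    have "w (x + t) - c * w x = 0" for x
      by (rule sqnorm_eq_0_continuous[OF e' \<eta>_norm ct q0])
    then show ?thesis using cr(1) by (intro exI[of _ c]) (auto simp: dist_norm)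
  qed
  have w0: "w 0 \<noteq> 0"
  proof
    assume "w 0 = 0"
    then have "w t = 0" for t using ex_c[of t] by (metis add_0 mult_zero_right)
    then show False using qw Mpos by (simp add: sqnorm_def)
  qed
  define \<phi> where "\<phi> t = w t / w 0" for t
  have weight: "w (x + t) = \<phi> t * w x" "norm (\<phi> t) \<le> 1" for x t
  proof -
    obtain c where c: "norm c \<le> 1" "\<And>x. w (x + t) = c * w x" using ex_c by blast
    have "\<phi> t = c" using c(2)[of 0] w0 by (simp add: \<phi>_def)
    then show "w (x + t) = \<phi> t * w x" "norm (\<phi> t) \<le> 1" using c by auto
  qed
  have mult: "\<phi> (s + t) = \<phi> s * \<phi> t" for s t using weight(1)[where x=s and t=t] by (simp add: \<phi>_def mult.commute)
  \<comment> \<open>Both \<phi> t and its inverse \<phi> (- t) have norm at most 1.\<close>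
  have nphi: "norm (\<phi> t) = 1" for t
  proof -
    have "\<phi> t * \<phi> (- t) = 1" using mult[of t "- t"] w0 by (simp add: \<phi>_def)
    then have "norm (\<phi> t) * norm (\<phi> (- t)) = 1" by (metis norm_mult norm_one)
    moreover have "norm (\<phi> t) * norm (\<phi> (- t)) \<le> norm (\<phi> t) * 1"
      by (intro mult_left_mono weight(2)) auto
    ultimately show ?thesis using weight(2)[of t] by linarith
  qed
  have nw: "norm (w x) = norm (w 0)" for x using nphi[of x] w0 by (simp add: \<phi>_def norm_divide)
  \<comment> \<open>Since \<open>w\<close> has constant modulus, sqrt (M / vol) is |w 0|; this is
    the origin of the denominator in the bound on \<phi> t - 1.\<close>
  have "M = (norm (w 0))\<^sup>2 * vol"
  proof -
    have "(\<lambda>x. (norm (w x))\<^sup>2) = (\<lambda>x. (norm (w 0))\<^sup>2)"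
      by (rule ext, subst nw, rule refl)
    then show ?thesis unfolding qw[symmetric] sqnorm_def by (simp only:) (simp add: measure_MC_UNIV mult.commute)
  qed
  then have "sqrt (M / vol) = norm (w 0)" using vol_pos by simp
  moreover have "norm (\<phi> t - 1) = norm (w (0 + t) - w 0) / norm (w 0)" for t
    using w0 by (simp add: \<phi>_def norm_divide[symmetric] diff_divide_distrib)
  ultimately have bound: "norm (\<phi> t - 1) \<le> osc t / sqrt (M / vol)" for t
    using wosc[where x=0 and t=t] by (simp add: divide_right_mono)
  have "\<phi> \<in> characters"
    using mult nphi w0 cw by (auto simp: characters_def \<phi>_def[abs_def] intro!: continuous_on_divide continuous_on_const)
  moreover have "\<phi> l = \<eta> l" if "l \<in> L" for l
    using quasi_periodic_L[OF ew that, of 0] w0 by (simp add: \<phi>_def)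
  ultimately show thesis using bound by (intro that)
qed

end

context lca
begin

text \<open>L1 continuity of translation by dominated convergence. The hypothesis
  \<open>supp\<close> confines all translates by elements of \<open>S\<close> to the compact set
  \<open>K\<close>, whose indicator dominates since \<open>u\<close> takes values between 0 and
  1.\<close>

lemma translation_osc_tendsto_0:
  fixes u :: "'g \<Rightarrow> real"
  assumes cont: "continuous_on UNIV u" and u01: "\<And>x. 0 \<le> u x" "\<And>x. u x \<le> 1"
    and S: "open S" "0 \<in> S" and K: "compact K" and supp: "\<And>x t. t \<in> S \<Longrightarrow> x \<notin> K \<Longrightarrow> u (x - t) = 0"
    and e: "e > 0"
  shows "\<exists>V. open V \<and> 0 \<in> V \<and> (\<forall>t\<in>V. (\<integral>y. \<bar>u (y - t) - u y\<bar> \<partial>\<mu>) \<le> e)"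
proof -
  define osc where "osc t = (\<integral>y. \<bar>u (y - t) - u y\<bar> \<partial>\<mu>)" for t
  have [measurable]: "u \<in> borel_measurable borel" by (rule borel_measurable_continuous_onI[OF cont])
  \<comment> \<open>The group is first countable, so sequences suffice; intersecting with the
    trivial principal filter gives the form in which the sequential criterion is stated.\<close>
  have "eventually (\<lambda>t. osc t \<le> e) (inf (nhds 0) (principal UNIV))"
    unfolding eventually_nhds_within_iff_sequentially
  proof (intro allI impI, elim conjE)
    fix X :: "nat \<Rightarrow> 'g" assume X: "X \<longlonglongrightarrow> 0"
    then have "eventually (\<lambda>n. X n \<in> S) sequentially" using S by (rule topological_tendstoD)
    then obtain N where N: "\<And>n. n \<ge> N \<Longrightarrow> X n \<in> S" by (auto simp: eventually_sequentially)
    have XN: "(\<lambda>n. X (n + N)) \<longlonglongrightarrow> 0" using X by (rule LIMSEQ_ignore_initial_segment)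
    have "(\<lambda>n. osc (X (n + N))) \<longlonglongrightarrow> (\<integral>y. 0 \<partial>\<mu>)"
      unfolding osc_def
    proof (rule integral_dominated_convergence[where w="\<lambda>y. indicator K y"])
      show "integrable \<mu> (indicator K :: 'g \<Rightarrow> real)"
        using emeasure_compact_finite[OF K] K by (simp add: borel_compact)
      show "AE y in \<mu>. (\<lambda>n. \<bar>u (y - X (n + N)) - u y\<bar>) \<longlonglongrightarrow> 0"
      proof (rule AE_I2)
        fix y
        have "continuous_on UNIV (\<lambda>t. u (y - t))"
          by (rule continuous_on_compose2[OF cont]) (auto intro!: continuous_on_group_diff continuous_on_const continuous_on_id)
        then have "(\<lambda>n. u (y - X (n + N))) \<longlonglongrightarrow> u (y - 0)"
          by (rule continuous_on_tendsto_compose[OF _ XN]) auto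
        then have "(\<lambda>n. \<bar>u (y - X (n + N)) - u y\<bar>) \<longlonglongrightarrow> \<bar>u (y - 0) - u y\<bar>" by (intro tendsto_intros)
        then show "(\<lambda>n. \<bar>u (y - X (n + N)) - u y\<bar>) \<longlonglongrightarrow> 0" by simp
      qed
      show "AE y in \<mu>. norm \<bar>u (y - X (n + N)) - u y\<bar> \<le> indicator K y" for n
      proof (rule AE_I2)
        fix y
        show "norm \<bar>u (y - X (n + N)) - u y\<bar> \<le> indicator K y"
          using u01(1)[of y] u01(1)[of "y - X (n + N)"] u01(2)[of y] u01(2)[of "y - X (n + N)"]
            supp[OF N[of "n + N"], of y] supp[OF S(2), of y]
          by (auto simp: indicator_def abs_le_iff)
      qed
    qed auto
    then have "(\<lambda>n. osc (X (n + N))) \<longlonglongrightarrow> 0" by simp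
    then have "(\<lambda>n. osc (X n)) \<longlonglongrightarrow> 0" by (rule LIMSEQ_offset)
    then have "eventually (\<lambda>n. osc (X n) < e) sequentially" using e by (rule order_tendstoD)
    then show "eventually (\<lambda>n. osc (X n) \<le> e) sequentially" by (rule eventually_mono) auto
  qed
  then show ?thesis by (simp add: eventually_nhds osc_def)
qed

end

section \<open>Uniform extension of homomorphisms from the lattice\<close>

context lca_lattice
begin

text \<open>The image of a neighbourhood of 0 in the quotient has positive measure: otherwise its
  \<open>L\<close>-saturation, a nonempty open set, would be null in the group.\<close>

lemma measure_saturation_pos:
  assumes S: "open S" "0 \<in> S"
  shows "{x. \<exists>l\<in>L. x + l \<in> S} \<in> sets borel" "measure MC {x. \<exists>l\<in>L. x + l \<in> S} > 0"
proof -
  let ?A = "{x. \<exists>l\<in>L. x + l \<in> S}"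
  have "?A = (\<Union>l\<in>L. {x. x + l \<in> S})" by auto
  then have oA: "open ?A" using open_translate[OF S(1)] by (metis (no_types, lifting) open_UN)
  then show mA: "?A \<in> sets borel" by simp
  show "measure MC ?A > 0"
  proof (rule ccontr)
    assume "\<not> measure MC ?A > 0"
    then have "measure MC ?A = 0" using measure_nonneg[of MC ?A] by linarith
    then have "?A \<in> null_sets MC" using mA by (simp add: null_sets_def MC.emeasure_eq_measure)
    then have "AE x in MC. x \<notin> ?A" by (rule AE_not_in)
    then have "AE x in \<mu>. x \<notin> ?A"
      unfolding T.AE_MC
    proof (rule T.AE_tile_invariant)
      fix i x assume i: "i \<in> L" and n: "x + i \<notin> ?A"
      show "x \<notin> ?A"
      proof
        assume "x \<in> ?A"
        then obtain l where l: "l \<in> L" "x + l \<in> S" by blast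
        then have "l - i \<in> L" "x + i + (l - i) \<in> S" using Ldiff[OF l(1) i] by simp_all
        then show False using n by blast
      qed
    qed
    then have "emeasure \<mu> ?A = 0"
      by (subst (asm) AE_iff_measurable[of ?A]) (use mA in auto)
    then show False using emeasure_open_pos[OF oA] S(2) L0 by force
  qed
qed

text \<open>The neighbourhood \<open>V\<close> does not depend on the homomorphism \<open>\<eta>\<close>; this uniformity yields
  the compactness of the dual of \<open>L\<close>.\<close>
theorem extend_character:
  "\<exists>V. open V \<and> 0 \<in> V \<and> (\<forall>\<eta>. (\<forall>x y. \<eta> (x + y) = \<eta> x * \<eta> y) \<longrightarrow> (\<forall>x. norm (\<eta> x) = 1) \<longrightarrow>
     (\<exists>\<phi>\<in>characters. (\<forall>l\<in>L. \<phi> l = \<eta> l) \<and> (\<forall>t\<in>V. norm (\<phi> t - 1) \<le> 1 / 4)))"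
proof -
  \<comment> \<open>A chain of neighbourhoods \<open>V0\<close>, \<open>V1\<close>,
    \<open>W\<close>, \<open>S\<close>, \<open>S0\<close>, in which sums of two elements of one lie
    in the preceding one. \<open>V0\<close> meets \<open>L\<close> only in 0, so a lattice translate
    into \<open>W\<close> stays unique under a shift from \<open>W\<close>. Sums from
    \<open>S\<close> stay in \<open>W\<close>, which bounds the autocorrelation below on
    \<open>S\<close>; sums from \<open>S0\<close> stay in \<open>S\<close>, which bounds its
    smoothing below on \<open>S0\<close>.\<close>
  obtain V00 where V00: "open V00" "V00 \<inter> L = {0}" using lat L0 by (auto simp: lattice_def)
  obtain Vc Kc where Kc: "open Vc" "(0::'g) \<in> Vc" "compact Kc" "Vc \<subseteq> Kc" by (rule nhd_compact)
  define V0 where "V0 = V00 \<inter> Vc"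
  have V0: "open V0" "0 \<in> V0" "V0 \<subseteq> Kc" using V00 Kc by (auto simp: V0_def)
  have V0L: "l = 0" if "l \<in> L" "l \<in> V0" for l using that V00 by (auto simp: V0_def)
  obtain V1 where V1: "open V1" "0 \<in> V1" "V1 \<subseteq> V0" "\<And>x. x \<in> V1 \<Longrightarrow> - x \<in> V1" "\<And>x y. x \<in> V1 \<Longrightarrow> y \<in> V1 \<Longrightarrow> x + y \<in> V0"
    using nhd_half[OF V0(1,2)] by blast
  obtain W where W: "open W" "0 \<in> W" "W \<subseteq> V1" "\<And>x. x \<in> W \<Longrightarrow> - x \<in> W" "\<And>x y. x \<in> W \<Longrightarrow> y \<in> W \<Longrightarrow> x + y \<in> V1"
    using nhd_half[OF V1(1,2)] by blast
  obtain S where S: "open S" "0 \<in> S" "S \<subseteq> W" "\<And>x. x \<in> S \<Longrightarrow> - x \<in> S" "\<And>x y. x \<in> S \<Longrightarrow> y \<in> S \<Longrightarrow> x + y \<in> W"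
    using nhd_half[OF W(1,2)] by blast
  obtain S0 where S0: "open S0" "0 \<in> S0" "S0 \<subseteq> S" "\<And>x. x \<in> S0 \<Longrightarrow> - x \<in> S0" "\<And>x y. x \<in> S0 \<Longrightarrow> y \<in> S0 \<Longrightarrow> x + y \<in> S"
    using nhd_half[OF S(1,2)] by blast
  have SK: "S \<subseteq> Kc" using S(3) W(3) V1(3) V0(3) by auto
  obtain u :: "'g \<Rightarrow> real" where u: "continuous_on UNIV u" "\<And>x. 0 \<le> u x" "\<And>x. u x \<le> 1" "u 0 = 1" "\<And>x. x \<notin> S0 \<Longrightarrow> u x = 0"
    by (rule bump[OF S0(1,2)]) blast
  have um [measurable]: "u \<in> borel_measurable borel" by (rule borel_measurable_continuous_onI[OF u(1)])
  have u_int: "integrable \<mu> u"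
  proof (rule Bochner_Integration.integrable_bound)
    show "integrable \<mu> (indicator Kc :: 'g \<Rightarrow> real)"
      using emeasure_compact_finite[OF Kc(3)] Kc(3) by (simp add: borel_compact)
    have "norm (u x) \<le> norm (indicator Kc x :: real)" for x
      using u(2)[of x] u(3)[of x] u(5)[of x] S0(3) SK by (auto simp: indicator_def)
    then show "AE x in \<mu>. norm (u x) \<le> norm (indicator Kc x :: real)" by simp
  qed simp
  have U_pos: "integral\<^sup>L \<mu> u > 0"
  proof (rule ccontr)
    assume "\<not> integral\<^sup>L \<mu> u > 0"
    moreover have "integral\<^sup>L \<mu> u \<ge> 0" by (simp add: u(2))
    ultimately have "integral\<^sup>L \<mu> u = 0" by linarith
    then have "AE x in \<mu>. u x = 0" using u_int u(2) by (subst (asm) integral_nonneg_eq_0_iff_AE) auto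
    then have "AE x in \<mu>. complex_of_real (u x) = 0" by simp
    moreover have "continuous_on UNIV (\<lambda>x. complex_of_real (u x))" using u(1) by (intro continuous_intros)
    ultimately show False using AE_continuous_eq_0[of "\<lambda>x. complex_of_real (u x)" 0] u(4) by simp
  qed
  define m where "m = measure MC {x. \<exists>l\<in>L. x + l \<in> S}"
  define m0 where "m0 = measure MC {x. \<exists>l\<in>L. x + l \<in> S0}"
  have m: "m > 0" "m0 > 0" using measure_saturation_pos S S0 by (auto simp: m_def m0_def)
  \<comment> \<open>A lower bound for the supremum valid for every \<eta>: the function
    \<open>f\<close> built below has smoothing at least the integral of \<open>u\<close> times
    \<open>m\<close> on a set of measure \<open>m0\<close>, while its square norm is at most
    \<open>vol\<close>.\<close>
  define M0 where "M0 = (integral\<^sup>L \<mu> u * m)\<^sup>2 * m0 / vol\<^sup>2"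
  have M0: "M0 > 0" using m U_pos vol_pos by (simp add: M0_def)
  have osc0: "\<exists>V. open V \<and> 0 \<in> V \<and> (\<forall>t\<in>V. (\<integral>y. \<bar>u (y - t) - u y\<bar> \<partial>\<mu>) \<le> e)" if "e > 0" for e
  proof (rule translation_osc_tendsto_0[OF u(1-3) S0(1,2) Kc(3) _ that])
    fix x t assume t: "t \<in> S0" and x: "x \<notin> Kc"
    show "u (x - t) = 0"
    proof (rule u(5), rule notI)
      assume "x - t \<in> S0"
      then have "x - t + t \<in> S" using t by (rule S0(5))
      then show False using x SK by auto
    qed
  qed
  \<comment> \<open>\<open>exists_character\<close> divides the oscillation by sqrt (E.M / vol), and
    M0 \<le> E.M, so this threshold gives the desired 1 / 4.\<close>
  obtain V where V: "open V" "0 \<in> V" "\<And>t. t \<in> V \<Longrightarrow> (\<integral>y. \<bar>u (y - t) - u y\<bar> \<partial>\<mu>) \<le> sqrt (M0 / vol) / 4"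
    using osc0[of "sqrt (M0 / vol) / 4"] M0 vol_pos by auto
  show ?thesis
  proof (intro exI[of _ V] conjI V(1,2) allI impI)
    fix \<eta> :: "'g \<Rightarrow> complex" assume \<eta>: "\<forall>x y. \<eta> (x + y) = \<eta> x * \<eta> y" "\<forall>x. norm (\<eta> x) = 1"
    interpret E: char_ext \<mu> L C \<eta> u
      by unfold_locales (use \<eta> u u_int in auto)
    \<comment> \<open>The indicator of \<open>W\<close> spread over its lattice translates, with the
      phases that quasi-periodicity prescribes. By \<open>uniq\<close> these translates are
      disjoint, so the choice of \<open>l\<close> is forced.\<close>
    define f where "f x = (if \<exists>l\<in>L. x + l \<in> W then cnj (\<eta> (SOME l. l \<in> L \<and> x + l \<in> W)) else 0)" for x
    have uniq: "l = l'" if l: "l \<in> L" "l' \<in> L" "x + l \<in> W" "x + t + l' \<in> W" "t \<in> W" for x l l' t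
    proof -
      have "(x + l + t) + (- (x + t + l')) \<in> V0"
        using W(5)[OF l(3,5)] W(4)[OF l(4)] W(3) by (intro V1(5)) auto
      then have "l - l' \<in> V0" by (simp add: algebra_simps)
      then show ?thesis using V0L[of "l - l'"] Ldiff[OF l(1,2)] by simp
    qed
    have f_eq: "f x = cnj (\<eta> l)" if l: "l \<in> L" "x + l \<in> W" for x l
    proof -
      have "(SOME l. l \<in> L \<and> x + l \<in> W) = l"
      proof (rule some_equality)
        fix l' assume "l' \<in> L \<and> x + l' \<in> W"
        then show "l' = l" using uniq[OF _ l(1), of l' x 0] l(2) W(2) by auto
      qed (use l in auto)
      moreover have "\<exists>l\<in>L. x + l \<in> W" using l by blast
      ultimately show ?thesis unfolding f_def by (simp only: if_True)
    qed
    have f_0: "f x = 0" if "\<not> (\<exists>l\<in>L. x + l \<in> W)" for x using that by (simp add: f_def)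
    have f1: "norm (f x) \<le> 1" for x using \<eta>(2) by (simp add: f_def)
    have f_meas: "f \<in> borel_measurable borel"
    proof (rule borel_measurableI)
      fix B :: "complex set" assume "open B"
      have "f -` B \<inter> space borel = (\<Union>l\<in>{l\<in>L. cnj (\<eta> l) \<in> B}. {x. x + l \<in> W}) \<union> (if 0 \<in> B then - (\<Union>l\<in>L. {x. x + l \<in> W}) else {})"
        (is "?X = ?Y \<union> ?Z")
      proof (intro set_eqI iffI)
        fix x assume x: "x \<in> ?X"
        show "x \<in> ?Y \<union> ?Z"
        proof (cases "\<exists>l\<in>L. x + l \<in> W")
          case True
          then obtain l where "l \<in> L" "x + l \<in> W" by blast
          then show ?thesis using x f_eq by auto
        next
          case False
          then show ?thesis using x f_0[OF False] by auto
        qed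
      next
        fix x assume "x \<in> ?Y \<union> ?Z"
        then show "x \<in> ?X"
        proof
          assume "x \<in> ?Y" then show ?thesis using f_eq by auto
        next
          assume Z: "x \<in> ?Z"
          then have "0 \<in> B" "\<not> (\<exists>l\<in>L. x + l \<in> W)" by (auto split: if_splits)
          then show ?thesis using f_0 by auto
        qed
      qed
      moreover have un: "(\<Union>l\<in>A. {x. x + l \<in> W}) \<in> sets borel" for A
        using open_translate[OF W(1)] by (intro borel_open) blast
      have "?Y \<union> ?Z \<in> sets borel"
        by (cases "0 \<in> B") (simp_all only: if_True if_False sets.Un sets.empty_sets borel_comp un)
      ultimately show "f -` B \<inter> space borel \<in> sets borel" by simp
    qed
    have ef: "quasi_periodic \<eta> f"
      unfolding quasi_periodic_def
    proof (intro conjI allI ballI)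
      show "bdd_meas f" using f_meas f1 by (auto simp: bdd_meas_def)
      fix x l0 assume l0: "l0 \<in> L"
      show "f (x + l0) = \<eta> l0 * f x"
      proof (cases "\<exists>l\<in>L. x + l0 + l \<in> W")
        case True
        then obtain l where l: "l \<in> L" "x + l0 + l \<in> W" by blast
        have "f (x + l0) = cnj (\<eta> l)" by (rule f_eq[OF l])
        moreover have "f x = cnj (\<eta> (l0 + l))" using l l0 Lplus by (intro f_eq) (auto simp: add.assoc)
        moreover have "\<eta> l0 * cnj (\<eta> l0) = 1" using \<eta>(2) by (simp add: complex_norm_square[symmetric])
        ultimately show ?thesis using \<eta>(1) by (simp add: mult.assoc[symmetric])
      next
        case False
        have "\<not> (\<exists>l\<in>L. x + l \<in> W)"
        proof
          assume "\<exists>l\<in>L. x + l \<in> W"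
          then obtain l where l: "l \<in> L" "x + l \<in> W" by blast
          then have "l - l0 \<in> L" "x + l0 + (l - l0) \<in> W" using Ldiff l0 by auto
          then show False using False by blast
        qed
        then show ?thesis using False by (simp add: f_0)
      qed
    qed
    \<comment> \<open>If x + l lies in \<open>S\<close>, then x + l and x + t + l both lie in
      \<open>W\<close>. The same lattice element occurs at both points, the phases cancel and the
      integrand is 1; elsewhere it is nonnegative.\<close>
    have autocorr_lower: "m \<le> Re (autocorr f t)" if t: "t \<in> S" for t
    proof -
      let ?A = "{x. \<exists>l\<in>L. x + l \<in> S}"
      have "Re (autocorr f t) = (\<integral>x. Re (f (x + t) * cnj (f x)) \<partial>MC)"
        unfolding autocorr_def by (intro integral_Re[symmetric] bdd_meas_integrable bdd_meas_intros quasi_periodic_bdd_meas[OF ef])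
      also have "\<dots> \<ge> (\<integral>x. indicator ?A x \<partial>MC)"
      proof (rule integral_mono)
        show "integrable MC (\<lambda>x. indicator ?A x :: real)" using measure_saturation_pos(1)[OF S(1,2)]
          by (intro integrable_real_indicator) (auto simp: MC.emeasure_eq_measure)
        show "integrable MC (\<lambda>x. Re (f (x + t) * cnj (f x)))"
          by (intro integrable_Re bdd_meas_integrable bdd_meas_intros quasi_periodic_bdd_meas[OF ef])
        fix x
        show "indicator ?A x \<le> Re (f (x + t) * cnj (f x))"
        proof (cases "(\<exists>l\<in>L. x + l \<in> W) \<and> (\<exists>l\<in>L. x + t + l \<in> W)")
          case True
          then obtain l l' where l: "l \<in> L" "x + l \<in> W" "l' \<in> L" "x + t + l' \<in> W" by blast
          then have "l' = l" using uniq[of l l' x t] t S(3) by auto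
          then have "f (x + t) * cnj (f x) = cnj (\<eta> l) * \<eta> l" using f_eq l by simp
          also have "\<dots> = 1" using \<eta>(2) by (simp add: complex_norm_square[symmetric] mult.commute[of "cnj _"])
          finally show ?thesis by (simp add: indicator_def)
        next
          case False
          have "x \<notin> ?A"
          proof
            assume "x \<in> ?A"
            then obtain l where l: "l \<in> L" "x + l \<in> S" by blast
            have "x + l + t \<in> W" using l(2) t by (rule S(5))
            then have "x + t + l \<in> W" by (simp add: ac_simps)
            then show False using False l S(3) by blast
          qed
          moreover have "Re (f (x + t) * cnj (f x)) = 0" using False f_0 by auto
          ultimately show ?thesis by (simp only: indicator_simps order_refl not_False_eq_True)
        qed
      qed
      finally show ?thesis by (simp add: m_def)
    qed
    have qf: "m \<le> sqnorm f" "sqnorm f \<le> vol"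
      using autocorr_lower[OF S(2)] E.sqnorm_le[OF quasi_periodic_bdd_meas[OF ef] f1] by (auto simp: autocorr_0 quasi_periodic_bdd_meas[OF ef])
    have smoothed_lower: "integral\<^sup>L \<mu> u * m \<le> norm (E.smoothed f x)" if x: "x \<in> S0" for x
    proof -
      have i: "integrable \<mu> (\<lambda>y. complex_of_real (u y) * autocorr f (x + y))" by (rule E.weight_int[OF ef um u_int])
      have "integral\<^sup>L \<mu> u * m = (\<integral>y. u y * m \<partial>\<mu>)" using u_int by simp
      also have "\<dots> \<le> (\<integral>y. Re (complex_of_real (u y) * autocorr f (x + y)) \<partial>\<mu>)"
      proof (rule integral_mono)
        fix y
        show "u y * m \<le> Re (complex_of_real (u y) * autocorr f (x + y))"
        proof (cases "y \<in> S0")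
          case True
          then show ?thesis using autocorr_lower[OF S0(5)[OF x True]] u(2)[of y] by (simp add: mult_left_mono)
        next
          case False then show ?thesis using u(5) by simp
        qed
      qed (intro integrable_mult_left u_int integrable_Re i)+
      also have "\<dots> = Re (E.smoothed f x)" unfolding E.smoothed_def using i by (rule integral_Re)
      also have "\<dots> \<le> norm (E.smoothed f x)" by (rule complex_Re_le_cmod)
      finally show ?thesis .
    qed
    have sqnorm_smoothed: "(integral\<^sup>L \<mu> u * m)\<^sup>2 * m0 \<le> sqnorm (E.smoothed f)"
    proof -
      let ?A = "{x. \<exists>l\<in>L. x + l \<in> S0}"
      have eo: "quasi_periodic \<eta> (E.smoothed f)" by (rule E.smoothed_eqv[OF ef])
      have "(integral\<^sup>L \<mu> u * m)\<^sup>2 * m0 = (\<integral>x. (integral\<^sup>L \<mu> u * m)\<^sup>2 * indicator ?A x \<partial>MC)"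
        using measure_saturation_pos(1)[OF S0(1,2)] by (simp add: m0_def)
      also have "\<dots> \<le> sqnorm (E.smoothed f)"
        unfolding sqnorm_def
      proof (rule integral_mono)
        show "integrable MC (\<lambda>x. (integral\<^sup>L \<mu> u * m)\<^sup>2 * indicator ?A x)"
          using measure_saturation_pos(1)[OF S0(1,2)]
          by (intro integrable_mult_right integrable_real_indicator) (auto simp: MC.emeasure_eq_measure)
        fix x
        show "(integral\<^sup>L \<mu> u * m)\<^sup>2 * indicator ?A x \<le> (norm (E.smoothed f x))\<^sup>2"
        proof (cases "x \<in> ?A")
          case True
          then obtain l where l: "l \<in> L" "x + l \<in> S0" by blast
          have "norm (E.smoothed f (x + l)) = norm (E.smoothed f x)" using \<eta>(2) by (simp add: quasi_periodic_L[OF eo l(1)] norm_mult)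
          then show ?thesis using smoothed_lower[OF l(2)] True m(1) U_pos by (auto intro!: power_mono)
        qed simp
      qed (rule bdd_meas_integrable_norm2[OF quasi_periodic_bdd_meas[OF eo]])
      finally show ?thesis .
    qed
    have le: "(integral\<^sup>L \<mu> u * m)\<^sup>2 * m0 \<le> E.M * (sqnorm f)\<^sup>2" using sqnorm_smoothed E.sqnorm_smoothed_le[OF ef] by linarith
    have Mpos: "E.M > 0"
    proof -
      have "0 < E.M * (sqnorm f)\<^sup>2" using le m U_pos by (meson less_le_trans mult_pos_pos zero_less_power)
      then show ?thesis by (simp add: zero_less_mult_iff)
    qed
    have MM: "M0 \<le> E.M"
    proof -
      have "E.M * (sqnorm f)\<^sup>2 \<le> E.M * vol\<^sup>2" using Mpos qf m by (intro mult_left_mono power_mono) auto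
      then show ?thesis using le vol_pos by (simp add: M0_def pos_divide_le_eq)
    qed
    have ne: "E.sphere \<noteq> {}"
    proof -
      have pos: "sqnorm f > 0" using qf m by linarith
      have "(\<lambda>x. complex_of_real (1 / sqrt (sqnorm f)) * f x) \<in> E.sphere"
        unfolding E.sphere_def mem_Collect_eq
        by (intro conjI quasi_periodic_cmult ef, subst sqnorm_cmult) (use pos in \<open>simp add: norm_divide power_divide\<close>)
      then show ?thesis by blast
    qed
    obtain \<phi> where \<phi>: "\<phi> \<in> characters" "\<And>l. l \<in> L \<Longrightarrow> \<phi> l = \<eta> l" "\<And>t. norm (\<phi> t - 1) \<le> E.osc t / sqrt (E.M / vol)"
      using E.exists_character[OF _ ne Mpos] osc0 unfolding E.osc_def by blast
    have "norm (\<phi> t - 1) \<le> 1 / 4" if t: "t \<in> V" for t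
    proof -
      have "E.osc t \<le> sqrt (M0 / vol) / 4" using V(3)[OF t] by (simp add: E.osc_def)
      also have "\<dots> \<le> sqrt (E.M / vol) / 4" using MM vol_pos by (simp add: divide_right_mono)
      finally have "E.osc t / sqrt (E.M / vol) \<le> 1 / 4" using Mpos vol_pos by (simp add: field_simps)
      then show ?thesis using \<phi>(3)[of t] by linarith
    qed
    then show "\<exists>\<phi>\<in>characters. (\<forall>l\<in>L. \<phi> l = \<eta> l) \<and> (\<forall>t\<in>V. norm (\<phi> t - 1) \<le> 1 / 4)"
      using \<phi> by blast
  qed
qed

end

section \<open>The dual group\<close>

lemma characters_mult: "\<alpha> \<in> characters \<Longrightarrow> \<alpha> (x + y) = \<alpha> x * \<alpha> y"
  and characters_norm: "\<alpha> \<in> characters \<Longrightarrow> norm (\<alpha> x) = 1"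
  and characters_cont: "\<alpha> \<in> characters \<Longrightarrow> continuous_on UNIV \<alpha>"
  by (auto simp: characters_def)

lemma characters_0: "\<alpha> \<in> characters \<Longrightarrow> \<alpha> 0 = 1"
  using characters_mult[of \<alpha> 0 0] characters_norm[of \<alpha> 0] by auto

lemma characters_cnj_mult: "\<alpha> \<in> characters \<Longrightarrow> \<alpha> x * cnj (\<alpha> x) = 1"
  using characters_norm[of \<alpha> x] by (simp add: complex_norm_square[symmetric])

lemma characters_uminus: "\<alpha> \<in> characters \<Longrightarrow> \<alpha> (- x) = cnj (\<alpha> x)"
proof -
  assume a: "\<alpha> \<in> characters"
  have "\<alpha> x * \<alpha> (- x) = \<alpha> x * cnj (\<alpha> x)"
    using characters_mult[OF a, of x "- x"] by (simp add: characters_0[OF a] characters_cnj_mult[OF a])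
  moreover have "\<alpha> x \<noteq> 0" using characters_norm[OF a, of x] by auto
  ultimately show ?thesis by simp
qed

lemma char_add_characters: "\<alpha> \<in> characters \<Longrightarrow> \<beta> \<in> characters \<Longrightarrow> char_add \<alpha> \<beta> \<in> characters"
  by (auto simp: characters_def char_add_def norm_mult intro: continuous_on_mult)

lemma char_neg_characters: "\<alpha> \<in> characters \<Longrightarrow> char_neg \<alpha> \<in> characters"
  by (auto simp: characters_def char_neg_def intro: continuous_on_cnj)

lemma char_add_assoc: "char_add (char_add \<alpha> \<beta>) \<gamma> = char_add \<alpha> (char_add \<beta> \<gamma>)"
  and char_add_commute: "char_add \<alpha> \<beta> = char_add \<beta> \<alpha>"
  and char_neg_add: "char_neg (char_add \<alpha> \<beta>) = char_add (char_neg \<alpha>) (char_neg \<beta>)"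
  and char_neg_neg: "char_neg (char_neg \<alpha>) = \<alpha>"
  by (auto simp: char_add_def char_neg_def mult_ac)

lemma char_add_neg_cancel:
  assumes "\<beta> \<in> characters"
  shows "char_add (char_add \<alpha> \<beta>) (char_neg \<beta>) = \<alpha>" "char_add (char_add \<alpha> (char_neg \<beta>)) \<beta> = \<alpha>"
  using characters_cnj_mult[OF assms] by (auto simp: char_add_def char_neg_def mult.assoc mult.commute[of "cnj _"])

lemma dual_lattice_characters: "\<alpha> \<in> dual_lattice L \<Longrightarrow> \<alpha> \<in> characters"
  by (simp add: dual_lattice_def)

lemma dual_lattice_add: "\<alpha> \<in> dual_lattice L \<Longrightarrow> \<beta> \<in> dual_lattice L \<Longrightarrow> char_add \<alpha> \<beta> \<in> dual_lattice L"
  by (auto simp: dual_lattice_def char_add_characters) (simp add: char_add_def)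

lemma dual_lattice_neg: "\<alpha> \<in> dual_lattice L \<Longrightarrow> char_neg \<alpha> \<in> dual_lattice L"
  by (auto simp: dual_lattice_def char_neg_characters) (simp add: char_neg_def)

text \<open>Here |z^2 - 1| factors as |z + 1| |z - 1|, and a point of the circle within distance 1
  of 1 has real part at least 1/2. Squaring thus expands small distances from 1 by the factor
  3/2.\<close>

lemma norm_square_minus_1:
  assumes "norm (z::complex) = 1" "norm (z - 1) \<le> 1"
  shows "3 / 2 * norm (z - 1) \<le> norm (z * z - 1)"
proof -
  have "(Re z)\<^sup>2 + (Im z)\<^sup>2 = 1" using assms(1) by (simp add: cmod_def)
  moreover have "(Re z - 1)\<^sup>2 + (Im z)\<^sup>2 \<le> 1" using assms(2) by (simp add: cmod_def)
  ultimately have "Re z \<ge> 1 / 2" by (simp add: power2_eq_square algebra_simps)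
  then have "3 / 2 \<le> norm (z + 1)" using complex_Re_le_cmod[of "z + 1"] by simp
  then have "3 / 2 * norm (z - 1) \<le> norm (z + 1) * norm (z - 1)" by (rule mult_right_mono) simp
  also have "\<dots> = norm (z * z - 1)" by (simp add: norm_mult[symmetric] algebra_simps)
  finally show ?thesis .
qed

text \<open>The circle has no small subgroups: repeated doubling would drive a positive distance
  from 1 beyond every bound.\<close>

lemma hom_near_1_trivial:
  fixes \<gamma> :: "'g::ab_group_add \<Rightarrow> complex"
  assumes "\<And>x y. \<gamma> (x + y) = \<gamma> x * \<gamma> y" "\<And>x. norm (\<gamma> x) = 1" "\<And>x. norm (\<gamma> x - 1) \<le> 1"
  shows "\<gamma> x = 1"
proof (rule ccontr)
  have le: "(3 / 2) ^ n * norm (\<gamma> x - 1) \<le> 1" for n x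
  proof (induction n arbitrary: x)
    case (Suc n)
    have "(3 / 2) ^ Suc n * norm (\<gamma> x - 1) = (3 / 2) ^ n * (3 / 2 * norm (\<gamma> x - 1))" by simp
    also have "\<dots> \<le> (3 / 2) ^ n * norm (\<gamma> (x + x) - 1)"
      unfolding assms(1) by (intro mult_left_mono norm_square_minus_1 assms(2,3)) auto
    also have "\<dots> \<le> 1" by (rule Suc.IH)
    finally show ?case .
  qed (simp add: assms)
  assume "\<gamma> x \<noteq> 1"
  then have "norm (\<gamma> x - 1) > 0" by simp
  moreover obtain n where "1 / norm (\<gamma> x - 1) < (3 / 2) ^ n"
    using real_arch_pow[of "3 / 2" "1 / norm (\<gamma> x - 1)"] by auto
  ultimately have "1 < (3 / 2) ^ n * norm (\<gamma> x - 1)" by (simp add: field_simps)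
  then show False using le[of n x] by linarith
qed

text \<open>A polar-like set of characters. For an open neighbourhood \<open>V\<close> of 0 it is
  compact in the dual topology (\<open>compactin_near_1\<close>), which makes it the source of
  compact sets of characters.\<close>

definition near_1 :: "'g::{ab_group_add, topological_space} set \<Rightarrow> ('g \<Rightarrow> complex) set" where
  "near_1 V = {\<alpha> \<in> characters. \<forall>x\<in>V. norm (\<alpha> x - 1) \<le> 1 / 4}"

lemma topspace_dual: "topspace dual_topology = characters"
  unfolding dual_topology_def topology_generated_by_topspace
proof (intro equalityI subsetI)
  fix c :: "'a \<Rightarrow> complex" assume "c \<in> characters"
  then show "c \<in> \<Union> {{c \<in> characters. \<forall>x\<in>K. cmod (c x - c0 x) < e} |K c0 e. compact K \<and> c0 \<in> characters \<and> 0 < e}"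
    \<comment> \<open>With the empty compact set the basic open set is the whole dual group.\<close>
    by (intro UnionI[of "{c' \<in> characters. \<forall>x\<in>{}. norm (c' x - c x) < 1}"]) (blast intro: compact_empty zero_less_one, simp)
qed auto

lemma openin_dual_subset: "openin dual_topology U \<Longrightarrow> U \<subseteq> characters"
  using openin_subset[of dual_topology U] by (simp add: topspace_dual)

lemma openin_dual_basic:
  assumes "compact K" "c0 \<in> characters" "e > 0"
  shows "openin dual_topology {c \<in> characters. \<forall>x\<in>K. norm (c x - c0 x) < e}"
  unfolding dual_topology_def by (rule topology_generated_by_Basis) (use assms in blast)

lemma continuous_map_eval: "continuous_map dual_topology euclidean (\<lambda>c. c x)"
  unfolding continuous_map topspace_dual
proof (intro conjI allI impI)
  fix B :: "complex set" assume "openin euclidean B"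
  then have B: "open B" by simp
  show "openin dual_topology {c \<in> characters. c x \<in> B}"
  proof (subst openin_subopen, intro ballI)
    fix c assume c: "c \<in> {c \<in> characters. c x \<in> B}"
    then obtain e where e: "e > 0" "ball (c x) e \<subseteq> B" using B by (auto simp: open_contains_ball)
    then show "\<exists>T. openin dual_topology T \<and> c \<in> T \<and> T \<subseteq> {c \<in> characters. c x \<in> B}"
      using openin_dual_basic[of "{x}" c e] c
      by (intro exI[of _ "{c' \<in> characters. \<forall>y\<in>{x}. norm (c' y - c y) < e}"])
        (auto simp: dist_norm norm_minus_commute subset_iff)
  qed
qed auto

lemma space_dual_borel [simp]: "space dual_borel = characters"
  unfolding dual_borel_def by (simp add: topspace_dual space_measure_of_conv)

lemma sets_dual_borel: "sets dual_borel = sigma_sets characters {U. openin dual_topology U}"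
  unfolding dual_borel_def by (subst sets_measure_of) (auto simp: topspace_dual dest: openin_dual_subset)

lemma openin_dual_sets: "openin dual_topology U \<Longrightarrow> U \<in> sets dual_borel"
  by (simp add: sets_dual_borel sigma_sets.Basic)

lemma closedin_dual_sets:
  assumes "closedin dual_topology U" shows "U \<in> sets dual_borel"
proof -
  have "characters - (characters - U) \<in> sets dual_borel"
    using assms sets.compl_sets[OF openin_dual_sets, of "characters - U"] by (simp add: closedin_def topspace_dual)
  moreover have "characters - (characters - U) = U" using assms by (auto simp: closedin_def topspace_dual)
  ultimately show ?thesis by simp
qed

lemma measurable_eval [measurable]: "(\<lambda>c. c x) \<in> borel_measurable dual_borel"
proof (rule borel_measurableI)
  fix B :: "complex set" assume "open B"
  then have "openin dual_topology {c \<in> topspace dual_topology. c x \<in> B}"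
    by (intro openin_continuous_map_preimage[OF continuous_map_eval]) simp
  moreover have "(\<lambda>c. c x) -` B \<inter> space dual_borel = {c \<in> topspace dual_topology. c x \<in> B}"
    by (auto simp: topspace_dual)
  ultimately show "(\<lambda>c. c x) -` B \<inter> space dual_borel \<in> sets dual_borel" by (simp add: openin_dual_sets)
qed

lemma near_1_sets: "near_1 V \<in> sets dual_borel"
proof (cases "V = {}")
  case True
  then have "near_1 V = characters" by (simp add: near_1_def)
  then show ?thesis using sets.top[of dual_borel] by simp
next
  case False
  have "closedin dual_topology (\<Inter>x\<in>V. {c \<in> topspace dual_topology. c x \<in> cball 1 (1 / 4)})"
    using False by (intro closedin_INT closedin_continuous_map_preimage[OF continuous_map_eval]) auto
  moreover have "(\<Inter>x\<in>V. {c \<in> topspace dual_topology. c x \<in> cball 1 (1 / 4)}) = near_1 V"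
    using False by (auto simp: near_1_def topspace_dual dist_norm norm_minus_commute)
  ultimately show ?thesis by (simp add: closedin_dual_sets)
qed

lemma continuous_map_char_add:
  fixes \<gamma> :: "'g::{ab_group_add, topological_space} \<Rightarrow> complex"
  assumes \<gamma>: "\<gamma> \<in> characters"
  shows "continuous_map dual_topology dual_topology (\<lambda>c. char_add c \<gamma>)"
proof -
  have "continuous_map dual_topology (topology_generated_by
     {{c \<in> characters. \<forall>x\<in>K. norm (c x - c0 x) < e} | K c0 e. compact K \<and> c0 \<in> characters \<and> e > 0}) (\<lambda>c. char_add c \<gamma>)"
    unfolding continuous_on_generated_topo_iff
  proof (intro conjI allI impI)
    fix U :: "('g \<Rightarrow> complex) set"
    assume "U \<in> {{c \<in> characters. \<forall>x\<in>K. norm (c x - c0 x) < e} | K c0 e. compact K \<and> c0 \<in> characters \<and> e > 0}"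
    then obtain K c0 e where U: "U = {c \<in> characters. \<forall>x\<in>K. norm (c x - c0 x) < e}" "compact K" "c0 \<in> characters" "e > 0"
      by blast
    have "norm (c x * \<gamma> x - c0 x) = norm (c x - c0 x * cnj (\<gamma> x))" for c :: "'g \<Rightarrow> complex" and x
    proof -
      have "c x * \<gamma> x - c0 x = (c x - c0 x * cnj (\<gamma> x)) * \<gamma> x"
        using characters_cnj_mult[OF \<gamma>, of x] by (simp add: algebra_simps)
      then show ?thesis using characters_norm[OF \<gamma>] by (simp add: norm_mult)
    qed
    then have "(\<lambda>c. char_add c \<gamma>) -` U \<inter> topspace dual_topology = {c \<in> characters. \<forall>x\<in>K. norm (c x - char_add c0 (char_neg \<gamma>) x) < e}"
      using char_add_characters \<gamma> by (auto simp: U(1) topspace_dual) (simp_all add: char_add_def char_neg_def)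
    then show "openin dual_topology ((\<lambda>c. char_add c \<gamma>) -` U \<inter> topspace dual_topology)"
      using openin_dual_basic[OF U(2) char_add_characters[OF U(3) char_neg_characters[OF \<gamma>]] U(4)] by simp
  next
    show "(\<lambda>c. char_add c \<gamma>) ` topspace dual_topology
      \<subseteq> \<Union> {{c \<in> characters. \<forall>x\<in>K. norm (c x - c0 x) < e} | K c0 e. compact K \<and> c0 \<in> characters \<and> e > 0}"
      using topspace_dual[where ?'a='g, unfolded dual_topology_def topology_generated_by_topspace] char_add_characters \<gamma>
      by (auto simp: topspace_dual)
  qed
  then show ?thesis by (simp add: dual_topology_def)
qed

lemma measurable_char_add:
  fixes \<gamma> :: "'g::{ab_group_add, topological_space} \<Rightarrow> complex"
  assumes \<gamma>: "\<gamma> \<in> characters"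
  shows "(\<lambda>c. char_add c \<gamma>) \<in> measurable dual_borel dual_borel"
proof (rule measurable_sigma_sets[OF sets_dual_borel])
  show "{U. openin dual_topology U} \<subseteq> Pow characters" by (auto dest: openin_dual_subset)
  show "(\<lambda>c. char_add c \<gamma>) \<in> space dual_borel \<rightarrow> characters" using char_add_characters \<gamma> by auto
  fix U :: "('g \<Rightarrow> complex) set" assume "U \<in> {U. openin dual_topology U}"
  then have "openin dual_topology {c \<in> topspace dual_topology. char_add c \<gamma> \<in> U}"
    by (intro openin_continuous_map_preimage[OF continuous_map_char_add[OF \<gamma>]]) simp
  moreover have "(\<lambda>c. char_add c \<gamma>) -` U \<inter> space dual_borel = {c \<in> topspace dual_topology. char_add c \<gamma> \<in> U}"
    by (auto simp: topspace_dual)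
  ultimately show "(\<lambda>c. char_add c \<gamma>) -` U \<inter> space dual_borel \<in> sets dual_borel" by (simp add: openin_dual_sets)
qed

section \<open>Compact sets of characters and discreteness of the dual lattice\<close>

context lca
begin

text \<open>The set \<open>near_1 V\<close> without the demand of continuity: in this form it is
  visibly closed under pointwise limits, and continuity turns out to be automatic.\<close>

definition unimodular_homs :: "'g set \<Rightarrow> ('g \<Rightarrow> complex) set" where
  "unimodular_homs V = {\<alpha>. (\<forall>x y. \<alpha> (x + y) = \<alpha> x * \<alpha> y) \<and> (\<forall>x. norm (\<alpha> x) = 1) \<and> (\<forall>x\<in>V. norm (\<alpha> x - 1) \<le> 1 / 4)}"

text \<open>Each halving of the neighbourhood improves the bound on |\<alpha> x - 1| by the factor
  2/3, by applying \<open>norm_square_minus_1\<close> at \<open>x\<close> and the previous bound at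
  its double; the gain is uniform in \<alpha>.\<close>

lemma equicontinuous_homs:
  assumes V: "open V" "0 \<in> V" and e: "e > 0"
  shows "\<exists>V'. open V' \<and> 0 \<in> V' \<and> (\<forall>\<alpha>\<in>unimodular_homs V. \<forall>x\<in>V'. norm (\<alpha> x - 1) < e)"
proof -
  have step: "\<exists>V'. open V' \<and> 0 \<in> V' \<and> (\<forall>\<alpha>\<in>unimodular_homs V. \<forall>x\<in>V'. (3 / 2) ^ n * norm (\<alpha> x - 1) \<le> 1 / 4)" for n
  proof (induction n)
    case 0
    show ?case using V by (intro exI[of _ V]) (auto simp: unimodular_homs_def)
  next
    case (Suc n)
    then obtain V' where V': "open V'" "0 \<in> V'" "\<forall>\<alpha>\<in>unimodular_homs V. \<forall>x\<in>V'. (3 / 2) ^ n * norm (\<alpha> x - 1) \<le> 1 / 4" by blast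
    have o: "open (V \<inter> V')" "0 \<in> V \<inter> V'" using V V' by auto
    obtain W where W: "open W" "0 \<in> W" "W \<subseteq> V \<inter> V'" "\<And>x y. x \<in> W \<Longrightarrow> y \<in> W \<Longrightarrow> x + y \<in> V \<inter> V'"
      by (rule nhd_half[OF o]) blast
    show ?case
    proof (intro exI[of _ W] conjI W(1,2) ballI)
      fix \<alpha> x assume \<alpha>: "\<alpha> \<in> unimodular_homs V" and x: "x \<in> W"
      have "norm (\<alpha> x - 1) \<le> 1 / 4" "norm (\<alpha> x) = 1" "\<alpha> (x + x) = \<alpha> x * \<alpha> x"
        using \<alpha> x W(3) by (auto simp: unimodular_homs_def)
      then have "3 / 2 * norm (\<alpha> x - 1) \<le> norm (\<alpha> (x + x) - 1)" using norm_square_minus_1[of "\<alpha> x"] by simp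
      then have "(3 / 2) ^ n * (3 / 2 * norm (\<alpha> x - 1)) \<le> (3 / 2) ^ n * norm (\<alpha> (x + x) - 1)"
        by (intro mult_left_mono) auto
      also have "\<dots> \<le> 1 / 4" using V'(3) \<alpha> W(4)[OF x x] by auto
      finally show "(3 / 2) ^ Suc n * norm (\<alpha> x - 1) \<le> 1 / 4" by (simp add: mult_ac)
    qed
  qed
  obtain n where n: "1 / e < (3 / 2) ^ n" using real_arch_pow[of "3 / 2" "1 / e"] by auto
  obtain V' where V': "open V'" "0 \<in> V'" "\<forall>\<alpha>\<in>unimodular_homs V. \<forall>x\<in>V'. (3 / 2) ^ n * norm (\<alpha> x - 1) \<le> 1 / 4"
    using step[of n] by blast
  have "norm (\<alpha> x - 1) < e" if "\<alpha> \<in> unimodular_homs V" "x \<in> V'" for \<alpha> x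
  proof (rule ccontr)
    assume "\<not> norm (\<alpha> x - 1) < e"
    then have "(3 / 2) ^ n * e \<le> (3 / 2) ^ n * norm (\<alpha> x - 1)" by (intro mult_left_mono) auto
    also have "\<dots> \<le> 1 / 4" using V'(3) that by blast
    finally have "(3 / 2) ^ n * e \<le> 1 / 4" .
    moreover have "1 < (3 / 2) ^ n * e" using n e by (simp only: pos_divide_less_eq)
    ultimately show False by linarith
  qed
  then show ?thesis using V' by blast
qed

text \<open>A homomorphism close to 1 on one neighbourhood of 0 is continuous at 0 by
  \<open>equicontinuous_homs\<close>, hence everywhere.\<close>

lemma unimodular_homs_eq:
  assumes V: "open V" "0 \<in> V" shows "unimodular_homs V = near_1 V"
proof (intro equalityI subsetI)
  fix \<alpha> assume \<alpha>: "\<alpha> \<in> unimodular_homs V"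
  then have hom: "\<And>x y. \<alpha> (x + y) = \<alpha> x * \<alpha> y" "\<And>x. norm (\<alpha> x) = 1" by (auto simp: unimodular_homs_def)
  have "continuous_on UNIV \<alpha>"
    unfolding continuous_on_eq_continuous_at[OF open_UNIV]
  proof
    fix x
    show "isCont \<alpha> x" unfolding isCont_def
    proof (rule tendstoI)
      fix e :: real assume "e > 0"
      then obtain V' where V': "open V'" "0 \<in> V'" "\<forall>x\<in>V'. norm (\<alpha> x - 1) < e"
        using equicontinuous_homs[OF V \<open>e > 0\<close>] \<alpha> by blast
      have "open {y. y + (- x) \<in> V'}" "x \<in> {y. y + (- x) \<in> V'}" using open_translate[OF V'(1), of "- x"] V'(2) by simp_all
      moreover have "dist (\<alpha> y) (\<alpha> x) < e" if "y \<in> {y. y + (- x) \<in> V'}" for y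
      proof -
        have "\<alpha> y - \<alpha> x = \<alpha> x * (\<alpha> (y - x) - 1)" using hom(1)[of x "y - x"] by (simp add: algebra_simps)
        then show ?thesis using V'(3) that hom(2) by (simp add: dist_norm norm_mult)
      qed
      ultimately show "\<forall>\<^sub>F y in at x. dist (\<alpha> y) (\<alpha> x) < e" unfolding eventually_at_topological by blast
    qed
  qed
  then show "\<alpha> \<in> near_1 V" using \<alpha> by (auto simp: near_1_def characters_def unimodular_homs_def)
qed (auto simp: near_1_def characters_def unimodular_homs_def)

text \<open>Tychonoff: the defining conditions are closed for pointwise convergence inside a product
  of circles.\<close>

lemma compact_unimodular_homs: "compact (unimodular_homs (V :: 'g set))"
proof -
  have "compactin (product_topology (\<lambda>i::'g. euclidean) UNIV) (PiE UNIV (\<lambda>_. sphere (0::complex) 1))"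
    by (subst compactin_PiE) auto
  then have c: "compact (PiE UNIV (\<lambda>_::'g. sphere (0::complex) 1))"
    by (simp add: euclidean_product_topology)
  have coord: "continuous_on UNIV (\<lambda>\<alpha>::'g \<Rightarrow> complex. \<alpha> x)" for x
    by (rule continuous_on_product_coordinates)
  have "closed ({\<alpha>. \<forall>x y. \<alpha> (x + y) = \<alpha> x * \<alpha> y} \<inter> (\<Inter>x\<in>V. {\<alpha>. norm (\<alpha> x - 1) \<le> 1 / 4}) :: ('g \<Rightarrow> complex) set)"
    by (intro closed_Int closed_Collect_all closed_INT ballI closed_Collect_eq closed_Collect_le coord
        continuous_on_mult continuous_on_norm continuous_on_diff continuous_on_const)
  from compact_Int_closed[OF c this] show ?thesis
    by (rule back_subst[of compact]) (auto simp: unimodular_homs_def)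
qed

text \<open>On an equicontinuous family pointwise convergence is uniform on compact sets, so the
  identity from the pointwise to the dual topology is continuous and transports compactness.\<close>

lemma compactin_near_1:
  assumes V: "open (V :: 'g set)" "0 \<in> V"
  shows "compactin dual_topology (near_1 V)"
proof -
  let ?P = "near_1 V"
  have P: "compact ?P" using compact_unimodular_homs[of V] unimodular_homs_eq[OF V] by simp
  have "continuous_map (top_of_set ?P) (topology_generated_by
     {{c \<in> characters. \<forall>x\<in>K. norm (c x - c0 x) < e} | K c0 e. compact K \<and> c0 \<in> characters \<and> e > 0}) (\<lambda>c. c)"
    unfolding continuous_on_generated_topo_iff
  proof (intro conjI allI impI)
    fix U assume "U \<in> {{c \<in> characters. \<forall>x\<in>K. norm (c x - c0 x) < e} | K c0 e. compact (K::'g set) \<and> c0 \<in> characters \<and> e > 0}"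
    then obtain K c0 e where U: "U = {c \<in> characters. \<forall>x\<in>K. norm (c x - c0 x) < e}" "compact K" "c0 \<in> characters" "e > 0"
      by blast
    show "openin (top_of_set ?P) ((\<lambda>c. c) -` U \<inter> topspace (top_of_set ?P))"
    proof (subst openin_subopen, intro ballI)
      fix \<alpha> assume "\<alpha> \<in> (\<lambda>c. c) -` U \<inter> topspace (top_of_set ?P)"
      then have \<alpha>: "\<alpha> \<in> U" "\<alpha> \<in> ?P" by auto
      have \<alpha>c: "\<alpha> \<in> characters" using \<alpha>(1) by (simp add: U(1))
      \<comment> \<open>The margin 3 d pays for three errors below \<open>d\<close>: the variation
        of \<beta> and that of \<alpha> between a point of \<open>K\<close> and a nearby point of
        the finite net, and their difference at that net point.\<close>
      obtain d where d: "d > 0" "\<And>x. x \<in> K \<Longrightarrow> norm (\<alpha> x - c0 x) \<le> e - 3 * d"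
      proof (cases "K = {}")
        case True then show ?thesis using that[of 1] by simp
      next
        case False
        have "continuous_on K (\<lambda>x. norm (\<alpha> x - c0 x))"
          using characters_cont[OF \<alpha>c] characters_cont[OF U(3)]
          by (intro continuous_on_norm continuous_on_diff) (auto intro: continuous_on_subset)
        then obtain x0 where x0: "x0 \<in> K" "\<And>x. x \<in> K \<Longrightarrow> norm (\<alpha> x - c0 x) \<le> norm (\<alpha> x0 - c0 x0)"
          using continuous_attains_sup[OF U(2) False] by blast
        have "norm (\<alpha> x0 - c0 x0) < e" using \<alpha>(1) x0(1) by (simp add: U(1))
        then show ?thesis using x0(2) by (intro that[of "(e - norm (\<alpha> x0 - c0 x0)) / 3"]) (auto simp: diff_divide_distrib)
      qed
      obtain V' where V': "open V'" "0 \<in> V'" "\<And>\<beta> x. \<beta> \<in> ?P \<Longrightarrow> x \<in> V' \<Longrightarrow> norm (\<beta> x - 1) < d"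
        using equicontinuous_homs[OF V d(1)] unfolding unimodular_homs_eq[OF V] by blast
      have "K \<subseteq> (\<Union>x\<in>K. {y. y + (- x) \<in> V'})" using V'(2) by auto
      then obtain F where F: "F \<subseteq> K" "finite F" "K \<subseteq> (\<Union>x\<in>F. {y. y + (- x) \<in> V'})"
        using compactE_image[OF U(2), of K "\<lambda>x. {y. y + (- x) \<in> V'}"] open_translate[OF V'(1)] by blast
      let ?T = "{\<beta>. \<forall>x\<in>F. norm (\<beta> x - \<alpha> x) < d}"
      have "open (\<Inter>x\<in>F. {\<beta>::'g \<Rightarrow> complex. norm (\<beta> x - \<alpha> x) < d})"
        by (intro open_INT F(2) ballI open_Collect_less continuous_on_norm continuous_on_diff continuous_on_const continuous_on_product_coordinates)
      moreover have "(\<Inter>x\<in>F. {\<beta>::'g \<Rightarrow> complex. norm (\<beta> x - \<alpha> x) < d}) = ?T" by auto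
      ultimately have oT: "open ?T" by simp
      have "\<beta> \<in> U" if \<beta>: "\<beta> \<in> ?P" "\<beta> \<in> ?T" for \<beta>
      proof -
        have \<beta>c: "\<beta> \<in> characters" using \<beta>(1) by (simp add: near_1_def)
        have "norm (\<beta> y - c0 y) < e" if y: "y \<in> K" for y
        proof -
          obtain x where x: "x \<in> F" "y - x \<in> V'" using F(3) y by auto
          have "\<beta> y = \<beta> x * \<beta> (y - x)" "\<alpha> y = \<alpha> x * \<alpha> (y - x)"
            using characters_mult[OF \<beta>c, of x "y - x"] characters_mult[OF \<alpha>c, of x "y - x"] by simp_all
          then have "\<beta> y - c0 y = \<beta> x * (\<beta> (y - x) - 1) + (\<beta> x - \<alpha> x) - \<alpha> x * (\<alpha> (y - x) - 1) + (\<alpha> y - c0 y)"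
            by (simp add: algebra_simps)
          also have "norm \<dots> \<le> norm (\<beta> x * (\<beta> (y - x) - 1)) + norm (\<beta> x - \<alpha> x) + norm (\<alpha> x * (\<alpha> (y - x) - 1)) + norm (\<alpha> y - c0 y)"
            by (intro norm_triangle_mono norm_triangle_le_diff add_mono order_refl)
          also have "\<dots> < e"
            using V'(3)[OF \<beta>(1) x(2)] V'(3)[OF \<alpha>(2) x(2)] \<beta>(2) x(1) d(2)[OF y]
            by (fastforce simp: norm_mult characters_norm[OF \<beta>c] characters_norm[OF \<alpha>c])
          finally show ?thesis .
        qed
        then show ?thesis using \<beta>c by (simp add: U(1))
      qed
      then show "\<exists>T. openin (top_of_set ?P) T \<and> \<alpha> \<in> T \<and> T \<subseteq> (\<lambda>c. c) -` U \<inter> topspace (top_of_set ?P)"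
        using oT \<alpha>(2) d(1) by (intro exI[of _ "?P \<inter> ?T"]) (auto intro: openin_open_Int)
    qed
  next
    show "(\<lambda>c. c) ` topspace (top_of_set ?P)
      \<subseteq> \<Union> {{c \<in> characters. \<forall>x\<in>K. norm (c x - c0 x) < e} | K c0 e. compact K \<and> c0 \<in> characters \<and> e > 0}"
      using topspace_dual[where ?'a='g, unfolded dual_topology_def topology_generated_by_topspace]
      by (auto simp: near_1_def)
  qed
  then have "continuous_map (top_of_set ?P) dual_topology (\<lambda>c. c)" by (simp add: dual_topology_def)
  moreover have "compactin (top_of_set ?P) ?P" using P by (simp add: compactin_subtopology)
  ultimately have "compactin dual_topology ((\<lambda>c. c) ` ?P)" by (rule image_compactin[rotated])
  then show ?thesis by simp
qed

text \<open>Two elements of the dual lattice within 1/2 of a common character on representatives of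
  the quotient by \<open>K\<close> have a quotient within 1 of 1 everywhere, so they coincide by
  \<open>hom_near_1_trivial\<close>. Each member of a finite cover of the compact set therefore
  contains at most one of them.\<close>

lemma finite_dual_lattice_near_1:
  assumes K: "lattice (K :: 'g set)" and V: "open V" "0 \<in> V"
  shows "finite (dual_lattice K \<inter> near_1 V)"
proof -
  obtain K0 where K0: "compact K0" "\<And>x. \<exists>k\<in>K0. \<exists>l\<in>K. x = k + l" using K by (auto simp: lattice_def)
  let ?U = "\<lambda>c. {c' \<in> characters. \<forall>x\<in>K0. norm (c' x - c x) < 1 / 2}"
  have one: "\<kappa>1 = \<kappa>2" if l: "\<kappa>1 \<in> dual_lattice K" "\<kappa>2 \<in> dual_lattice K" "\<kappa>1 \<in> ?U c" "\<kappa>2 \<in> ?U c" for \<kappa>1 \<kappa>2 c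
  proof -
    have lc: "\<kappa>1 \<in> characters" "\<kappa>2 \<in> characters" using l by (auto simp: dual_lattice_def)
    let ?g = "\<lambda>x. \<kappa>1 x * cnj (\<kappa>2 x)"
    have "?g x = 1" for x
    proof (rule hom_near_1_trivial[of ?g])
      show "?g (x + y) = ?g x * ?g y" for x y by (simp add: characters_mult lc)
      show "norm (?g x) = 1" for x by (simp add: norm_mult characters_norm lc)
      show "norm (?g x - 1) \<le> 1" for x
      proof -
        obtain k m where km: "k \<in> K0" "m \<in> K" "x = k + m" using K0(2) by blast
        have "\<kappa>1 x = \<kappa>1 k" "\<kappa>2 x = \<kappa>2 k" using l km by (auto simp: dual_lattice_def characters_mult)
        moreover have "norm (?g k - 1) \<le> 1"
        proof -
          have "?g k - 1 = (\<kappa>1 k - \<kappa>2 k) * cnj (\<kappa>2 k)" using characters_cnj_mult[OF lc(2), of k] by (simp add: algebra_simps)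
          then have "norm (?g k - 1) = norm ((\<kappa>1 k - c k) - (\<kappa>2 k - c k))" by (simp add: norm_mult characters_norm lc)
          also have "\<dots> \<le> norm (\<kappa>1 k - c k) + norm (\<kappa>2 k - c k)" by (rule norm_triangle_ineq4)
          also have "\<dots> \<le> 1" using l(3,4) km(1) by fastforce
          finally show ?thesis .
        qed
        ultimately show ?thesis by simp
      qed
    qed
    then have "\<kappa>1 x * (cnj (\<kappa>2 x) * \<kappa>2 x) = \<kappa>2 x" for x by (simp add: mult.assoc[symmetric])
    then show ?thesis using characters_cnj_mult[OF lc(2)] by (auto simp: mult.commute[of "cnj _"])
  qed
  have "\<exists>\<F>. finite \<F> \<and> \<F> \<subseteq> ?U ` characters \<and> near_1 V \<subseteq> \<Union>\<F>"
  proof (rule compactinD[OF compactin_near_1[OF V]])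
    show "openin dual_topology U" if "U \<in> ?U ` characters" for U
      using that openin_dual_basic[OF K0(1), of _ "1 / 2"] by auto
    show "near_1 V \<subseteq> \<Union> (?U ` characters)" by (auto simp: near_1_def)
  qed
  then obtain \<F> where F: "finite \<F>" "\<F> \<subseteq> ?U ` characters" "near_1 V \<subseteq> \<Union>\<F>" by blast
  have "finite (dual_lattice K \<inter> U)" if U: "U \<in> \<F>" for U
  proof (cases "dual_lattice K \<inter> U = {}")
    case False
    then obtain \<kappa>1 where l: "\<kappa>1 \<in> dual_lattice K \<inter> U" by blast
    have "dual_lattice K \<inter> U \<subseteq> {\<kappa>1}" using one l U F(2) by blast
    then show ?thesis by (rule finite_subset) simp
  qed simp
  then have "finite (\<Union>U\<in>\<F>. dual_lattice K \<inter> U)" using F(1) by blast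
  then show ?thesis by (rule rev_finite_subset) (use F(3) in blast)
qed

text \<open>Every character is close to 1 on some member of a countable neighbourhood base of 0,
  which writes the dual lattice as a countable union of finite sets.\<close>

lemma countable_dual_lattice:
  assumes K: "lattice (K :: 'g set)" shows "countable (dual_lattice K)"
proof -
  obtain A :: "nat \<Rightarrow> 'g set" where A: "\<And>i. open (A i)" "\<And>i. 0 \<in> A i"
    "\<And>S. open S \<Longrightarrow> 0 \<in> S \<Longrightarrow> eventually (\<lambda>i. A i \<subseteq> S) sequentially"
    by (rule countable_basis_at_decseq[of "0::'g"]) blast
  have "dual_lattice K \<subseteq> (\<Union>i. dual_lattice K \<inter> near_1 (A i))"
  proof
    fix \<alpha> assume a: "\<alpha> \<in> dual_lattice K"
    then have ac: "\<alpha> \<in> characters" by (simp add: dual_lattice_def)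
    have "open {x. norm (\<alpha> x - 1) < 1 / 4}"
      by (intro open_Collect_less continuous_on_norm continuous_on_diff characters_cont[OF ac] continuous_on_const)
    moreover have "0 \<in> {x. norm (\<alpha> x - 1) < 1 / 4}" by (simp add: characters_0[OF ac])
    ultimately have "eventually (\<lambda>i. A i \<subseteq> {x. norm (\<alpha> x - 1) < 1 / 4}) sequentially" by (rule A(3))
    then obtain i where "A i \<subseteq> {x. norm (\<alpha> x - 1) < 1 / 4}" by (auto simp: eventually_sequentially)
    then have "\<alpha> \<in> near_1 (A i)" using ac by (force simp: near_1_def)
    then show "\<alpha> \<in> (\<Union>i. dual_lattice K \<inter> near_1 (A i))" using a by blast
  qed
  moreover have "countable (\<Union>i. dual_lattice K \<inter> near_1 (A i))"
    by (intro countable_UN) (auto intro: countable_finite finite_dual_lattice_near_1[OF K A(1,2)])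
  ultimately show ?thesis by (rule countable_subset)
qed

end

section \<open>Orthogonality of characters on the dual tile\<close>

text \<open>For complex families summability and absolute summability coincide, and outside that
  case both sides take the default value 0. The integral form gives access to Fubini and dominated
  convergence.\<close>

lemma infsum_eq_integral_count_space:
  fixes f :: "'a \<Rightarrow> complex"
  shows "infsum f A = (\<integral>x. f x \<partial>count_space A)"
proof (cases "integrable (count_space A) f")
  case True
  then have "Infinite_Set_Sum.abs_summable_on f A" by (simp add: abs_summable_on_def)
  from infsetsum_infsum[OF this] show ?thesis by (simp add: infsetsum_def)
next
  case False
  then have "\<not> Infinite_Set_Sum.abs_summable_on f A" by (simp add: abs_summable_on_def)
  then have "\<not> f summable_on A"
    by (simp add: abs_summable_equivalent summable_on_iff_abs_summable_on_complex)
  then show ?thesis using False by (simp add: infsum_not_exists not_integrable_integral_eq)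
qed

locale dual_tile = lca \<mu> for \<mu> :: "'g::{ab_group_add, t2_space, second_countable_topology} measure" +
  fixes \<nu> :: "('g \<Rightarrow> complex) measure" and L :: "'g set" and D :: "('g \<Rightarrow> complex) set"
  assumes dual_haar: "dual_haar_measure \<nu>" and lat': "lattice L" and dual_tiling: "dual_tiling_set (dual_lattice L) D"
begin

lemma sets_nu [simp, measurable_cong]: "sets \<nu> = sets dual_borel" and space_nu [simp]: "space \<nu> = characters"
  using dual_haar by (auto simp: dual_haar_measure_def)

lemma distr_char_add:
  assumes \<gamma>: "\<gamma> \<in> characters" shows "distr \<nu> \<nu> (\<lambda>c. char_add c \<gamma>) = \<nu>"
proof (rule measure_eqI)
  fix A assume "A \<in> sets (distr \<nu> \<nu> (\<lambda>c. char_add c \<gamma>))"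
  then have A: "A \<in> sets \<nu>" by simp
  then have Ac: "A \<subseteq> characters" using sets.sets_into_space by fastforce
  have m: "(\<lambda>c. char_add c \<gamma>) \<in> measurable \<nu> \<nu>"
    using measurable_char_add[OF \<gamma>] by (simp cong: measurable_cong_sets)
  have "(\<lambda>c. char_add c \<gamma>) -` A \<inter> space \<nu> = char_add (char_neg \<gamma>) ` A"
  proof (intro equalityI subsetI)
    fix c assume "c \<in> (\<lambda>c. char_add c \<gamma>) -` A \<inter> space \<nu>"
    then show "c \<in> char_add (char_neg \<gamma>) ` A"
      using char_add_neg_cancel(1)[OF \<gamma>, of c] by (intro image_eqI[of _ _ "char_add c \<gamma>"]) (auto simp: char_add_commute)
  next
    fix c assume "c \<in> char_add (char_neg \<gamma>) ` A"
    then obtain a where a: "a \<in> A" "c = char_add a (char_neg \<gamma>)" by (auto simp: char_add_commute)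
    then show "c \<in> (\<lambda>c. char_add c \<gamma>) -` A \<inter> space \<nu>"
      using Ac char_add_neg_cancel(2)[OF \<gamma>, of a] char_add_characters char_neg_characters[OF \<gamma>] by auto
  qed
  then have "emeasure \<nu> ((\<lambda>c. char_add c \<gamma>) -` A \<inter> space \<nu>) = emeasure \<nu> A"
    using dual_haar A char_neg_characters[OF \<gamma>] unfolding dual_haar_measure_def by auto
  then show "emeasure (distr \<nu> \<nu> (\<lambda>c. char_add c \<gamma>)) A = emeasure \<nu> A"
    using A m by (subst emeasure_distr) auto
qed simp

lemma measurable_char_add_nu: "\<gamma> \<in> characters \<Longrightarrow> (\<lambda>c. char_add c \<gamma>) \<in> measurable \<nu> \<nu>"
  using measurable_char_add[of \<gamma>] by (simp cong: measurable_cong_sets)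

sublocale DT: tile \<nu> "dual_lattice L" "\<lambda>\<kappa> \<alpha>. char_add \<alpha> \<kappa>" char_neg D
proof
  show "countable (dual_lattice L)" by (rule countable_dual_lattice[OF lat'])
  fix i assume i: "i \<in> dual_lattice L"
  then have ic: "i \<in> characters" by (rule dual_lattice_characters)
  show "(\<lambda>c. char_add c i) \<in> measurable \<nu> \<nu>" by (rule measurable_char_add_nu[OF ic])
  show "distr \<nu> \<nu> (\<lambda>c. char_add c i) = \<nu>" by (rule distr_char_add[OF ic])
  show "char_add (char_add x (char_neg i)) i = x" for x by (rule char_add_neg_cancel(2)[OF ic])
next
  show "bij_betw char_neg (dual_lattice L) (dual_lattice L)"
    by (rule bij_betw_byWitness[where f'=char_neg]) (use dual_lattice_neg char_neg_neg in auto)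
  show "D \<in> sets \<nu>" using dual_tiling by (simp add: dual_tiling_set_def)
  fix x assume "x \<in> space \<nu>"
  then have x: "x \<in> characters" by simp
  obtain p where p: "fst p \<in> D \<and> snd p \<in> dual_lattice L \<and> x = char_add (fst p) (snd p)"
    "\<And>r. fst r \<in> D \<and> snd r \<in> dual_lattice L \<and> x = char_add (fst r) (snd r) \<Longrightarrow> r = p"
    using dual_tiling x unfolding dual_tiling_set_def by blast
  have pc: "snd p \<in> characters" using p(1) dual_lattice_characters by blast
  show "\<exists>!i. i \<in> dual_lattice L \<and> char_add x i \<in> D"
  proof (rule ex1I)
    show "char_neg (snd p) \<in> dual_lattice L \<and> char_add x (char_neg (snd p)) \<in> D"
      using p(1) char_add_neg_cancel(1)[OF pc, of "fst p"] dual_lattice_neg by auto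
    fix i assume i: "i \<in> dual_lattice L \<and> char_add x i \<in> D"
    have "(char_add x i, char_neg i) = p"
      using i char_add_neg_cancel(1)[of i x] dual_lattice_characters dual_lattice_neg by (intro p(2)) auto
    then show "i = char_neg (snd p)" using char_neg_neg[of i] by auto
  qed
qed

abbreviation "MD \<equiv> DT.MC"

end

section \<open>Compactness of the dual quotient, orthogonality and Parseval's identity\<close>

locale zak_setting = lca_lattice \<mu> L C + dual_tile \<mu> \<nu> L D
  for \<mu> :: "'g::{ab_group_add, t2_space, second_countable_topology} measure" and L C \<nu> D
begin

lemma extend_character_on:
  assumes \<eta>: "\<And>x y. \<eta> (x + y) = \<eta> x * \<eta> y" "\<And>x. norm (\<eta> x) = 1"
  obtains \<phi> where "\<phi> \<in> characters" "\<And>l. l \<in> L \<Longrightarrow> \<phi> l = \<eta> l"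
  using extend_character \<eta> by blast

text \<open>Extend the restriction of \<alpha> to \<open>L\<close> to a character that is near 1 on
  \<open>V\<close>; the two differ by an element of the dual lattice. In effect the dual group
  modulo the dual lattice is compact.\<close>

lemma exists_near_1_cover:
  obtains V where "open V" "0 \<in> V" "\<And>\<alpha>. \<alpha> \<in> characters \<Longrightarrow> \<exists>\<kappa>\<in>dual_lattice L. char_add \<alpha> \<kappa> \<in> near_1 V"
proof -
  obtain V where V: "open V" "0 \<in> V" and ext: "\<And>\<eta>. (\<forall>x y. \<eta> (x + y) = \<eta> x * \<eta> y) \<Longrightarrow> (\<forall>x. norm (\<eta> x) = 1) \<Longrightarrow>
     (\<exists>\<phi>\<in>characters. (\<forall>l\<in>L. \<phi> l = \<eta> l) \<and> (\<forall>t\<in>V. norm (\<phi> t - 1) \<le> 1 / 4))"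
    using extend_character by blast
  show thesis
  proof (rule that[OF V])
    fix \<alpha> :: "'g \<Rightarrow> complex" assume \<alpha>: "\<alpha> \<in> characters"
    obtain \<phi> where \<phi>: "\<phi> \<in> characters" "\<And>l. l \<in> L \<Longrightarrow> \<phi> l = \<alpha> l" "\<And>t. t \<in> V \<Longrightarrow> norm (\<phi> t - 1) \<le> 1 / 4"
      using ext[of \<alpha>] \<alpha> by (auto simp: characters_mult characters_norm)
    let ?k = "char_add \<phi> (char_neg \<alpha>)"
    have "?k \<in> dual_lattice L"
      using char_add_characters[OF \<phi>(1) char_neg_characters[OF \<alpha>]] \<phi>(2) characters_cnj_mult[OF \<alpha>]
      by (simp add: dual_lattice_def) (simp add: char_add_def char_neg_def)
    moreover have "char_add \<alpha> ?k = \<phi>"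
      using char_add_neg_cancel(2)[OF \<alpha>, of \<phi>] by (simp add: char_add_commute[of \<alpha>])
    ultimately show "\<exists>\<kappa>\<in>dual_lattice L. char_add \<alpha> \<kappa> \<in> near_1 V"
      using \<phi> by (intro bexI[of _ ?k]) (auto simp: near_1_def)
  qed
qed

lemma emeasure_D_finite: "emeasure \<nu> D < \<infinity>"
proof -
  obtain V where V: "open V" "0 \<in> V" "\<And>\<alpha>. \<alpha> \<in> characters \<Longrightarrow> \<exists>\<kappa>\<in>dual_lattice L. char_add \<alpha> \<kappa> \<in> near_1 V"
    by (rule exists_near_1_cover) blast
  show ?thesis
  proof (rule DT.emeasure_tile_finite)
    show "near_1 V \<in> sets \<nu>" by (simp add: near_1_sets)
    show "emeasure \<nu> (near_1 V) < \<infinity>"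
      using dual_haar compactin_near_1[OF V(1,2)] by (auto simp: dual_haar_measure_def)
  qed (use V(3) in simp)
qed

sublocale MD: finite_measure MD
proof
  have "emeasure MD (space MD) = emeasure \<nu> (D \<inter> space \<nu>)"
    using DT.emeasure_MC[OF sets.top] by simp
  also have "\<dots> \<le> emeasure \<nu> D" by (rule emeasure_mono[OF _ DT.tile_sets]) auto
  finally show "emeasure MD (space MD) \<noteq> \<infinity>" using emeasure_D_finite by (auto simp: top_unique)
qed

sublocale N: sigma_finite_measure \<nu>
  by (rule DT.sigma_finite[OF emeasure_D_finite])

definition dvol :: real where "dvol = measure \<nu> D"

lemma dvol_pos: "dvol > 0"
proof -
  have "emeasure \<nu> (space \<nu>) \<noteq> 0" using dual_haar by (simp add: dual_haar_measure_def)
  from DT.emeasure_tile_pos[OF this] show ?thesis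
    using emeasure_D_finite by (simp add: dvol_def measure_def enn2real_positive_iff zero_less_iff_neq_zero)
qed

lemma measure_MD: "measure MD characters = dvol"
  using DT.emeasure_MC[of characters] sets.top[of \<nu>] sets.sets_into_space[OF DT.tile_sets]
  by (simp add: dvol_def measure_def Int_absorb2)

text \<open>Translating by a character whose value at \<open>l\<close> is not 1 multiplies the
  integral by that value and yet leaves it unchanged.\<close>

lemma orthogonality:
  assumes l: "l \<in> L" "l \<noteq> 0" shows "(\<integral>\<alpha>. \<alpha> l \<partial>MD) = 0"
proof -
  obtain \<eta> :: "'g \<Rightarrow> complex" where \<eta>: "\<And>x y. \<eta> (x + y) = \<eta> x * \<eta> y" "\<And>x. norm (\<eta> x) = 1" "\<eta> l \<noteq> 1"
    by (rule hom_separates[of "{0}" l]) (use l in auto)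
  obtain \<gamma> where \<gamma>: "\<gamma> \<in> characters" "\<And>l. l \<in> L \<Longrightarrow> \<gamma> l = \<eta> l"
    by (rule extend_character_on[OF \<eta>(1,2)]) blast
  have "(\<integral>\<alpha>. char_add \<alpha> \<gamma> l \<partial>MD) = (\<integral>\<alpha>. \<alpha> l \<partial>MD)"
  proof (rule DT.integral_tile_shift[where \<sigma>'="\<lambda>c. char_add c (char_neg \<gamma>)" and B = 1])
    show "(\<lambda>c. c l) \<in> borel_measurable \<nu>" by simp
    show "norm (\<alpha> l) \<le> 1" if "\<alpha> \<in> space \<nu>" for \<alpha> using that characters_norm[of \<alpha> l] by simp
    show "char_add x i l = x l" if "i \<in> dual_lattice L" for i x using that l by (simp add: dual_lattice_def char_add_def)
    show "char_add (char_add x i) (char_neg \<gamma>) = char_add (char_add x (char_neg \<gamma>)) i" for x i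
      by (simp add: char_add_def mult_ac)
  qed (use \<gamma> in \<open>auto intro: measurable_char_add_nu char_neg_characters distr_char_add char_add_neg_cancel emeasure_D_finite[unfolded infinity_ennreal_def]\<close>)
  then have "\<gamma> l * (\<integral>\<alpha>. \<alpha> l \<partial>MD) = (\<integral>\<alpha>. \<alpha> l \<partial>MD)" by (simp add: char_add_def mult.commute)
  then show ?thesis using \<gamma>(2)[OF l(1)] \<eta>(3) by auto
qed

lemma integrable_eval: "integrable MD (\<lambda>\<alpha>. \<alpha> x)"
  by (rule MD.integrable_const_bound[where B = 1]) (auto simp: characters_norm)

lemma parseval_finite:
  fixes a :: "'g \<Rightarrow> complex"
  assumes F: "finite F" "F \<subseteq> L"
  shows "(\<integral>\<^sup>+\<alpha>. ennreal ((norm (\<Sum>l\<in>F. a l * \<alpha> (- l)))\<^sup>2) \<partial>MD) = ennreal dvol * (\<Sum>l\<in>F. ennreal ((norm (a l))\<^sup>2))"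
proof -
  let ?S = "\<lambda>\<alpha>. \<Sum>l\<in>F. a l * \<alpha> (- l)"
  have sq: "complex_of_real ((norm (?S \<alpha>))\<^sup>2) = (\<Sum>l\<in>F. \<Sum>k\<in>F. a l * cnj (a k) * \<alpha> (k - l))" if "\<alpha> \<in> characters" for \<alpha>
  proof -
    have "complex_of_real ((norm (?S \<alpha>))\<^sup>2) = ?S \<alpha> * cnj (?S \<alpha>)" by (rule complex_norm_square)
    also have "\<dots> = (\<Sum>l\<in>F. \<Sum>k\<in>F. (a l * \<alpha> (- l)) * cnj (a k * \<alpha> (- k)))"
      by (simp only: cnj_sum sum_product)
    also have "\<dots> = (\<Sum>l\<in>F. \<Sum>k\<in>F. a l * cnj (a k) * \<alpha> (k - l))"
      using characters_mult[OF that, of _ "- _"] characters_uminus[OF that]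
      by (intro sum.cong refl) (simp add: mult_ac diff_conv_add_uminus del: add_uminus_conv_diff)
    finally show ?thesis .
  qed
  have int: "integrable MD (\<lambda>\<alpha>. \<Sum>l\<in>F. \<Sum>k\<in>F. a l * cnj (a k) * \<alpha> (k - l))"
    by (intro Bochner_Integration.integrable_sum integrable_mult_right integrable_eval)
  have sp: "AE \<alpha> in MD. \<alpha> \<in> characters" using AE_space[of MD] by simp
  have S_meas: "(\<lambda>\<alpha>. (norm (?S \<alpha>))\<^sup>2) \<in> borel_measurable MD" by measurable
  have int2: "integrable MD (\<lambda>\<alpha>. complex_of_real ((norm (?S \<alpha>))\<^sup>2))"
    by (rule Bochner_Integration.integrable_cong_AE_imp[OF int]) (use sp in \<open>auto simp: sq simp del: of_real_power elim!: eventually_mono\<close>)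
  have "complex_of_real (\<integral>\<alpha>. (norm (?S \<alpha>))\<^sup>2 \<partial>MD) = (\<integral>\<alpha>. complex_of_real ((norm (?S \<alpha>))\<^sup>2) \<partial>MD)"
    by (rule integral_complex_of_real[symmetric])
  also have "\<dots> = (\<integral>\<alpha>. (\<Sum>l\<in>F. \<Sum>k\<in>F. a l * cnj (a k) * \<alpha> (k - l)) \<partial>MD)"
    by (intro Bochner_Integration.integral_cong refl) (use sq in simp)
  also have "\<dots> = (\<Sum>l\<in>F. \<Sum>k\<in>F. a l * cnj (a k) * (\<integral>\<alpha>. \<alpha> (k - l) \<partial>MD))"
    by (simp add: integrable_eval Bochner_Integration.integral_sum)
  also have "\<dots> = (\<Sum>l\<in>F. \<Sum>k\<in>F. if k = l then a l * cnj (a k) * of_real dvol else 0)"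
  proof (intro sum.cong refl)
    fix l k assume lk: "l \<in> F" "k \<in> F"
    show "a l * cnj (a k) * (\<integral>\<alpha>. \<alpha> (k - l) \<partial>MD) = (if k = l then a l * cnj (a k) * of_real dvol else 0)"
    proof (cases "k = l")
      case True
      have "(\<integral>\<alpha>. \<alpha> 0 \<partial>MD) = (\<integral>\<alpha>. 1 \<partial>MD)"
        by (intro Bochner_Integration.integral_cong refl) (simp add: characters_0)
      then show ?thesis using True measure_MD by (simp add: scaleR_conv_of_real)
    next
      case False
      have "k - l \<in> L" using lk F Ldiff by blast
      then show ?thesis using False orthogonality[of "k - l"] by simp
    qed
  qed
  also have "\<dots> = (\<Sum>l\<in>F. a l * cnj (a l) * of_real dvol)" using F(1) by simp
  also have "\<dots> = complex_of_real (dvol * (\<Sum>l\<in>F. (norm (a l))\<^sup>2))"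
    by (simp only: complex_norm_square[symmetric] of_real_mult[symmetric] of_real_sum[symmetric] sum_distrib_left mult.commute)
  finally have eq: "(\<integral>\<alpha>. (norm (?S \<alpha>))\<^sup>2 \<partial>MD) = dvol * (\<Sum>l\<in>F. (norm (a l))\<^sup>2)" by (simp only: of_real_eq_iff)
  have "integrable MD (\<lambda>\<alpha>. (norm (?S \<alpha>))\<^sup>2)"
    using int2 by (simp only: complex_of_real_integrable_eq)
  then have "(\<integral>\<^sup>+\<alpha>. ennreal ((norm (?S \<alpha>))\<^sup>2) \<partial>MD) = ennreal (\<integral>\<alpha>. (norm (?S \<alpha>))\<^sup>2 \<partial>MD)"
    by (intro nn_integral_eq_integral) auto
  also have "\<dots> = ennreal dvol * (\<Sum>l\<in>F. ennreal ((norm (a l))\<^sup>2))"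
    using dvol_pos by (simp add: eq ennreal_mult' sum_nonneg sum_ennreal)
  finally show ?thesis .
qed

text \<open>Exhaust \<open>L\<close> by finite sets. On the left the absolute sum dominates all
  partial sums on a finite measure; on the right the squares increase monotonically.\<close>

lemma parseval:
  fixes a :: "'g \<Rightarrow> complex"
  assumes a: "integrable (count_space L) a"
  shows "(\<integral>\<^sup>+\<alpha>. ennreal ((norm (\<integral>l. a l * \<alpha> (- l) \<partial>count_space L))\<^sup>2) \<partial>MD)
       = ennreal dvol * (\<integral>\<^sup>+l. ennreal ((norm (a l))\<^sup>2) \<partial>count_space L)"
proof -
  define F where "F n = from_nat_into L ` {..n}" for n
  have Lne: "L \<noteq> {}" using L0 by blast
  have F: "finite (F n)" "F n \<subseteq> L" for n using from_nat_into[OF Lne] by (auto simp: F_def)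
  have Fmono: "F m \<subseteq> F n" if "m \<le> n" for m n using that by (auto simp: F_def)
  have Fev: "eventually (\<lambda>n. l \<in> F n) sequentially" if l: "l \<in> L" for l
  proof -
    obtain k where k: "from_nat_into L k = l" using from_nat_into_surj[OF Lcountable l] by blast
    have "l \<in> F n" if "n \<ge> k" for n using k that by (auto simp: F_def)
    then show ?thesis unfolding eventually_sequentially by blast
  qed
  have ind: "(\<lambda>n. indicator (F n) l * c) \<longlonglongrightarrow> (c::'z::{real_normed_algebra_1})" if "l \<in> L" for l c
    by (rule tendsto_eventually) (use Fev[OF that] in \<open>auto elim!: eventually_mono\<close>)
  let ?S = "\<lambda>n \<alpha>. \<Sum>l\<in>F n. a l * \<alpha> (- l)"
  let ?S' = "\<lambda>\<alpha>. \<integral>l. a l * \<alpha> (- l) \<partial>count_space L"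
  let ?A = "\<integral>l. norm (a l) \<partial>count_space L"
  have Sint: "?S n \<alpha> = (\<integral>l. indicator (F n) l * (a l * \<alpha> (- l)) \<partial>count_space L)" for n \<alpha>
  proof -
    have "(\<integral>l. indicator (F n) l * (a l * \<alpha> (- l)) \<partial>count_space L)
      = (\<Sum>l | l \<in> L \<and> indicator (F n) l * (a l * \<alpha> (- l)) \<noteq> 0. indicator (F n) l * (a l * \<alpha> (- l)))"
      by (rule lebesgue_integral_count_space_finite_support) (rule finite_subset[OF _ F(1)[of n]], auto simp: indicator_def split: if_splits)
    also have "\<dots> = (\<Sum>l\<in>F n. indicator (F n) l * (a l * \<alpha> (- l)))"
      by (rule sum.mono_neutral_left) (use F in \<open>auto simp: indicator_def split: if_splits\<close>)
    finally show ?thesis by (simp add: indicator_def)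
  qed
  have bd: "norm (indicator (F n) l * (a l * \<alpha> (- l))) \<le> norm (a l)" if "\<alpha> \<in> characters" for n l \<alpha>
    using characters_norm[OF that] by (simp add: norm_mult indicator_def)
  have Slim: "(\<lambda>n. ?S n \<alpha>) \<longlonglongrightarrow> ?S' \<alpha>" if \<alpha>: "\<alpha> \<in> characters" for \<alpha>
    unfolding Sint
    by (rule integral_dominated_convergence[where w="\<lambda>l. norm (a l)"]) (use a ind bd[OF \<alpha>] in \<open>auto intro!: AE_I2\<close>)
  have Sbd: "norm (?S n \<alpha>) \<le> ?A" if \<alpha>: "\<alpha> \<in> characters" for n \<alpha>
    unfolding Sint by (rule order_trans[OF integral_norm_bound integral_mono])
      (use a bd[OF \<alpha>] in \<open>auto intro!: Bochner_Integration.integrable_bound[OF a]\<close>)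
  have "(\<lambda>n. \<integral>\<^sup>+\<alpha>. ennreal ((norm (?S n \<alpha>))\<^sup>2) \<partial>MD) \<longlonglongrightarrow> (\<integral>\<^sup>+\<alpha>. ennreal ((norm (?S' \<alpha>))\<^sup>2) \<partial>MD)"
  proof (rule nn_integral_dominated_convergence[where w="\<lambda>_. ennreal (?A\<^sup>2)"])
    show m: "(\<lambda>\<alpha>. ennreal ((norm (?S n \<alpha>))\<^sup>2)) \<in> borel_measurable MD" for n by measurable
    have "?S' \<in> borel_measurable MD"
      by (rule borel_measurable_LIMSEQ_metric[where f="?S"]) (use Slim in auto)
    then show "(\<lambda>\<alpha>. ennreal ((norm (?S' \<alpha>))\<^sup>2)) \<in> borel_measurable MD" by measurable
    show "AE \<alpha> in MD. ennreal ((norm (?S n \<alpha>))\<^sup>2) \<le> ennreal (?A\<^sup>2)" for n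
      using Sbd by (intro AE_I2 ennreal_leI power_mono) auto
    show "(\<integral>\<^sup>+\<alpha>. ennreal (?A\<^sup>2) \<partial>MD) < \<infinity>"
      using MD.emeasure_finite[of "space MD"] by (auto simp: ennreal_mult_eq_top_iff less_top[symmetric])
    show "AE \<alpha> in MD. (\<lambda>n. ennreal ((norm (?S n \<alpha>))\<^sup>2)) \<longlonglongrightarrow> ennreal ((norm (?S' \<alpha>))\<^sup>2)"
      using Slim by (intro AE_I2 tendsto_ennrealI tendsto_power tendsto_norm) simp
  qed simp
  moreover have "(\<lambda>n. \<integral>\<^sup>+\<alpha>. ennreal ((norm (?S n \<alpha>))\<^sup>2) \<partial>MD) \<longlonglongrightarrow> ennreal dvol * (\<integral>\<^sup>+l. ennreal ((norm (a l))\<^sup>2) \<partial>count_space L)"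
  proof -
    have "(\<lambda>n. \<integral>\<^sup>+l. indicator (F n) l * ennreal ((norm (a l))\<^sup>2) \<partial>count_space L) \<longlonglongrightarrow> (\<integral>\<^sup>+l. indicator L l * ennreal ((norm (a l))\<^sup>2) \<partial>count_space L)"
    proof (rule nn_integral_LIMSEQ)
      show "incseq (\<lambda>n l. indicator (F n) l * ennreal ((norm (a l))\<^sup>2))"
      proof (rule incseq_SucI, rule le_funI)
        fix n l
        have "F n \<subseteq> F (Suc n)" by (rule Fmono) simp
        then show "indicator (F n) l * ennreal ((norm (a l))\<^sup>2) \<le> indicator (F (Suc n)) l * ennreal ((norm (a l))\<^sup>2)"
          by (intro mult_right_mono) (auto split: split_indicator)
      qed
      show "(\<lambda>n. indicator (F n) l * ennreal ((norm (a l))\<^sup>2)) \<longlonglongrightarrow> indicator L l * ennreal ((norm (a l))\<^sup>2)" for l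
      proof (cases "l \<in> L")
        case True
        then show ?thesis by (intro tendsto_eventually) (use Fev[of l] in \<open>auto elim!: eventually_mono\<close>)
      next
        case False
        then have "l \<notin> F n" for n using F(2) by blast
        then show ?thesis using False by simp
      qed
    qed simp
    moreover have "(\<integral>\<^sup>+l. indicator L l * ennreal ((norm (a l))\<^sup>2) \<partial>count_space L) = (\<integral>\<^sup>+l. ennreal ((norm (a l))\<^sup>2) \<partial>count_space L)"
      by (intro nn_integral_cong) simp
    moreover have "(\<integral>\<^sup>+l. indicator (F n) l * ennreal ((norm (a l))\<^sup>2) \<partial>count_space L) = (\<Sum>l\<in>F n. ennreal ((norm (a l))\<^sup>2))" for n
      using F by (subst nn_integral_count_space'[where A="F n"]) auto
    ultimately have "(\<lambda>n. \<Sum>l\<in>F n. ennreal ((norm (a l))\<^sup>2)) \<longlonglongrightarrow> (\<integral>\<^sup>+l. ennreal ((norm (a l))\<^sup>2) \<partial>count_space L)" by simp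
    then have "(\<lambda>n. ennreal dvol * (\<Sum>l\<in>F n. ennreal ((norm (a l))\<^sup>2))) \<longlonglongrightarrow> ennreal dvol * (\<integral>\<^sup>+l. ennreal ((norm (a l))\<^sup>2) \<partial>count_space L)"
      by (intro ennreal_tendsto_cmult) auto
    then show ?thesis by (simp only: parseval_finite[OF F])
  qed
  ultimately show ?thesis by (rule LIMSEQ_unique)
qed

end

section \<open>Density of function algebras\<close>

lemma norm_add_square_le: "(norm (a + b))\<^sup>2 \<le> 2 * (norm a)\<^sup>2 + 2 * (norm (b::complex))\<^sup>2"
proof -
  have "(norm (a + b))\<^sup>2 \<le> (norm a + norm b)\<^sup>2" by (intro power_mono norm_triangle_ineq) auto
  also have "\<dots> \<le> 2 * (norm a)\<^sup>2 + 2 * (norm b)\<^sup>2"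
    using sum_squares_bound[of "norm a" "norm b"] by (simp add: power2_sum)
  finally show ?thesis .
qed

text \<open>A weighted form of 2xy \<le> d x^2 + y^2 / d. Fixing a small \<open>d\<close> before the
  distance is made small yields convergence of norms by integrating a pointwise estimate.\<close>

lemma norm_square_diff_le:
  assumes "d > 0"
  shows "\<bar>(norm (a::complex))\<^sup>2 - (norm b)\<^sup>2\<bar> \<le> d * (norm b)\<^sup>2 + (1 + 1 / d) * (norm (a - b))\<^sup>2"
proof -
  define x y where "x = norm b" and "y = norm (a - b)"
  have xy: "x \<ge> 0" "y \<ge> 0" by (auto simp: x_def y_def)
  have le: "2 * x * y \<le> d * x\<^sup>2 + y\<^sup>2 / d"
  proof -
    have "0 \<le> (d * x - y)\<^sup>2 / d" using assms by simp
    also have "\<dots> = d * x\<^sup>2 + y\<^sup>2 / d - 2 * x * y" using assms by (simp add: power2_eq_square field_simps)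
    finally show ?thesis by simp
  qed
  have a1: "norm a \<le> x + y" using norm_triangle_ineq[of b "a - b"] by (simp add: x_def y_def)
  have a2: "x - y \<le> norm a" using norm_triangle_ineq2[of b "b - a"] by (simp add: x_def y_def norm_minus_commute)
  have up: "(norm a)\<^sup>2 \<le> x\<^sup>2 + 2 * x * y + y\<^sup>2" using power_mono[OF a1, of 2] by (simp add: power2_sum)
  have lo: "x\<^sup>2 - 2 * x * y \<le> (norm a)\<^sup>2"
  proof (cases "x \<ge> y")
    case True
    then have "(x - y)\<^sup>2 \<le> (norm a)\<^sup>2" using a2 by (intro power_mono) auto
    then show ?thesis using zero_le_power2[of y] unfolding power2_diff by linarith
  next
    case False
    then have "x * x \<le> x * y" using xy by (intro mult_left_mono) auto
    then have "x\<^sup>2 - 2 * x * y \<le> 0" using mult_nonneg_nonneg[OF xy] unfolding power2_eq_square by linarith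
    then show ?thesis using zero_le_power2[of "norm a"] by linarith
  qed
  have "\<bar>(norm a)\<^sup>2 - x\<^sup>2\<bar> \<le> 2 * x * y + y\<^sup>2" 
    using up lo zero_le_power2[of y] unfolding abs_le_iff by linarith
  also have "\<dots> \<le> d * x\<^sup>2 + (1 + 1 / d) * y\<^sup>2" using le by (simp add: algebra_simps)
  finally show ?thesis by (simp add: x_def y_def)
qed

lemma nn_L2_finite:
  assumes [measurable]: "X \<in> borel_measurable M" "Y \<in> borel_measurable M"
    and fin: "(\<integral>\<^sup>+x. ennreal ((norm (Y x :: complex))\<^sup>2) \<partial>M) < \<infinity>" "(\<integral>\<^sup>+x. ennreal ((norm (X x - Y x))\<^sup>2) \<partial>M) < \<infinity>"
  shows "(\<integral>\<^sup>+x. ennreal ((norm (X x))\<^sup>2) \<partial>M) < \<infinity>"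
proof -
  have "(\<integral>\<^sup>+x. ennreal ((norm (X x))\<^sup>2) \<partial>M) \<le> (\<integral>\<^sup>+x. 2 * ennreal ((norm (Y x))\<^sup>2) + 2 * ennreal ((norm (X x - Y x))\<^sup>2) \<partial>M)"
  proof (rule nn_integral_mono)
    fix x
    have "ennreal ((norm (X x))\<^sup>2) \<le> ennreal (2 * (norm (Y x))\<^sup>2 + 2 * (norm (X x - Y x))\<^sup>2)"
      using norm_add_square_le[of "Y x" "X x - Y x"] by (intro ennreal_leI) simp
    then show "ennreal ((norm (X x))\<^sup>2) \<le> 2 * ennreal ((norm (Y x))\<^sup>2) + 2 * ennreal ((norm (X x - Y x))\<^sup>2)"
      by (simp add: ennreal_plus ennreal_mult')
  qed
  also have "\<dots> = 2 * (\<integral>\<^sup>+x. ennreal ((norm (Y x))\<^sup>2) \<partial>M) + 2 * (\<integral>\<^sup>+x. ennreal ((norm (X x - Y x))\<^sup>2) \<partial>M)"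
    by (simp add: nn_integral_add nn_integral_cmult)
  also have "\<dots> < \<infinity>" using fin by (auto simp: ennreal_mult_less_top)
  finally show ?thesis .
qed

lemma nn_L2_tendsto:
  fixes X :: "nat \<Rightarrow> 'a \<Rightarrow> complex"
  assumes [measurable]: "\<And>n. X n \<in> borel_measurable M" "Y \<in> borel_measurable M"
    and fin: "(\<integral>\<^sup>+x. ennreal ((norm (Y x))\<^sup>2) \<partial>M) < \<infinity>"
    and lim: "(\<lambda>n. \<integral>\<^sup>+x. ennreal ((norm (X n x - Y x))\<^sup>2) \<partial>M) \<longlonglongrightarrow> 0"
  shows "(\<lambda>n. \<integral>\<^sup>+x. ennreal ((norm (X n x))\<^sup>2) \<partial>M) \<longlonglongrightarrow> (\<integral>\<^sup>+x. ennreal ((norm (Y x))\<^sup>2) \<partial>M)"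
proof -
  define e where "e n = (\<integral>\<^sup>+x. ennreal ((norm (X n x - Y x))\<^sup>2) \<partial>M)" for n
  have "eventually (\<lambda>n. e n < 1) sequentially" using lim unfolding e_def by (rule order_tendstoD) simp
  then obtain N where N: "\<And>n. n \<ge> N \<Longrightarrow> e n < 1" by (auto simp: eventually_sequentially)
  have iY: "integrable M (\<lambda>x. (norm (Y x))\<^sup>2)" using fin by (intro integrableI_bounded) auto
  have iE: "integrable M (\<lambda>x. (norm (X (n + N) x - Y x))\<^sup>2)" for n
    using order.strict_trans[OF N[of "n + N"], of \<infinity>] by (intro integrableI_bounded) (auto simp: e_def)
  have iX: "integrable M (\<lambda>x. (norm (X (n + N) x))\<^sup>2)" for n
    using nn_L2_finite[of "X (n + N)" M Y] fin order.strict_trans[OF N[of "n + N"], of \<infinity>]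
    by (intro integrableI_bounded) (auto simp: e_def)
  define E where "E n = (\<integral>x. (norm (X (n + N) x - Y x))\<^sup>2 \<partial>M)" for n
  have Ee: "E n = enn2real (e (n + N))" for n
    unfolding E_def e_def by (rule integral_eq_nn_integral) auto
  have "(\<lambda>n. enn2real (e (n + N))) \<longlonglongrightarrow> enn2real 0"
    using LIMSEQ_ignore_initial_segment[OF lim, of N] by (intro tendsto_enn2real) (auto simp: e_def)
  then have E0: "E \<longlonglongrightarrow> 0" by (simp add: Ee[abs_def])
  define A where "A = (\<integral>x. (norm (Y x))\<^sup>2 \<partial>M)"
  have A: "A \<ge> 0" by (simp add: A_def)
  have "(\<lambda>n. \<integral>x. (norm (X (n + N) x))\<^sup>2 \<partial>M) \<longlonglongrightarrow> A"
  proof (rule LIMSEQ_I)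
    fix r :: real assume r: "r > 0"
    \<comment> \<open>The first error term is then below r / 2, the added 1 covering the case A = 0;
      the constant \<open>c\<close> is chosen so that the second is below r / 2 as well.\<close>
    define d where "d = r / (2 * (A + 1))"
    have d: "d > 0" "d * A < r / 2" using r A by (auto simp: d_def field_simps)
    define c where "c = r / (2 * (1 + 1 / d))"
    have k: "k * (r / (2 * k)) = r / 2" "r / (2 * k) > 0" if "k > 0" for k using that r by auto
    have "1 + 1 / d > 0" using d(1) by (simp add: add_pos_pos)
    from k[OF this] have c: "c > 0" "(1 + 1 / d) * c = r / 2" by (simp_all only: c_def)
    obtain m where m: "\<And>n. n \<ge> m \<Longrightarrow> E n < c"
      using order_tendstoD(2)[OF E0 c(1)] by (auto simp: eventually_sequentially)
    have "norm ((\<integral>x. (norm (X (n + N) x))\<^sup>2 \<partial>M) - A) < r" if n: "n \<ge> m" for n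
    proof -
      have "norm ((\<integral>x. (norm (X (n + N) x))\<^sup>2 \<partial>M) - A) = norm (\<integral>x. (norm (X (n + N) x))\<^sup>2 - (norm (Y x))\<^sup>2 \<partial>M)"
        using iX iY by (simp add: A_def)
      also have "\<dots> \<le> (\<integral>x. norm ((norm (X (n + N) x))\<^sup>2 - (norm (Y x))\<^sup>2) \<partial>M)" by (rule integral_norm_bound)
      also have "\<dots> \<le> (\<integral>x. d * (norm (Y x))\<^sup>2 + (1 + 1 / d) * (norm (X (n + N) x - Y x))\<^sup>2 \<partial>M)"
        by (rule integral_mono) (use iX iY iE norm_square_diff_le[OF d(1)] in auto)
      also have "\<dots> = d * A + (1 + 1 / d) * E n" using iY iE by (simp add: A_def E_def)
      also have "\<dots> < r / 2 + (1 + 1 / d) * c"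
        using d m[OF n] by (intro add_strict_mono mult_strict_left_mono) (auto intro: add_pos_pos)
      finally show ?thesis using c by simp
    qed
    then show "\<exists>no. \<forall>n\<ge>no. norm ((\<integral>x. (norm (X (n + N) x))\<^sup>2 \<partial>M) - A) < r" by blast
  qed
  then have "(\<lambda>n. ennreal (\<integral>x. (norm (X (n + N) x))\<^sup>2 \<partial>M)) \<longlonglongrightarrow> ennreal A" by (rule tendsto_ennrealI)
  then have "(\<lambda>n. \<integral>\<^sup>+x. ennreal ((norm (X (n + N) x))\<^sup>2) \<partial>M) \<longlonglongrightarrow> (\<integral>\<^sup>+x. ennreal ((norm (Y x))\<^sup>2) \<partial>M)"
    using iX iY by (simp add: A_def nn_integral_eq_integral)
  then show ?thesis by (rule LIMSEQ_offset)
qed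

text \<open>Setting for a measure-theoretic Stone-Weierstrass theorem: an algebra of bounded
  functions closed under conjugation approximates, in L2 of a finite measure, the indicator of every
  set in the sigma-algebra it generates.\<close>

locale function_algebra = finite_measure M for M :: "'a measure" +
  fixes T :: "('a \<Rightarrow> complex) set"
  assumes T_meas: "t \<in> T \<Longrightarrow> t \<in> borel_measurable M"
    and T_bound: "t \<in> T \<Longrightarrow> \<exists>B. \<forall>x\<in>space M. norm (t x) \<le> B"
    and T_const: "(\<lambda>x. c) \<in> T"
    and T_add: "s \<in> T \<Longrightarrow> t \<in> T \<Longrightarrow> (\<lambda>x. s x + t x) \<in> T"
    and T_mult: "s \<in> T \<Longrightarrow> t \<in> T \<Longrightarrow> (\<lambda>x. s x * t x) \<in> T"
    and T_cnj: "t \<in> T \<Longrightarrow> (\<lambda>x. cnj (t x)) \<in> T"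
begin

definition bounded_fun :: "('a \<Rightarrow> complex) \<Rightarrow> bool" where
  "bounded_fun f \<longleftrightarrow> f \<in> borel_measurable M \<and> (\<exists>B. \<forall>x\<in>space M. norm (f x) \<le> B)"

definition dist2 :: "('a \<Rightarrow> complex) \<Rightarrow> ('a \<Rightarrow> complex) \<Rightarrow> real" where
  "dist2 f g = (\<integral>x. (norm (f x - g x))\<^sup>2 \<partial>M)"

text \<open>Membership in the L2-closure of \<open>T\<close>. Boundedness belongs to the notion
  because products are controlled through bounds on the factors.\<close>

definition approx :: "('a \<Rightarrow> complex) \<Rightarrow> bool" where
  "approx f \<longleftrightarrow> bounded_fun f \<and> (\<forall>e>0. \<exists>t\<in>T. dist2 f t < e)"

lemma bounded_fun_T: "t \<in> T \<Longrightarrow> bounded_fun t" using T_meas T_bound by (simp add: bounded_fun_def)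

lemma bounded_fun_bound: "bounded_fun f \<Longrightarrow> \<exists>B\<ge>0. \<forall>x\<in>space M. norm (f x) \<le> B"
  unfolding bounded_fun_def by (meson abs_ge_zero abs_ge_self order_trans)

lemma bounded_fun_add: "bounded_fun f \<Longrightarrow> bounded_fun g \<Longrightarrow> bounded_fun (\<lambda>x. f x + g x)"
proof -
  assume f: "bounded_fun f" and g: "bounded_fun g"
  obtain A B where AB: "\<And>x. x \<in> space M \<Longrightarrow> norm (f x) \<le> A" "\<And>x. x \<in> space M \<Longrightarrow> norm (g x) \<le> B"
    using f g unfolding bounded_fun_def by blast
  have "norm (f x + g x) \<le> A + B" if "x \<in> space M" for x using that by (intro norm_triangle_mono AB)
  then show ?thesis using f g unfolding bounded_fun_def by auto
qed

lemma bounded_fun_mult: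
  assumes f: "bounded_fun f" and g: "bounded_fun g" shows "bounded_fun (\<lambda>x. f x * g x)"
proof -
  obtain A B where AB: "A \<ge> 0" "B \<ge> 0" "\<And>x. x \<in> space M \<Longrightarrow> norm (f x) \<le> A" "\<And>x. x \<in> space M \<Longrightarrow> norm (g x) \<le> B"
    using bounded_fun_bound[OF f] bounded_fun_bound[OF g] by blast
  have "norm (f x * g x) \<le> A * B" if "x \<in> space M" for x unfolding norm_mult using that by (intro mult_mono AB) auto
  then show ?thesis using f g unfolding bounded_fun_def by auto
qed

lemma bounded_fun_const: "bounded_fun (\<lambda>x. c)" by (auto simp: bounded_fun_def)

lemma bounded_fun_diff: "bounded_fun f \<Longrightarrow> bounded_fun g \<Longrightarrow> bounded_fun (\<lambda>x. f x - g x)"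
  using bounded_fun_add[of f "\<lambda>x. - 1 * g x"] bounded_fun_mult[OF bounded_fun_const, of g "- 1"] by simp

lemma dist2_integrable:
  assumes "bounded_fun f" "bounded_fun g" shows "integrable M (\<lambda>x. (norm (f x - g x))\<^sup>2)"
proof -
  have d: "bounded_fun (\<lambda>x. f x - g x)" by (rule bounded_fun_diff[OF assms])
  then obtain B where "\<And>x. x \<in> space M \<Longrightarrow> norm (f x - g x) \<le> B" unfolding bounded_fun_def by blast
  then show ?thesis using d unfolding bounded_fun_def
    by (intro integrable_const_bound[where B="B\<^sup>2"]) (auto intro!: AE_I2 power_mono)
qed

lemma approx_bounded: "approx f \<Longrightarrow> bounded_fun f" by (simp add: approx_def)

lemma approx_T: "t \<in> T \<Longrightarrow> approx t"
  using bounded_fun_T by (auto simp: approx_def dist2_def intro!: bexI[of _ t])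

lemma approx_add:
  assumes f: "approx f" and g: "approx g" shows "approx (\<lambda>x. f x + g x)"
  unfolding approx_def
proof (intro conjI allI impI)
  show "bounded_fun (\<lambda>x. f x + g x)" by (intro bounded_fun_add approx_bounded f g)
  fix e :: real assume "e > 0"
  then obtain s t where st: "s \<in> T" "dist2 f s < e / 4" "t \<in> T" "dist2 g t < e / 4"
    using f g unfolding approx_def by (meson divide_pos_pos zero_less_numeral)
  have i: "integrable M (\<lambda>x. (norm (f x - s x))\<^sup>2)" "integrable M (\<lambda>x. (norm (g x - t x))\<^sup>2)"
    by (intro dist2_integrable approx_bounded f g bounded_fun_T st)+
  have "dist2 (\<lambda>x. f x + g x) (\<lambda>x. s x + t x) \<le> (\<integral>x. 2 * (norm (f x - s x))\<^sup>2 + 2 * (norm (g x - t x))\<^sup>2 \<partial>M)"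
    unfolding dist2_def
  proof (rule integral_mono)
    show "integrable M (\<lambda>x. (norm (f x + g x - (s x + t x)))\<^sup>2)"
      by (intro dist2_integrable bounded_fun_add approx_bounded f g bounded_fun_T st)
    show "(norm (f x + g x - (s x + t x)))\<^sup>2 \<le> 2 * (norm (f x - s x))\<^sup>2 + 2 * (norm (g x - t x))\<^sup>2" for x
      using norm_add_square_le[of "f x - s x" "g x - t x"] by (simp add: algebra_simps)
  qed (use i in auto)
  also have "\<dots> = 2 * dist2 f s + 2 * dist2 g t" using i by (simp add: dist2_def)
  also have "\<dots> < e" using st by simp
  finally show "\<exists>t\<in>T. dist2 (\<lambda>x. f x + g x) t < e" using T_add st by blast
qed

lemma approx_mult:
  assumes f: "approx f" and g: "approx g" shows "approx (\<lambda>x. f x * g x)"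
  unfolding approx_def
proof (intro conjI allI impI)
  show "bounded_fun (\<lambda>x. f x * g x)" by (intro bounded_fun_mult approx_bounded f g)
  fix e :: real assume e: "e > 0"
  obtain A where A: "A \<ge> 0" "\<And>x. x \<in> space M \<Longrightarrow> norm (f x) \<le> A" using bounded_fun_bound[OF approx_bounded[OF f]] by blast
  have pA: "A\<^sup>2 + 1 > 0" by (simp add: add_nonneg_pos)
  have "e / (4 * (A\<^sup>2 + 1)) > 0" using e pA by simp
  \<comment> \<open>The order matters: \<open>g\<close> is approximated first, relative to the bound
    of \<open>f\<close>; only then is the bound \<open>S\<close> of \<open>s\<close> known, relative
    to which \<open>f\<close> is approximated.\<close>
  then obtain s where s: "s \<in> T" "dist2 g s < e / (4 * (A\<^sup>2 + 1))" using g unfolding approx_def by blast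
  obtain S where S: "S \<ge> 0" "\<And>x. x \<in> space M \<Longrightarrow> norm (s x) \<le> S" using bounded_fun_bound[OF bounded_fun_T[OF s(1)]] by blast
  have pS: "S\<^sup>2 + 1 > 0" by (simp add: add_nonneg_pos)
  have "e / (4 * (S\<^sup>2 + 1)) > 0" using e pS by simp
  then obtain t where t: "t \<in> T" "dist2 f t < e / (4 * (S\<^sup>2 + 1))" using f unfolding approx_def by blast
  have i: "integrable M (\<lambda>x. (norm (g x - s x))\<^sup>2)" "integrable M (\<lambda>x. (norm (f x - t x))\<^sup>2)"
    by (intro dist2_integrable approx_bounded f g bounded_fun_T s t)+
  have "dist2 (\<lambda>x. f x * g x) (\<lambda>x. t x * s x) \<le> (\<integral>x. 2 * A\<^sup>2 * (norm (g x - s x))\<^sup>2 + 2 * S\<^sup>2 * (norm (f x - t x))\<^sup>2 \<partial>M)"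
    unfolding dist2_def
  proof (rule integral_mono)
    show "integrable M (\<lambda>x. (norm (f x * g x - t x * s x))\<^sup>2)"
      by (intro dist2_integrable bounded_fun_mult approx_bounded f g bounded_fun_T s t)
    fix x assume x: "x \<in> space M"
    have "(norm (f x * g x - t x * s x))\<^sup>2 = (norm (f x * (g x - s x) + s x * (f x - t x)))\<^sup>2"
      by (simp add: algebra_simps)
    also have "\<dots> \<le> 2 * (norm (f x * (g x - s x)))\<^sup>2 + 2 * (norm (s x * (f x - t x)))\<^sup>2" by (rule norm_add_square_le)
    also have "\<dots> \<le> 2 * A\<^sup>2 * (norm (g x - s x))\<^sup>2 + 2 * S\<^sup>2 * (norm (f x - t x))\<^sup>2"
      using A(2)[OF x] S(2)[OF x] by (auto simp: norm_mult power_mult_distrib intro!: add_mono mult_right_mono power_mono)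
    finally show "(norm (f x * g x - t x * s x))\<^sup>2 \<le> 2 * A\<^sup>2 * (norm (g x - s x))\<^sup>2 + 2 * S\<^sup>2 * (norm (f x - t x))\<^sup>2" .
  qed (use i in auto)
  also have "\<dots> = 2 * A\<^sup>2 * dist2 g s + 2 * S\<^sup>2 * dist2 f t" using i by (simp add: dist2_def)
  also have "\<dots> \<le> 2 * A\<^sup>2 * (e / (4 * (A\<^sup>2 + 1))) + 2 * S\<^sup>2 * (e / (4 * (S\<^sup>2 + 1)))"
    using s t by (intro add_mono mult_left_mono) auto
  also have "\<dots> < e / 2 + e / 2"
    using e pA pS by (intro add_strict_mono) (simp_all add: field_simps)
  finally show "\<exists>t\<in>T. dist2 (\<lambda>x. f x * g x) t < e" using T_mult s t by (auto intro!: bexI[of _ "\<lambda>x. t x * s x"])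
qed

lemma approx_limit:
  assumes f: "\<And>n::nat. approx (f n)" and bd: "\<And>n x. x \<in> space M \<Longrightarrow> norm (f n x) \<le> B"
    and lim: "\<And>x. x \<in> space M \<Longrightarrow> (\<lambda>n. f n x) \<longlonglongrightarrow> g x"
  shows "approx g"
proof -
  have fm: "f n \<in> borel_measurable M" for n using approx_bounded[OF f] by (simp add: bounded_fun_def)
  have gm: "g \<in> borel_measurable M" by (rule borel_measurable_LIMSEQ_metric[where f=f]) (use lim fm in auto)
  have gb: "norm (g x) \<le> B" if "x \<in> space M" for x
    by (rule Lim_bounded[OF tendsto_norm[OF lim[OF that]]]) (use bd that in auto)
  have bg: "bounded_fun g" using gm gb by (auto simp: bounded_fun_def)
  have "(\<lambda>n. dist2 g (f n)) \<longlonglongrightarrow> (\<integral>x. 0 \<partial>M)"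
    unfolding dist2_def
  proof (rule integral_dominated_convergence[where w="\<lambda>_. (2 * B)\<^sup>2"])
    show "AE x in M. (\<lambda>n. (norm (g x - f n x))\<^sup>2) \<longlonglongrightarrow> 0"
    proof (rule AE_I2)
      fix x assume "x \<in> space M"
      then have "(\<lambda>n. (norm (g x - f n x))\<^sup>2) \<longlonglongrightarrow> (norm (g x - g x))\<^sup>2" by (intro tendsto_intros lim)
      then show "(\<lambda>n. (norm (g x - f n x))\<^sup>2) \<longlonglongrightarrow> 0" by simp
    qed
    show "AE x in M. norm ((norm (g x - f n x))\<^sup>2) \<le> (2 * B)\<^sup>2" for n
    proof (rule AE_I2)
      fix x assume x: "x \<in> space M"
      have "norm (g x - f n x) \<le> 2 * B" using norm_triangle_ineq4[of "g x" "f n x"] gb[OF x] bd[OF x, of n] by linarith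
      then have "(norm (g x - f n x))\<^sup>2 \<le> (2 * B)\<^sup>2" by (intro power_mono) auto
      then show "norm ((norm (g x - f n x))\<^sup>2) \<le> (2 * B)\<^sup>2" by (simp only: real_norm_def abs_power2)
    qed
  qed (use fm gm in auto)
  then have lim0: "(\<lambda>n. dist2 g (f n)) \<longlonglongrightarrow> 0" by simp
  show ?thesis
    unfolding approx_def
  proof (intro conjI allI impI bg)
    fix e :: real assume e: "e > 0"
    obtain n where n: "dist2 g (f n) < e / 4"
      using order_tendstoD(2)[OF lim0, of "e / 4"] e by (auto simp: eventually_sequentially)
    obtain t where t: "t \<in> T" "dist2 (f n) t < e / 4" using f[of n] e unfolding approx_def by (meson divide_pos_pos zero_less_numeral)
    have i: "integrable M (\<lambda>x. (norm (g x - f n x))\<^sup>2)" "integrable M (\<lambda>x. (norm (f n x - t x))\<^sup>2)"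
      by (intro dist2_integrable bg approx_bounded f bounded_fun_T t)+
    have "dist2 g t \<le> (\<integral>x. 2 * (norm (g x - f n x))\<^sup>2 + 2 * (norm (f n x - t x))\<^sup>2 \<partial>M)"
      unfolding dist2_def
    proof (rule integral_mono)
      show "integrable M (\<lambda>x. (norm (g x - t x))\<^sup>2)" by (intro dist2_integrable bg bounded_fun_T t)
      show "(norm (g x - t x))\<^sup>2 \<le> 2 * (norm (g x - f n x))\<^sup>2 + 2 * (norm (f n x - t x))\<^sup>2" for x
        using norm_add_square_le[of "g x - f n x" "f n x - t x"] by simp
    qed (use i in auto)
    also have "\<dots> = 2 * dist2 g (f n) + 2 * dist2 (f n) t" using i by (simp add: dist2_def)
    also have "\<dots> < e" using n t by simp
    finally show "\<exists>t\<in>T. dist2 g t < e" using t by blast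
  qed
qed

text \<open>This family is a sigma-algebra for which all members of \<open>T\<close> are measurable.
  Approximability of a set can therefore be proved by showing that a function is measurable for
  \<open>approx_space\<close>.\<close>

definition approx_sets :: "'a set set" where
  "approx_sets = {A \<in> sets M. approx (\<lambda>x. indicator A x)}"

text \<open>Sums and products of indicators give the finite Boolean operations, and bounded
  pointwise limits give countable unions.\<close>

lemma approx_sets_sigma: "sigma_algebra (space M) approx_sets"
proof -
  have compl: "space M - A \<in> approx_sets" if A: "A \<in> approx_sets" for A
  proof -
    have "approx (\<lambda>x. 1 + (- 1) * indicator A x)"
      using A by (intro approx_add approx_mult approx_T[OF T_const]) (auto simp: approx_sets_def)
    \<comment> \<open>The two functions agree on the space only, so a constant sequence in
      \<open>approx_limit\<close> is used to pass from one to the other.\<close>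
    then have "approx (\<lambda>x. indicator (space M - A) x)"
      by (rule approx_limit[where f="\<lambda>_ x. 1 + (- 1) * indicator A x" and B=1]) (auto simp: indicator_def)
    then show ?thesis using A by (auto simp: approx_sets_def)
  qed
  have inter: "A \<inter> B \<in> approx_sets" if A: "A \<in> approx_sets" "B \<in> approx_sets" for A B
  proof -
    have "approx (\<lambda>x. indicator A x * indicator B x)"
      using A by (intro approx_mult) (auto simp: approx_sets_def)
    then show ?thesis using A by (auto simp: approx_sets_def indicator_inter_arith[abs_def])
  qed
  have empty: "{} \<in> approx_sets" using approx_T[OF T_const[of 0]] by (simp add: approx_sets_def indicator_def[abs_def])
  have un: "A \<union> B \<in> approx_sets" if A: "A \<in> approx_sets" "B \<in> approx_sets" for A B
  proof -
    have "A \<union> B = space M - ((space M - A) \<inter> (space M - B))"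
      using A sets.sets_into_space by (auto simp: approx_sets_def)
    then show ?thesis using compl inter A by simp
  qed
  show ?thesis
    unfolding sigma_algebra_iff2
  proof (intro conjI ballI allI impI empty compl)
    show "approx_sets \<subseteq> Pow (space M)" using sets.sets_into_space by (auto simp: approx_sets_def)
    fix A :: "nat \<Rightarrow> 'a set" assume A: "range A \<subseteq> approx_sets"
    have fin: "(\<Union>i<n. A i) \<in> approx_sets" for n
      by (induction n) (use A empty un in \<open>auto simp: lessThan_Suc\<close>)
    have "approx (\<lambda>x. indicator (\<Union>i. A i) x)"
    proof (rule approx_limit[where B=1])
      show "approx (\<lambda>x. indicator (\<Union>i<n. A i) x)" for n using fin by (simp add: approx_sets_def)
      show "(\<lambda>n. indicator (\<Union>i<n. A i) x) \<longlonglongrightarrow> indicator (\<Union>i. A i) x" for x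
        by (rule LIMSEQ_indicator_UN)
    qed (auto simp: indicator_def)
    then show "(\<Union>i. A i) \<in> approx_sets" using A by (auto simp: approx_sets_def)
  qed
qed

definition approx_space :: "'a measure" where "approx_space = sigma (space M) approx_sets"

lemma space_approx [simp]: "space approx_space = space M"
  by (simp add: approx_space_def space_measure_of_conv)

lemma sets_approx: "sets approx_space = approx_sets"
  unfolding approx_space_def using approx_sets_sigma by (simp add: sigma_algebra.sets_measure_of_eq)

lemma T_polynomial:
  assumes p: "real_polynomial_function p" and t: "(\<lambda>x. complex_of_real (r x)) \<in> T"
  shows "(\<lambda>x. complex_of_real (p (r x))) \<in> T"
  using p
proof (induction p rule: real_polynomial_function.induct)
  case (linear f)
  then have "f s = f 1 * s" for s using linear_scale[of f s 1] bounded_linear.linear[of f] by (simp add: mult.commute)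
  then have "(\<lambda>x. complex_of_real (f (r x))) = (\<lambda>x. of_real (f 1) * of_real (r x))" by (metis of_real_mult)
  then show ?case using T_mult[OF T_const t] by simp
qed (use T_const T_add T_mult in simp_all)

lemma approx_continuous:
  assumes t: "(\<lambda>x. complex_of_real (r x)) \<in> T" and cont: "continuous_on UNIV (p :: real \<Rightarrow> real)"
  shows "approx (\<lambda>x. of_real (p (r x)))"
proof -
  obtain B where B: "\<And>x. x \<in> space M \<Longrightarrow> norm (complex_of_real (r x)) \<le> B" using T_bound[OF t] by blast
  then have rB: "\<And>x. x \<in> space M \<Longrightarrow> r x \<in> {-B..B}" by (fastforce simp: abs_le_iff)
  have pc: "continuous_on {-B..B} p" using cont by (rule continuous_on_subset) auto
  have "\<exists>g. real_polynomial_function g \<and> (\<forall>s\<in>{-B..B}. \<bar>p s - g s\<bar> < 1 / Suc n)" for n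
  proof -
    have pos: "0 < 1 / real (Suc n)" by simp
    show ?thesis
    proof (rule Stone_Weierstrass_real_polynomial_function[OF compact_Icc pc pos])
      fix g assume "real_polynomial_function g" "\<And>s. s \<in> {-B..B} \<Longrightarrow> \<bar>p s - g s\<bar> < 1 / real (Suc n)"
      then show ?thesis by (intro exI[of _ g]) simp
    qed
  qed
  then obtain g where g: "\<And>n. real_polynomial_function (g n)" "\<And>n s. s \<in> {-B..B} \<Longrightarrow> \<bar>p s - g n s\<bar> < 1 / Suc n"
    by metis
  obtain P where P: "\<And>s. s \<in> {-B..B} \<Longrightarrow> norm (p s) \<le> P"
    using compact_imp_bounded[OF compact_continuous_image[OF pc compact_Icc]] unfolding bounded_iff by blast
  show ?thesis
  proof (rule approx_limit[where f="\<lambda>n x. of_real (g n (r x))" and B="P + 1"])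
    show "approx (\<lambda>x. of_real (g n (r x)))" for n by (rule approx_T[OF T_polynomial[OF g(1) t]])
    fix x assume x: "x \<in> space M"
    have gn: "\<bar>p (r x) - g n (r x)\<bar> < 1 / Suc n" for n using g(2)[OF rB[OF x]] .
    show "norm (complex_of_real (g n (r x))) \<le> P + 1" for n
    proof -
      have "1 / real (Suc n) \<le> 1" by simp
      then show ?thesis using gn[of n] P[OF rB[OF x]] by (simp only: norm_of_real real_norm_def)
    qed
    have "(\<lambda>n. g n (r x) - p (r x)) \<longlonglongrightarrow> 0"
      by (rule Lim_null_comparison[OF _ LIMSEQ_Suc[OF lim_1_over_n]])
        (use gn in \<open>auto intro!: always_eventually less_imp_le simp: abs_minus_commute\<close>)
    then have "(\<lambda>n. g n (r x)) \<longlonglongrightarrow> p (r x)" by (rule LIM_zero_cancel)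
    then show "(\<lambda>n. complex_of_real (g n (r x))) \<longlonglongrightarrow> of_real (p (r x))" by (rule tendsto_of_real)
  qed
qed

text \<open>The indicator of a superlevel set of \<open>r\<close> is a limit of continuous ramps in
  \<open>r\<close>, and these are limits of polynomials in \<open>r\<close>, which stay in
  \<open>T\<close>.\<close>

lemma approx_measurable_real:
  assumes t: "(\<lambda>x. complex_of_real (r x)) \<in> T"
  shows "r \<in> borel_measurable approx_space"
proof (subst borel_measurable_iff_greater, intro allI)
  fix a :: real
  let ?A = "{x \<in> space M. a < r x}"
  have rm: "r \<in> borel_measurable M"
    using measurable_compose[OF T_meas[OF t] borel_measurable_Re] by simp
  define p where "p n s = min 1 (real n * max 0 (s - a))" for n s
  have "approx (\<lambda>x. indicator ?A x)"
  proof (rule approx_limit[where f="\<lambda>n x. of_real (p n (r x))" and B=1])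
    show "approx (\<lambda>x. of_real (p n (r x)))" for n
      unfolding p_def by (rule approx_continuous[OF t]) (intro continuous_intros)
    fix x assume x: "x \<in> space M"
    show "norm (complex_of_real (p n (r x))) \<le> 1" for n by (simp add: p_def)
    show "(\<lambda>n. complex_of_real (p n (r x))) \<longlonglongrightarrow> indicator ?A x"
    proof (cases "a < r x")
      case True
      obtain N where N: "1 / (r x - a) < real N" using reals_Archimedean2 by blast
      have "p n (r x) = 1" if "n \<ge> N" for n
      proof -
        have "1 < real N * (r x - a)" using N True by (simp add: field_simps)
        also have "\<dots> \<le> real n * (r x - a)" using that True by (intro mult_right_mono) auto
        finally show ?thesis using True by (simp add: p_def)
      qed
      then have "eventually (\<lambda>n. complex_of_real (p n (r x)) = indicator ?A x) sequentially"
        using True x unfolding eventually_sequentially by (auto simp: indicator_def)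
      then show ?thesis by (rule tendsto_eventually)
    next
      case False
      then show ?thesis by (simp add: p_def indicator_def)
    qed
  qed
  then show "{x \<in> space approx_space. a < r x} \<in> sets approx_space"
    using rm by (simp add: sets_approx approx_sets_def)
qed

lemma approx_measurable_T:
  assumes t: "t \<in> T" shows "t \<in> borel_measurable approx_space"
proof -
  have "(\<lambda>x. complex_of_real (Re (t x))) = (\<lambda>x. (1 / 2) * (t x + cnj (t x)))"
    by (simp add: complex_eq_iff fun_eq_iff)
  then have re: "(\<lambda>x. complex_of_real (Re (t x))) \<in> T" by (simp only:) (intro T_mult T_add T_const T_cnj t)
  have "(\<lambda>x. complex_of_real (Im (t x))) = (\<lambda>x. (- \<i> / 2) * (t x + (- 1) * cnj (t x)))"
    by (simp add: complex_eq_iff fun_eq_iff)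
  then have im: "(\<lambda>x. complex_of_real (Im (t x))) \<in> T" by (simp only:) (intro T_mult T_add T_const T_cnj t)
  show ?thesis
    using approx_measurable_real[OF re] approx_measurable_real[OF im] by (simp add: borel_measurable_complex_iff)
qed

lemma approx_indicator:
  assumes "A \<in> sets approx_space" "e > 0"
  shows "\<exists>t\<in>T. (\<integral>\<^sup>+x. ennreal ((norm (indicator A x - t x))\<^sup>2) \<partial>M) < ennreal e"
proof -
  have a: "approx (\<lambda>x. indicator A x)" using assms(1) by (simp add: sets_approx approx_sets_def)
  then obtain t where t: "t \<in> T" "dist2 (\<lambda>x. indicator A x) t < e" using assms(2) by (auto simp: approx_def)
  have "(\<integral>\<^sup>+x. ennreal ((norm (indicator A x - t x))\<^sup>2) \<partial>M) = ennreal (dist2 (\<lambda>x. indicator A x) t)"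
    unfolding dist2_def using dist2_integrable[OF approx_bounded[OF a] bounded_fun_T[OF t(1)]]
    by (intro nn_integral_eq_integral) auto
  then show ?thesis using t assms(2) by (intro bexI[of _ t]) (auto intro!: ennreal_lessI)
qed

end

section \<open>The Zak transform\<close>

text \<open>Pairs a finite combination of translates with its symbol. It is a relation because
  translates may be linearly dependent, so that \<open>g\<close> need not determine
  \<open>t\<close>.\<close>

definition transl_poly :: "'g::ab_group_add set \<Rightarrow> ('g \<Rightarrow> complex) \<Rightarrow> ('g \<Rightarrow> complex) \<Rightarrow> (('g \<Rightarrow> complex) \<Rightarrow> complex) \<Rightarrow> bool" where
  "transl_poly S \<psi> g t \<longleftrightarrow> (\<exists>F a. finite F \<and> F \<subseteq> S \<and> g = (\<lambda>y. \<Sum>l\<in>F. a l * \<psi> (y - l)) \<and> t = (\<lambda>\<alpha>. \<Sum>l\<in>F. a l * \<alpha> (- l)))"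

lemma transl_polyI: "finite F \<Longrightarrow> F \<subseteq> S \<Longrightarrow> transl_poly S \<psi> (\<lambda>y. \<Sum>l\<in>F. a l * \<psi> (y - l)) (\<lambda>\<alpha>. \<Sum>l\<in>F. a l * \<alpha> (- l))"
  unfolding transl_poly_def by blast

lemma transl_poly_mono: "transl_poly S \<psi> g t \<Longrightarrow> S \<subseteq> S' \<Longrightarrow> transl_poly S' \<psi> g t"
  unfolding transl_poly_def by blast

lemma transl_poly_monomial: "l \<in> S \<Longrightarrow> transl_poly S \<psi> (\<lambda>y. c * \<psi> (y - l)) (\<lambda>\<alpha>. c * \<alpha> (- l))"
  using transl_polyI[of "{l}" S \<psi> "\<lambda>_. c"] by simp

lemma transl_poly_0: "transl_poly S \<psi> (\<lambda>y. 0) (\<lambda>\<alpha>. 0)"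
  using transl_polyI[of "{}" S \<psi>] by simp

lemma transl_poly_add:
  assumes "transl_poly S \<psi> g t" "transl_poly S \<psi> g' t'"
  shows "transl_poly S \<psi> (\<lambda>y. g y + g' y) (\<lambda>\<alpha>. t \<alpha> + t' \<alpha>)"
proof -
  obtain F a F' a' where F: "finite F" "F \<subseteq> S" "g = (\<lambda>y. \<Sum>l\<in>F. a l * \<psi> (y - l))" "t = (\<lambda>\<alpha>. \<Sum>l\<in>F. a l * \<alpha> (- l))"
    and F': "finite F'" "F' \<subseteq> S" "g' = (\<lambda>y. \<Sum>l\<in>F'. a' l * \<psi> (y - l))" "t' = (\<lambda>\<alpha>. \<Sum>l\<in>F'. a' l * \<alpha> (- l))"
    using assms unfolding transl_poly_def by blast
  define b where "b l = (if l \<in> F then a l else 0) + (if l \<in> F' then a' l else 0)" for l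
  have s: "(\<Sum>l\<in>F. a l * f l) + (\<Sum>l\<in>F'. a' l * f l) = (\<Sum>l\<in>F \<union> F'. b l * f l)" for f :: "'a \<Rightarrow> complex"
  proof -
    have "(\<Sum>l\<in>F. a l * f l) = (\<Sum>l\<in>F \<union> F'. (if l \<in> F then a l else 0) * f l)"
      by (rule sum.mono_neutral_cong_left) (use F F' in auto)
    moreover have "(\<Sum>l\<in>F'. a' l * f l) = (\<Sum>l\<in>F \<union> F'. (if l \<in> F' then a' l else 0) * f l)"
      by (rule sum.mono_neutral_cong_left) (use F F' in auto)
    ultimately show ?thesis by (simp add: b_def distrib_right sum.distrib)
  qed
  show ?thesis
    unfolding F(3,4) F'(3,4) s using transl_polyI[of "F \<union> F'" S \<psi> b] F F' by simp
qed

lemma transl_poly_shift: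
  assumes "transl_poly S \<psi> g t" and l: "l \<in> S" and S: "\<And>a b. a \<in> S \<Longrightarrow> b \<in> S \<Longrightarrow> a + b \<in> S"
  shows "\<exists>t'. transl_poly S \<psi> (\<lambda>y. c * g (y - l)) t' \<and> (\<forall>\<alpha>\<in>characters. t' \<alpha> = c * \<alpha> (- l) * t \<alpha>)"
proof -
  obtain F a where F: "finite F" "F \<subseteq> S" "g = (\<lambda>y. \<Sum>l\<in>F. a l * \<psi> (y - l))" "t = (\<lambda>\<alpha>. \<Sum>l\<in>F. a l * \<alpha> (- l))"
    using assms(1) unfolding transl_poly_def by blast
  let ?F = "(\<lambda>k. k + l) ` F" and ?a = "\<lambda>k. c * a (k - l)"
  have inj: "inj_on (\<lambda>k. k + l) F" by (rule inj_onI) simp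
  have "transl_poly S \<psi> (\<lambda>y. \<Sum>k\<in>?F. ?a k * \<psi> (y - k)) (\<lambda>\<alpha>. \<Sum>k\<in>?F. ?a k * \<alpha> (- k))"
    by (rule transl_polyI) (use F l S in auto)
  moreover have "(\<Sum>k\<in>?F. ?a k * \<psi> (y - k)) = c * g (y - l)" for y
    by (subst sum.reindex[OF inj]) (simp add: F(3) sum_distrib_left mult_ac diff_diff_eq add.commute)
  moreover have "(\<Sum>k\<in>?F. ?a k * \<alpha> (- k)) = c * \<alpha> (- l) * t \<alpha>" if \<alpha>: "\<alpha> \<in> characters" for \<alpha>
  proof -
    have "\<alpha> (- (k + l)) = \<alpha> (- k) * \<alpha> (- l)" for k using characters_mult[OF \<alpha>, of "- k" "- l"] by (simp add: add.commute)
    then show ?thesis by (subst sum.reindex[OF inj]) (simp add: F(4) sum_distrib_left mult_ac)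
  qed
  ultimately show ?thesis by auto
qed

text \<open>Apply the coefficients of the first combination to translates of the second. The symbols
  agree on characters only, since the product rule uses multiplicativity of \<alpha>.\<close>

lemma transl_poly_mult:
  assumes "transl_poly S \<psi> g t" "transl_poly S \<psi> g' t'" and S: "\<And>a b. a \<in> S \<Longrightarrow> b \<in> S \<Longrightarrow> a + b \<in> S"
  shows "\<exists>g'' t''. transl_poly S \<psi> g'' t'' \<and> (\<forall>\<alpha>\<in>characters. t'' \<alpha> = t \<alpha> * t' \<alpha>)"
proof -
  obtain F a where F: "finite F" "F \<subseteq> S" "t = (\<lambda>\<alpha>. \<Sum>l\<in>F. a l * \<alpha> (- l))"
    using assms(1) unfolding transl_poly_def by blast
  have "\<exists>g'' t''. transl_poly S \<psi> g'' t'' \<and> (\<forall>\<alpha>\<in>characters. t'' \<alpha> = (\<Sum>l\<in>F. a l * \<alpha> (- l)) * t' \<alpha>)"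
    using F(1,2)
  proof (induction F rule: finite_induct)
    case empty
    then show ?case using transl_poly_0 by fastforce
  next
    case (insert l F)
    then obtain g1 t1 where 1: "transl_poly S \<psi> g1 t1" "\<forall>\<alpha>\<in>characters. t1 \<alpha> = (\<Sum>l\<in>F. a l * \<alpha> (- l)) * t' \<alpha>" by auto
    obtain t2 where 2: "transl_poly S \<psi> (\<lambda>y. a l * g' (y - l)) t2" "\<forall>\<alpha>\<in>characters. t2 \<alpha> = a l * \<alpha> (- l) * t' \<alpha>"
      using transl_poly_shift[OF assms(2) _ S, of l "a l"] insert.prems by auto
    have "\<forall>\<alpha>\<in>characters. t1 \<alpha> + t2 \<alpha> = (\<Sum>l\<in>insert l F. a l * \<alpha> (- l)) * t' \<alpha>"
      using insert.hyps 1(2) 2(2) by (simp add: distrib_right)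
    then show ?case using transl_poly_add[OF 1(1) 2(1)] by blast
  qed
  then show ?thesis using F(3) by simp
qed

lemma transl_poly_bounded:
  assumes "transl_poly S \<psi> g t" shows "\<exists>B\<ge>0. \<forall>\<alpha>\<in>characters. norm (t \<alpha>) \<le> B"
proof -
  obtain F a where F: "finite F" "F \<subseteq> S" "t = (\<lambda>\<alpha>. \<Sum>l\<in>F. a l * \<alpha> (- l))"
    using assms(1) unfolding transl_poly_def by blast
  have "norm (t \<alpha>) \<le> (\<Sum>l\<in>F. norm (a l))" if "\<alpha> \<in> characters" for \<alpha>
    unfolding F(3) by (rule sum_norm_le) (simp add: norm_mult characters_norm[OF that])
  then show ?thesis by (intro exI[of _ "\<Sum>l\<in>F. norm (a l)"]) (auto intro: sum_nonneg)
qed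

lemma transl_poly_measurable:
  "transl_poly S \<psi> g t \<Longrightarrow> t \<in> borel_measurable dual_borel"
  unfolding transl_poly_def by auto

lemma measurable_count_space_split:
  assumes I: "countable I" and f: "\<And>i. i \<in> I \<Longrightarrow> f i \<in> measurable M N"
  shows "(\<lambda>(x, i). f i x) \<in> measurable (M \<Otimes>\<^sub>M count_space I) N"
proof -
  have "(\<lambda>(i, x). f i x) \<in> measurable (count_space I \<Otimes>\<^sub>M M) N"
    by (rule measurable_pair_measure_countable1[OF I]) (use f in simp)
  from measurable_pair_swap[OF this] show ?thesis by (simp add: case_prod_beta' split_beta')
qed

lemma measurable_nn_integral_count_space:
  assumes I: "countable I" and f: "\<And>i. i \<in> I \<Longrightarrow> f i \<in> borel_measurable M"
  shows "(\<lambda>x. \<integral>\<^sup>+i. f i x \<partial>count_space I) \<in> borel_measurable M"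
  by (rule sigma_finite_measure.borel_measurable_nn_integral[OF sigma_finite_measure_count_space_countable[OF I]
        measurable_count_space_split[OF I f]])

context zak_setting
begin

text \<open>The Zak sum without the volume factor, written as an integral for the counting measure
  so that the Fubini and convergence theorems apply to it.\<close>

definition zak :: "('g \<Rightarrow> complex) \<Rightarrow> ('g \<Rightarrow> complex) \<Rightarrow> 'g \<Rightarrow> complex" where
  "zak h \<alpha> x = (\<integral>l. h (x + l) * \<alpha> (- l) \<partial>count_space L)"

lemma zak_L1_eq: "zak_L1 \<mu> L C h \<alpha> x = of_real vol * zak h \<alpha> x"
  by (simp add: zak_L1_def zak_def vol_def infsum_eq_integral_count_space)

text \<open>The measure \<open>N\<close> is left general: it suffices that the evaluations at
  lattice points are measurable. The later use with \<open>approx_space\<close> depends on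
  this.\<close>

lemma zak_measurable:
  assumes N: "\<And>l. l \<in> L \<Longrightarrow> (\<lambda>\<alpha>. \<alpha> (- l)) \<in> borel_measurable N" and h [measurable]: "h \<in> borel_measurable borel"
  shows "(\<lambda>p. zak h (fst p) (snd p)) \<in> borel_measurable (N \<Otimes>\<^sub>M MC)"
  unfolding zak_def
proof (rule sigma_finite_measure.borel_measurable_lebesgue_integral)
  show "sigma_finite_measure (count_space L)" by (rule sigma_finite_measure_count_space_countable[OF Lcountable])
  show "(\<lambda>(p, l). h (snd p + l) * fst p (- l)) \<in> borel_measurable ((N \<Otimes>\<^sub>M MC) \<Otimes>\<^sub>M count_space L)"
  proof (rule measurable_count_space_split[OF Lcountable])
    fix l assume l: "l \<in> L"
    have "(\<lambda>p. fst p (- l)) \<in> borel_measurable (N \<Otimes>\<^sub>M MC)" by (rule measurable_compose[OF measurable_fst N[OF l]])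
    moreover have "(\<lambda>p. h (snd p + l)) \<in> borel_measurable (N \<Otimes>\<^sub>M MC)" by measurable
    ultimately show "(\<lambda>p. h (snd p + l) * fst p (- l)) \<in> borel_measurable (N \<Otimes>\<^sub>M MC)" by simp
  qed
qed

lemma AE_summable:
  fixes h :: "'g \<Rightarrow> complex"
  assumes h: "integrable \<mu> h" shows "AE x in MC. integrable (count_space L) (\<lambda>l. h (x + l))"
proof -
  have hm [measurable]: "h \<in> borel_measurable borel" using borel_measurable_integrable[OF h] by simp
  have "(\<integral>\<^sup>+x. (\<integral>\<^sup>+l. ennreal (norm (h (x + l))) \<partial>count_space L) \<partial>MC) = (\<integral>\<^sup>+x. ennreal (norm (h x)) \<partial>\<mu>)"
    by (rule T.nn_integral_unfold[symmetric]) measurable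
  also have "\<dots> < \<infinity>" using h unfolding integrable_iff_bounded by simp
  finally have fin: "(\<integral>\<^sup>+x. (\<integral>\<^sup>+l. ennreal (norm (h (x + l))) \<partial>count_space L) \<partial>MC) \<noteq> \<infinity>" by simp
  have m: "(\<lambda>x. \<integral>\<^sup>+l. ennreal (norm (h (x + l))) \<partial>count_space L) \<in> borel_measurable MC"
    by (rule measurable_nn_integral_count_space[OF Lcountable]) auto
  have "AE x in MC. (\<integral>\<^sup>+l. ennreal (norm (h (x + l))) \<partial>count_space L) \<noteq> \<infinity>"
    by (rule nn_integral_PInf_AE[OF m fin])
  then show ?thesis by (rule AE_mp) (auto intro!: AE_I2 integrableI_bounded simp: less_top)
qed

text \<open>Parseval in \<alpha> for almost every \<open>x\<close>, namely where the values over the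
  coset are summable, followed by unfolding the tile integral to the whole group.\<close>

lemma zak_isometry:
  assumes h: "integrable \<mu> h"
  shows "(\<integral>\<^sup>+p. ennreal ((norm (zak h (fst p) (snd p)))\<^sup>2) \<partial>(MD \<Otimes>\<^sub>M MC)) = ennreal dvol * (\<integral>\<^sup>+x. ennreal ((norm (h x))\<^sup>2) \<partial>\<mu>)"
proof -
  interpret P: pair_sigma_finite MD MC ..
  have hm [measurable]: "h \<in> borel_measurable borel" using borel_measurable_integrable[OF h] by simp
  have zm [measurable]: "(\<lambda>p. zak h (fst p) (snd p)) \<in> borel_measurable (MD \<Otimes>\<^sub>M MC)"
    by (rule zak_measurable) (use measurable_eval in auto)
  have "(\<integral>\<^sup>+p. ennreal ((norm (zak h (fst p) (snd p)))\<^sup>2) \<partial>(MD \<Otimes>\<^sub>M MC))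
      = (\<integral>\<^sup>+x. (\<integral>\<^sup>+\<alpha>. ennreal ((norm (zak h \<alpha> x))\<^sup>2) \<partial>MD) \<partial>MC)"
    by (subst P.nn_integral_snd[symmetric]) auto
  also have "\<dots> = (\<integral>\<^sup>+x. ennreal dvol * (\<integral>\<^sup>+l. ennreal ((norm (h (x + l)))\<^sup>2) \<partial>count_space L) \<partial>MC)"
    using AE_summable[OF h] by (intro nn_integral_cong_AE) (auto elim!: eventually_mono simp: zak_def parseval)
  also have "\<dots> = ennreal dvol * (\<integral>\<^sup>+x. (\<integral>\<^sup>+l. ennreal ((norm (h (x + l)))\<^sup>2) \<partial>count_space L) \<partial>MC)"
    by (rule nn_integral_cmult) (rule measurable_nn_integral_count_space[OF Lcountable], auto)
  also have "\<dots> = ennreal dvol * (\<integral>\<^sup>+x. ennreal ((norm (h x))\<^sup>2) \<partial>\<mu>)"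
    by (subst T.nn_integral_unfold[of "\<lambda>x. ennreal ((norm (h x))\<^sup>2)"]) auto
  finally show ?thesis .
qed

lemma zak_transl:
  assumes \<alpha>: "\<alpha> \<in> characters" and k: "k \<in> L"
  shows "zak (\<lambda>y. h (y - k)) \<alpha> x = \<alpha> (- k) * zak h \<alpha> x"
proof -
  have b: "bij_betw (\<lambda>l. l + k) L L"
    by (rule bij_betw_byWitness[where f'="\<lambda>l. l - k"]) (use k Lplus Ldiff in auto)
  have "zak (\<lambda>y. h (y - k)) \<alpha> x = (\<integral>l. h (x + (l + k) - k) * \<alpha> (- (l + k)) \<partial>count_space L)"
    unfolding zak_def by (rule integral_bij_count_space[OF b, symmetric])
  also have "\<dots> = (\<integral>l. \<alpha> (- k) * (h (x + l) * \<alpha> (- l)) \<partial>count_space L)"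
  proof (intro Bochner_Integration.integral_cong refl)
    fix l
    have "\<alpha> (- (l + k)) = \<alpha> (- l) * \<alpha> (- k)" using characters_mult[OF \<alpha>, of "- l" "- k"] by (simp add: add.commute)
    then show "h (x + (l + k) - k) * \<alpha> (- (l + k)) = \<alpha> (- k) * (h (x + l) * \<alpha> (- l))"
      by (simp add: add_diff_eq[symmetric])
  qed
  also have "\<dots> = \<alpha> (- k) * zak h \<alpha> x" by (simp add: zak_def)
  finally show ?thesis .
qed

lemma integrable_zk_term:
  assumes \<alpha>: "\<alpha> \<in> characters" and i: "integrable (count_space L) (\<lambda>l. h (x + l))"
  shows "integrable (count_space L) (\<lambda>l. h (x + l) * \<alpha> (- l))"
  by (rule Bochner_Integration.integrable_bound[OF i]) (auto simp: norm_mult characters_norm[OF \<alpha>])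

lemma zak_poly:
  assumes \<alpha>: "\<alpha> \<in> characters" and i: "integrable (count_space L) (\<lambda>l. h (x + l))" and F: "finite F" "F \<subseteq> L"
  shows "zak (\<lambda>y. \<Sum>k\<in>F. a k * h (y - k)) \<alpha> x = (\<Sum>k\<in>F. a k * \<alpha> (- k)) * zak h \<alpha> x"
proof -
  have ik: "integrable (count_space L) (\<lambda>l. h (x + l - k) * \<alpha> (- l))" if k: "k \<in> F" for k
  proof -
    have b: "bij_betw (\<lambda>l. l - k) L L"
      by (rule bij_betw_byWitness[where f'="\<lambda>l. l + k"]) (use k F Lplus Ldiff in auto)
    have "integrable (count_space L) (\<lambda>l. h (x + (l - k)))"
      using i by (subst integrable_bij_count_space[OF b, of "\<lambda>l. h (x + l)"])
    then have "integrable (count_space L) (\<lambda>l. (\<lambda>y. h (y - k)) (x + l))" by (simp add: add_diff_eq)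
    from integrable_zk_term[OF \<alpha> this] show ?thesis by simp
  qed
  have "zak (\<lambda>y. \<Sum>k\<in>F. a k * h (y - k)) \<alpha> x = (\<integral>l. (\<Sum>k\<in>F. a k * (h (x + l - k) * \<alpha> (- l))) \<partial>count_space L)"
    unfolding zak_def by (simp add: sum_distrib_right mult.assoc)
  also have "\<dots> = (\<Sum>k\<in>F. a k * zak (\<lambda>y. h (y - k)) \<alpha> x)"
    unfolding zak_def using ik by (simp add: Bochner_Integration.integral_sum)
  also have "\<dots> = (\<Sum>k\<in>F. a k * \<alpha> (- k)) * zak h \<alpha> x"
    using F(2) by (simp add: zak_transl[OF \<alpha>] sum_distrib_right mult.assoc subset_iff)
  finally show ?thesis .
qed

lemma nn_integral_MD_MC:
  assumes F [measurable]: "F \<in> borel_measurable (\<nu> \<Otimes>\<^sub>M \<mu>)"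
  shows "(\<integral>\<^sup>+p. indicator (D \<times> C) p * F p \<partial>(\<nu> \<Otimes>\<^sub>M \<mu>)) = (\<integral>\<^sup>+p. F p \<partial>(MD \<Otimes>\<^sub>M MC))"
proof -
  have m: "D \<times> C \<in> sets (\<nu> \<Otimes>\<^sub>M \<mu>)" using DT.tile_sets T.tile_sets by (intro pair_measureI) auto
  have F1: "(\<lambda>x. F (\<alpha>, x)) \<in> borel_measurable \<mu>" if "\<alpha> \<in> characters" for \<alpha>
    by (rule measurable_Pair2[OF F]) (use that in simp)
  have "(\<integral>\<^sup>+p. indicator (D \<times> C) p * F p \<partial>(\<nu> \<Otimes>\<^sub>M \<mu>)) = (\<integral>\<^sup>+\<alpha>. (\<integral>\<^sup>+x. indicator (D \<times> C) (\<alpha>, x) * F (\<alpha>, x) \<partial>\<mu>) \<partial>\<nu>)"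
    using m by (subst nn_integral_fst[symmetric]) auto
  also have "\<dots> = (\<integral>\<^sup>+\<alpha>. indicator D \<alpha> * (\<integral>\<^sup>+x. F (\<alpha>, x) \<partial>MC) \<partial>\<nu>)"
  proof (rule nn_integral_cong)
    fix \<alpha> assume "\<alpha> \<in> space \<nu>"
    then have a: "\<alpha> \<in> characters" by simp
    have "(\<integral>\<^sup>+x. indicator (D \<times> C) (\<alpha>, x) * F (\<alpha>, x) \<partial>\<mu>) = (\<integral>\<^sup>+x. indicator D \<alpha> * (indicator C x * F (\<alpha>, x)) \<partial>\<mu>)"
      by (intro nn_integral_cong) (simp add: indicator_def)
    also have "\<dots> = indicator D \<alpha> * (\<integral>\<^sup>+x. F (\<alpha>, x) \<partial>MC)"
      using F1[OF a] T.tile_sets by (subst T.nn_integral_MC) (auto intro!: nn_integral_cmult)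
    finally show "(\<integral>\<^sup>+x. indicator (D \<times> C) (\<alpha>, x) * F (\<alpha>, x) \<partial>\<mu>) = indicator D \<alpha> * (\<integral>\<^sup>+x. F (\<alpha>, x) \<partial>MC)" .
  qed
  also have "\<dots> = (\<integral>\<^sup>+\<alpha>. (\<integral>\<^sup>+x. F (\<alpha>, x) \<partial>MC) \<partial>MD)"
  proof (rule DT.nn_integral_MC[symmetric])
    have "F \<in> borel_measurable (\<nu> \<Otimes>\<^sub>M MC)" using F by (simp cong: measurable_cong_sets sets_pair_measure_cong)
    then show "(\<lambda>\<alpha>. \<integral>\<^sup>+x. F (\<alpha>, x) \<partial>MC) \<in> borel_measurable \<nu>" by measurable
  qed
  also have "\<dots> = (\<integral>\<^sup>+p. F p \<partial>(MD \<Otimes>\<^sub>M MC))"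
    by (rule MC.nn_integral_fst) (use F in \<open>simp cong: measurable_cong_sets sets_pair_measure_cong\<close>)
  finally show ?thesis .
qed

end

context zak_setting
begin

text \<open>A crude operator bound. Because \<open>c\<close> does not depend on \<open>h\<close>, it
  carries L2 convergence of approximants of the generator over to their finite combinations of
  translates.\<close>

lemma transl_sum_bound:
  assumes F: "finite F"
  shows "\<exists>c::real. 0 \<le> c \<and> (\<forall>h\<in>borel_measurable borel.
    (\<integral>\<^sup>+y. ennreal ((norm (\<Sum>l\<in>F. a l * h (y - l)))\<^sup>2) \<partial>\<mu>) \<le> ennreal c * (\<integral>\<^sup>+y. ennreal ((norm (h y :: complex))\<^sup>2) \<partial>\<mu>))"
  using F
proof (induction F rule: finite_induct)
  case empty
  then show ?case by (intro exI[of _ 0]) simp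
next
  case (insert k F)
  then obtain c where c: "0 \<le> c" "\<And>h. h \<in> borel_measurable borel \<Longrightarrow>
    (\<integral>\<^sup>+y. ennreal ((norm (\<Sum>l\<in>F. a l * h (y - l)))\<^sup>2) \<partial>\<mu>) \<le> ennreal c * (\<integral>\<^sup>+y. ennreal ((norm (h y))\<^sup>2) \<partial>\<mu>)" by blast
  show ?case
  proof (intro exI[of _ "2 * (norm (a k))\<^sup>2 + 2 * c"] conjI ballI)
    show "0 \<le> 2 * (norm (a k))\<^sup>2 + 2 * c" using c(1) by simp
    fix h :: "'g \<Rightarrow> complex" assume h [measurable]: "h \<in> borel_measurable borel"
    let ?I = "\<integral>\<^sup>+y. ennreal ((norm (h y))\<^sup>2) \<partial>\<mu>"
    let ?S = "\<lambda>y. \<Sum>l\<in>F. a l * h (y - l)"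
    have "(\<integral>\<^sup>+y. ennreal ((norm (\<Sum>l\<in>insert k F. a l * h (y - l)))\<^sup>2) \<partial>\<mu>)
      \<le> (\<integral>\<^sup>+y. ennreal (2 * (norm (a k))\<^sup>2) * ennreal ((norm (h (y - k)))\<^sup>2) + 2 * ennreal ((norm (?S y))\<^sup>2) \<partial>\<mu>)"
    proof (rule nn_integral_mono)
      fix y
      have "(norm (\<Sum>l\<in>insert k F. a l * h (y - l)))\<^sup>2 \<le> 2 * (norm (a k * h (y - k)))\<^sup>2 + 2 * (norm (?S y))\<^sup>2"
        using norm_add_square_le[of "a k * h (y - k)" "?S y"] insert.hyps by simp
      also have "\<dots> = (2 * (norm (a k))\<^sup>2) * (norm (h (y - k)))\<^sup>2 + 2 * (norm (?S y))\<^sup>2"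
        by (simp add: norm_mult power_mult_distrib)
      finally have "ennreal ((norm (\<Sum>l\<in>insert k F. a l * h (y - l)))\<^sup>2) \<le> ennreal ((2 * (norm (a k))\<^sup>2) * (norm (h (y - k)))\<^sup>2 + 2 * (norm (?S y))\<^sup>2)"
        by (rule ennreal_leI)
      then show "ennreal ((norm (\<Sum>l\<in>insert k F. a l * h (y - l)))\<^sup>2)
        \<le> ennreal (2 * (norm (a k))\<^sup>2) * ennreal ((norm (h (y - k)))\<^sup>2) + 2 * ennreal ((norm (?S y))\<^sup>2)"
        by (simp add: ennreal_plus ennreal_mult ennreal_mult')
    qed
    also have "\<dots> = ennreal (2 * (norm (a k))\<^sup>2) * (\<integral>\<^sup>+y. ennreal ((norm (h (y - k)))\<^sup>2) \<partial>\<mu>) + 2 * (\<integral>\<^sup>+y. ennreal ((norm (?S y))\<^sup>2) \<partial>\<mu>)"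
      by (simp add: nn_integral_add nn_integral_cmult)
    also have "\<dots> \<le> ennreal (2 * (norm (a k))\<^sup>2) * ?I + 2 * (ennreal c * ?I)"
      using nn_integral_translate[of "\<lambda>y. ennreal ((norm (h y))\<^sup>2)" "- k"] c(2)[OF h] by (intro add_mono mult_left_mono) auto
    also have "\<dots> = ennreal (2 * (norm (a k))\<^sup>2 + 2 * c) * ?I"
      using c(1) by (simp add: ennreal_plus ennreal_mult' distrib_right mult.assoc)
    finally show "(\<integral>\<^sup>+y. ennreal ((norm (\<Sum>l\<in>insert k F. a l * h (y - l)))\<^sup>2) \<partial>\<mu>) \<le> ennreal (2 * (norm (a k))\<^sup>2 + 2 * c) * ?I" .
  qed
qed

end

section \<open>The weighted isometry for a square-integrable generator\<close>

locale zak_transform = zak_setting \<mu> L C \<nu> D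
  for \<mu> :: "'g::{ab_group_add, t2_space, second_countable_topology} measure" and L C \<nu> D +
  fixes \<psi> :: "'g \<Rightarrow> complex" and Z :: "('g \<Rightarrow> complex) \<Rightarrow> 'g \<Rightarrow> complex"
  assumes psi: "\<psi> \<in> L2 \<mu>" and isz: "is_zak_transform \<mu> \<nu> L C D \<psi> Z"
begin

lemma psi_meas [measurable]: "\<psi> \<in> borel_measurable borel"
  and psi_fin: "(\<integral>\<^sup>+x. ennreal ((norm (\<psi> x))\<^sup>2) \<partial>\<mu>) < \<infinity>"
  using psi by (auto simp: L2_def)

lemma Z_meas: "(\<lambda>p. Z (fst p) (snd p)) \<in> borel_measurable (\<nu> \<Otimes>\<^sub>M \<mu>)"
  using isz by (simp add: is_zak_transform_def)

lemma Z_meas' [measurable]: "(\<lambda>p. Z (fst p) (snd p)) \<in> borel_measurable (MD \<Otimes>\<^sub>M MC)"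
  using Z_meas by (simp cong: measurable_cong_sets sets_pair_measure_cong)

lemma Z_per: "\<kappa> \<in> dual_lattice L \<Longrightarrow> \<alpha> \<in> characters \<Longrightarrow> Z (char_add \<alpha> \<kappa>) x = Z \<alpha> x"
  using isz by (simp add: is_zak_transform_def)

lemma Z_meas_x: "\<alpha> \<in> characters \<Longrightarrow> Z \<alpha> \<in> borel_measurable \<mu>"
  using measurable_Pair2[OF Z_meas, of \<alpha>] by simp

definition weight :: "('g \<Rightarrow> complex) \<Rightarrow> ennreal" where
  "weight \<alpha> = (\<integral>\<^sup>+x. ennreal ((norm (Z \<alpha> x))\<^sup>2) \<partial>MC)"

lemma weight_meas [measurable]: "weight \<in> borel_measurable \<nu>"
proof -
  have "(\<lambda>p. ennreal ((norm (Z (fst p) (snd p)))\<^sup>2)) \<in> borel_measurable (\<nu> \<Otimes>\<^sub>M MC)"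
    using Z_meas by (simp cong: measurable_cong_sets sets_pair_measure_cong)
  from MC.borel_measurable_nn_integral_fst[OF this] show ?thesis by (simp add: weight_def[abs_def])
qed

lemma weight_per: "\<kappa> \<in> dual_lattice L \<Longrightarrow> \<alpha> \<in> characters \<Longrightarrow> weight (char_add \<alpha> \<kappa>) = weight \<alpha>"
  by (simp add: weight_def Z_per)

lemma approximants:
  obtains fs :: "nat \<Rightarrow> 'g \<Rightarrow> complex" where "\<And>n. integrable \<mu> (fs n)"
    "\<And>n. (\<integral>\<^sup>+x. ennreal ((norm (fs n x))\<^sup>2) \<partial>\<mu>) < \<infinity>"
    "(\<lambda>n. \<integral>\<^sup>+x. ennreal ((norm (fs n x - \<psi> x))\<^sup>2) \<partial>\<mu>) \<longlonglongrightarrow> 0"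
    "(\<lambda>n. \<integral>\<^sup>+p. ennreal ((norm (of_real vol * zak (fs n) (fst p) (snd p) - Z (fst p) (snd p)))\<^sup>2) \<partial>(MD \<Otimes>\<^sub>M MC)) \<longlonglongrightarrow> 0"
proof -
  obtain fs :: "nat \<Rightarrow> 'g \<Rightarrow> complex" where fs: "\<And>n. integrable \<mu> (fs n)" "\<And>n. fs n \<in> L2 \<mu>"
    "(\<lambda>n. L2_dist2 \<mu> (fs n) \<psi>) \<longlonglongrightarrow> 0"
    "(\<lambda>n. \<integral>\<^sup>+p. indicator (D \<times> C) p * ennreal ((norm (zak_L1 \<mu> L C (fs n) (fst p) (snd p) - Z (fst p) (snd p)))\<^sup>2)
              \<partial>(\<nu> \<Otimes>\<^sub>M \<mu>)) \<longlonglongrightarrow> 0"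
    using isz unfolding is_zak_transform_def by blast
  show thesis
  proof (rule that[of fs])
    show "integrable \<mu> (fs n)" for n by (rule fs)
    show "(\<integral>\<^sup>+x. ennreal ((norm (fs n x))\<^sup>2) \<partial>\<mu>) < \<infinity>" for n using fs(2)[of n] by (simp add: L2_def)
    show "(\<lambda>n. \<integral>\<^sup>+x. ennreal ((norm (fs n x - \<psi> x))\<^sup>2) \<partial>\<mu>) \<longlonglongrightarrow> 0" using fs(3) by (simp add: L2_dist2_def)
    have "(\<integral>\<^sup>+p. indicator (D \<times> C) p * ennreal ((norm (zak_L1 \<mu> L C (fs n) (fst p) (snd p) - Z (fst p) (snd p)))\<^sup>2) \<partial>(\<nu> \<Otimes>\<^sub>M \<mu>))
      = (\<integral>\<^sup>+p. ennreal ((norm (of_real vol * zak (fs n) (fst p) (snd p) - Z (fst p) (snd p)))\<^sup>2) \<partial>(MD \<Otimes>\<^sub>M MC))" for n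
    proof -
      have "fs n \<in> borel_measurable borel" using borel_measurable_integrable[OF fs(1)[of n]] by simp
      then have "(\<lambda>p. zak (fs n) (fst p) (snd p)) \<in> borel_measurable (MD \<Otimes>\<^sub>M MC)" by (intro zak_measurable) auto
      then have [measurable]: "(\<lambda>p. zak (fs n) (fst p) (snd p)) \<in> borel_measurable (\<nu> \<Otimes>\<^sub>M \<mu>)"
        by (simp cong: measurable_cong_sets sets_pair_measure_cong)
      note [measurable] = Z_meas
      show ?thesis unfolding zak_L1_eq by (rule nn_integral_MD_MC) measurable
    qed
    then show "(\<lambda>n. \<integral>\<^sup>+p. ennreal ((norm (of_real vol * zak (fs n) (fst p) (snd p) - Z (fst p) (snd p)))\<^sup>2) \<partial>(MD \<Otimes>\<^sub>M MC)) \<longlonglongrightarrow> 0"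
      using fs(4) by simp
  qed
qed

lemma transl_poly_L2:
  assumes "transl_poly S \<psi> g t"
  shows "g \<in> borel_measurable borel" "(\<integral>\<^sup>+x. ennreal ((norm (g x))\<^sup>2) \<partial>\<mu>) < \<infinity>"
proof -
  obtain F a where F: "finite F" "F \<subseteq> S" "g = (\<lambda>y. \<Sum>l\<in>F. a l * \<psi> (y - l))"
    using assms unfolding transl_poly_def by blast
  show "g \<in> borel_measurable borel" unfolding F(3) by measurable
  obtain c :: real where c: "(\<integral>\<^sup>+y. ennreal ((norm (\<Sum>l\<in>F. a l * \<psi> (y - l)))\<^sup>2) \<partial>\<mu>) \<le> ennreal c * (\<integral>\<^sup>+y. ennreal ((norm (\<psi> y))\<^sup>2) \<partial>\<mu>)"
    using transl_sum_bound[OF F(1), of a] psi_meas by blast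
  have "ennreal c * (\<integral>\<^sup>+y. ennreal ((norm (\<psi> y))\<^sup>2) \<partial>\<mu>) < \<infinity>" using psi_fin by (simp add: ennreal_mult_less_top)
  then show "(\<integral>\<^sup>+x. ennreal ((norm (g x))\<^sup>2) \<partial>\<mu>) < \<infinity>" using c unfolding F(3) by (rule le_less_trans[rotated])
qed

definition zconst :: ennreal where "zconst = ennreal (vol\<^sup>2) * ennreal dvol"

lemma zconst: "0 < zconst" "zconst < top"
  using vol_pos dvol_pos by (auto simp: zconst_def ennreal_zero_less_mult_iff ennreal_mult_less_top)

text \<open>For the integrable approximants the symbol multiplies the Zak transform
  (\<open>zak_poly\<close>), so the identity is \<open>zak_isometry\<close>. Both sides pass to the
  limit: the symbol is bounded on characters, and \<open>transl_sum_bound\<close> controls the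
  combinations.\<close>

theorem weighted_isometry:
  assumes gt: "transl_poly L \<psi> g t"
  shows "(\<integral>\<^sup>+\<alpha>. ennreal ((norm (t \<alpha>))\<^sup>2) * weight \<alpha> \<partial>MD) = zconst * (\<integral>\<^sup>+x. ennreal ((norm (g x))\<^sup>2) \<partial>\<mu>)"
proof -
  obtain fs :: "nat \<Rightarrow> 'g \<Rightarrow> complex" where fs: "\<And>n. integrable \<mu> (fs n)"
    "\<And>n. (\<integral>\<^sup>+x. ennreal ((norm (fs n x))\<^sup>2) \<partial>\<mu>) < \<infinity>"
    "(\<lambda>n. \<integral>\<^sup>+x. ennreal ((norm (fs n x - \<psi> x))\<^sup>2) \<partial>\<mu>) \<longlonglongrightarrow> 0"
    "(\<lambda>n. \<integral>\<^sup>+p. ennreal ((norm (of_real vol * zak (fs n) (fst p) (snd p) - Z (fst p) (snd p)))\<^sup>2) \<partial>(MD \<Otimes>\<^sub>M MC)) \<longlonglongrightarrow> 0"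
    by (rule approximants) blast
  have fm [measurable]: "fs n \<in> borel_measurable borel" for n using borel_measurable_integrable[OF fs(1)[of n]] by simp
  obtain F a where F: "finite F" "F \<subseteq> L" "g = (\<lambda>y. \<Sum>l\<in>F. a l * \<psi> (y - l))" "t = (\<lambda>\<alpha>. \<Sum>l\<in>F. a l * \<alpha> (- l))"
    using gt unfolding transl_poly_def by blast
  obtain B where B: "B \<ge> 0" "\<And>\<alpha>. \<alpha> \<in> characters \<Longrightarrow> norm (t \<alpha>) \<le> B" using transl_poly_bounded[OF gt] by blast
  have gm [measurable]: "g \<in> borel_measurable borel" by (rule transl_poly_L2[OF gt])
  have tm [measurable]: "t \<in> borel_measurable MD" using transl_poly_measurable[OF gt] by (simp cong: measurable_cong_sets)
  have zm [measurable]: "(\<lambda>p. zak (fs n) (fst p) (snd p)) \<in> borel_measurable (MD \<Otimes>\<^sub>M MC)" for n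
    by (rule zak_measurable) (auto intro: fm)
  define gs where "gs n y = (\<Sum>l\<in>F. a l * fs n (y - l))" for n y
  have gsm [measurable]: "gs n \<in> borel_measurable borel" for n unfolding gs_def by measurable
  have gs_int: "integrable \<mu> (gs n)" for n
  proof -
    have "integrable \<mu> (\<lambda>y. fs n (y - l))" for l
      using integrable_translate[OF fm[of n], of "- l"] fs(1)[of n] by simp
    then show ?thesis unfolding gs_def by (intro Bochner_Integration.integrable_sum integrable_mult_right)
  qed
  define X where "X n p = t (fst p) * (of_real vol * zak (fs n) (fst p) (snd p))" for n p
  define Y where "Y p = t (fst p) * Z (fst p) (snd p)" for p
  have tfst [measurable]: "(\<lambda>p. t (fst p)) \<in> borel_measurable (MD \<Otimes>\<^sub>M MC)" by (rule measurable_compose[OF measurable_fst tm])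
  have Xm [measurable]: "X n \<in> borel_measurable (MD \<Otimes>\<^sub>M MC)" for n unfolding X_def by measurable
  have Ym [measurable]: "Y \<in> borel_measurable (MD \<Otimes>\<^sub>M MC)" unfolding Y_def by measurable
  have XY: "(\<lambda>n. \<integral>\<^sup>+p. ennreal ((norm (X n p - Y p))\<^sup>2) \<partial>(MD \<Otimes>\<^sub>M MC)) \<longlonglongrightarrow> 0"
  proof (rule tendsto_sandwich[where f="\<lambda>_. 0" and h="\<lambda>n. ennreal (B\<^sup>2) * (\<integral>\<^sup>+p. ennreal ((norm (of_real vol * zak (fs n) (fst p) (snd p) - Z (fst p) (snd p)))\<^sup>2) \<partial>(MD \<Otimes>\<^sub>M MC))"])
    have "(\<integral>\<^sup>+p. ennreal ((norm (X n p - Y p))\<^sup>2) \<partial>(MD \<Otimes>\<^sub>M MC)) \<le> ennreal (B\<^sup>2) * (\<integral>\<^sup>+p. ennreal ((norm (of_real vol * zak (fs n) (fst p) (snd p) - Z (fst p) (snd p)))\<^sup>2) \<partial>(MD \<Otimes>\<^sub>M MC))" for n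
    proof -
      have "(\<integral>\<^sup>+p. ennreal ((norm (X n p - Y p))\<^sup>2) \<partial>(MD \<Otimes>\<^sub>M MC)) \<le> (\<integral>\<^sup>+p. ennreal (B\<^sup>2) * ennreal ((norm (of_real vol * zak (fs n) (fst p) (snd p) - Z (fst p) (snd p)))\<^sup>2) \<partial>(MD \<Otimes>\<^sub>M MC))"
      proof (rule nn_integral_mono)
        fix p assume "p \<in> space (MD \<Otimes>\<^sub>M MC)"
        then have "fst p \<in> characters" by (auto simp: space_pair_measure)
        then have "(norm (t (fst p)))\<^sup>2 \<le> B\<^sup>2" using B by (intro power_mono) auto
        then have "(norm (X n p - Y p))\<^sup>2 \<le> B\<^sup>2 * (norm (of_real vol * zak (fs n) (fst p) (snd p) - Z (fst p) (snd p)))\<^sup>2"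
          unfolding X_def Y_def right_diff_distrib[symmetric] norm_mult power_mult_distrib by (rule mult_right_mono) simp
        then show "ennreal ((norm (X n p - Y p))\<^sup>2) \<le> ennreal (B\<^sup>2) * ennreal ((norm (of_real vol * zak (fs n) (fst p) (snd p) - Z (fst p) (snd p)))\<^sup>2)"
          by (simp add: ennreal_mult[symmetric] ennreal_leI)
      qed
      also have "\<dots> = ennreal (B\<^sup>2) * (\<integral>\<^sup>+p. ennreal ((norm (of_real vol * zak (fs n) (fst p) (snd p) - Z (fst p) (snd p)))\<^sup>2) \<partial>(MD \<Otimes>\<^sub>M MC))"
        by (rule nn_integral_cmult) measurable
      finally show ?thesis .
    qed
    then show "\<forall>\<^sub>F n in sequentially. (\<integral>\<^sup>+p. ennreal ((norm (X n p - Y p))\<^sup>2) \<partial>(MD \<Otimes>\<^sub>M MC)) \<le> ennreal (B\<^sup>2) * (\<integral>\<^sup>+p. ennreal ((norm (of_real vol * zak (fs n) (fst p) (snd p) - Z (fst p) (snd p)))\<^sup>2) \<partial>(MD \<Otimes>\<^sub>M MC))"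
      by simp
    show "(\<lambda>n. ennreal (B\<^sup>2) * (\<integral>\<^sup>+p. ennreal ((norm (of_real vol * zak (fs n) (fst p) (snd p) - Z (fst p) (snd p)))\<^sup>2) \<partial>(MD \<Otimes>\<^sub>M MC))) \<longlonglongrightarrow> 0"
      using ennreal_tendsto_cmult[OF _ fs(4), of "ennreal (B\<^sup>2)"] by simp
  qed auto
  have Xnorm: "(\<integral>\<^sup>+p. ennreal ((norm (X n p))\<^sup>2) \<partial>(MD \<Otimes>\<^sub>M MC)) = zconst * (\<integral>\<^sup>+x. ennreal ((norm (gs n x))\<^sup>2) \<partial>\<mu>)" for n
  proof -
    have zg [measurable]: "(\<lambda>p. zak (gs n) (fst p) (snd p)) \<in> borel_measurable (MD \<Otimes>\<^sub>M MC)"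
      by (rule zak_measurable) (auto intro: gsm)
    have "(\<integral>\<^sup>+p. ennreal ((norm (X n p))\<^sup>2) \<partial>(MD \<Otimes>\<^sub>M MC)) = (\<integral>\<^sup>+\<alpha>. (\<integral>\<^sup>+x. ennreal ((norm (X n (\<alpha>, x)))\<^sup>2) \<partial>MC) \<partial>MD)"
      by (rule MC.nn_integral_fst[symmetric]) measurable
    also have "\<dots> = (\<integral>\<^sup>+\<alpha>. (\<integral>\<^sup>+x. ennreal (vol\<^sup>2) * ennreal ((norm (zak (gs n) \<alpha> x))\<^sup>2) \<partial>MC) \<partial>MD)"
    proof (rule nn_integral_cong)
      fix \<alpha> assume "\<alpha> \<in> space MD"
      then have \<alpha>: "\<alpha> \<in> characters" by simp
      show "(\<integral>\<^sup>+x. ennreal ((norm (X n (\<alpha>, x)))\<^sup>2) \<partial>MC) = (\<integral>\<^sup>+x. ennreal (vol\<^sup>2) * ennreal ((norm (zak (gs n) \<alpha> x))\<^sup>2) \<partial>MC)"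
      proof (rule nn_integral_cong_AE, rule AE_mp[OF AE_summable[OF fs(1)[of n]]], intro AE_I2 impI)
        fix x assume i: "integrable (count_space L) (\<lambda>l. fs n (x + l))"
        have "zak (gs n) \<alpha> x = t \<alpha> * zak (fs n) \<alpha> x"
          unfolding gs_def F(4) by (rule zak_poly[OF \<alpha> i F(1,2)])
        then have "X n (\<alpha>, x) = of_real vol * zak (gs n) \<alpha> x" by (simp add: X_def mult_ac)
        then show "ennreal ((norm (X n (\<alpha>, x)))\<^sup>2) = ennreal (vol\<^sup>2) * ennreal ((norm (zak (gs n) \<alpha> x))\<^sup>2)"
          using vol_pos by (simp add: norm_mult power_mult_distrib ennreal_mult)
      qed
    qed
    also have "\<dots> = (\<integral>\<^sup>+p. ennreal (vol\<^sup>2) * ennreal ((norm (zak (gs n) (fst p) (snd p)))\<^sup>2) \<partial>(MD \<Otimes>\<^sub>M MC))"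
      by (subst MC.nn_integral_fst[symmetric]) auto
    also have "\<dots> = ennreal (vol\<^sup>2) * (\<integral>\<^sup>+p. ennreal ((norm (zak (gs n) (fst p) (snd p)))\<^sup>2) \<partial>(MD \<Otimes>\<^sub>M MC))"
      by (rule nn_integral_cmult) measurable
    also have "\<dots> = zconst * (\<integral>\<^sup>+x. ennreal ((norm (gs n x))\<^sup>2) \<partial>\<mu>)"
      by (simp add: zak_isometry[OF gs_int] zconst_def mult.assoc)
    finally show ?thesis .
  qed
  obtain c :: real where c: "0 \<le> c" "\<And>h. h \<in> borel_measurable borel \<Longrightarrow>
    (\<integral>\<^sup>+y. ennreal ((norm (\<Sum>l\<in>F. a l * h (y - l)))\<^sup>2) \<partial>\<mu>) \<le> ennreal c * (\<integral>\<^sup>+y. ennreal ((norm (h y))\<^sup>2) \<partial>\<mu>)"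
    using transl_sum_bound[OF F(1), of a] by blast
  have gs_fin: "(\<integral>\<^sup>+x. ennreal ((norm (gs n x))\<^sup>2) \<partial>\<mu>) < \<infinity>" for n
  proof -
    have "(\<integral>\<^sup>+x. ennreal ((norm (gs n x))\<^sup>2) \<partial>\<mu>) \<le> ennreal c * (\<integral>\<^sup>+y. ennreal ((norm (fs n y))\<^sup>2) \<partial>\<mu>)"
      unfolding gs_def by (rule c(2)[OF fm])
    also have "\<dots> < \<infinity>" using fs(2)[of n] by (simp add: ennreal_mult_less_top)
    finally show ?thesis .
  qed
  have gs_lim: "(\<lambda>n. \<integral>\<^sup>+x. ennreal ((norm (gs n x - g x))\<^sup>2) \<partial>\<mu>) \<longlonglongrightarrow> 0"
  proof (rule tendsto_sandwich[where f="\<lambda>_. 0" and h="\<lambda>n. ennreal c * (\<integral>\<^sup>+x. ennreal ((norm (fs n x - \<psi> x))\<^sup>2) \<partial>\<mu>)"])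
    have "(\<integral>\<^sup>+x. ennreal ((norm (gs n x - g x))\<^sup>2) \<partial>\<mu>) \<le> ennreal c * (\<integral>\<^sup>+x. ennreal ((norm (fs n x - \<psi> x))\<^sup>2) \<partial>\<mu>)" for n
      using c(2)[of "\<lambda>x. fs n x - \<psi> x"] unfolding gs_def F(3) by (simp add: sum_subtractf[symmetric] right_diff_distrib[symmetric])
    then show "\<forall>\<^sub>F n in sequentially. (\<integral>\<^sup>+x. ennreal ((norm (gs n x - g x))\<^sup>2) \<partial>\<mu>) \<le> ennreal c * (\<integral>\<^sup>+x. ennreal ((norm (fs n x - \<psi> x))\<^sup>2) \<partial>\<mu>)" by simp
    show "(\<lambda>n. ennreal c * (\<integral>\<^sup>+x. ennreal ((norm (fs n x - \<psi> x))\<^sup>2) \<partial>\<mu>)) \<longlonglongrightarrow> 0"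
      using ennreal_tendsto_cmult[OF _ fs(3), of "ennreal c"] by simp
  qed auto
  have Yfin: "(\<integral>\<^sup>+p. ennreal ((norm (Y p))\<^sup>2) \<partial>(MD \<Otimes>\<^sub>M MC)) < \<infinity>"
  proof -
    have "eventually (\<lambda>n. (\<integral>\<^sup>+p. ennreal ((norm (X n p - Y p))\<^sup>2) \<partial>(MD \<Otimes>\<^sub>M MC)) < \<infinity>) sequentially"
      by (rule order_tendstoD[OF XY]) simp
    then obtain n where "(\<integral>\<^sup>+p. ennreal ((norm (X n p - Y p))\<^sup>2) \<partial>(MD \<Otimes>\<^sub>M MC)) < \<infinity>"
      by (auto simp: eventually_sequentially)
    moreover have "(\<integral>\<^sup>+p. ennreal ((norm (X n p))\<^sup>2) \<partial>(MD \<Otimes>\<^sub>M MC)) < \<infinity>"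
      using gs_fin[of n] zconst by (simp add: Xnorm ennreal_mult_less_top)
    ultimately show ?thesis by (intro nn_L2_finite[of Y _ "X n"]) (auto simp: norm_minus_commute)
  qed
  have "(\<lambda>n. \<integral>\<^sup>+p. ennreal ((norm (X n p))\<^sup>2) \<partial>(MD \<Otimes>\<^sub>M MC)) \<longlonglongrightarrow> (\<integral>\<^sup>+p. ennreal ((norm (Y p))\<^sup>2) \<partial>(MD \<Otimes>\<^sub>M MC))"
    by (rule nn_L2_tendsto[OF Xm Ym Yfin XY])
  moreover have "(\<lambda>n. \<integral>\<^sup>+p. ennreal ((norm (X n p))\<^sup>2) \<partial>(MD \<Otimes>\<^sub>M MC)) \<longlonglongrightarrow> zconst * (\<integral>\<^sup>+x. ennreal ((norm (g x))\<^sup>2) \<partial>\<mu>)"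
    unfolding Xnorm
    by (intro ennreal_tendsto_cmult zconst nn_L2_tendsto gs_lim transl_poly_L2(2)[OF gt]) measurable
  ultimately have "(\<integral>\<^sup>+p. ennreal ((norm (Y p))\<^sup>2) \<partial>(MD \<Otimes>\<^sub>M MC)) = zconst * (\<integral>\<^sup>+x. ennreal ((norm (g x))\<^sup>2) \<partial>\<mu>)"
    by (rule LIMSEQ_unique)
  moreover have "(\<integral>\<^sup>+p. ennreal ((norm (Y p))\<^sup>2) \<partial>(MD \<Otimes>\<^sub>M MC)) = (\<integral>\<^sup>+\<alpha>. ennreal ((norm (t \<alpha>))\<^sup>2) * weight \<alpha> \<partial>MD)"
  proof -
    have "(\<integral>\<^sup>+p. ennreal ((norm (Y p))\<^sup>2) \<partial>(MD \<Otimes>\<^sub>M MC)) = (\<integral>\<^sup>+\<alpha>. (\<integral>\<^sup>+x. ennreal ((norm (Y (\<alpha>, x)))\<^sup>2) \<partial>MC) \<partial>MD)"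
      by (rule MC.nn_integral_fst[symmetric]) measurable
    also have "\<dots> = (\<integral>\<^sup>+\<alpha>. ennreal ((norm (t \<alpha>))\<^sup>2) * weight \<alpha> \<partial>MD)"
    proof (rule nn_integral_cong)
      fix \<alpha> assume "\<alpha> \<in> space MD"
      then have [measurable]: "Z \<alpha> \<in> borel_measurable borel" using Z_meas_x[of \<alpha>] by simp
      show "(\<integral>\<^sup>+x. ennreal ((norm (Y (\<alpha>, x)))\<^sup>2) \<partial>MC) = ennreal ((norm (t \<alpha>))\<^sup>2) * weight \<alpha>"
        unfolding weight_def by (subst nn_integral_cmult[symmetric]) (auto simp: Y_def norm_mult power_mult_distrib ennreal_mult)
    qed
    finally show ?thesis .
  qed
  ultimately show ?thesis by simp
qed

lemma weight_finite: "(\<integral>\<^sup>+\<alpha>. weight \<alpha> \<partial>MD) < \<infinity>"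
proof -
  have "transl_poly L \<psi> (\<lambda>y. 1 * \<psi> (y - 0)) (\<lambda>\<alpha>. 1 * \<alpha> (- 0))" by (rule transl_poly_monomial[OF L0])
  from weighted_isometry[OF this] have "(\<integral>\<^sup>+\<alpha>. ennreal ((norm (\<alpha> 0))\<^sup>2) * weight \<alpha> \<partial>MD) = zconst * (\<integral>\<^sup>+x. ennreal ((norm (\<psi> x))\<^sup>2) \<partial>\<mu>)"
    by simp
  moreover have "(\<integral>\<^sup>+\<alpha>. ennreal ((norm (\<alpha> 0))\<^sup>2) * weight \<alpha> \<partial>MD) = (\<integral>\<^sup>+\<alpha>. weight \<alpha> \<partial>MD)"
    by (rule nn_integral_cong) (simp add: characters_norm)
  ultimately show ?thesis using psi_fin zconst by (simp add: ennreal_mult_less_top)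
qed

end

section \<open>Approximating the support of the weight by symbols\<close>

context zak_transform
begin

text \<open>Agreement with a symbol is asked on characters only, because products and conjugates of
  symbols are again symbols only there.\<close>

definition trig :: "(('g \<Rightarrow> complex) \<Rightarrow> complex) set" where
  "trig = {t \<in> borel_measurable dual_borel. \<exists>g t'. transl_poly L \<psi> g t' \<and> (\<forall>\<alpha>\<in>characters. t \<alpha> = t' \<alpha>)}"

lemma trigI:
  "t \<in> borel_measurable dual_borel \<Longrightarrow> transl_poly L \<psi> g t' \<Longrightarrow> (\<And>\<alpha>. \<alpha> \<in> characters \<Longrightarrow> t \<alpha> = t' \<alpha>) \<Longrightarrow> t \<in> trig"
  unfolding trig_def by blast

lemma trig_measurable: "t \<in> trig \<Longrightarrow> t \<in> borel_measurable dual_borel"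
  by (simp add: trig_def)

lemma trig_eval: "l \<in> L \<Longrightarrow> (\<lambda>\<alpha>. \<alpha> (- l)) \<in> trig"
  using transl_poly_monomial[of l L \<psi> 1] unfolding trig_def by auto

lemma trig_algebra:
  assumes W [measurable]: "W \<in> borel_measurable \<nu>" and fin: "(\<integral>\<^sup>+\<alpha>. W \<alpha> \<partial>MD) < \<infinity>"
  shows "function_algebra (density MD W) trig"
proof (intro function_algebra.intro finite_measureI function_algebra_axioms.intro)
  have W' [measurable]: "W \<in> borel_measurable MD" using W by (simp cong: measurable_cong_sets)
  have "emeasure (density MD W) (space (density MD W)) = (\<integral>\<^sup>+\<alpha>. W \<alpha> * indicator (space MD) \<alpha> \<partial>MD)"
    using sets.top[of dual_borel] by (subst emeasure_density) auto
  also have "\<dots> = (\<integral>\<^sup>+\<alpha>. W \<alpha> \<partial>MD)" by (intro nn_integral_cong) simp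
  finally show "emeasure (density MD W) (space (density MD W)) \<noteq> \<infinity>" using fin by simp
next
  fix t assume t: "t \<in> trig"
  then obtain g t' where t': "transl_poly L \<psi> g t'" "\<And>\<alpha>. \<alpha> \<in> characters \<Longrightarrow> t \<alpha> = t' \<alpha>" unfolding trig_def by blast
  show "t \<in> borel_measurable (density MD W)" using t by (simp add: trig_def cong: measurable_cong_sets)
  show "\<exists>B. \<forall>x\<in>space (density MD W). norm (t x) \<le> B" using transl_poly_bounded[OF t'(1)] t'(2) by auto
  show "(\<lambda>x. cnj (t x)) \<in> trig"
  proof -
    obtain F a where F: "finite F" "F \<subseteq> L" "t' = (\<lambda>\<alpha>. \<Sum>l\<in>F. a l * \<alpha> (- l))"
      using t'(1) unfolding transl_poly_def by blast
    have "transl_poly L \<psi> (\<lambda>y. \<Sum>l\<in>uminus ` F. cnj (a (- l)) * \<psi> (y - l)) (\<lambda>\<alpha>. \<Sum>l\<in>uminus ` F. cnj (a (- l)) * \<alpha> (- l))"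
      by (rule transl_polyI) (use F Luminus in auto)
    moreover have "cnj (t \<alpha>) = (\<Sum>l\<in>uminus ` F. cnj (a (- l)) * \<alpha> (- l))" if \<alpha>: "\<alpha> \<in> characters" for \<alpha>
      by (subst sum.reindex) (auto simp: inj_on_def t'(2)[OF \<alpha>] F(3) characters_uminus[OF \<alpha>])
    moreover have "(\<lambda>x. cnj (t x)) \<in> borel_measurable dual_borel"
      using t by (auto simp: trig_def intro: measurable_compose[OF _ borel_measurable_continuous_onI[OF continuous_on_cnj[OF continuous_on_id]]])
    ultimately show ?thesis unfolding trig_def by blast
  qed
  fix s assume s: "s \<in> trig"
  then obtain h s' where s': "transl_poly L \<psi> h s'" "\<And>\<alpha>. \<alpha> \<in> characters \<Longrightarrow> s \<alpha> = s' \<alpha>" unfolding trig_def by blast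
  show "(\<lambda>x. s x + t x) \<in> trig"
    by (rule trigI[OF _ transl_poly_add[OF s'(1) t'(1)]]) (use s t s'(2) t'(2) in \<open>auto intro: borel_measurable_add dest: trig_measurable\<close>)
  obtain g'' t'' where p: "transl_poly L \<psi> g'' t''" "\<And>\<alpha>. \<alpha> \<in> characters \<Longrightarrow> t'' \<alpha> = s' \<alpha> * t' \<alpha>"
    using transl_poly_mult[OF s'(1) t'(1) Lplus] by blast
  show "(\<lambda>x. s x * t x) \<in> trig"
    by (rule trigI[OF _ p(1)]) (use s t s'(2) t'(2) p(2) in \<open>auto intro: borel_measurable_times dest: trig_measurable\<close>)
next
  fix c :: complex
  show "(\<lambda>x. c) \<in> trig"
    using transl_poly_monomial[OF L0, of \<psi> c] unfolding trig_def by (auto simp: characters_0 intro!: exI)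
qed

text \<open>Fibre norms of Zak transforms of the approximants. They are measurable for every
  sigma-algebra that measures the evaluations at points of \<open>L\<close>, a property the chosen
  representative \<open>Z\<close> itself need not have.\<close>

lemma weight_as_limit:
  obtains wn :: "nat \<Rightarrow> ('g \<Rightarrow> complex) \<Rightarrow> ennreal" where
    "\<And>n N. (\<And>l. l \<in> L \<Longrightarrow> (\<lambda>\<alpha>. \<alpha> (- l)) \<in> borel_measurable N) \<Longrightarrow> wn n \<in> borel_measurable N"
    "AE \<alpha> in MD. (\<lambda>n. wn n \<alpha>) \<longlonglongrightarrow> weight \<alpha>"
proof -
  obtain fs :: "nat \<Rightarrow> 'g \<Rightarrow> complex" where fs: "\<And>n. integrable \<mu> (fs n)"
    "(\<lambda>n. \<integral>\<^sup>+p. ennreal ((norm (of_real vol * zak (fs n) (fst p) (snd p) - Z (fst p) (snd p)))\<^sup>2) \<partial>(MD \<Otimes>\<^sub>M MC)) \<longlonglongrightarrow> 0"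
    by (rule approximants) blast
  have fm [measurable]: "fs n \<in> borel_measurable borel" for n using borel_measurable_integrable[OF fs(1)[of n]] by simp
  have zm: "(\<lambda>p. zak (fs n) (fst p) (snd p)) \<in> borel_measurable (N \<Otimes>\<^sub>M MC)"
    if "\<And>l. l \<in> L \<Longrightarrow> (\<lambda>\<alpha>. \<alpha> (- l)) \<in> borel_measurable N" for n N
    by (rule zak_measurable[OF that fm])
  have zmD [measurable]: "(\<lambda>p. zak (fs n) (fst p) (snd p)) \<in> borel_measurable (MD \<Otimes>\<^sub>M MC)" for n
    by (rule zm) auto
  define W where "W n \<alpha> = (\<integral>\<^sup>+x. ennreal ((norm (of_real vol * zak (fs n) \<alpha> x))\<^sup>2) \<partial>MC)" for n \<alpha>
  define v where "v n \<alpha> = (\<integral>\<^sup>+x. ennreal ((norm (of_real vol * zak (fs n) \<alpha> x - Z \<alpha> x))\<^sup>2) \<partial>MC)" for n \<alpha>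
  have Wm: "W n \<in> borel_measurable N" if "\<And>l. l \<in> L \<Longrightarrow> (\<lambda>\<alpha>. \<alpha> (- l)) \<in> borel_measurable N" for n N
  proof -
    note [measurable] = zm[OF that]
    have "(\<lambda>p. ennreal ((norm (of_real vol * zak (fs n) (fst p) (snd p)))\<^sup>2)) \<in> borel_measurable (N \<Otimes>\<^sub>M MC)" by measurable
    from MC.borel_measurable_nn_integral_fst[OF this] show ?thesis by (simp add: W_def[abs_def])
  qed
  have vp: "(\<lambda>p. ennreal ((norm (of_real vol * zak (fs n) (fst p) (snd p) - Z (fst p) (snd p)))\<^sup>2)) \<in> borel_measurable (MD \<Otimes>\<^sub>M MC)" for n
    by measurable
  have vm [measurable]: "v n \<in> borel_measurable MD" for n
    using MC.borel_measurable_nn_integral_fst[OF vp[of n]] by (simp add: v_def[abs_def])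
  have vint: "(\<integral>\<^sup>+p. ennreal ((norm (of_real vol * zak (fs n) (fst p) (snd p) - Z (fst p) (snd p)))\<^sup>2) \<partial>(MD \<Otimes>\<^sub>M MC)) = (\<integral>\<^sup>+\<alpha>. v n \<alpha> \<partial>MD)" for n
    using MC.nn_integral_fst[OF vp[of n]] by (simp add: v_def)
  have v0: "(\<lambda>n. \<integral>\<^sup>+\<alpha>. v n \<alpha> \<partial>MD) \<longlonglongrightarrow> 0" using fs(2) by (simp only: vint)
  have "eventually (\<lambda>n. (\<integral>\<^sup>+\<alpha>. v n \<alpha> \<partial>MD) < \<infinity>) sequentially" by (rule order_tendstoD[OF v0]) simp
  then obtain N where N: "\<And>n. n \<ge> N \<Longrightarrow> (\<integral>\<^sup>+\<alpha>. v n \<alpha> \<partial>MD) < \<infinity>" by (auto simp: eventually_sequentially)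
  \<comment> \<open>From index \<open>N\<close> on the integrals of \<open>v\<close> are finite, so
    \<open>v\<close> is a real function up to null sets, and its L1 convergence to 0 yields a
    subsequence converging almost everywhere.\<close>
  define u where "u n \<alpha> = enn2real (v (n + N) \<alpha>)" for n \<alpha>
  have vfin: "AE \<alpha> in MD. v (n + N) \<alpha> \<noteq> \<infinity>" for n
    by (rule nn_integral_PInf_AE[OF vm]) (use N[of "n + N"] in simp)
  have uv: "AE \<alpha> in MD. ennreal (u n \<alpha>) = v (n + N) \<alpha>" for n
    using vfin[of n] by (auto elim!: eventually_mono simp: u_def less_top)
  have um [measurable]: "u n \<in> borel_measurable MD" for n unfolding u_def by measurable
  have unn: "(\<integral>\<^sup>+\<alpha>. ennreal (u n \<alpha>) \<partial>MD) = (\<integral>\<^sup>+\<alpha>. v (n + N) \<alpha> \<partial>MD)" for n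
    by (rule nn_integral_cong_AE[OF uv])
  have ui: "integrable MD (u n)" for n
    using N[of "n + N"] by (intro integrableI_nonneg) (auto simp: unn, simp add: u_def)
  have ul: "(\<lambda>n. \<integral>\<alpha>. norm (u n \<alpha>) \<partial>MD) \<longlonglongrightarrow> 0"
  proof -
    have "(\<integral>\<alpha>. norm (u n \<alpha>) \<partial>MD) = enn2real (\<integral>\<^sup>+\<alpha>. v (n + N) \<alpha> \<partial>MD)" for n
    proof -
      have "(\<integral>\<alpha>. norm (u n \<alpha>) \<partial>MD) = (\<integral>\<alpha>. u n \<alpha> \<partial>MD)" by (simp add: u_def)
      also have "\<dots> = enn2real (\<integral>\<^sup>+\<alpha>. ennreal (u n \<alpha>) \<partial>MD)" by (rule integral_eq_nn_integral) (auto simp: u_def)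
      finally show ?thesis by (simp add: unn)
    qed
    moreover have "(\<lambda>n. enn2real (\<integral>\<^sup>+\<alpha>. v (n + N) \<alpha> \<partial>MD)) \<longlonglongrightarrow> enn2real 0"
      using LIMSEQ_ignore_initial_segment[OF v0, of N] by (intro tendsto_enn2real) auto
    ultimately show ?thesis by simp
  qed
  obtain r :: "nat \<Rightarrow> nat" where r: "strict_mono r" "AE \<alpha> in MD. (\<lambda>n. u (r n) \<alpha>) \<longlonglongrightarrow> 0"
    using tendsto_L1_AE_subseq[OF ui ul] by blast
  have uvall: "AE \<alpha> in MD. \<forall>n. ennreal (u n \<alpha>) = v (n + N) \<alpha>" using uv by (simp add: AE_all_countable)
  have wtfin: "AE \<alpha> in MD. weight \<alpha> \<noteq> \<infinity>"
    by (rule nn_integral_PInf_AE) (use weight_finite weight_meas in \<open>auto cong: measurable_cong_sets\<close>)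
  show thesis
  proof (rule that[of "\<lambda>n. W (r n + N)"])
    show "W (r n + N) \<in> borel_measurable N'" if "\<And>l. l \<in> L \<Longrightarrow> (\<lambda>\<alpha>. \<alpha> (- l)) \<in> borel_measurable N'" for n N'
      by (rule Wm[OF that])
    have "AE \<alpha> in MD. \<alpha> \<in> characters" using AE_space[of MD] by simp
    with r(2) uvall wtfin show "AE \<alpha> in MD. (\<lambda>n. W (r n + N) \<alpha>) \<longlonglongrightarrow> weight \<alpha>"
    proof (eventually_elim)
      case (elim \<alpha>)
      have [measurable]: "Z \<alpha> \<in> borel_measurable MC"
        using Z_meas_x[OF elim(4)] by (simp cong: measurable_cong_sets)
      have zx [measurable]: "zak (fs n) \<alpha> \<in> borel_measurable MC" for n
        using measurable_Pair2[OF zmD, of \<alpha> n] elim(4) by simp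
      have "(\<lambda>n. ennreal (u (r n) \<alpha>)) \<longlonglongrightarrow> ennreal 0" by (rule tendsto_ennrealI[OF elim(1)])
      then have "(\<lambda>n. v (r n + N) \<alpha>) \<longlonglongrightarrow> 0" using elim(2) by simp
      then show ?case
        unfolding v_def W_def weight_def using elim(3)
        by (intro nn_L2_tendsto) (auto simp: weight_def less_top)
    qed
  qed
qed

text \<open>The support belongs to \<open>weight\<close>, but the approximation is measured by an
  arbitrary integrable \<open>W\<close>; the converse implication needs a periodised weight in that
  place.\<close>

lemma support_approx:
  assumes W [measurable]: "W \<in> borel_measurable \<nu>" and fin: "(\<integral>\<^sup>+\<alpha>. W \<alpha> \<partial>MD) < \<infinity>" and e: "e > 0"
  shows "\<exists>g t. transl_poly L \<psi> g t \<and>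
    (\<integral>\<^sup>+\<alpha>. W \<alpha> * ennreal ((norm (indicator {\<alpha>. weight \<alpha> \<noteq> 0} \<alpha> - t \<alpha>))\<^sup>2) \<partial>MD) < ennreal e"
proof -
  interpret A: function_algebra "density MD W" trig by (rule trig_algebra[OF W fin])
  have W' [measurable]: "W \<in> borel_measurable MD" using W by (simp cong: measurable_cong_sets)
  obtain wn :: "nat \<Rightarrow> ('g \<Rightarrow> complex) \<Rightarrow> ennreal" where wn:
    "\<And>n N. (\<And>l. l \<in> L \<Longrightarrow> (\<lambda>\<alpha>. \<alpha> (- l)) \<in> borel_measurable N) \<Longrightarrow> wn n \<in> borel_measurable N"
    "AE \<alpha> in MD. (\<lambda>n. wn n \<alpha>) \<longlonglongrightarrow> weight \<alpha>"
    by (rule weight_as_limit) blast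
  \<comment> \<open>The lower limit is defined everywhere and stays measurable for
    \<open>A.approx_space\<close>; it equals the weight almost everywhere, so its support may
    replace that of the weight.\<close>
  define w' where "w' \<alpha> = liminf (\<lambda>n. wn n \<alpha>)" for \<alpha>
  have wnA [measurable]: "wn n \<in> borel_measurable A.approx_space" for n
    by (rule wn(1)) (rule A.approx_measurable_T[OF trig_eval])
  have w'A [measurable]: "w' \<in> borel_measurable A.approx_space" unfolding w'_def by measurable
  have "{\<alpha> \<in> space A.approx_space. w' \<alpha> \<noteq> 0} \<in> sets A.approx_space" by measurable
  then have E: "{\<alpha> \<in> characters. w' \<alpha> \<noteq> 0} \<in> sets A.approx_space" by simp
  obtain t where t: "t \<in> trig" "(\<integral>\<^sup>+\<alpha>. ennreal ((norm (indicator {\<alpha> \<in> characters. w' \<alpha> \<noteq> 0} \<alpha> - t \<alpha>))\<^sup>2) \<partial>density MD W) < ennreal e"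
    using A.approx_indicator[OF E e] by blast
  obtain g t' where t': "transl_poly L \<psi> g t'" "\<And>\<alpha>. \<alpha> \<in> characters \<Longrightarrow> t \<alpha> = t' \<alpha>" using t(1) unfolding trig_def by blast
  have tm: "t \<in> borel_measurable MD" using t(1) by (simp add: trig_def cong: measurable_cong_sets)
  have Em: "{\<alpha> \<in> characters. w' \<alpha> \<noteq> 0} \<in> sets MD" using E unfolding A.sets_approx by (simp add: A.approx_sets_def)
  have "AE \<alpha> in MD. \<alpha> \<in> characters" using AE_space[of MD] by simp
  with wn(2) have "AE \<alpha> in MD. w' \<alpha> = weight \<alpha> \<and> \<alpha> \<in> characters"
    by eventually_elim (auto simp: w'_def lim_imp_Liminf)
  then have "AE \<alpha> in MD. W \<alpha> * ennreal ((norm (indicator {\<alpha>. weight \<alpha> \<noteq> 0} \<alpha> - t' \<alpha>))\<^sup>2)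
    = W \<alpha> * ennreal ((norm (indicator {\<alpha> \<in> characters. w' \<alpha> \<noteq> 0} \<alpha> - t \<alpha>))\<^sup>2)"
    by (rule eventually_mono) (auto simp: indicator_def t'(2))
  then have "(\<integral>\<^sup>+\<alpha>. W \<alpha> * ennreal ((norm (indicator {\<alpha>. weight \<alpha> \<noteq> 0} \<alpha> - t' \<alpha>))\<^sup>2) \<partial>MD)
    = (\<integral>\<^sup>+\<alpha>. W \<alpha> * ennreal ((norm (indicator {\<alpha> \<in> characters. w' \<alpha> \<noteq> 0} \<alpha> - t \<alpha>))\<^sup>2) \<partial>MD)"
    by (rule nn_integral_cong_AE)
  also have "\<dots> = (\<integral>\<^sup>+\<alpha>. ennreal ((norm (indicator {\<alpha> \<in> characters. w' \<alpha> \<noteq> 0} \<alpha> - t \<alpha>))\<^sup>2) \<partial>density MD W)"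
    by (subst nn_integral_density) (use tm Em in auto)
  finally show ?thesis using t(2) t'(1) by (intro exI[of _ g] exI[of _ t'] conjI) simp_all
qed

end

section \<open>The equivalence\<close>

context zak_transform
begin

lemma weight_shift_meas: "\<beta> \<in> characters \<Longrightarrow> (\<lambda>\<alpha>. weight (char_add \<alpha> \<beta>)) \<in> borel_measurable \<nu>"
  by (rule measurable_compose[OF measurable_char_add_nu weight_meas])

text \<open>For fixed \<alpha>, Tonelli factors the integral over \<open>x\<close> and
  \<open>y\<close> of the squared modulus of the product into the product of the two weights. A
  nonnegative integral vanishes exactly when its integrand vanishes almost everywhere.\<close>

lemma orthogonality_iff_weights:
  assumes \<beta>: "\<beta>1 \<in> characters" "\<beta>2 \<in> characters" and Q: "Q \<in> sets \<nu>"
  shows "(AE p in \<nu> \<Otimes>\<^sub>M (\<mu> \<Otimes>\<^sub>M \<mu>). (case p of (\<alpha>, x, y) \<Rightarrow> \<alpha> \<in> Q \<and> x \<in> C \<and> y \<in> C \<longrightarrow>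
            Z (char_add \<alpha> \<beta>1) x * Z (char_add \<alpha> \<beta>2) y = 0))
     \<longleftrightarrow> (AE \<alpha> in \<nu>. \<alpha> \<in> Q \<longrightarrow> weight (char_add \<alpha> \<beta>1) * weight (char_add \<alpha> \<beta>2) = 0)"
proof -
  interpret MM: pair_sigma_finite \<mu> \<mu> ..
  have C [measurable]: "C \<in> sets borel" using T.tile_sets by simp
  define f where "f \<beta> \<alpha> x = indicator C x * ennreal ((norm (Z (char_add \<alpha> \<beta>) x))\<^sup>2)" for \<beta> \<alpha> x
  define F where "F p = indicator Q (fst p) * (f \<beta>1 (fst p) (fst (snd p)) * f \<beta>2 (fst p) (snd (snd p)))" for p
  have fm: "(\<lambda>p. f \<beta> (fst p) (snd p)) \<in> borel_measurable (\<nu> \<Otimes>\<^sub>M \<mu>)" if b: "\<beta> \<in> characters" for \<beta>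
  proof -
    have "(\<lambda>p. (char_add (fst p) \<beta>, snd p)) \<in> measurable (\<nu> \<Otimes>\<^sub>M \<mu>) (\<nu> \<Otimes>\<^sub>M \<mu>)"
      using measurable_compose[OF measurable_fst measurable_char_add_nu[OF b]] by (intro measurable_Pair) auto
    from measurable_compose[OF this Z_meas] have [measurable]: "(\<lambda>p. Z (char_add (fst p) \<beta>) (snd p)) \<in> borel_measurable (\<nu> \<Otimes>\<^sub>M \<mu>)" by simp
    show ?thesis unfolding f_def by measurable
  qed
  have Fm [measurable]: "F \<in> borel_measurable (\<nu> \<Otimes>\<^sub>M (\<mu> \<Otimes>\<^sub>M \<mu>))"
  proof -
    have 1: "(\<lambda>p. f \<beta>1 (fst p) (fst (snd p))) \<in> borel_measurable (\<nu> \<Otimes>\<^sub>M (\<mu> \<Otimes>\<^sub>M \<mu>))"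
      using measurable_compose[OF _ fm[OF \<beta>(1)], of "\<lambda>p. (fst p, fst (snd p))" "\<nu> \<Otimes>\<^sub>M (\<mu> \<Otimes>\<^sub>M \<mu>)"] by simp
    have 2: "(\<lambda>p. f \<beta>2 (fst p) (snd (snd p))) \<in> borel_measurable (\<nu> \<Otimes>\<^sub>M (\<mu> \<Otimes>\<^sub>M \<mu>))"
      using measurable_compose[OF _ fm[OF \<beta>(2)], of "\<lambda>p. (fst p, snd (snd p))" "\<nu> \<Otimes>\<^sub>M (\<mu> \<Otimes>\<^sub>M \<mu>)"] by simp
    have 3: "(\<lambda>p. indicator Q (fst p) :: ennreal) \<in> borel_measurable (\<nu> \<Otimes>\<^sub>M (\<mu> \<Otimes>\<^sub>M \<mu>))"
      using Q by (intro measurable_compose[OF measurable_fst]) auto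
    show ?thesis unfolding F_def by (intro borel_measurable_times_ennreal 1 2 3)
  qed
  have fx: "f \<beta> \<alpha> \<in> borel_measurable \<mu>" "(\<integral>\<^sup>+x. f \<beta> \<alpha> x \<partial>\<mu>) = weight (char_add \<alpha> \<beta>)" if "\<beta> \<in> characters" "\<alpha> \<in> characters" for \<alpha> \<beta>
  proof -
    have [measurable]: "Z (char_add \<alpha> \<beta>) \<in> borel_measurable \<mu>" using that by (intro Z_meas_x char_add_characters)
    show "f \<beta> \<alpha> \<in> borel_measurable \<mu>" unfolding f_def by measurable
    show "(\<integral>\<^sup>+x. f \<beta> \<alpha> x \<partial>\<mu>) = weight (char_add \<alpha> \<beta>)"
      unfolding f_def weight_def by (rule T.nn_integral_MC[symmetric]) measurable
  qed
  have "(\<integral>\<^sup>+p. F p \<partial>(\<nu> \<Otimes>\<^sub>M (\<mu> \<Otimes>\<^sub>M \<mu>))) = (\<integral>\<^sup>+\<alpha>. (\<integral>\<^sup>+r. F (\<alpha>, r) \<partial>(\<mu> \<Otimes>\<^sub>M \<mu>)) \<partial>\<nu>)"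
    by (rule sigma_finite_measure.nn_integral_fst[OF _ Fm, symmetric]) (rule MM.sigma_finite_measure_axioms)
  also have "\<dots> = (\<integral>\<^sup>+\<alpha>. indicator Q \<alpha> * (weight (char_add \<alpha> \<beta>1) * weight (char_add \<alpha> \<beta>2)) \<partial>\<nu>)"
  proof (rule nn_integral_cong)
    fix \<alpha> assume "\<alpha> \<in> space \<nu>"
    then have \<alpha>: "\<alpha> \<in> characters" by simp
    note [measurable] = fx(1)[OF \<beta>(1) \<alpha>] fx(1)[OF \<beta>(2) \<alpha>]
    have "(\<lambda>r. F (\<alpha>, r)) \<in> borel_measurable (\<mu> \<Otimes>\<^sub>M \<mu>)" by (rule measurable_Pair2[OF Fm]) (use \<alpha> in simp)
    then have "(\<integral>\<^sup>+r. F (\<alpha>, r) \<partial>(\<mu> \<Otimes>\<^sub>M \<mu>)) = (\<integral>\<^sup>+x. (\<integral>\<^sup>+y. F (\<alpha>, (x, y)) \<partial>\<mu>) \<partial>\<mu>)"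
      by (rule nn_integral_fst[symmetric])
    also have "\<dots> = (\<integral>\<^sup>+x. indicator Q \<alpha> * f \<beta>1 \<alpha> x * weight (char_add \<alpha> \<beta>2) \<partial>\<mu>)"
    proof (rule nn_integral_cong)
      fix x
      have "(\<integral>\<^sup>+y. F (\<alpha>, (x, y)) \<partial>\<mu>) = (\<integral>\<^sup>+y. (indicator Q \<alpha> * f \<beta>1 \<alpha> x) * f \<beta>2 \<alpha> y \<partial>\<mu>)"
        by (simp add: F_def mult.assoc)
      also have "\<dots> = indicator Q \<alpha> * f \<beta>1 \<alpha> x * weight (char_add \<alpha> \<beta>2)"
        by (subst nn_integral_cmult) (auto simp: fx(2)[OF \<beta>(2) \<alpha>])
      finally show "(\<integral>\<^sup>+y. F (\<alpha>, (x, y)) \<partial>\<mu>) = indicator Q \<alpha> * f \<beta>1 \<alpha> x * weight (char_add \<alpha> \<beta>2)" .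
    qed
    also have "\<dots> = (\<integral>\<^sup>+x. (indicator Q \<alpha> * weight (char_add \<alpha> \<beta>2)) * f \<beta>1 \<alpha> x \<partial>\<mu>)" by (simp add: mult_ac)
    also have "\<dots> = indicator Q \<alpha> * (weight (char_add \<alpha> \<beta>1) * weight (char_add \<alpha> \<beta>2))"
      by (subst nn_integral_cmult) (auto simp: fx(2)[OF \<beta>(1) \<alpha>] mult_ac)
    finally show "(\<integral>\<^sup>+r. F (\<alpha>, r) \<partial>(\<mu> \<Otimes>\<^sub>M \<mu>)) = indicator Q \<alpha> * (weight (char_add \<alpha> \<beta>1) * weight (char_add \<alpha> \<beta>2))" .
  qed
  finally have int: "(\<integral>\<^sup>+p. F p \<partial>(\<nu> \<Otimes>\<^sub>M (\<mu> \<Otimes>\<^sub>M \<mu>))) = (\<integral>\<^sup>+\<alpha>. indicator Q \<alpha> * (weight (char_add \<alpha> \<beta>1) * weight (char_add \<alpha> \<beta>2)) \<partial>\<nu>)" .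
  have "F p = 0 \<longleftrightarrow> (case p of (\<alpha>, x, y) \<Rightarrow> \<alpha> \<in> Q \<and> x \<in> C \<and> y \<in> C \<longrightarrow> Z (char_add \<alpha> \<beta>1) x * Z (char_add \<alpha> \<beta>2) y = 0)" for p
    by (auto simp: F_def f_def indicator_def split: prod.splits)
  then have "(AE p in \<nu> \<Otimes>\<^sub>M (\<mu> \<Otimes>\<^sub>M \<mu>). (case p of (\<alpha>, x, y) \<Rightarrow> \<alpha> \<in> Q \<and> x \<in> C \<and> y \<in> C \<longrightarrow>
            Z (char_add \<alpha> \<beta>1) x * Z (char_add \<alpha> \<beta>2) y = 0)) \<longleftrightarrow> (\<integral>\<^sup>+p. F p \<partial>(\<nu> \<Otimes>\<^sub>M (\<mu> \<Otimes>\<^sub>M \<mu>))) = 0"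
    by (simp add: nn_integral_0_iff_AE[OF Fm])
  also have "\<dots> \<longleftrightarrow> (AE \<alpha> in \<nu>. indicator Q \<alpha> * (weight (char_add \<alpha> \<beta>1) * weight (char_add \<alpha> \<beta>2)) = 0)"
    unfolding int by (rule nn_integral_0_iff_AE)
      (use Q in \<open>intro borel_measurable_times_ennreal weight_shift_meas \<beta> borel_measurable_indicator\<close>)
  also have "\<dots> \<longleftrightarrow> (AE \<alpha> in \<nu>. \<alpha> \<in> Q \<longrightarrow> weight (char_add \<alpha> \<beta>1) * weight (char_add \<alpha> \<beta>2) = 0)"
    by (intro arg_cong[where f="\<lambda>P. almost_everywhere \<nu> P"] ext) (auto simp: indicator_def)
  finally show ?thesis .
qed

lemma closed_span_iff:
  "f \<in> closed_span_transl \<mu> K \<psi> \<longleftrightarrow> f \<in> L2 \<mu> \<and> (\<forall>e>0. \<exists>g t. transl_poly K \<psi> g t \<and> L2_dist2 \<mu> f g < ennreal e)"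
  unfolding closed_span_transl_def transl_poly_def transl_def by blast

lemma transl_poly_periodic:
  assumes "transl_poly K \<psi> g t" "lattice K" "\<beta> \<in> dual_lattice K" shows "t (char_add \<alpha> \<beta>) = t \<alpha>"
proof -
  obtain F a where F: "finite F" "F \<subseteq> K" "t = (\<lambda>\<alpha>. \<Sum>l\<in>F. a l * \<alpha> (- l))"
    using assms(1) unfolding transl_poly_def by blast
  have "\<beta> (- l) = 1" if "l \<in> F" for l using that F(2) assms(3) lattice_uminus[OF assms(2)] by (auto simp: dual_lattice_def)
  then show ?thesis unfolding F(3) by (intro sum.cong refl) (simp add: char_add_def)
qed

text \<open>For functions periodic under the dual lattice, integration over the dual tile is
  translation invariant.\<close>

lemma nn_integral_MD_shift:
  assumes F: "F \<in> borel_measurable \<nu>" and per: "\<And>\<alpha> \<kappa>. \<alpha> \<in> characters \<Longrightarrow> \<kappa> \<in> dual_lattice L \<Longrightarrow> F (char_add \<alpha> \<kappa>) = F \<alpha>"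
    and \<beta>: "\<beta> \<in> characters"
  shows "(\<integral>\<^sup>+\<alpha>. F (char_add \<alpha> \<beta>) \<partial>MD) = (\<integral>\<^sup>+\<alpha>. F \<alpha> \<partial>MD)"
proof (rule DT.nn_integral_tile_shift[where \<sigma>'="\<lambda>\<alpha>. char_add \<alpha> (char_neg \<beta>)"])
  show "char_add (char_add x i) (char_neg \<beta>) = char_add (char_add x (char_neg \<beta>)) i" for x i
    by (simp add: char_add_def mult_ac)
qed (use F per \<beta> in \<open>auto intro: measurable_char_add_nu char_neg_characters distr_char_add char_add_neg_cancel\<close>)

theorem invariant_imp_orthogonal:
  assumes K: "lattice K" "K \<subseteq> L"
    and inv: "\<And>f l. f \<in> closed_span_transl \<mu> K \<psi> \<Longrightarrow> l \<in> L \<Longrightarrow> transl l f \<in> closed_span_transl \<mu> K \<psi>"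
    and \<beta>: "\<beta>1 \<in> dual_lattice K" "\<beta>2 \<in> dual_lattice K" and ne: "char_add \<beta>1 (char_neg \<beta>2) \<notin> dual_lattice L"
  shows "AE \<alpha> in \<nu>. weight (char_add \<alpha> \<beta>1) * weight (char_add \<alpha> \<beta>2) = 0"
proof -
  have \<beta>c: "\<beta>1 \<in> characters" "\<beta>2 \<in> characters" using \<beta> dual_lattice_characters by auto
  obtain l where l: "l \<in> L" "\<beta>1 l * cnj (\<beta>2 l) \<noteq> 1"
    using ne char_add_characters[OF \<beta>c(1) char_neg_characters[OF \<beta>c(2)]]
    by (auto simp: dual_lattice_def) (simp add: char_add_def char_neg_def)
  define c where "c = \<beta>1 l - \<beta>2 l"
  have c: "c \<noteq> 0" using l(2) characters_cnj_mult[OF \<beta>c(2), of l] by (auto simp: c_def)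
  \<comment> \<open>The product of the two weights vanishes exactly where their minimum does, and
    the minimum lies below both, so one function can be estimated by the two errors
    together.\<close>
  define m where "m \<alpha> = min (weight (char_add \<alpha> \<beta>1)) (weight (char_add \<alpha> \<beta>2))" for \<alpha>
  have mm [measurable]: "m \<in> borel_measurable \<nu>" unfolding m_def by (intro borel_measurable_min weight_shift_meas \<beta>c)
  have mmD [measurable]: "m \<in> borel_measurable MD" using mm by (simp cong: measurable_cong_sets)
  have psi_mem: "\<psi> \<in> closed_span_transl \<mu> K \<psi>"
    unfolding closed_span_iff
  proof (intro conjI psi allI impI)
    fix e :: real assume "e > 0"
    have "transl_poly K \<psi> (\<lambda>y. 1 * \<psi> (y - 0)) (\<lambda>\<alpha>. 1 * \<alpha> (- 0))" by (rule transl_poly_monomial[OF lattice_0[OF K(1)]])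
    moreover have "L2_dist2 \<mu> \<psi> (\<lambda>y. 1 * \<psi> (y - 0)) < ennreal e" using \<open>e > 0\<close> by (simp add: L2_dist2_def)
    ultimately show "\<exists>g t. transl_poly K \<psi> g t \<and> L2_dist2 \<mu> \<psi> g < ennreal e" by blast
  qed
  \<comment> \<open>The translate by - l has symbol \<alpha> l, and the approximating symbol
    \<open>t\<close> is unchanged by shifts from the dual lattice of \<open>K\<close>. Shifting one
    error integral by \<beta>1 and by \<beta>2 bounds the integrals of \<open>G \<beta>1\<close> and
    \<open>G \<beta>2\<close>; the differences inside these two differ by a number of modulus
    |c|.\<close>
  have le: "ennreal ((norm c)\<^sup>2) * (\<integral>\<^sup>+\<alpha>. m \<alpha> \<partial>MD) \<le> 4 * (zconst * ennreal e)" if e: "e > 0" for e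
  proof -
    have "transl (- l) \<psi> \<in> closed_span_transl \<mu> K \<psi>" by (rule inv[OF psi_mem Luminus[OF l(1)]])
    then obtain g t where gt: "transl_poly K \<psi> g t" "L2_dist2 \<mu> (transl (- l) \<psi>) g < ennreal e"
      using e unfolding closed_span_iff by blast
    obtain t1 where t1: "transl_poly K \<psi> (\<lambda>y. - 1 * g (y - 0)) t1" "\<And>\<alpha>. \<alpha> \<in> characters \<Longrightarrow> t1 \<alpha> = - 1 * \<alpha> (- 0) * t \<alpha>"
      using transl_poly_shift[OF gt(1) lattice_0[OF K(1)] lattice_plus[OF K(1)], of "- 1"] by blast
    have "transl_poly L \<psi> (\<lambda>y. 1 * \<psi> (y - (- l)) + - 1 * g (y - 0)) (\<lambda>\<alpha>. 1 * \<alpha> (- (- l)) + t1 \<alpha>)"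
      by (rule transl_poly_add[OF transl_poly_monomial[OF Luminus[OF l(1)]] transl_poly_mono[OF t1(1) K(2)]])
    from weighted_isometry[OF this]
    have "(\<integral>\<^sup>+\<alpha>. ennreal ((norm (1 * \<alpha> (- (- l)) + t1 \<alpha>))\<^sup>2) * weight \<alpha> \<partial>MD) = zconst * L2_dist2 \<mu> (transl (- l) \<psi>) g"
      by (simp add: L2_dist2_def transl_def)
    moreover have "(\<integral>\<^sup>+\<alpha>. ennreal ((norm (1 * \<alpha> (- (- l)) + t1 \<alpha>))\<^sup>2) * weight \<alpha> \<partial>MD) = (\<integral>\<^sup>+\<alpha>. ennreal ((norm (\<alpha> l - t \<alpha>))\<^sup>2) * weight \<alpha> \<partial>MD)"
      by (intro nn_integral_cong) (simp add: t1(2) characters_0)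
    ultimately have "(\<integral>\<^sup>+\<alpha>. ennreal ((norm (\<alpha> l - t \<alpha>))\<^sup>2) * weight \<alpha> \<partial>MD) = zconst * L2_dist2 \<mu> (transl (- l) \<psi>) g"
      by (simp only:)
    also have "\<dots> \<le> zconst * ennreal e" using gt(2) by (intro mult_left_mono) auto
    finally have iso: "(\<integral>\<^sup>+\<alpha>. ennreal ((norm (\<alpha> l - t \<alpha>))\<^sup>2) * weight \<alpha> \<partial>MD) \<le> zconst * ennreal e" .
    have tm [measurable]: "t \<in> borel_measurable \<nu>" using transl_poly_measurable[OF gt(1)] by (simp cong: measurable_cong_sets)
    define G where "G \<beta> \<alpha> = ennreal ((norm (\<alpha> l * \<beta> l - t \<alpha>))\<^sup>2) * weight (char_add \<alpha> \<beta>)" for \<beta> \<alpha>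
    have Gm: "G \<beta> \<in> borel_measurable MD" if "\<beta> \<in> characters" for \<beta>
    proof -
      note [measurable] = weight_shift_meas[OF that]
      have "G \<beta> \<in> borel_measurable \<nu>" unfolding G_def by measurable
      then show ?thesis by (simp cong: measurable_cong_sets)
    qed
    have Gint: "(\<integral>\<^sup>+\<alpha>. G \<beta> \<alpha> \<partial>MD) \<le> zconst * ennreal e" if b: "\<beta> \<in> dual_lattice K" for \<beta>
    proof -
      have "(\<integral>\<^sup>+\<alpha>. G \<beta> \<alpha> \<partial>MD) = (\<integral>\<^sup>+\<alpha>. (\<lambda>\<alpha>. ennreal ((norm (\<alpha> l - t \<alpha>))\<^sup>2) * weight \<alpha>) (char_add \<alpha> \<beta>) \<partial>MD)"
        unfolding G_def by (intro nn_integral_cong) (simp add: transl_poly_periodic[OF gt(1) K(1) b], simp add: char_add_def)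
      also have "\<dots> = (\<integral>\<^sup>+\<alpha>. ennreal ((norm (\<alpha> l - t \<alpha>))\<^sup>2) * weight \<alpha> \<partial>MD)"
      proof (rule nn_integral_MD_shift)
        show "(\<lambda>\<alpha>. ennreal ((norm (\<alpha> l - t \<alpha>))\<^sup>2) * weight \<alpha>) \<in> borel_measurable \<nu>" by measurable
        fix \<alpha> \<kappa> :: "'g \<Rightarrow> complex" assume a: "\<alpha> \<in> characters" and k: "\<kappa> \<in> dual_lattice L"
        have "\<kappa> \<in> dual_lattice K" using k K(2) by (auto simp: dual_lattice_def)
        then show "ennreal ((norm (char_add \<alpha> \<kappa> l - t (char_add \<alpha> \<kappa>)))\<^sup>2) * weight (char_add \<alpha> \<kappa>) = ennreal ((norm (\<alpha> l - t \<alpha>))\<^sup>2) * weight \<alpha>"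
          using k l(1) by (simp add: transl_poly_periodic[OF gt(1) K(1)] weight_per[OF k a]) (simp add: char_add_def dual_lattice_def)
      qed (use b dual_lattice_characters in blast)
      also note iso
      finally show ?thesis .
    qed
    have pt: "ennreal ((norm c)\<^sup>2) * m \<alpha> \<le> 2 * G \<beta>1 \<alpha> + 2 * G \<beta>2 \<alpha>" if \<alpha>: "\<alpha> \<in> characters" for \<alpha>
    proof -
      let ?x = "\<alpha> l * \<beta>1 l - t \<alpha>" and ?y = "\<alpha> l * \<beta>2 l - t \<alpha>"
      have "(norm c)\<^sup>2 = (norm (?x + (- ?y)))\<^sup>2"
        using characters_norm[OF \<alpha>, of l] norm_mult[of "\<alpha> l" c] by (simp add: c_def right_diff_distrib)
      also have "\<dots> \<le> 2 * (norm ?x)\<^sup>2 + 2 * (norm ?y)\<^sup>2" using norm_add_square_le[of ?x "- ?y"] by (simp add: norm_minus_commute)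
      finally have "ennreal ((norm c)\<^sup>2) * m \<alpha> \<le> ennreal (2 * (norm ?x)\<^sup>2 + 2 * (norm ?y)\<^sup>2) * m \<alpha>"
        by (intro mult_right_mono ennreal_leI) auto
      also have "\<dots> = 2 * (ennreal ((norm ?x)\<^sup>2) * m \<alpha>) + 2 * (ennreal ((norm ?y)\<^sup>2) * m \<alpha>)"
        by (simp add: ennreal_plus ennreal_mult' distrib_right mult.assoc)
      also have "\<dots> \<le> 2 * G \<beta>1 \<alpha> + 2 * G \<beta>2 \<alpha>"
        unfolding G_def m_def by (intro add_mono mult_left_mono) auto
      finally show ?thesis .
    qed
    have "ennreal ((norm c)\<^sup>2) * (\<integral>\<^sup>+\<alpha>. m \<alpha> \<partial>MD) = (\<integral>\<^sup>+\<alpha>. ennreal ((norm c)\<^sup>2) * m \<alpha> \<partial>MD)"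
      by (rule nn_integral_cmult[symmetric]) measurable
    also have "\<dots> \<le> (\<integral>\<^sup>+\<alpha>. 2 * G \<beta>1 \<alpha> + 2 * G \<beta>2 \<alpha> \<partial>MD)" by (rule nn_integral_mono) (use pt in simp)
    also have "\<dots> = 2 * (\<integral>\<^sup>+\<alpha>. G \<beta>1 \<alpha> \<partial>MD) + 2 * (\<integral>\<^sup>+\<alpha>. G \<beta>2 \<alpha> \<partial>MD)"
      using Gm[OF \<beta>c(1)] Gm[OF \<beta>c(2)] by (simp add: nn_integral_add nn_integral_cmult)
    also have "\<dots> \<le> 2 * (zconst * ennreal e) + 2 * (zconst * ennreal e)"
      using Gint \<beta> by (intro add_mono mult_left_mono) auto
    also have "\<dots> = 4 * (zconst * ennreal e)" by (simp add: distrib_right[symmetric])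
    finally show ?thesis .
  qed
  have "ennreal ((norm c)\<^sup>2) * (\<integral>\<^sup>+\<alpha>. m \<alpha> \<partial>MD) \<le> 0"
  proof (rule ennreal_le_epsilon)
    fix d :: real assume d: "d > 0"
    have z: "vol\<^sup>2 * dvol > 0" using vol_pos dvol_pos by simp
    define e where "e = d / (4 * (vol\<^sup>2 * dvol))"
    have e: "e > 0" "4 * (vol\<^sup>2 * dvol * e) = d" using d z by (auto simp: e_def)
    have "4 * (zconst * ennreal e) = ennreal (4 * (vol\<^sup>2 * dvol * e))"
      using e(1) vol_pos dvol_pos by (simp add: zconst_def ennreal_mult')
    then show "ennreal ((norm c)\<^sup>2) * (\<integral>\<^sup>+\<alpha>. m \<alpha> \<partial>MD) \<le> 0 + ennreal d"
      using le[OF e(1)] by (simp only: e(2) add_0)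
  qed
  then have "(\<integral>\<^sup>+\<alpha>. m \<alpha> \<partial>MD) = 0" using c by simp
  then have "AE \<alpha> in MD. m \<alpha> = 0" by (simp add: nn_integral_0_iff_AE)
  then have "AE \<alpha> in \<nu>. m \<alpha> = 0"
    unfolding DT.AE_MC
  proof (rule DT.AE_tile_invariant)
    fix \<kappa> \<alpha> assume k: "\<kappa> \<in> dual_lattice L" and "\<alpha> \<in> space \<nu>" and 0: "m (char_add \<alpha> \<kappa>) = 0"
    then have \<alpha>: "\<alpha> \<in> characters" by simp
    have "weight (char_add (char_add \<alpha> \<kappa>) \<beta>) = weight (char_add \<alpha> \<beta>)" if "\<beta> \<in> characters" for \<beta>
      using weight_per[OF k char_add_characters[OF \<alpha> that]] by (simp add: char_add_def mult_ac)
    then show "m \<alpha> = 0" using 0 \<beta>c by (simp add: m_def)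
  qed
  then show ?thesis by (rule eventually_mono) (auto simp: m_def min_def split: if_splits)
qed

end

lemma dual_lattice_antimono: "K \<subseteq> L \<Longrightarrow> dual_lattice L \<subseteq> dual_lattice K"
  by (auto simp: dual_lattice_def)

lemma one_dual_lattice: "(\<lambda>_. 1) \<in> dual_lattice L"
  by (simp add: dual_lattice_def characters_def)

section \<open>The finite quotient of the dual lattices and the converse implication\<close>

locale zak_sublattice = zak_transform \<mu> L C \<nu> D \<psi> Z
  for \<mu> :: "'g::{ab_group_add, t2_space, second_countable_topology} measure" and L C \<nu> D \<psi> Z +
  fixes K :: "'g set"
  assumes latK: "lattice K" and KL: "K \<subseteq> L"
begin

definition same_class :: "('g \<Rightarrow> complex) \<Rightarrow> ('g \<Rightarrow> complex) \<Rightarrow> bool" where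
  "same_class \<beta> \<rho> \<longleftrightarrow> char_add \<beta> (char_neg \<rho>) \<in> dual_lattice L"

lemma same_class_obtain:
  assumes "same_class \<beta> \<rho>" "\<rho> \<in> characters"
  obtains \<kappa> where "\<kappa> \<in> dual_lattice L" "\<beta> = char_add \<rho> \<kappa>"
  using assms char_add_neg_cancel(2)[OF assms(2), of \<beta>] unfolding same_class_def
  by (metis char_add_commute)

lemma same_class_sym: "same_class \<beta> \<rho> \<Longrightarrow> same_class \<rho> \<beta>"
  using dual_lattice_neg[of "char_add \<beta> (char_neg \<rho>)" L]
  by (simp add: same_class_def char_neg_add char_neg_neg char_add_commute)

lemma same_class_trans:
  assumes "same_class \<beta> \<rho>" "same_class \<rho> \<sigma>" "\<rho> \<in> characters" shows "same_class \<beta> \<sigma>"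
proof -
  have "char_add (char_add \<beta> (char_neg \<rho>)) (char_add \<rho> (char_neg \<sigma>)) = char_add \<beta> (char_neg \<sigma>)"
    using char_add_neg_cancel(2)[OF assms(3), of \<beta>] by (simp add: char_add_assoc[symmetric])
  then show ?thesis using dual_lattice_add assms(1,2) unfolding same_class_def by metis
qed

lemma same_class_mult:
  assumes "\<gamma> \<in> characters" shows "same_class (char_add \<beta> \<gamma>) (char_add \<rho> \<gamma>) \<longleftrightarrow> same_class \<beta> \<rho>"
proof -
  have "char_add (char_add \<beta> \<gamma>) (char_neg (char_add \<rho> \<gamma>)) = char_add \<beta> (char_neg \<rho>)"
    using characters_cnj_mult[OF assms] by (simp add: char_add_def char_neg_def fun_eq_iff mult_ac)
  then show ?thesis by (simp add: same_class_def)
qed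

text \<open>By \<open>exists_near_1_cover\<close> every class has a member in
  \<open>near_1 V\<close>, and only finitely many elements of the dual lattice of \<open>K\<close>
  lie there.\<close>

lemma exists_representatives:
  obtains R where "finite R" "R \<subseteq> dual_lattice K" "\<And>\<beta>. \<beta> \<in> dual_lattice K \<Longrightarrow> \<exists>!\<rho>. \<rho> \<in> R \<and> same_class \<beta> \<rho>"
proof -
  obtain V where V: "open V" "0 \<in> V" "\<And>\<alpha>. \<alpha> \<in> characters \<Longrightarrow> \<exists>\<kappa>\<in>dual_lattice L. char_add \<alpha> \<kappa> \<in> near_1 V"
    by (rule exists_near_1_cover) blast
  let ?N = "dual_lattice K \<inter> near_1 V"
  have fin: "finite ?N" by (rule finite_dual_lattice_near_1[OF latK V(1,2)])
  define sel where "sel \<beta> = (SOME \<rho>. \<rho> \<in> ?N \<and> same_class \<beta> \<rho>)" for \<beta>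
  have ex: "\<exists>\<rho>. \<rho> \<in> ?N \<and> same_class \<beta> \<rho>" if b: "\<beta> \<in> dual_lattice K" for \<beta>
  proof -
    have bc: "\<beta> \<in> characters" using b by (rule dual_lattice_characters)
    then obtain \<kappa> where k: "\<kappa> \<in> dual_lattice L" "char_add \<beta> \<kappa> \<in> near_1 V" using V(3) by blast
    have "char_add \<beta> \<kappa> \<in> dual_lattice K" using b k(1) dual_lattice_antimono[OF KL] dual_lattice_add by blast
    moreover have "same_class (char_add \<beta> \<kappa>) \<beta>"
      using k(1) char_add_neg_cancel(1)[OF bc, of \<kappa>] by (simp add: same_class_def char_add_commute)
    ultimately show ?thesis using k(2) same_class_sym by blast
  qed
  have sel: "sel \<beta> \<in> ?N" "same_class \<beta> (sel \<beta>)" if "\<beta> \<in> dual_lattice K" for \<beta>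
    using someI_ex[OF ex[OF that]] by (auto simp: sel_def)
  \<comment> \<open>Congruent elements yield the same predicate under \<open>SOME\<close>, so
    \<open>sel\<close> picks a single element of each class.\<close>
  have sel_eq: "sel \<beta> = sel \<beta>'" if b: "\<beta> \<in> dual_lattice K" "\<beta>' \<in> dual_lattice K" "same_class \<beta> \<beta>'" for \<beta> \<beta>'
  proof -
    have "same_class \<beta> \<rho> \<longleftrightarrow> same_class \<beta>' \<rho>" for \<rho>
      using b same_class_trans[OF b(3)] same_class_trans[OF same_class_sym[OF b(3)]] dual_lattice_characters by blast
    then show ?thesis by (simp add: sel_def)
  qed
  show thesis
  proof (rule that[of "sel ` dual_lattice K"])
    show "finite (sel ` dual_lattice K)" by (rule finite_subset[OF _ fin]) (use sel in blast)
    show "sel ` dual_lattice K \<subseteq> dual_lattice K" using sel by blast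
    fix \<beta> assume b: "\<beta> \<in> dual_lattice K"
    show "\<exists>!\<rho>. \<rho> \<in> sel ` dual_lattice K \<and> same_class \<beta> \<rho>"
    proof (rule ex1I)
      show "sel \<beta> \<in> sel ` dual_lattice K \<and> same_class \<beta> (sel \<beta>)" using sel b by blast
      fix \<rho> assume r: "\<rho> \<in> sel ` dual_lattice K \<and> same_class \<beta> \<rho>"
      then obtain \<gamma> where g: "\<gamma> \<in> dual_lattice K" "\<rho> = sel \<gamma>" by blast
      have rK: "\<rho> \<in> dual_lattice K" using g sel by blast
      have "\<rho> = sel \<rho>" using sel_eq[OF g(1) rK] sel(2)[OF g(1)] g(2) by simp
      also have "\<dots> = sel \<beta>" using sel_eq[OF b rK] r by simp
      finally show "\<rho> = sel \<beta>" .
    qed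
  qed
qed

text \<open>Adding \<gamma> permutes the classes, and \<open>H\<close> depends on the class
  only.\<close>

lemma sum_representatives_shift:
  fixes H :: "('g \<Rightarrow> complex) \<Rightarrow> 'c::comm_monoid_add"
  assumes R: "finite R" "R \<subseteq> dual_lattice K" "\<And>\<beta>. \<beta> \<in> dual_lattice K \<Longrightarrow> \<exists>!\<rho>. \<rho> \<in> R \<and> same_class \<beta> \<rho>"
    and \<gamma>: "\<gamma> \<in> dual_lattice K"
    and H: "\<And>\<beta> \<kappa>. \<beta> \<in> dual_lattice K \<Longrightarrow> \<kappa> \<in> dual_lattice L \<Longrightarrow> H (char_add \<beta> \<kappa>) = H \<beta>"
  shows "(\<Sum>\<rho>\<in>R. H (char_add \<rho> \<gamma>)) = (\<Sum>\<rho>\<in>R. H \<rho>)"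
proof -
  define s where "s \<rho> = (THE \<sigma>. \<sigma> \<in> R \<and> same_class (char_add \<rho> \<gamma>) \<sigma>)" for \<rho>
  have gc: "\<gamma> \<in> characters" by (rule dual_lattice_characters[OF \<gamma>])
  have s: "s \<rho> \<in> R" "same_class (char_add \<rho> \<gamma>) (s \<rho>)" if "\<rho> \<in> R" for \<rho>
    using theI'[OF R(3)[OF dual_lattice_add[OF subsetD[OF R(2) that] \<gamma>]]] by (auto simp: s_def)
  have "inj_on s R"
  proof (rule inj_onI)
    fix \<rho> \<sigma> assume r: "\<rho> \<in> R" "\<sigma> \<in> R" "s \<rho> = s \<sigma>"
    have "same_class (char_add \<rho> \<gamma>) (char_add \<sigma> \<gamma>)"
      using s(2)[OF r(1)] same_class_sym[OF s(2)[OF r(2)]] r(3) s(1)[OF r(1)] R(2) dual_lattice_characters same_class_trans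
      by (metis subsetD)
    then have "same_class \<rho> \<sigma>" by (simp add: same_class_mult[OF gc])
    moreover have "same_class \<rho> \<rho>"
    proof -
      have "\<rho> \<in> characters" using r(1) R(2) dual_lattice_characters by blast
      then have "char_add \<rho> (char_neg \<rho>) = (\<lambda>_. 1)" by (simp add: char_add_def char_neg_def characters_cnj_mult)
      then show ?thesis by (simp add: same_class_def one_dual_lattice)
    qed
    ultimately show "\<rho> = \<sigma>" using R(3)[of \<rho>] r R(2) by blast
  qed
  moreover have "s ` R \<subseteq> R" using s by blast
  ultimately have bij: "bij_betw s R R" using R(1) by (simp add: bij_betw_def endo_inj_surj)
  have "(\<Sum>\<rho>\<in>R. H (char_add \<rho> \<gamma>)) = (\<Sum>\<rho>\<in>R. H (s \<rho>))"
  proof (intro sum.cong refl)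
    fix \<rho> assume r: "\<rho> \<in> R"
    have sK: "s \<rho> \<in> dual_lattice K" using s(1)[OF r] R(2) by blast
    obtain \<kappa> where "\<kappa> \<in> dual_lattice L" "char_add \<rho> \<gamma> = char_add (s \<rho>) \<kappa>"
      by (rule same_class_obtain[OF s(2)[OF r] dual_lattice_characters[OF sK]])
    then show "H (char_add \<rho> \<gamma>) = H (s \<rho>)" using H[OF sK] by simp
  qed
  also have "\<dots> = (\<Sum>\<rho>\<in>R. H \<rho>)" by (rule sum.reindex_bij_betw[OF bij])
  finally show ?thesis .
qed

text \<open>Orthogonality for the finite quotient of the dual lattices: a homomorphism trivial on
  \<open>K\<close> but not at \<open>l\<close> agrees on \<open>L\<close> with a character, and
  shifting by that character multiplies the sum by a factor other than 1 without changing
  it.\<close>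

lemma sum_representatives_eval:
  assumes R: "finite R" "R \<subseteq> dual_lattice K" "\<And>\<beta>. \<beta> \<in> dual_lattice K \<Longrightarrow> \<exists>!\<rho>. \<rho> \<in> R \<and> same_class \<beta> \<rho>"
    and l: "l \<in> L" "l \<notin> K"
  shows "(\<Sum>\<rho>\<in>R. \<rho> l) = 0"
proof -
  obtain \<eta> :: "'g \<Rightarrow> complex" where \<eta>: "\<And>x y. \<eta> (x + y) = \<eta> x * \<eta> y" "\<And>x. norm (\<eta> x) = 1" "\<And>k. k \<in> K \<Longrightarrow> \<eta> k = 1" "\<eta> l \<noteq> 1"
    by (rule hom_separates[of K l]) (use lattice_0[OF latK] lattice_diff[OF latK] l(2) in auto)
  obtain \<gamma> where \<gamma>: "\<gamma> \<in> characters" "\<And>l. l \<in> L \<Longrightarrow> \<gamma> l = \<eta> l"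
    by (rule extend_character_on[OF \<eta>(1,2)]) blast
  have gK: "\<gamma> \<in> dual_lattice K" using \<gamma> \<eta>(3) KL by (auto simp: dual_lattice_def)
  have "(\<Sum>\<rho>\<in>R. char_add \<rho> \<gamma> l) = (\<Sum>\<rho>\<in>R. \<rho> l)"
    by (rule sum_representatives_shift[OF R gK, of "\<lambda>\<rho>. \<rho> l"]) (use l in \<open>simp_all add: char_add_def dual_lattice_def\<close>)
  then have "\<gamma> l * (\<Sum>\<rho>\<in>R. \<rho> l) = (\<Sum>\<rho>\<in>R. \<rho> l)" by (simp add: char_add_def sum_distrib_left mult.commute)
  then show ?thesis using \<gamma>(2)[OF l(1)] \<eta>(4) by auto
qed

text \<open>In the sum over \<open>R\<close> the term of \<open>t\<close> with index j acquires the
  sum of the values \<rho> (- (j + l)). This is \<open>card R\<close> if j + l lies in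
  \<open>K\<close> and 0 otherwise, so summation discards all frequencies outside
  \<open>K\<close>.\<close>

lemma average_is_sublattice_poly:
  assumes R: "finite R" "R \<subseteq> dual_lattice K" "\<And>\<beta>. \<beta> \<in> dual_lattice K \<Longrightarrow> \<exists>!\<rho>. \<rho> \<in> R \<and> same_class \<beta> \<rho>"
    and t: "transl_poly L \<psi> g t" and l: "l \<in> L"
  shows "\<exists>g' t'. transl_poly K \<psi> g' t' \<and> (\<forall>\<alpha>\<in>characters. t' \<alpha> = (\<Sum>\<rho>\<in>R. char_add \<alpha> \<rho> (- l) * t (char_add \<alpha> \<rho>)))"
proof -
  obtain F a where F: "finite F" "F \<subseteq> L" "t = (\<lambda>\<alpha>. \<Sum>j\<in>F. a j * \<alpha> (- j))"
    using t unfolding transl_poly_def by blast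
  let ?F = "{j\<in>F. j + l \<in> K}" and ?m = "of_nat (card R) :: complex"
  have "transl_poly K \<psi> (\<lambda>y. \<Sum>k\<in>(\<lambda>j. j + l) ` ?F. (?m * a (k - l)) * \<psi> (y - k)) (\<lambda>\<alpha>. \<Sum>k\<in>(\<lambda>j. j + l) ` ?F. (?m * a (k - l)) * \<alpha> (- k))"
    by (rule transl_polyI) (use F(1) in auto)
  moreover have "(\<Sum>k\<in>(\<lambda>j. j + l) ` ?F. (?m * a (k - l)) * \<alpha> (- k)) = (\<Sum>\<rho>\<in>R. char_add \<alpha> \<rho> (- l) * t (char_add \<alpha> \<rho>))"
    if \<alpha>: "\<alpha> \<in> characters" for \<alpha>
  proof -
    have "(\<Sum>\<rho>\<in>R. char_add \<alpha> \<rho> (- l) * t (char_add \<alpha> \<rho>)) = (\<Sum>\<rho>\<in>R. \<Sum>j\<in>F. a j * \<alpha> (- (j + l)) * \<rho> (- (j + l)))"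
    proof (rule sum.cong[OF refl])
      fix \<rho> assume "\<rho> \<in> R"
      then have \<rho>: "\<rho> \<in> characters" using R(2) dual_lattice_characters by blast
      have e: "c (- (j + l)) = c (- j) * c (- l)" if "c \<in> characters" for c :: "'g \<Rightarrow> complex" and j
        using characters_mult[OF that, of "- j" "- l"] by (simp add: add.commute)
      show "char_add \<alpha> \<rho> (- l) * t (char_add \<alpha> \<rho>) = (\<Sum>j\<in>F. a j * \<alpha> (- (j + l)) * \<rho> (- (j + l)))"
        unfolding F(3) sum_distrib_left by (intro sum.cong refl) (simp only: e[OF \<alpha>] e[OF \<rho>] char_add_def mult_ac)
    qed
    also have "\<dots> = (\<Sum>j\<in>F. a j * \<alpha> (- (j + l)) * (\<Sum>\<rho>\<in>R. \<rho> (- (j + l))))"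
      by (subst sum.swap) (simp only: sum_distrib_left)
    also have "\<dots> = (\<Sum>j\<in>F. if j + l \<in> K then ?m * a j * \<alpha> (- (j + l)) else 0)"
    proof (rule sum.cong[OF refl])
      fix j assume j: "j \<in> F"
      show "a j * \<alpha> (- (j + l)) * (\<Sum>\<rho>\<in>R. \<rho> (- (j + l))) = (if j + l \<in> K then ?m * a j * \<alpha> (- (j + l)) else 0)"
      proof (cases "j + l \<in> K")
        case True
        then have "- (j + l) \<in> K" by (rule lattice_uminus[OF latK])
        then have "(\<Sum>\<rho>\<in>R. \<rho> (- (j + l))) = (\<Sum>\<rho>\<in>R. 1)"
          using R(2) by (intro sum.cong refl) (auto simp: dual_lattice_def)
        then show ?thesis using True by (simp add: mult_ac)
      next
        case False
        have "- (j + l) \<notin> K"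
        proof
          assume "- (j + l) \<in> K"
          then have "- (- (j + l)) \<in> K" by (rule lattice_uminus[OF latK])
          then show False using False by (simp only: minus_minus)
        qed
        moreover have "- (j + l) \<in> L" using j F(2) l by (intro Luminus Lplus) auto
        ultimately have "(\<Sum>\<rho>\<in>R. \<rho> (- (j + l))) = 0" by (intro sum_representatives_eval[OF R])
        then show ?thesis using False by simp
      qed
    qed
    also have "\<dots> = (\<Sum>j\<in>?F. ?m * a j * \<alpha> (- (j + l)))"
      by (rule sum.inter_filter[OF F(1), symmetric])
    also have "\<dots> = (\<Sum>k\<in>(\<lambda>j. j + l) ` ?F. (?m * a (k - l)) * \<alpha> (- k))"
      by (subst sum.reindex) (auto simp: inj_on_def)
    finally show ?thesis by simp
  qed
  ultimately show ?thesis by blast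
qed

text \<open>After the indicator is replaced by a symbol \<open>t\<close>, the sum over
  \<open>R\<close> is a \<open>K\<close>-symbol by \<open>average_is_sublattice_poly\<close>. The
  error at \<alpha> is at most the sum of the errors of \<open>t\<close> at the shifts of \<alpha>
  by the representatives.\<close>

lemma translation_approximable:
  assumes P: "AE \<alpha> in \<nu>. \<forall>\<beta>1\<in>dual_lattice K. \<forall>\<beta>2\<in>dual_lattice K.
      char_add \<beta>1 (char_neg \<beta>2) \<notin> dual_lattice L \<longrightarrow> weight (char_add \<alpha> \<beta>1) * weight (char_add \<alpha> \<beta>2) = 0"
    and l: "l \<in> L" and e: "e > 0"
  shows "\<exists>g t. transl_poly K \<psi> g t \<and> (\<integral>\<^sup>+\<alpha>. ennreal ((norm (\<alpha> (- l) - t \<alpha>))\<^sup>2) * weight \<alpha> \<partial>MD) < ennreal e"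
proof -
  obtain R where R: "finite R" "R \<subseteq> dual_lattice K" "\<And>\<beta>. \<beta> \<in> dual_lattice K \<Longrightarrow> \<exists>!\<rho>. \<rho> \<in> R \<and> same_class \<beta> \<rho>"
    by (rule exists_representatives) blast
  have Rc: "\<rho> \<in> characters" if "\<rho> \<in> R" for \<rho> using that R(2) dual_lattice_characters by blast
  \<comment> \<open>The representative of the trivial class, which need not be the constant 1; it
    lies in the dual lattice of \<open>L\<close>, so shifting by it changes neither the weight nor
    values at points of \<open>L\<close>.\<close>
  obtain \<rho>0 where \<rho>0: "\<rho>0 \<in> R" "same_class (\<lambda>_. 1) \<rho>0" using R(3)[OF one_dual_lattice] by blast
  have "char_neg \<rho>0 \<in> dual_lattice L" using \<rho>0(2) by (simp add: same_class_def char_add_def)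
  then have \<rho>0L: "\<rho>0 \<in> dual_lattice L" using dual_lattice_neg char_neg_neg by metis
  have per: "H (char_add (char_add \<alpha> \<rho>) \<kappa>) = H (char_add (char_add \<alpha> \<kappa>) \<rho>)" for H :: "('g \<Rightarrow> complex) \<Rightarrow> 'c" and \<alpha> \<rho> \<kappa>
    by (simp add: char_add_def mult_ac)
  \<comment> \<open>Summing over representatives makes the weight periodic under the dual lattice of
    \<open>K\<close> and keeps it above \<open>weight\<close>. An approximation in L2(W) is then
    equally good at all the shifts.\<close>
  define W where "W \<alpha> = (\<Sum>\<rho>\<in>R. weight (char_add \<alpha> \<rho>))" for \<alpha>
  have Wm [measurable]: "W \<in> borel_measurable \<nu>"
    unfolding W_def by (intro borel_measurable_sum weight_shift_meas Rc)
  have Wper: "W (char_add \<alpha> \<gamma>) = W \<alpha>" if \<alpha>: "\<alpha> \<in> characters" and \<gamma>: "\<gamma> \<in> dual_lattice K" for \<alpha> \<gamma>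
  proof -
    have "W (char_add \<alpha> \<gamma>) = (\<Sum>\<rho>\<in>R. weight (char_add \<alpha> (char_add \<rho> \<gamma>)))"
      unfolding W_def by (intro sum.cong refl) (simp add: char_add_def mult_ac)
    also have "\<dots> = (\<Sum>\<rho>\<in>R. weight (char_add \<alpha> \<rho>))"
    proof (rule sum_representatives_shift[OF R \<gamma>])
      fix \<beta> \<kappa> assume b: "\<beta> \<in> dual_lattice K" and k: "\<kappa> \<in> dual_lattice L"
      show "weight (char_add \<alpha> (char_add \<beta> \<kappa>)) = weight (char_add \<alpha> \<beta>)"
        using weight_per[OF k char_add_characters[OF \<alpha> dual_lattice_characters[OF b]]] by (simp add: char_add_assoc)
    qed
    finally show ?thesis by (simp add: W_def)
  qed
  have Wfin: "(\<integral>\<^sup>+\<alpha>. W \<alpha> \<partial>MD) < \<infinity>"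
  proof -
    have "(\<integral>\<^sup>+\<alpha>. W \<alpha> \<partial>MD) = (\<Sum>\<rho>\<in>R. \<integral>\<^sup>+\<alpha>. weight (char_add \<alpha> \<rho>) \<partial>MD)"
      unfolding W_def by (rule nn_integral_sum) (use weight_shift_meas Rc in \<open>simp cong: measurable_cong_sets\<close>)
    also have "\<dots> = (\<Sum>\<rho>\<in>R. \<integral>\<^sup>+\<alpha>. weight \<alpha> \<partial>MD)"
      by (intro sum.cong refl nn_integral_MD_shift weight_meas Rc) (auto intro: weight_per)
    also have "\<dots> < \<infinity>" using weight_finite by (simp add: ennreal_mult_less_top of_nat_less_top)
    finally show ?thesis .
  qed
  let ?E = "\<lambda>\<alpha>. indicator {\<alpha>. weight \<alpha> \<noteq> 0} \<alpha> :: complex"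
  let ?m = "real (card R)"
  have mpos: "?m > 0" using \<rho>0(1) R(1) card_gt_0_iff by fastforce
  \<comment> \<open>One factor \<open>card R\<close> is spent on the Cauchy-Schwarz inequality for
    the sum over \<open>R\<close>, the other on adding up \<open>card R\<close> integrals of
    \<open>J\<close>.\<close>
  define d where "d = e / ?m\<^sup>2"
  have d: "d > 0" "?m * ?m * d = e" using e mpos by (auto simp: d_def power2_eq_square)
  obtain g t where t: "transl_poly L \<psi> g t" "(\<integral>\<^sup>+\<alpha>. W \<alpha> * ennreal ((norm (?E \<alpha> - t \<alpha>))\<^sup>2) \<partial>MD) < ennreal d"
    using support_approx[OF Wm Wfin d(1)] by blast
  have tm [measurable]: "t \<in> borel_measurable \<nu>" using transl_poly_measurable[OF t(1)] by (simp cong: measurable_cong_sets)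
  obtain g' t' where t': "transl_poly K \<psi> g' t'" "\<And>\<alpha>. \<alpha> \<in> characters \<Longrightarrow> t' \<alpha> = (\<Sum>\<rho>\<in>R. char_add \<alpha> \<rho> (- l) * t (char_add \<alpha> \<rho>))"
    using average_is_sublattice_poly[OF R t(1) l] by blast
  define J where "J \<alpha> = W \<alpha> * ennreal ((norm (?E \<alpha> - t \<alpha>))\<^sup>2)" for \<alpha>
  have Em: "?E \<in> borel_measurable \<nu>"
  proof -
    have "(\<lambda>\<alpha>. if weight \<alpha> \<noteq> 0 then 1 else 0 :: complex) \<in> borel_measurable \<nu>" by measurable
    then show ?thesis by (simp add: indicator_def[abs_def] of_bool_def)
  qed
  have Jm: "J \<in> borel_measurable \<nu>" unfolding J_def using Em by measurable
  have Jshift: "(\<integral>\<^sup>+\<alpha>. J (char_add \<alpha> \<rho>) \<partial>MD) < ennreal d" if "\<rho> \<in> R" for \<rho>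
  proof -
    have "(\<integral>\<^sup>+\<alpha>. J (char_add \<alpha> \<rho>) \<partial>MD) = (\<integral>\<^sup>+\<alpha>. J \<alpha> \<partial>MD)"
    proof (rule nn_integral_MD_shift[OF Jm _ Rc[OF that]])
      fix \<alpha> \<kappa> :: "'g \<Rightarrow> complex" assume a: "\<alpha> \<in> characters" "\<kappa> \<in> dual_lattice L"
      then show "J (char_add \<alpha> \<kappa>) = J \<alpha>"
        using Wper[OF a(1)] dual_lattice_antimono[OF KL] weight_per[OF a(2,1)] transl_poly_periodic[OF t(1) lat a(2)]
        by (auto simp: J_def indicator_def)
    qed
    then show ?thesis using t(2) by (simp add: J_def)
  qed
  have pt: "ennreal ((norm (\<alpha> (- l) - t' \<alpha>))\<^sup>2) * weight \<alpha> \<le> ennreal ?m * (\<Sum>\<rho>\<in>R. J (char_add \<alpha> \<rho>))"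
    if \<alpha>: "\<alpha> \<in> characters" and P\<alpha>: "\<forall>\<beta>1\<in>dual_lattice K. \<forall>\<beta>2\<in>dual_lattice K.
      char_add \<beta>1 (char_neg \<beta>2) \<notin> dual_lattice L \<longrightarrow> weight (char_add \<alpha> \<beta>1) * weight (char_add \<alpha> \<beta>2) = 0" for \<alpha>
  proof (cases "weight \<alpha> = 0")
    case True then show ?thesis by simp
  next
    case False
    have w0: "weight (char_add \<alpha> \<rho>0) = weight \<alpha>" by (rule weight_per[OF \<rho>0L \<alpha>])
    have wr: "weight (char_add \<alpha> \<rho>) = 0" if r: "\<rho> \<in> R" "\<rho> \<noteq> \<rho>0" for \<rho>
    proof -
      have "\<not> same_class \<rho>0 \<rho>"
      proof
        assume "same_class \<rho>0 \<rho>"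
        then have "same_class (\<lambda>_. 1) \<rho>" by (rule same_class_trans[OF \<rho>0(2) _ Rc[OF \<rho>0(1)]])
        then show False using R(3)[OF one_dual_lattice] \<rho>0 r by blast
      qed
      then have "weight (char_add \<alpha> \<rho>0) * weight (char_add \<alpha> \<rho>) = 0"
        using P\<alpha> R(2) \<rho>0(1) r(1) unfolding same_class_def by blast
      then show ?thesis using w0 False by simp
    qed
    \<comment> \<open>Where the weight is positive, \<open>P\<close> makes it vanish at the shifts
      by all other representatives, so only the term of \<rho>0 survives.\<close>
    have eq: "\<alpha> (- l) = (\<Sum>\<rho>\<in>R. char_add \<alpha> \<rho> (- l) * ?E (char_add \<alpha> \<rho>))"
    proof -
      have "(\<Sum>\<rho>\<in>R. char_add \<alpha> \<rho> (- l) * ?E (char_add \<alpha> \<rho>)) = (\<Sum>\<rho>\<in>R. if \<rho> = \<rho>0 then char_add \<alpha> \<rho> (- l) else 0)"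
        using w0 wr False by (intro sum.cong refl) (auto simp: indicator_def)
      also have "\<dots> = char_add \<alpha> \<rho>0 (- l)" using R(1) \<rho>0(1) by simp
      also have "\<dots> = \<alpha> (- l)" using \<rho>0L Luminus[OF l] by (simp add: char_add_def dual_lattice_def)
      finally show ?thesis by simp
    qed
    have "(norm (\<alpha> (- l) - t' \<alpha>))\<^sup>2 = (norm (\<Sum>\<rho>\<in>R. char_add \<alpha> \<rho> (- l) * (?E (char_add \<alpha> \<rho>) - t (char_add \<alpha> \<rho>))))\<^sup>2"
      unfolding t'(2)[OF \<alpha>] by (subst eq) (simp only: sum_subtractf[symmetric] right_diff_distrib[symmetric])
    also have "\<dots> \<le> (\<Sum>\<rho>\<in>R. norm (char_add \<alpha> \<rho> (- l) * (?E (char_add \<alpha> \<rho>) - t (char_add \<alpha> \<rho>))))\<^sup>2"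
      by (intro power_mono norm_sum) simp
    also have "\<dots> = (\<Sum>\<rho>\<in>R. norm (?E (char_add \<alpha> \<rho>) - t (char_add \<alpha> \<rho>)))\<^sup>2"
      using characters_norm[OF char_add_characters[OF \<alpha> Rc]]
      by (intro arg_cong[where f="\<lambda>x. x\<^sup>2"] sum.cong refl) (simp add: norm_mult)
    also have "\<dots> \<le> (\<Sum>\<rho>\<in>R. (norm (?E (char_add \<alpha> \<rho>) - t (char_add \<alpha> \<rho>)))\<^sup>2) * ?m"
      by (rule sum_squared_le_sum_of_squares)
    finally have le: "(norm (\<alpha> (- l) - t' \<alpha>))\<^sup>2 \<le> ?m * (\<Sum>\<rho>\<in>R. (norm (?E (char_add \<alpha> \<rho>) - t (char_add \<alpha> \<rho>)))\<^sup>2)"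
      by (simp add: mult.commute)
    have "weight \<alpha> \<le> W \<alpha>" unfolding W_def w0[symmetric] by (rule member_le_sum) (use \<rho>0(1) R(1) in auto)
    then have "ennreal ((norm (\<alpha> (- l) - t' \<alpha>))\<^sup>2) * weight \<alpha>
      \<le> ennreal (?m * (\<Sum>\<rho>\<in>R. (norm (?E (char_add \<alpha> \<rho>) - t (char_add \<alpha> \<rho>)))\<^sup>2)) * W \<alpha>"
      by (intro mult_mono ennreal_leI le) auto
    also have "\<dots> = ennreal ?m * (\<Sum>\<rho>\<in>R. W \<alpha> * ennreal ((norm (?E (char_add \<alpha> \<rho>) - t (char_add \<alpha> \<rho>)))\<^sup>2))"
      by (simp add: ennreal_mult sum_nonneg sum_ennreal[symmetric] sum_distrib_right sum_distrib_left mult_ac)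
    also have "\<dots> = ennreal ?m * (\<Sum>\<rho>\<in>R. J (char_add \<alpha> \<rho>))"
    proof -
      have "W (char_add \<alpha> \<rho>) = W \<alpha>" if "\<rho> \<in> R" for \<rho> using Wper[OF \<alpha>] that R(2) by blast
      then show ?thesis by (simp add: J_def)
    qed
    finally show ?thesis .
  qed
  have Jsm: "(\<lambda>\<alpha>. J (char_add \<alpha> \<rho>)) \<in> borel_measurable MD" if "\<rho> \<in> R" for \<rho>
    using measurable_compose[OF measurable_char_add_nu[OF Rc[OF that]] Jm] by (simp cong: measurable_cong_sets)
  have "(\<integral>\<^sup>+\<alpha>. ennreal ((norm (\<alpha> (- l) - t' \<alpha>))\<^sup>2) * weight \<alpha> \<partial>MD) \<le> (\<integral>\<^sup>+\<alpha>. ennreal ?m * (\<Sum>\<rho>\<in>R. J (char_add \<alpha> \<rho>)) \<partial>MD)"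
  proof (rule nn_integral_mono_AE)
    have "AE \<alpha> in MD. \<alpha> \<in> characters" using AE_space[of MD] by simp
    moreover have "AE \<alpha> in MD. \<forall>\<beta>1\<in>dual_lattice K. \<forall>\<beta>2\<in>dual_lattice K.
      char_add \<beta>1 (char_neg \<beta>2) \<notin> dual_lattice L \<longrightarrow> weight (char_add \<alpha> \<beta>1) * weight (char_add \<alpha> \<beta>2) = 0"
      unfolding DT.AE_MC using P by (rule eventually_mono) blast
    ultimately show "AE \<alpha> in MD. ennreal ((norm (\<alpha> (- l) - t' \<alpha>))\<^sup>2) * weight \<alpha> \<le> ennreal ?m * (\<Sum>\<rho>\<in>R. J (char_add \<alpha> \<rho>))"
      by eventually_elim (rule pt)
  qed
  also have "\<dots> = ennreal ?m * (\<Sum>\<rho>\<in>R. \<integral>\<^sup>+\<alpha>. J (char_add \<alpha> \<rho>) \<partial>MD)"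
    using Jsm by (subst nn_integral_cmult) (auto simp: nn_integral_sum)
  also have "\<dots> < ennreal ?m * (\<Sum>\<rho>\<in>R. ennreal d)"
  proof (rule ennreal_mult_strict_left_mono)
    show "(\<Sum>\<rho>\<in>R. \<integral>\<^sup>+\<alpha>. J (char_add \<alpha> \<rho>) \<partial>MD) < (\<Sum>\<rho>\<in>R. ennreal d)"
    proof -
      have "(\<Sum>\<rho>\<in>R. \<integral>\<^sup>+\<alpha>. J (char_add \<alpha> \<rho>) \<partial>MD) = (\<Sum>\<rho>\<in>R. ennreal (enn2real (\<integral>\<^sup>+\<alpha>. J (char_add \<alpha> \<rho>) \<partial>MD)))"
        using order.strict_trans[OF Jshift ennreal_less_top] by (intro sum.cong refl) simp
      also have "\<dots> = ennreal (\<Sum>\<rho>\<in>R. enn2real (\<integral>\<^sup>+\<alpha>. J (char_add \<alpha> \<rho>) \<partial>MD))" by (rule sum_ennreal) simp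
      also have "\<dots> < ennreal (\<Sum>\<rho>\<in>R. d)"
      proof (rule ennreal_lessI)
        show "0 < (\<Sum>\<rho>\<in>R. d)" using d(1) mpos by simp
        show "(\<Sum>\<rho>\<in>R. enn2real (\<integral>\<^sup>+\<alpha>. J (char_add \<alpha> \<rho>) \<partial>MD)) < (\<Sum>\<rho>\<in>R. d)"
        proof (intro sum_strict_mono R(1))
          show "enn2real (\<integral>\<^sup>+\<alpha>. J (char_add \<alpha> \<rho>) \<partial>MD) < d" if r: "\<rho> \<in> R" for \<rho>
            using Jshift[OF r] order.strict_trans[OF Jshift[OF r] ennreal_less_top]
              ennreal_less_iff[of "enn2real (\<integral>\<^sup>+\<alpha>. J (char_add \<alpha> \<rho>) \<partial>MD)" d] by simp
        qed (use \<rho>0(1) in auto)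
      qed
      also have "\<dots> = (\<Sum>\<rho>\<in>R. ennreal d)" by (rule sum_ennreal[symmetric]) (use d(1) in simp)
      finally show ?thesis .
    qed
  qed (use mpos in auto)
  also have "\<dots> = ennreal (?m * ?m * d)"
    using d(1) by (simp add: ennreal_mult ennreal_of_nat_eq_real_of_nat mult.assoc)
  finally show ?thesis using t'(1) by (auto simp: d(2))
qed

text \<open>It suffices to translate a \<open>K\<close>-combination \<open>g1\<close> close to
  \<open>f\<close>. Its translate has symbol \<alpha> (- l) times \<open>t1\<close>, and replacing
  \<alpha> (- l) by a \<open>K\<close>-symbol multiplies the approximation error by at most the
  bound of \<open>t1\<close>.\<close>

theorem orthogonal_imp_invariant:
  assumes P: "AE \<alpha> in \<nu>. \<forall>\<beta>1\<in>dual_lattice K. \<forall>\<beta>2\<in>dual_lattice K.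
      char_add \<beta>1 (char_neg \<beta>2) \<notin> dual_lattice L \<longrightarrow> weight (char_add \<alpha> \<beta>1) * weight (char_add \<alpha> \<beta>2) = 0"
    and f: "f \<in> closed_span_transl \<mu> K \<psi>" and l: "l \<in> L"
  shows "transl l f \<in> closed_span_transl \<mu> K \<psi>"
  unfolding closed_span_iff
proof (intro conjI allI impI)
  have fm [measurable]: "f \<in> borel_measurable borel" and fL: "(\<integral>\<^sup>+x. ennreal ((norm (f x))\<^sup>2) \<partial>\<mu>) < \<infinity>"
    using f by (auto simp: closed_span_iff L2_def)
  show "transl l f \<in> L2 \<mu>"
    using fL nn_integral_translate[of "\<lambda>x. ennreal ((norm (f x))\<^sup>2)" "- l"] by (simp add: L2_def transl_def)
  fix e :: real assume e: "e > 0"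
  obtain g1 t1 where 1: "transl_poly K \<psi> g1 t1" "L2_dist2 \<mu> f g1 < ennreal (e / 4)"
    using f e unfolding closed_span_iff by (meson divide_pos_pos zero_less_numeral)
  obtain B where B: "B \<ge> 0" "\<And>\<alpha>. \<alpha> \<in> characters \<Longrightarrow> norm (t1 \<alpha>) \<le> B" using transl_poly_bounded[OF 1(1)] by blast
  define z where "z = vol\<^sup>2 * dvol"
  have z: "z > 0" "zconst = ennreal z" using vol_pos dvol_pos by (simp_all add: z_def zconst_def ennreal_mult)
  have B1: "B\<^sup>2 + 1 > 0" by (simp add: add_nonneg_pos)
  \<comment> \<open>The 1 excludes division by 0 and makes the resulting estimate strict. The target
    is e / 4 because each of the two distances enters the final bound with factor 2.\<close>
  define d where "d = z * e / (4 * (B\<^sup>2 + 1))"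
  have d: "d > 0" using z e B1 by (simp add: d_def)
  have Bd: "(B\<^sup>2 + 1) * d = z * (e / 4)"
  proof -
    have "k * (z * e / (4 * k)) = z * (e / 4)" if "k > 0" for k :: real using that by simp
    from this[OF B1] show ?thesis by (simp only: d_def)
  qed
  obtain g t where t: "transl_poly K \<psi> g t" "(\<integral>\<^sup>+\<alpha>. ennreal ((norm (\<alpha> (- l) - t \<alpha>))\<^sup>2) * weight \<alpha> \<partial>MD) < ennreal d"
    using translation_approximable[OF P l d] by blast
  obtain g2 t2 where 2: "transl_poly K \<psi> g2 t2" "\<And>\<alpha>. \<alpha> \<in> characters \<Longrightarrow> t2 \<alpha> = t1 \<alpha> * t \<alpha>"
    using transl_poly_mult[OF 1(1) t(1) lattice_plus[OF latK]] by blast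
  obtain s1 where s1: "transl_poly L \<psi> (\<lambda>y. 1 * g1 (y - l)) s1" "\<And>\<alpha>. \<alpha> \<in> characters \<Longrightarrow> s1 \<alpha> = 1 * \<alpha> (- l) * t1 \<alpha>"
    using transl_poly_shift[OF transl_poly_mono[OF 1(1) KL] l Lplus, of 1] by blast
  obtain s2 where s2: "transl_poly L \<psi> (\<lambda>y. - 1 * g2 (y - 0)) s2" "\<And>\<alpha>. \<alpha> \<in> characters \<Longrightarrow> s2 \<alpha> = - 1 * \<alpha> (- 0) * t2 \<alpha>"
    using transl_poly_shift[OF transl_poly_mono[OF 2(1) KL] L0 Lplus, of "- 1"] by blast
  have tm: "t \<in> borel_measurable MD" using transl_poly_measurable[OF t(1)] by (simp cong: measurable_cong_sets)
  have wm: "weight \<in> borel_measurable MD" using weight_meas by (simp cong: measurable_cong_sets)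
  have g1m [measurable]: "g1 \<in> borel_measurable borel" and g2m [measurable]: "g2 \<in> borel_measurable borel"
    using transl_poly_L2 1(1) 2(1) by auto
  have "zconst * L2_dist2 \<mu> (transl l g1) g2 = (\<integral>\<^sup>+\<alpha>. ennreal ((norm (s1 \<alpha> + s2 \<alpha>))\<^sup>2) * weight \<alpha> \<partial>MD)"
    using weighted_isometry[OF transl_poly_add[OF s1(1) s2(1)]] by (simp add: L2_dist2_def transl_def)
  also have "\<dots> \<le> (\<integral>\<^sup>+\<alpha>. ennreal (B\<^sup>2) * (ennreal ((norm (\<alpha> (- l) - t \<alpha>))\<^sup>2) * weight \<alpha>) \<partial>MD)"
  proof (rule nn_integral_mono)
    fix \<alpha> assume "\<alpha> \<in> space MD"
    then have \<alpha>: "\<alpha> \<in> characters" by simp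
    have "s1 \<alpha> + s2 \<alpha> = t1 \<alpha> * (\<alpha> (- l) - t \<alpha>)"
      by (simp add: s1(2)[OF \<alpha>] s2(2)[OF \<alpha>] 2(2)[OF \<alpha>] characters_0[OF \<alpha>] algebra_simps)
    then have "(norm (s1 \<alpha> + s2 \<alpha>))\<^sup>2 \<le> B\<^sup>2 * (norm (\<alpha> (- l) - t \<alpha>))\<^sup>2"
      using B(2)[OF \<alpha>] by (simp add: norm_mult power_mult_distrib mult_right_mono power_mono)
    then have "ennreal ((norm (s1 \<alpha> + s2 \<alpha>))\<^sup>2) * weight \<alpha> \<le> ennreal (B\<^sup>2 * (norm (\<alpha> (- l) - t \<alpha>))\<^sup>2) * weight \<alpha>"
      by (intro mult_right_mono ennreal_leI) auto
    then show "ennreal ((norm (s1 \<alpha> + s2 \<alpha>))\<^sup>2) * weight \<alpha> \<le> ennreal (B\<^sup>2) * (ennreal ((norm (\<alpha> (- l) - t \<alpha>))\<^sup>2) * weight \<alpha>)"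
      by (simp add: ennreal_mult mult.assoc)
  qed
  also have "\<dots> = ennreal (B\<^sup>2) * (\<integral>\<^sup>+\<alpha>. ennreal ((norm (\<alpha> (- l) - t \<alpha>))\<^sup>2) * weight \<alpha> \<partial>MD)"
    using tm wm by (intro nn_integral_cmult) auto
  also have "\<dots> \<le> ennreal (B\<^sup>2) * ennreal d" using t(2) by (intro mult_left_mono) auto
  also have "\<dots> = ennreal (B\<^sup>2 * d)" using d by (simp add: ennreal_mult)
  also have "\<dots> < ennreal ((B\<^sup>2 + 1) * d)" using d B1 by (intro ennreal_lessI) auto
  also have "\<dots> = zconst * ennreal (e / 4)" 
    unfolding Bd z(2) using z(1) e by (intro ennreal_mult) auto
  finally have small: "L2_dist2 \<mu> (transl l g1) g2 < ennreal (e / 4)"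
    by (rule contrapos_pp) (auto simp: not_less intro: mult_left_mono)
  have shift: "L2_dist2 \<mu> (transl l f) (transl l g1) = L2_dist2 \<mu> f g1"
    using nn_integral_translate[of "\<lambda>x. ennreal ((norm (f x - g1 x))\<^sup>2)" "- l"] by (simp add: L2_dist2_def transl_def)
  have "L2_dist2 \<mu> (transl l f) g2 \<le> (\<integral>\<^sup>+x. 2 * ennreal ((norm (transl l f x - transl l g1 x))\<^sup>2) + 2 * ennreal ((norm (transl l g1 x - g2 x))\<^sup>2) \<partial>\<mu>)"
    unfolding L2_dist2_def
  proof (rule nn_integral_mono)
    fix x
    have "ennreal ((norm (transl l f x - g2 x))\<^sup>2) \<le> ennreal (2 * (norm (transl l f x - transl l g1 x))\<^sup>2 + 2 * (norm (transl l g1 x - g2 x))\<^sup>2)"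
      using norm_add_square_le[of "transl l f x - transl l g1 x" "transl l g1 x - g2 x"] by (intro ennreal_leI) simp
    then show "ennreal ((norm (transl l f x - g2 x))\<^sup>2) \<le> 2 * ennreal ((norm (transl l f x - transl l g1 x))\<^sup>2) + 2 * ennreal ((norm (transl l g1 x - g2 x))\<^sup>2)"
      by (simp add: ennreal_plus ennreal_mult')
  qed
  also have "\<dots> = 2 * L2_dist2 \<mu> (transl l f) (transl l g1) + 2 * L2_dist2 \<mu> (transl l g1) g2"
    unfolding L2_dist2_def transl_def by (subst nn_integral_add) (auto simp: nn_integral_cmult)
  also have "\<dots> < 2 * ennreal (e / 4) + 2 * ennreal (e / 4)"
    unfolding shift by (intro add_strict_mono ennreal_mult_strict_left_mono 1(2) small) auto
  also have "\<dots> = ennreal e" using e by (simp add: ennreal_plus[symmetric] ennreal_mult'[symmetric] ennreal_numeral[symmetric] del: ennreal_plus ennreal_numeral)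
  finally show "\<exists>g t. transl_poly K \<psi> g t \<and> L2_dist2 \<mu> (transl l f) g < ennreal e" using 2(1) by blast
qed

end

theorem theorem1p2:
  fixes \<mu> :: "'g::{ab_group_add, t2_space, second_countable_topology} measure"
    and \<nu> :: "('g \<Rightarrow> complex) measure"
    and K L :: "'g set"
    and \<psi> :: "'g \<Rightarrow> complex"
    and CL :: "'g set"
    and CLd CKd :: "('g \<Rightarrow> complex) set"
    and Z :: "('g \<Rightarrow> complex) \<Rightarrow> 'g \<Rightarrow> complex"
  assumes G: "LCA_group TYPE('g)"
    and haar: "haar_measure \<mu>"
    and dual_haar: "dual_haar_measure \<nu>"
    and latK: "lattice K" and latL: "lattice L" and KL: "K \<subseteq> L"
    and psi: "\<psi> \<in> L2 \<mu>" and psi_nz: "L2_dist2 \<mu> \<psi> (\<lambda>_. 0) \<noteq> 0"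
    and CL: "tiling_set L CL"
    and CLd: "dual_tiling_set (dual_lattice L) CLd"
    and CKd: "dual_tiling_set (dual_lattice K) CKd"
    and Z: "is_zak_transform \<mu> \<nu> L CL CLd \<psi> Z"
  shows "(\<forall>f\<in>closed_span_transl \<mu> K \<psi>. \<forall>l\<in>L. transl l f \<in> closed_span_transl \<mu> K \<psi>)
     \<longleftrightarrow>
     (\<forall>\<beta>1\<in>dual_lattice K. \<forall>\<beta>2\<in>dual_lattice K.
        char_add \<beta>1 (char_neg \<beta>2) \<notin> dual_lattice L \<longrightarrow>
        (AE p in \<nu> \<Otimes>\<^sub>M (\<mu> \<Otimes>\<^sub>M \<mu>).
           (case p of (\<alpha>, x, y) \<Rightarrow>
              \<alpha> \<in> CKd \<and> x \<in> CL \<and> y \<in> CL \<longrightarrow>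
              Z (char_add \<alpha> \<beta>1) x * Z (char_add \<alpha> \<beta>2) y = 0)))"
  (is "?A \<longleftrightarrow> (\<forall>\<beta>1\<in>_. \<forall>\<beta>2\<in>_. ?N \<beta>1 \<beta>2 \<longrightarrow> ?Q \<beta>1 \<beta>2)")
proof -
  interpret zak_sublattice \<mu> L CL \<nu> CLd \<psi> Z K
    by unfold_locales (use assms in auto)
  interpret DK: dual_tile \<mu> \<nu> K CKd
    by unfold_locales (use assms in auto)
  let ?w = "\<lambda>\<alpha> \<beta>1 \<beta>2. weight (char_add \<alpha> \<beta>1) * weight (char_add \<alpha> \<beta>2) = 0"
  have Q: "?Q \<beta>1 \<beta>2 \<longleftrightarrow> (AE \<alpha> in \<nu>. \<alpha> \<in> CKd \<longrightarrow> ?w \<alpha> \<beta>1 \<beta>2)" if "\<beta>1 \<in> dual_lattice K" "\<beta>2 \<in> dual_lattice K" for \<beta>1 \<beta>2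
    using that DK.DT.tile_sets by (intro orthogonality_iff_weights dual_lattice_characters)
  show ?thesis
  proof
    assume ?A
    then have inv: "\<And>f l. f \<in> closed_span_transl \<mu> K \<psi> \<Longrightarrow> l \<in> L \<Longrightarrow> transl l f \<in> closed_span_transl \<mu> K \<psi>"
      by blast
    show "\<forall>\<beta>1\<in>dual_lattice K. \<forall>\<beta>2\<in>dual_lattice K. ?N \<beta>1 \<beta>2 \<longrightarrow> ?Q \<beta>1 \<beta>2"
    proof (intro ballI impI)
      fix \<beta>1 \<beta>2 assume \<beta>: "\<beta>1 \<in> dual_lattice K" "\<beta>2 \<in> dual_lattice K" "?N \<beta>1 \<beta>2"
      have "AE \<alpha> in \<nu>. ?w \<alpha> \<beta>1 \<beta>2" by (rule invariant_imp_orthogonal[OF latK KL _ \<beta>]) (rule inv)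
      then show "?Q \<beta>1 \<beta>2"
        unfolding Q[OF \<beta>(1,2)] by (rule eventually_mono) (rule impI)
    qed
  next
    assume b: "\<forall>\<beta>1\<in>dual_lattice K. \<forall>\<beta>2\<in>dual_lattice K. ?N \<beta>1 \<beta>2 \<longrightarrow> ?Q \<beta>1 \<beta>2"
    \<comment> \<open>For a single pair \<beta>1, \<beta>2 the condition on the tile says nothing
      about its translates; for all pairs at once it is invariant. Countability collects the null
      sets of the pairs into one.\<close>
    have ctb: "countable (dual_lattice K)" by (rule countable_dual_lattice[OF latK])
    let ?P = "\<lambda>\<alpha>. \<forall>\<beta>1\<in>dual_lattice K. \<forall>\<beta>2\<in>dual_lattice K. ?N \<beta>1 \<beta>2 \<longrightarrow> ?w \<alpha> \<beta>1 \<beta>2"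
    have "AE \<alpha> in \<nu>. \<forall>\<beta>1\<in>dual_lattice K. \<forall>\<beta>2\<in>dual_lattice K. ?N \<beta>1 \<beta>2 \<longrightarrow> \<alpha> \<in> CKd \<longrightarrow> ?w \<alpha> \<beta>1 \<beta>2"
      unfolding AE_ball_countable[OF ctb]
    proof (intro ballI)
      fix \<beta>1 \<beta>2 assume "\<beta>1 \<in> dual_lattice K" "\<beta>2 \<in> dual_lattice K"
      then show "AE \<alpha> in \<nu>. ?N \<beta>1 \<beta>2 \<longrightarrow> \<alpha> \<in> CKd \<longrightarrow> ?w \<alpha> \<beta>1 \<beta>2"
        using b Q by (cases "?N \<beta>1 \<beta>2") auto
    qed
    then have "AE \<alpha> in \<nu>. \<alpha> \<in> CKd \<longrightarrow> ?P \<alpha>" by (rule eventually_mono) blast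
    \<comment> \<open>A shift of \<alpha> by \<gamma> is compensated by subtracting \<gamma> from
      both \<beta>1 and \<beta>2, which does not change their difference; so the condition spreads
      from the tile of the dual lattice of \<open>K\<close> to the whole dual group.\<close>
    then have "AE \<alpha> in \<nu>. ?P \<alpha>"
    proof (rule DK.DT.AE_tile_invariant)
      fix \<gamma> \<alpha> assume \<gamma>: "\<gamma> \<in> dual_lattice K" and P: "?P (char_add \<alpha> \<gamma>)"
      have gc: "\<gamma> \<in> characters" by (rule dual_lattice_characters[OF \<gamma>])
      show "?P \<alpha>"
      proof (intro ballI impI)
        fix \<beta>1 \<beta>2 assume \<beta>: "\<beta>1 \<in> dual_lattice K" "\<beta>2 \<in> dual_lattice K" "?N \<beta>1 \<beta>2"
        have mem: "char_add \<beta>1 (char_neg \<gamma>) \<in> dual_lattice K" "char_add \<beta>2 (char_neg \<gamma>) \<in> dual_lattice K"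
          using dual_lattice_add[OF \<beta>(1) dual_lattice_neg[OF \<gamma>]] dual_lattice_add[OF \<beta>(2) dual_lattice_neg[OF \<gamma>]] by simp_all
        have "?N (char_add \<beta>1 (char_neg \<gamma>)) (char_add \<beta>2 (char_neg \<gamma>))"
          using same_class_mult[OF char_neg_characters[OF gc], of \<beta>1 \<beta>2] \<beta>(3) by (simp add: same_class_def)
        then have "?w (char_add \<alpha> \<gamma>) (char_add \<beta>1 (char_neg \<gamma>)) (char_add \<beta>2 (char_neg \<gamma>))" using P mem by blast
        moreover have "char_add (char_add \<alpha> \<gamma>) (char_add \<beta> (char_neg \<gamma>)) = char_add \<alpha> \<beta>" for \<beta>
          using characters_cnj_mult[OF gc] by (simp add: char_add_def char_neg_def fun_eq_iff mult_ac)
        ultimately show "?w \<alpha> \<beta>1 \<beta>2" by simp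
      qed
    qed
    then show ?A using orthogonal_imp_invariant by blast
  qed
qed

end
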